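(* Let $(R,\mathfrak r)\to(A,\mathfrak a)$ be a morphism of bounded $q$-PD-pairs, where $A$ is complete with a fixed topologically étale coordinate $x$ over $R$, the $\delta$-structure of $A$ is the one for which $\delta(x)=0$, and $\mathfrak a$ is closed in $A$. Put $\overline A=A/\mathfrak a$ and $\overline R=R/\mathfrak r$. Then there exists a functor $E\mapsto E_A$ (where the $A$-module underlying $E_A$ is the value of $E$ on the object $(A,\mathfrak a)$ of $q\mathrm{-CRIS}(\overline A/R)$) from the category of finitely presented flat $q$-crystals on $\overline A/R$ to the category of finitely presented flat topologically quasi-nilpotent $D_{A/R,q}$-modules (that is, topologically quasi-nilpotent $D_{A/R,q}$-modules whose underlying $A$-module is finitely presented and flat).
   Context: Fix a prime $p$. A $\delta$-structure on a commutative ring $B$ is a map $\delta:B\to B$ with $\delta(0)=\delta(1)=0$, $\delta(f+g)=\delta(f)+\delta(g)-\sum_{k=1}^{p-1}\frac1p\binom pk f^{p-k}g^k$ and $\delta(fg)=f^p\delta(g)+\delta(f)g^p+p\delta(f)\delta(g)$; put $\phi(f)=f^p+p\delta(f)$. An element $f$ has rank one if $\delta(f)=0$. All $\delta$-rings live over $\mathbb Z[q]_{(p,q-1)}$ (localization of $\mathbb Z[q]$ at the ideal $(p,q-1)$, with $\delta(q)=0$). All rings and modules carry the $(p,q-1)$-adic topology; completion and completeness refer to this topology. $(n)_q=\frac{q^n-1}{q-1}$. A $\delta$-pair $(B,J)$ is a $\delta$-ring $B$ (over $R$, when a base $R$ is given) with an ideal $J$; morphisms are morphisms of $\delta$-rings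 sending ideal into ideal. It is a $q$-PD-pair if $B$ is $(p)_q$-torsion-free and $\phi(f)-(p)_q\delta(f)\in(p)_qJ$ for all $f\in J$. $B$ is bounded if it is $(p)_q$-torsion-free and $B/(p)_q$ has bounded $p^\infty$-torsion; a pair is bounded if $B$ is. A pair $(B,J)$ is complete if $B$ is complete and $J$ is closed. A topologically étale coordinate $x\in A$ over $R$ is an element such that $R[X]\to A$, $X\mapsto x$, is formally étale and topologically finitely presented; there is a unique $\delta$-structure on $A$ over $R$ with $\delta(x)=0$. The site $q\mathrm{-CRIS}(\overline A/R)$ is the category opposite to the following one, endowed with the coarse topology (every presheaf is a sheaf). Objects: morphisms $(R,\mathfrak r)\to(B,J)$ to a complete bounded $q$-PD-pair together with a morphism $\mathrm{Spf}(B/J)\to\mathrm{Spf}(\overline A)$ of formal $\overline R$-schemes (that is, an $\overline R$-algebra map $\overline A\to B/J$); morphisms: compatible morphisms of $q$-PD-pairs under $(R,\mathfrak r)$. The structure sheaf $\mathcal O_{\overline A/R,q}$ sends $(B,J)$ to $B$. A sheaf of $\mathcal O_{\overline A/R,q}$-modules $E$ is a family of $B$-modules $E_B$ with compatible $B'$-linear transition maps $B'\otimes_BE_B\to E_{B'}$ for morphisms $(B,J)\to(B',J')$. A $q$-crystal on $\overline A/R$ is such an $E$ all of whose transition maps are bijective. $E$ is finitely presented (resp. flat) if and only if it is a $q$-crystal and all $E_B$ are finitely presented $B$-modules (resp. if and only if all $E_B$ are flat). There is a unique $R$-algebra endomorphism $\sigma$ of $A$ with $\sigma(x)=qx$ and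 $\sigma\equiv\mathrm{Id}_A\bmod q-1$, and a unique $R$-linear map $\partial_{A,q}:A\to A$ with $\partial_{A,q}(fg)=\partial_{A,q}(f)g+\sigma(f)\partial_{A,q}(g)$ and $\partial_{A,q}(x)=1$. $D_{A/R,q}$ is the non-commutative polynomial ring in one generator $\partial_q$ over $A$ with commutation rule $\partial_q\circ f=\sigma(f)\partial_q+\partial_{A,q}(f)$. A $D_{A/R,q}$-module $M$, with $\partial_{M,q}$ the action of $\partial_q$, is topologically quasi-nilpotent if $\lim_{k\to+\infty}\partial_{M,q}^k(s)=0$ for all $s\in M$. *)

theory Defs
  imports
    "HOL-Algebra.UnivPoly"
    "HOL-Algebra.IntRing"
    "HOL-Algebra.QuotRing"
    "HOL-Algebra.Ideal_Product"
    "HOL-Algebra.Free_Abelian_Groups"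
    "HOL-Algebra.Indexed_Polynomials"
begin

section \<open>Categories and functors\<close>

record ('o, 'a) cat =
  ob :: "'o set"
  arr :: "'o \<Rightarrow> 'o \<Rightarrow> 'a set"
  idt :: "'o \<Rightarrow> 'a"
  cmp :: "'o \<Rightarrow> 'o \<Rightarrow> 'o \<Rightarrow> 'a \<Rightarrow> 'a \<Rightarrow> 'a"

text \<open>\<open>cmp C U V W g f\<close> is the composite of \<open>f : U \<rightarrow> V\<close> followed by \<open>g : V \<rightarrow> W\<close>.  In all the
  categories below morphisms are extensional functions, so that equality of morphisms is
  equality in HOL.\<close>

definition is_functor ::
    "('o, 'a) cat \<Rightarrow> ('p, 'b) cat \<Rightarrow> ('o \<Rightarrow> 'p) \<Rightarrow> ('o \<Rightarrow> 'o \<Rightarrow> 'a \<Rightarrow> 'b) \<Rightarrow> bool" where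
  "is_functor C D Fo Fm \<longleftrightarrow>
     (\<forall>U\<in>ob C. Fo U \<in> ob D) \<and>
     (\<forall>U\<in>ob C. \<forall>V\<in>ob C. \<forall>f\<in>arr C U V. Fm U V f \<in> arr D (Fo U) (Fo V)) \<and>
     (\<forall>U\<in>ob C. Fm U U (idt C U) = idt D (Fo U)) \<and>
     (\<forall>U\<in>ob C. \<forall>V\<in>ob C. \<forall>W\<in>ob C. \<forall>f\<in>arr C U V. \<forall>g\<in>arr C V W.
        Fm U W (cmp C U V W g f) = cmp D (Fo U) (Fo V) (Fo W) (Fm V W g) (Fm U V f))"


section \<open>Modules\<close>

text \<open>The library's \<open>module\<close> locale requires a commutative ring; this is the analogue for left
  modules over an arbitrary ring.\<close>

locale left_module = D?: ring D + M?: abelian_group M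
  for D :: "('d, 'x) ring_scheme" (structure) and M :: "('d, 'm, 'y) module_scheme" (structure) +
  assumes smult_closed:
      "\<lbrakk>a \<in> carrier D; s \<in> carrier M\<rbrakk> \<Longrightarrow> a \<odot>\<^bsub>M\<^esub> s \<in> carrier M"
    and smult_l_distr:
      "\<lbrakk>a \<in> carrier D; b \<in> carrier D; s \<in> carrier M\<rbrakk> \<Longrightarrow>
        (a \<oplus>\<^bsub>D\<^esub> b) \<odot>\<^bsub>M\<^esub> s = a \<odot>\<^bsub>M\<^esub> s \<oplus>\<^bsub>M\<^esub> b \<odot>\<^bsub>M\<^esub> s"
    and smult_r_distr:
      "\<lbrakk>a \<in> carrier D; s \<in> carrier M; t \<in> carrier M\<rbrakk> \<Longrightarrow>
        a \<odot>\<^bsub>M\<^esub> (s \<oplus>\<^bsub>M\<^esub> t) = a \<odot>\<^bsub>M\<^esub> s \<oplus>\<^bsub>M\<^esub> a \<odot>\<^bsub>M\<^esub> t"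
    and smult_assoc:
      "\<lbrakk>a \<in> carrier D; b \<in> carrier D; s \<in> carrier M\<rbrakk> \<Longrightarrow>
        (a \<otimes>\<^bsub>D\<^esub> b) \<odot>\<^bsub>M\<^esub> s = a \<odot>\<^bsub>M\<^esub> (b \<odot>\<^bsub>M\<^esub> s)"
    and smult_one: "s \<in> carrier M \<Longrightarrow> \<one>\<^bsub>D\<^esub> \<odot>\<^bsub>M\<^esub> s = s"

definition mod_hom ::
    "('d, 'x) ring_scheme \<Rightarrow> ('d, 'm) module \<Rightarrow> ('d, 'n) module \<Rightarrow> ('m \<Rightarrow> 'n) set" where
  "mod_hom D M N = {t \<in> carrier M \<rightarrow>\<^sub>E carrier N.
     (\<forall>s\<in>carrier M. \<forall>s'\<in>carrier M. t (s \<oplus>\<^bsub>M\<^esub> s') = t s \<oplus>\<^bsub>N\<^esub> t s') \<and>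
     (\<forall>a\<in>carrier D. \<forall>s\<in>carrier M. t (a \<odot>\<^bsub>M\<^esub> s) = a \<odot>\<^bsub>N\<^esub> t s)}"

definition restrict_scalars :: "('a \<Rightarrow> 'd) \<Rightarrow> ('d, 'm) module \<Rightarrow> ('a, 'm) module" where
  "restrict_scalars j M = \<lparr>carrier = carrier M, monoid.mult = monoid.mult M, monoid.one = \<one>\<^bsub>M\<^esub>,
     ring.zero = \<zero>\<^bsub>M\<^esub>,
     ring.add = ring.add M, smult = (\<lambda>a s. j a \<odot>\<^bsub>M\<^esub> s)\<rparr>"

text \<open>Equality of modules up to the values of the operations outside the carriers and up to the
  fields \<open>mult\<close> and \<open>one\<close>, which play no role in a module.\<close>

definition same_module :: "('a, 'x) ring_scheme \<Rightarrow> ('a, 'm) module \<Rightarrow> ('a, 'm) module \<Rightarrow> bool" where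
  "same_module A M N \<longleftrightarrow> carrier M = carrier N \<and> \<zero>\<^bsub>M\<^esub> = \<zero>\<^bsub>N\<^esub> \<and>
     (\<forall>s\<in>carrier M. \<forall>t\<in>carrier M. s \<oplus>\<^bsub>M\<^esub> t = s \<oplus>\<^bsub>N\<^esub> t) \<and>
     (\<forall>a\<in>carrier A. \<forall>s\<in>carrier M. a \<odot>\<^bsub>M\<^esub> s = a \<odot>\<^bsub>N\<^esub> s)"

text \<open>The ring \<open>C\<close> seen as a module over \<open>B\<close> through \<open>f : B \<rightarrow> C\<close>.\<close>

definition alg_module :: "('c, 'x) ring_scheme \<Rightarrow> ('b \<Rightarrow> 'c) \<Rightarrow> ('b, 'c) module" where
  "alg_module C f = \<lparr>carrier = carrier C, monoid.mult = monoid.mult C, monoid.one = \<one>\<^bsub>C\<^esub>,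
     ring.zero = \<zero>\<^bsub>C\<^esub>,
     ring.add = ring.add C, smult = (\<lambda>b c. f b \<otimes>\<^bsub>C\<^esub> c)\<rparr>"

definition mod_span :: "('a, 'x) ring_scheme \<Rightarrow> ('a, 'm) module \<Rightarrow> 'm set \<Rightarrow> 'm set" where
  "mod_span B M S = \<Inter>{N. submodule N B M \<and> S \<subseteq> N}"

definition free_module :: "('a, 'x) ring_scheme \<Rightarrow> nat \<Rightarrow> ('a, nat \<Rightarrow> 'a) module" where
  "free_module B n = \<lparr>carrier = {..<n} \<rightarrow>\<^sub>E carrier B,
     monoid.mult = (\<lambda>_ _. undefined), monoid.one = undefined,
     ring.zero = (\<lambda>i\<in>{..<n}. \<zero>\<^bsub>B\<^esub>), ring.add = (\<lambda>v w. \<lambda>i\<in>{..<n}. v i \<oplus>\<^bsub>B\<^esub> w i),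
     smult = (\<lambda>b v. \<lambda>i\<in>{..<n}. b \<otimes>\<^bsub>B\<^esub> v i)\<rparr>"

definition fin_pres_module :: "('a, 'x) ring_scheme \<Rightarrow> ('a, 'm) module \<Rightarrow> bool" where
  "fin_pres_module B M \<longleftrightarrow> (\<exists>n. \<exists>t \<in> mod_hom B (free_module B n) M.
     t ` carrier (free_module B n) = carrier M \<and>
     (\<exists>K. finite K \<and> K \<subseteq> carrier (free_module B n) \<and>
        {v \<in> carrier (free_module B n). t v = \<zero>\<^bsub>M\<^esub>} = mod_span B (free_module B n) K))"

text \<open>The tensor product over a commutative ring \<open>B\<close>, as the quotient of the free abelian group on
  the set of pairs by the usual relations.  It is only needed as an abelian group, and
  is written multiplicatively because quotient groups are in the library.\<close>

definition tensor_rels ::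
    "('a, 'x) ring_scheme \<Rightarrow> ('a, 'm) module \<Rightarrow> ('a, 'n) module \<Rightarrow> (('m \<times> 'n) \<Rightarrow>\<^sub>0 int) set" where
  "tensor_rels B M N =
     {frag_of (s \<oplus>\<^bsub>M\<^esub> s', t) - frag_of (s, t) - frag_of (s', t) | s s' t.
        s \<in> carrier M \<and> s' \<in> carrier M \<and> t \<in> carrier N} \<union>
     {frag_of (s, t \<oplus>\<^bsub>N\<^esub> t') - frag_of (s, t) - frag_of (s, t') | s t t'.
        s \<in> carrier M \<and> t \<in> carrier N \<and> t' \<in> carrier N} \<union>
     {frag_of (b \<odot>\<^bsub>M\<^esub> s, t) - frag_of (s, b \<odot>\<^bsub>N\<^esub> t) | b s t.
        b \<in> carrier B \<and> s \<in> carrier M \<and> t \<in> carrier N}"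

definition tensor_null ::
    "('a, 'x) ring_scheme \<Rightarrow> ('a, 'm) module \<Rightarrow> ('a, 'n) module \<Rightarrow> (('m \<times> 'n) \<Rightarrow>\<^sub>0 int) set" where
  "tensor_null B M N =
     generate (free_Abelian_group (carrier M \<times> carrier N)) (tensor_rels B M N)"

definition tensor ::
    "('a, 'x) ring_scheme \<Rightarrow> ('a, 'm) module \<Rightarrow> ('a, 'n) module \<Rightarrow>
     (('m \<times> 'n) \<Rightarrow>\<^sub>0 int) set monoid" where
  "tensor B M N = free_Abelian_group (carrier M \<times> carrier N) Mod tensor_null B M N"

definition pure_tensor ::
    "('a, 'x) ring_scheme \<Rightarrow> ('a, 'm) module \<Rightarrow> ('a, 'n) module \<Rightarrow> 'm \<Rightarrow> 'n \<Rightarrow>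
     (('m \<times> 'n) \<Rightarrow>\<^sub>0 int) set" where
  "pure_tensor B M N s t =
     tensor_null B M N #>\<^bsub>free_Abelian_group (carrier M \<times> carrier N)\<^esub> frag_of (s, t)"

text \<open>The map out of a tensor product into an abelian group \<open>G\<close> induced by a balanced biadditive
  map \<open>\<beta>\<close>: it sends the class of a formal sum of pairs to the corresponding sum
  (product, in multiplicative notation) of values of \<open>\<beta>\<close>.\<close>

definition tensor_lift ::
    "('g, 'y) monoid_scheme \<Rightarrow> ('m \<Rightarrow> 'n \<Rightarrow> 'g) \<Rightarrow> (('m \<times> 'n) \<Rightarrow>\<^sub>0 int) set \<Rightarrow> 'g" where
  "tensor_lift G \<beta> c =
     the_elem ((\<lambda>z. \<Otimes>\<^bsub>G\<^esub>k \<in> Poly_Mapping.keys z.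
                  \<beta> (fst k) (snd k) [^]\<^bsub>G\<^esub> Poly_Mapping.lookup z k) ` c)"

text \<open>Flatness is tested on the modules carried by the type of the ring.  These include all ideals,
  so nothing is lost with respect to arbitrary test modules.\<close>

definition flat_module :: "('a, 'x) ring_scheme \<Rightarrow> ('a, 'm) module \<Rightarrow> bool" where
  "flat_module B M \<longleftrightarrow>
     (\<forall>(N :: ('a, 'a) module) (N' :: ('a, 'a) module). \<forall>u \<in> mod_hom B N N'.
        module B N \<and> module B N' \<and> inj_on u (carrier N) \<longrightarrow>
        inj_on (tensor_lift (tensor B M N') (\<lambda>s t. pure_tensor B M N' s (u t)))
          (carrier (tensor B M N)))"


section \<open>Adic topologies\<close>

fun ideal_pow :: "('a, 'x) ring_scheme \<Rightarrow> 'a set \<Rightarrow> nat \<Rightarrow> 'a set" where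
  "ideal_pow B I 0 = carrier B"
| "ideal_pow B I (Suc n) = ideal_prod B I (ideal_pow B I n)"

text \<open>The inverse limit of the rings \<open>B / I\<^sup>n\<close>; the inclusion of cosets expresses compatibility.\<close>

definition adic_completion :: "('a, 'x) ring_scheme \<Rightarrow> 'a set \<Rightarrow> (nat \<Rightarrow> 'a set) ring" where
  "adic_completion B I = \<lparr>
     carrier = {s. \<forall>n. s n \<in> carrier (B Quot ideal_pow B I n) \<and> s (Suc n) \<subseteq> s n},
     monoid.mult = (\<lambda>s t n. s n \<otimes>\<^bsub>B Quot ideal_pow B I n\<^esub> t n),
     monoid.one = (\<lambda>n. \<one>\<^bsub>B Quot ideal_pow B I n\<^esub>),
     ring.zero = (\<lambda>n. \<zero>\<^bsub>B Quot ideal_pow B I n\<^esub>),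
     ring.add = (\<lambda>s t n. s n \<oplus>\<^bsub>B Quot ideal_pow B I n\<^esub> t n)\<rparr>"

definition to_completion :: "('a, 'x) ring_scheme \<Rightarrow> 'a set \<Rightarrow> 'a \<Rightarrow> nat \<Rightarrow> 'a set" where
  "to_completion B I b = (\<lambda>n. ideal_pow B I n +>\<^bsub>B\<^esub> b)"

definition adic_complete :: "('a, 'x) ring_scheme \<Rightarrow> 'a set \<Rightarrow> bool" where
  "adic_complete B I \<longleftrightarrow>
     bij_betw (to_completion B I) (carrier B) (carrier (adic_completion B I))"

definition adic_closed :: "('a, 'x) ring_scheme \<Rightarrow> 'a set \<Rightarrow> 'a set \<Rightarrow> bool" where
  "adic_closed B I J \<longleftrightarrow>
     (\<forall>b\<in>carrier B. (\<forall>n. \<exists>j\<in>J. b \<ominus>\<^bsub>B\<^esub> j \<in> ideal_pow B I n) \<longrightarrow> b \<in> J)"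

definition adic_submodule ::
    "('a, 'x) ring_scheme \<Rightarrow> 'a set \<Rightarrow> ('a, 'm) module \<Rightarrow> nat \<Rightarrow> 'm set" where
  "adic_submodule B I M n =
     mod_span B M {a \<odot>\<^bsub>M\<^esub> s | a s. a \<in> ideal_pow B I n \<and> s \<in> carrier M}"

definition adic_null_seq ::
    "('a, 'x) ring_scheme \<Rightarrow> 'a set \<Rightarrow> ('a, 'm) module \<Rightarrow> (nat \<Rightarrow> 'm) \<Rightarrow> bool" where
  "adic_null_seq B I M s \<longleftrightarrow> (\<forall>n. \<exists>K. \<forall>k\<ge>K. s k \<in> adic_submodule B I M n)"


section \<open>Topologically etale maps\<close>

text \<open>A ring map \<open>f : S \<rightarrow> A\<close>, where \<open>S\<close> carries the \<open>I\<close>-adic and \<open>A\<close> the \<open>IA\<close>-adic topology, is formally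
  etale (as a map of topological rings) if continuous maps to discrete rings lift uniquely
  along square-zero ideals.  A map \<open>u\<close> from \<open>S\<close> to a discrete ring is continuous iff it kills a
  power of \<open>I\<close>; the continuity of the maps from \<open>A\<close> is then automatic.  The test rings are those
  carried by the type of \<open>A\<close>; for a topologically finitely presented map from a polynomial ring
  over a ring carried by the same infinite type this is no restriction, because a lifting problem
  can be solved in the subring generated by the image of \<open>S\<close> and by finitely many lifts.\<close>

definition formally_etale ::
    "('s, 'x) ring_scheme \<Rightarrow> 's set \<Rightarrow> ('a, 'y) ring_scheme \<Rightarrow> ('s \<Rightarrow> 'a) \<Rightarrow> bool" where
  "formally_etale S I A f \<longleftrightarrow> f \<in> ring_hom S A \<and>
     (\<forall>(C :: 'a ring) N u v.
        cring C \<and> ideal N C \<and> ideal_prod C N N = {\<zero>\<^bsub>C\<^esub>} \<and>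
        u \<in> ring_hom S C \<and> (\<exists>k. u ` ideal_pow S I k = {\<zero>\<^bsub>C\<^esub>}) \<and>
        v \<in> ring_hom A (C Quot N) \<and> (\<forall>s\<in>carrier S. v (f s) = N +>\<^bsub>C\<^esub> u s) \<longrightarrow>
        (\<exists>!w. w \<in> ring_hom A C \<inter> extensional (carrier A) \<and>
           (\<forall>s\<in>carrier S. w (f s) = u s) \<and> (\<forall>a\<in>carrier A. N +>\<^bsub>C\<^esub> w a = v a)))"

text \<open>The polynomial ring over \<open>S\<close> in the variables \<open>T\<^sub>0, \<dots>, T\<^sub>n\<^sub>-\<^sub>1\<close>; monomials are multisets of
  indices.\<close>

definition mpoly_ring :: "('s, 'x) ring_scheme \<Rightarrow> nat \<Rightarrow> (nat multiset \<Rightarrow> 's) ring" where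
  "mpoly_ring S n = \<lparr>
     carrier = ring.indexed_pset S {..<n} (carrier S),
     monoid.mult = (\<lambda>P Q m. \<Oplus>\<^bsub>S\<^esub>a \<in> {a. a \<subseteq># m}. P a \<otimes>\<^bsub>S\<^esub> Q (m - a)),
     monoid.one = ring.indexed_const S \<one>\<^bsub>S\<^esub>,
     ring.zero = ring.indexed_const S \<zero>\<^bsub>S\<^esub>,
     ring.add = ring.indexed_padd S\<rparr>"

text \<open>\<open>A\<close> is a quotient of some completed polynomial ring over \<open>S\<close> by a finitely generated
  ideal.\<close>

definition top_fin_pres ::
    "('s, 'x) ring_scheme \<Rightarrow> 's set \<Rightarrow> ('a, 'y) ring_scheme \<Rightarrow> ('s \<Rightarrow> 'a) \<Rightarrow> bool" where
  "top_fin_pres S I A f \<longleftrightarrow> (\<exists>n.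
     let P = mpoly_ring S n;
         IP = genideal P (ring.indexed_const S ` I);
         PC = adic_completion P IP
     in \<exists>g \<in> ring_hom PC A. g ` carrier PC = carrier A \<and>
          (\<forall>s\<in>carrier S. g (to_completion P IP (ring.indexed_const S s)) = f s) \<and>
          (\<exists>K. finite K \<and> K \<subseteq> carrier PC \<and> a_kernel PC A g = genideal PC K))"


section \<open>Delta-pairs\<close>

text \<open>The element \<open>qel\<close> is the image of \<open>q\<close> in the ring, \<open>pd_ideal\<close> is the ideal of the pair.\<close>

record 'u dpair = "'u ring" +
  delta :: "'u \<Rightarrow> 'u"
  qel :: 'u
  pd_ideal :: "'u set"

text \<open>A ring map from the localization of \<open>\<int>[q]\<close> at \<open>(p, q - 1)\<close> is, by the universal property, the
  choice of an element \<open>q\<close> such that every polynomial outside \<open>(p, q - 1)\<close> takes an invertible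
  value at \<open>q\<close>.  It is a map of \<open>\<delta>\<close>-rings iff \<open>\<delta>(q) = 0\<close>.\<close>

definition over_base :: "nat \<Rightarrow> 'u dpair \<Rightarrow> bool" where
  "over_base p B \<longleftrightarrow> qel B \<in> carrier B \<and> delta B (qel B) = \<zero>\<^bsub>B\<^esub> \<and>
     (\<forall>f \<in> carrier (UP \<Z>) -
          genideal (UP \<Z>) {monom (UP \<Z>) (int p) 0, monom (UP \<Z>) 1 1 \<ominus>\<^bsub>UP \<Z>\<^esub> \<one>\<^bsub>UP \<Z>\<^esub>}.
        eval \<Z> B (\<lambda>k. add_pow B k \<one>\<^bsub>B\<^esub>) (qel B) f \<in> Units B)"

definition delta_structure :: "nat \<Rightarrow> 'u dpair \<Rightarrow> bool" where
  "delta_structure p B \<longleftrightarrow>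
     delta B \<in> carrier B \<rightarrow> carrier B \<and>
     delta B \<zero>\<^bsub>B\<^esub> = \<zero>\<^bsub>B\<^esub> \<and> delta B \<one>\<^bsub>B\<^esub> = \<zero>\<^bsub>B\<^esub> \<and>
     (\<forall>f\<in>carrier B. \<forall>g\<in>carrier B.
        delta B (f \<oplus>\<^bsub>B\<^esub> g) = (delta B f \<oplus>\<^bsub>B\<^esub> delta B g) \<ominus>\<^bsub>B\<^esub>
          (\<Oplus>\<^bsub>B\<^esub>k \<in> {1..p-1}. add_pow B ((p choose k) div p)
             (f [^]\<^bsub>B\<^esub> (p - k) \<otimes>\<^bsub>B\<^esub> g [^]\<^bsub>B\<^esub> k))) \<and>
     (\<forall>f\<in>carrier B. \<forall>g\<in>carrier B.
        delta B (f \<otimes>\<^bsub>B\<^esub> g) =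
          f [^]\<^bsub>B\<^esub> p \<otimes>\<^bsub>B\<^esub> delta B g \<oplus>\<^bsub>B\<^esub> delta B f \<otimes>\<^bsub>B\<^esub> g [^]\<^bsub>B\<^esub> p
          \<oplus>\<^bsub>B\<^esub> add_pow B p (delta B f \<otimes>\<^bsub>B\<^esub> delta B g))"

definition frob :: "nat \<Rightarrow> 'u dpair \<Rightarrow> 'u \<Rightarrow> 'u" where
  "frob p B f = f [^]\<^bsub>B\<^esub> p \<oplus>\<^bsub>B\<^esub> add_pow B p (delta B f)"

definition delta_pair :: "nat \<Rightarrow> 'u dpair \<Rightarrow> bool" where
  "delta_pair p B \<longleftrightarrow> cring B \<and> delta_structure p B \<and> over_base p B \<and> ideal (pd_ideal B) B"

definition dpair_hom :: "'u dpair \<Rightarrow> 'u dpair \<Rightarrow> ('u \<Rightarrow> 'u) set" where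
  "dpair_hom B C = {f \<in> ring_hom B C. (\<forall>b\<in>carrier B. f (delta B b) = delta C (f b)) \<and>
     f (qel B) = qel C \<and> f ` pd_ideal B \<subseteq> pd_ideal C}"

text \<open>\<open>(q\<^sup>n - 1)/(q - 1)\<close>, written as a geometric sum since \<open>q - 1\<close> may be a zero divisor.\<close>

definition qnum :: "'u dpair \<Rightarrow> nat \<Rightarrow> 'u" where
  "qnum B n = (\<Oplus>\<^bsub>B\<^esub>i \<in> {..<n}. qel B [^]\<^bsub>B\<^esub> i)"

definition pq_ideal :: "nat \<Rightarrow> 'u dpair \<Rightarrow> 'u set" where
  "pq_ideal p B = genideal B {add_pow B p \<one>\<^bsub>B\<^esub>, qel B \<ominus>\<^bsub>B\<^esub> \<one>\<^bsub>B\<^esub>}"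

definition qnum_torsion_free :: "nat \<Rightarrow> 'u dpair \<Rightarrow> bool" where
  "qnum_torsion_free p B \<longleftrightarrow>
     (\<forall>b\<in>carrier B. qnum B p \<otimes>\<^bsub>B\<^esub> b = \<zero>\<^bsub>B\<^esub> \<longrightarrow> b = \<zero>\<^bsub>B\<^esub>)"

definition qPD_pair :: "nat \<Rightarrow> 'u dpair \<Rightarrow> bool" where
  "qPD_pair p B \<longleftrightarrow> delta_pair p B \<and> qnum_torsion_free p B \<and>
     (\<forall>f\<in>pd_ideal B. \<exists>j\<in>pd_ideal B.
        frob p B f \<ominus>\<^bsub>B\<^esub> qnum B p \<otimes>\<^bsub>B\<^esub> delta B f = qnum B p \<otimes>\<^bsub>B\<^esub> j)"

definition bounded_pair :: "nat \<Rightarrow> 'u dpair \<Rightarrow> bool" where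
  "bounded_pair p B \<longleftrightarrow> qnum_torsion_free p B \<and>
     (let Q = B Quot cgenideal B (qnum B p) in
        \<exists>N::nat. \<forall>y\<in>carrier Q.
          (\<exists>n::nat. add_pow Q (p ^ n) y = \<zero>\<^bsub>Q\<^esub>) \<longrightarrow> add_pow Q (p ^ N) y = \<zero>\<^bsub>Q\<^esub>)"

definition complete_pair :: "nat \<Rightarrow> 'u dpair \<Rightarrow> bool" where
  "complete_pair p B \<longleftrightarrow>
     adic_complete B (pq_ideal p B) \<and> adic_closed B (pq_ideal p B) (pd_ideal B)"

definition quot_pair :: "'u dpair \<Rightarrow> 'u set ring" where
  "quot_pair B = B Quot pd_ideal B"

text \<open>Here \<open>UP R\<close> is \<open>R[X]\<close> and \<open>eval R A h x\<close> is the map \<open>R[X] \<rightarrow> A\<close> extending \<open>h : R \<rightarrow> A\<close> with \<open>X \<mapsto> x\<close>.\<close>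

definition top_etale_coordinate ::
    "nat \<Rightarrow> 'u dpair \<Rightarrow> 'u dpair \<Rightarrow> ('u \<Rightarrow> 'u) \<Rightarrow> 'u \<Rightarrow> bool" where
  "top_etale_coordinate p R A h x \<longleftrightarrow> x \<in> carrier A \<and>
     (let I = genideal (UP R) ((\<lambda>r. monom (UP R) r 0) ` pq_ideal p R) in
        formally_etale (UP R) I A (eval R A h x) \<and> top_fin_pres (UP R) I A (eval R A h x))"


section \<open>The q-crystalline site and q-crystals\<close>

text \<open>An object consists of a pair \<open>(B, J)\<close>, a structure morphism \<open>(R, r) \<rightarrow> (B, J)\<close> and a map from
  \<open>A / a\<close> to \<open>B / J\<close>.\<close>

record 'u qobj =
  opair :: "'u dpair"
  ostr :: "'u \<Rightarrow> 'u"
  ospf :: "'u set \<Rightarrow> 'u set"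

text \<open>This is the opposite of the q-crystalline site, so that arrows go in the direction of the
  maps of rings and sheaves (on a coarse topology, presheaves) are covariant.

  All pairs are carried by the type \<open>'u\<close>, which plays the role of the universe in which the
  site is formed.  For this site to be the intended one, \<open>'u\<close> must be stable under the formation
  of completed (countably generated) algebras over rings carried by \<open>'u\<close>; it is enough that
  sequences in \<open>'u\<close> can be encoded as elements of \<open>'u\<close>.  Every type embeds in one with this
  property, namely \<open>nat \<Rightarrow> 'a\<close> for the given type \<open>'a\<close>.\<close>

definition qCRIS_op ::
    "nat \<Rightarrow> 'u dpair \<Rightarrow> 'u dpair \<Rightarrow> ('u \<Rightarrow> 'u) \<Rightarrow> ('u qobj, 'u \<Rightarrow> 'u) cat" where
  "qCRIS_op p R A h = \<lparr>
     ob = {U. qPD_pair p (opair U) \<and> bounded_pair p (opair U) \<and> complete_pair p (opair U) \<and>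
              ostr U \<in> dpair_hom R (opair U) \<and>
              ospf U \<in> ring_hom (quot_pair A) (quot_pair (opair U)) \<and>
              (\<forall>r\<in>carrier R. ospf U (pd_ideal A +>\<^bsub>A\<^esub> h r) =
                 pd_ideal (opair U) +>\<^bsub>opair U\<^esub> ostr U r)},
     arr = (\<lambda>U V. {f \<in> dpair_hom (opair U) (opair V) \<inter> extensional (carrier (opair U)).
              (\<forall>r\<in>carrier R. f (ostr U r) = ostr V r) \<and>
              (\<forall>c\<in>carrier (quot_pair A). f ` ospf U c \<subseteq> ospf V c)}),
     idt = (\<lambda>U. \<lambda>b\<in>carrier (opair U). b),
     cmp = (\<lambda>U V W g f. compose (carrier (opair U)) g f)\<rparr>"

definition base_obj :: "'u dpair \<Rightarrow> ('u \<Rightarrow> 'u) \<Rightarrow> 'u qobj" where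
  "base_obj A h = \<lparr>opair = A, ostr = h, ospf = (\<lambda>c. c)\<rparr>"

text \<open>\<open>trans E U V f\<close> is the restriction map \<open>E\<^sub>B \<rightarrow> E\<^sub>B\<^sub>'\<close>, which is semilinear with respect to
  \<open>f : B \<rightarrow> B'\<close>; the linear transition map \<open>B' \<otimes>\<^sub>B E\<^sub>B \<rightarrow> E\<^sub>B\<^sub>'\<close> is its linearization.\<close>

record ('u, 'm) omod =
  sect :: "'u qobj \<Rightarrow> ('u, 'm) module"
  trans :: "'u qobj \<Rightarrow> 'u qobj \<Rightarrow> ('u \<Rightarrow> 'u) \<Rightarrow> 'm \<Rightarrow> 'm"

definition is_omod :: "('u qobj, 'u \<Rightarrow> 'u) cat \<Rightarrow> ('u, 'm) omod \<Rightarrow> bool" where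
  "is_omod C E \<longleftrightarrow>
     (\<forall>U\<in>ob C. module (opair U) (sect E U)) \<and>
     (\<forall>U\<in>ob C. \<forall>V\<in>ob C. \<forall>f\<in>arr C U V.
        trans E U V f \<in> carrier (sect E U) \<rightarrow> carrier (sect E V) \<and>
        (\<forall>s\<in>carrier (sect E U). \<forall>t\<in>carrier (sect E U).
           trans E U V f (s \<oplus>\<^bsub>sect E U\<^esub> t) =
             trans E U V f s \<oplus>\<^bsub>sect E V\<^esub> trans E U V f t) \<and>
        (\<forall>b\<in>carrier (opair U). \<forall>s\<in>carrier (sect E U).
           trans E U V f (b \<odot>\<^bsub>sect E U\<^esub> s) = f b \<odot>\<^bsub>sect E V\<^esub> trans E U V f s)) \<and>
     (\<forall>U\<in>ob C. \<forall>s\<in>carrier (sect E U). trans E U U (idt C U) s = s) \<and>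
     (\<forall>U\<in>ob C. \<forall>V\<in>ob C. \<forall>W\<in>ob C. \<forall>f\<in>arr C U V. \<forall>g\<in>arr C V W.
        \<forall>s\<in>carrier (sect E U).
          trans E U W (cmp C U V W g f) s = trans E V W g (trans E U V f s))"

definition lin_trans ::
    "('u, 'm) omod \<Rightarrow> 'u qobj \<Rightarrow> 'u qobj \<Rightarrow> ('u \<Rightarrow> 'u) \<Rightarrow> (('u \<times> 'm) \<Rightarrow>\<^sub>0 int) set \<Rightarrow> 'm" where
  "lin_trans E U V f =
     tensor_lift (add_monoid (sect E V)) (\<lambda>b s. b \<odot>\<^bsub>sect E V\<^esub> trans E U V f s)"

definition is_crystal :: "('u qobj, 'u \<Rightarrow> 'u) cat \<Rightarrow> ('u, 'm) omod \<Rightarrow> bool" where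
  "is_crystal C E \<longleftrightarrow> is_omod C E \<and>
     (\<forall>U\<in>ob C. \<forall>V\<in>ob C. \<forall>f\<in>arr C U V.
        bij_betw (lin_trans E U V f)
          (carrier (tensor (opair U) (alg_module (opair V) f) (sect E U)))
          (carrier (sect E V)))"

definition omod_hom ::
    "('u qobj, 'u \<Rightarrow> 'u) cat \<Rightarrow> ('u, 'm) omod \<Rightarrow> ('u, 'm) omod \<Rightarrow> ('u qobj \<Rightarrow> 'm \<Rightarrow> 'm) set" where
  "omod_hom C E E' = {\<alpha> \<in> extensional (ob C).
     (\<forall>U\<in>ob C. \<alpha> U \<in> mod_hom (opair U) (sect E U) (sect E' U)) \<and>
     (\<forall>U\<in>ob C. \<forall>V\<in>ob C. \<forall>f\<in>arr C U V. \<forall>s\<in>carrier (sect E U).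
        \<alpha> V (trans E U V f s) = trans E' U V f (\<alpha> U s))}"

definition fp_flat_crystals ::
    "('u qobj, 'u \<Rightarrow> 'u) cat \<Rightarrow> (('u, 'm) omod, 'u qobj \<Rightarrow> 'm \<Rightarrow> 'm) cat" where
  "fp_flat_crystals C = \<lparr>
     ob = {E. is_crystal C E \<and> (\<forall>U\<in>ob C. fin_pres_module (opair U) (sect E U) \<and>
                                        flat_module (opair U) (sect E U))},
     arr = omod_hom C,
     idt = (\<lambda>E. \<lambda>U\<in>ob C. \<lambda>s\<in>carrier (sect E U). s),
     cmp = (\<lambda>E E' E'' \<beta> \<alpha>. \<lambda>U\<in>ob C. compose (carrier (sect E U)) (\<beta> U) (\<alpha> U))\<rparr>"


section \<open>Twisted differential operators\<close>

definition is_sigma :: "'u dpair \<Rightarrow> 'u dpair \<Rightarrow> ('u \<Rightarrow> 'u) \<Rightarrow> 'u \<Rightarrow> ('u \<Rightarrow> 'u) \<Rightarrow> bool" where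
  "is_sigma R A h x \<sigma> \<longleftrightarrow> \<sigma> \<in> ring_hom A A \<and> (\<forall>r\<in>carrier R. \<sigma> (h r) = h r) \<and>
     \<sigma> x = qel A \<otimes>\<^bsub>A\<^esub> x \<and>
     (\<forall>f\<in>carrier A. \<sigma> f \<ominus>\<^bsub>A\<^esub> f \<in> cgenideal A (qel A \<ominus>\<^bsub>A\<^esub> \<one>\<^bsub>A\<^esub>))"

definition is_qderiv ::
    "'u dpair \<Rightarrow> 'u dpair \<Rightarrow> ('u \<Rightarrow> 'u) \<Rightarrow> 'u \<Rightarrow> ('u \<Rightarrow> 'u) \<Rightarrow> ('u \<Rightarrow> 'u) \<Rightarrow> bool" where
  "is_qderiv R A h x \<sigma> d \<longleftrightarrow> d \<in> carrier A \<rightarrow> carrier A \<and>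
     (\<forall>f\<in>carrier A. \<forall>g\<in>carrier A. d (f \<oplus>\<^bsub>A\<^esub> g) = d f \<oplus>\<^bsub>A\<^esub> d g) \<and>
     (\<forall>r\<in>carrier R. \<forall>f\<in>carrier A. d (h r \<otimes>\<^bsub>A\<^esub> f) = h r \<otimes>\<^bsub>A\<^esub> d f) \<and>
     (\<forall>f\<in>carrier A. \<forall>g\<in>carrier A.
        d (f \<otimes>\<^bsub>A\<^esub> g) = d f \<otimes>\<^bsub>A\<^esub> g \<oplus>\<^bsub>A\<^esub> \<sigma> f \<otimes>\<^bsub>A\<^esub> d g) \<and>
     d x = \<one>\<^bsub>A\<^esub>"

text \<open>The elements of the twisted polynomial ring are the finite sums \<open>\<Sum> f\<^sub>k \<partial>\<^sup>k\<close>, represented by the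
  sequences of their coefficients as in \<open>UP A\<close>.  Left multiplication by \<open>\<partial>\<close> is dictated by the
  commutation rule: \<open>\<partial> (\<Sum> g\<^sub>k \<partial>\<^sup>k) = \<Sum> (\<sigma>(g\<^sub>k) \<partial>\<^sup>k\<^sup>+\<^sup>1 + d(g\<^sub>k) \<partial>\<^sup>k)\<close>.\<close>

definition skew_shift ::
    "('a, 'x) ring_scheme \<Rightarrow> ('a \<Rightarrow> 'a) \<Rightarrow> ('a \<Rightarrow> 'a) \<Rightarrow> (nat \<Rightarrow> 'a) \<Rightarrow> nat \<Rightarrow> 'a" where
  "skew_shift A \<sigma> d Q = (\<lambda>k. d (Q k) \<oplus>\<^bsub>A\<^esub> (if k = 0 then \<zero>\<^bsub>A\<^esub> else \<sigma> (Q (k - 1))))"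

definition D_ring ::
    "('a, 'x) ring_scheme \<Rightarrow> ('a \<Rightarrow> 'a) \<Rightarrow> ('a \<Rightarrow> 'a) \<Rightarrow> (nat \<Rightarrow> 'a) ring" where
  "D_ring A \<sigma> d = \<lparr>
     carrier = carrier (UP A),
     monoid.mult = (\<lambda>P Q k. \<Oplus>\<^bsub>A\<^esub>i \<in> {..deg A P}. P i \<otimes>\<^bsub>A\<^esub> (skew_shift A \<sigma> d ^^ i) Q k),
     monoid.one = \<one>\<^bsub>UP A\<^esub>, ring.zero = \<zero>\<^bsub>UP A\<^esub>, ring.add = ring.add (UP A)\<rparr>"

definition D_const :: "('a, 'x) ring_scheme \<Rightarrow> 'a \<Rightarrow> nat \<Rightarrow> 'a" where
  "D_const A f = monom (UP A) f 0"

definition D_gen :: "('a, 'x) ring_scheme \<Rightarrow> nat \<Rightarrow> 'a" where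
  "D_gen A = monom (UP A) \<one>\<^bsub>A\<^esub> 1"

definition underlying_module ::
    "('a, 'x) ring_scheme \<Rightarrow> (nat \<Rightarrow> 'a, 'm) module \<Rightarrow> ('a, 'm) module" where
  "underlying_module A M = restrict_scalars (D_const A) M"

definition top_quasi_nilpotent :: "nat \<Rightarrow> 'u dpair \<Rightarrow> (nat \<Rightarrow> 'u, 'm) module \<Rightarrow> bool" where
  "top_quasi_nilpotent p A M \<longleftrightarrow> (\<forall>s\<in>carrier M.
     adic_null_seq A (pq_ideal p A) (underlying_module A M)
       (\<lambda>k. ((\<lambda>t. D_gen A \<odot>\<^bsub>M\<^esub> t) ^^ k) s))"

definition fp_flat_D_modules ::
    "nat \<Rightarrow> 'u dpair \<Rightarrow> ('u \<Rightarrow> 'u) \<Rightarrow> ('u \<Rightarrow> 'u) \<Rightarrow> ((nat \<Rightarrow> 'u, 'm) module, 'm \<Rightarrow> 'm) cat" where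
  "fp_flat_D_modules p A \<sigma> d = \<lparr>
     ob = {M. left_module (D_ring A \<sigma> d) M \<and> top_quasi_nilpotent p A M \<and>
              fin_pres_module A (underlying_module A M) \<and>
              flat_module A (underlying_module A M)},
     arr = mod_hom (D_ring A \<sigma> d),
     idt = (\<lambda>M. \<lambda>s\<in>carrier M. s),
     cmp = (\<lambda>M N L g f. compose (carrier M) g f)\<rparr>"

end

theory Submission
  imports Defs "HOL-Decision_Procs.Commutative_Ring"
begin

text \<open>Let \<open>B\<close> be the ring of sequences \<open>(g\<^sub>k)\<close> in \<open>A\<close> converging to \<open>0\<close>, read as formal sums
  \<open>\<Sum>\<^sub>k g\<^sub>k \<xi>\<^sup>[\<^sup>k\<^sup>]\<close> in the twisted divided powers of \<open>\<xi> = y - x\<close>.  It has a \<open>\<delta>\<close>-structure with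
  \<open>\<delta>(y) = 0\<close>, and it is a complete bounded q-PD-pair with respect to the sequences whose constant term
  is in the ideal of \<open>A\<close>.  Besides the constant map there is the Taylor map
  \<open>a \<mapsto> \<Sum>\<^sub>k \<partial>\<^sup>k(a) \<xi>\<^sup>[\<^sup>k\<^sup>]\<close> from \<open>A\<close> to \<open>B\<close>: it commutes with \<open>\<delta>\<close>, because the failure to do so is a
  twisted derivation killing \<open>R\<close> and \<open>x\<close>, and its values are null sequences, because \<open>\<partial>\<^sup>p\<close> vanishes
  modulo \<open>(p, q - 1)\<close> for the same reason.

  For a crystal \<open>E\<close> the constant map identifies \<open>E(B)\<close> with \<open>B \<otimes> E(A)\<close>, so the elements of \<open>E(B)\<close> have
  coefficients in \<open>E(A)\<close>.  The action of \<open>\<partial>\<close> on \<open>s\<close> is the first coefficient of the image of \<open>s\<close> under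
  the Taylor map.  Repeating the construction over \<open>B\<close> shows that the \<open>k\<close>-th coefficient is
  \<open>\<partial>\<^sup>k(s)\<close>, which therefore converges to \<open>0\<close>.\<close>

text \<open>Neither \<open>p\<close> nor \<open>q - 1\<close> need be regular in the rings that
  occur, so \<delta> cannot be recovered from its Frobenius lift, nor a twisted derivation from the
  endomorphism \<sigma>. Both are therefore read through the ring
  \<open>A[\<zeta>]/(\<zeta>^2 - \<eta> \<zeta>)\<close> with \<eta> = \<open>(q - 1) y\<close>: a
  twisted derivation is the same as a ring map \<open>g \<mapsto> g + \<partial>g \<zeta>\<close>,
  whose value at \<zeta> = 0 is \<open>g\<close> and whose value at \<zeta> = \<eta> is
  \<open>\<sigma>(g)\<close>. This ring gets the \<delta>-structure with
  \<open>\<delta>(\<zeta>) = c \<zeta>\<close>, where \<open>c\<close> is chosen such that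
  \<open>\<delta>(\<eta>) = c \<eta>\<close>; then \<open>\<phi>(\<zeta>) = u \<zeta>\<close> with
  \<open>u = \<eta>^(p-1) + p c = (p)_q y^(p-1)\<close>. Compatibility of \<partial> with \<delta>
  thus becomes compatibility of a ring map with \<delta>, and this determines \<delta> on sequences,
  one coefficient after the other. All rings of the site live on one type, so sequences must be
  encoded as elements of that type; this is the purpose of the assumed injection.\<close>

text \<open>The identities below are reified with the rules \<open>reify\<close>, and the library's normal forms of
  both sides are compared by the simplifier.\<close>

context cring
begin

lemma ring_eqI:
  "a = Ipolex xs e \<Longrightarrow> b = Ipolex xs e' \<Longrightarrow>
   Commutative_Ring.norm e = Commutative_Ring.norm e' \<Longrightarrow> in_carrier xs \<Longrightarrow> a = b"
  by (metis norm_ci)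

lemma reify:
  "x0 = Ipolex (x0 # xs) (Var 0)"
  "x1 = Ipolex (x0 # x1 # xs) (Var 1)"
  "x2 = Ipolex (x0 # x1 # x2 # xs) (Var 2)"
  "x3 = Ipolex (x0 # x1 # x2 # x3 # xs) (Var 3)"
  "x4 = Ipolex (x0 # x1 # x2 # x3 # x4 # xs) (Var 4)"
  "x5 = Ipolex (x0 # x1 # x2 # x3 # x4 # x5 # xs) (Var 5)"
  "x6 = Ipolex (x0 # x1 # x2 # x3 # x4 # x5 # x6 # xs) (Var 6)"
  "x7 = Ipolex (x0 # x1 # x2 # x3 # x4 # x5 # x6 # x7 # xs) (Var 7)"
  "x8 = Ipolex (x0 # x1 # x2 # x3 # x4 # x5 # x6 # x7 # x8 # xs) (Var 8)"
  "x9 = Ipolex (x0 # x1 # x2 # x3 # x4 # x5 # x6 # x7 # x8 # x9 # xs) (Var 9)"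
  "\<zero> = Ipolex ys (Const 0)"
  "\<one> = Ipolex ys (Const 1)"
  "a = Ipolex ys e \<Longrightarrow> b = Ipolex ys e' \<Longrightarrow> a \<oplus> b = Ipolex ys (Add e e')"
  "a = Ipolex ys e \<Longrightarrow> b = Ipolex ys e' \<Longrightarrow> a \<ominus> b = Ipolex ys (Sub e e')"
  "a = Ipolex ys e \<Longrightarrow> b = Ipolex ys e' \<Longrightarrow> a \<otimes> b = Ipolex ys (Mul e e')"
  "a = Ipolex ys e \<Longrightarrow> \<ominus> a = Ipolex ys (Neg e)"
  "a = Ipolex ys e \<Longrightarrow> a [^] n = Ipolex ys (Pow e n)"
  by (simp_all add: eval_nat_numeral)

lemmas carrier_list = in_carrier_Nil in_carrier_Cons

end

section \<open>Finite sums, multiples and the binomial theorem\<close>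

lemma (in semiring) add_pow_distr_nat:
  "x \<in> carrier R \<Longrightarrow> y \<in> carrier R \<Longrightarrow> add_pow R (n::nat) (x \<oplus> y) = add_pow R n x \<oplus> add_pow R n y"
  by (induction n) (auto simp: a_ac)

lemma (in semiring) add_pow_one:
  "x \<in> carrier R \<Longrightarrow> add_pow R (n::nat) x = (add_pow R n \<one>) \<otimes> x"
  by (induction n) (auto simp: l_distr)

lemma (in semiring) add_pow_finsum:
  assumes "f \<in> S \<rightarrow> carrier R"
  shows "add_pow R (n::nat) (finsum R f S) = (\<Oplus>i\<in>S. add_pow R n (f i))"
  using assms
proof (induction S rule: infinite_finite_induct)
  case (insert x F)
  then show ?case by (auto simp: add_pow_distr_nat Pi_iff)
qed auto

lemma (in cring) finsum_swap:
  assumes "\<And>i j. f i j \<in> carrier R"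
  shows "(\<Oplus>i\<in>{..m::nat}. \<Oplus>j\<in>{..n::nat}. f i j) = (\<Oplus>j\<in>{..n}. \<Oplus>i\<in>{..m}. f i j)"
proof (induction m)
  case 0
  then show ?case using assms by (simp add: Pi_iff)
next
  case (Suc m)
  then show ?case using assms by (simp add: Pi_iff finsum_addf)
qed

text \<open>Pascal's rule, term by term. The summand is an arbitrary array \<open>f i k\<close>
  because the same step serves powers of a sum and iterated derivatives of a product.\<close>

lemma (in cring) pascal_sum:
  assumes [simp]: "\<And>i k. f i k \<in> carrier R"
  shows "(\<Oplus>k\<in>{..n}. add_pow R (n choose k) (f (Suc n - k) k)) \<oplus>
      (\<Oplus>k\<in>{..n}. add_pow R (n choose k) (f (n - k) (Suc k))) =
    (\<Oplus>k\<in>{..Suc n}. add_pow R (Suc n choose k) (f (Suc n - k) k))"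
proof -
  let ?g = "\<lambda>k. add_pow R (n choose k) (f (Suc n - k) k)"
  \<comment> \<open>The shifted sum starts at index 1, while the other one may be extended to
    \<open>Suc n\<close> because \<open>n choose Suc n = 0\<close>.\<close>
  let ?h = "\<lambda>k. if k = 0 then \<zero> else add_pow R (n choose (k - 1)) (f (Suc n - k) k)"
  have "(\<Oplus>k\<in>{..n}. ?g k) = (\<Oplus>k\<in>{..Suc n}. ?g k)"
    using finsum_Suc[of ?g n] by (simp add: binomial_eq_0 Pi_iff)
  moreover have "(\<Oplus>k\<in>{..n}. add_pow R (n choose k) (f (n - k) (Suc k))) = (\<Oplus>k\<in>{..Suc n}. ?h k)"
    using finsum_Suc2[of ?h n] by (simp add: Pi_iff)
  moreover have "(\<Oplus>k\<in>{..Suc n}. ?g k) \<oplus> (\<Oplus>k\<in>{..Suc n}. ?h k) = (\<Oplus>k\<in>{..Suc n}. ?g k \<oplus> ?h k)"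
    by (rule finsum_addf[symmetric]) auto
  moreover have "\<dots> = (\<Oplus>k\<in>{..Suc n}. add_pow R (Suc n choose k) (f (Suc n - k) k))"
  proof (rule finsum_cong')
    fix k assume "k \<in> {..Suc n}"
    show "?g k \<oplus> ?h k = add_pow R (Suc n choose k) (f (Suc n - k) k)"
      by (cases k) (auto simp: add.nat_pow_mult add.m_comm)
  qed auto
  ultimately show ?thesis by simp
qed

theorem (in cring) binomial:
  assumes [simp]: "a \<in> carrier R" "b \<in> carrier R"
  shows "(a \<oplus> b) [^] n = (\<Oplus>k\<in>{..n}. add_pow R (n choose k) (a [^] (n - k) \<otimes> b [^] k))"
proof (induction n)
  case (Suc n)
  let ?f = "\<lambda>k. add_pow R (n choose k) (a [^] (n - k) \<otimes> b [^] k)"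
  have "(a \<oplus> b) [^] Suc n = (\<Oplus>k\<in>{..n}. ?f k) \<otimes> a \<oplus> (\<Oplus>k\<in>{..n}. ?f k) \<otimes> b"
    by (simp add: Suc r_distr)
  also have "(\<Oplus>k\<in>{..n}. ?f k) \<otimes> a = (\<Oplus>k\<in>{..n}. add_pow R (n choose k) (a [^] (Suc n - k) \<otimes> b [^] k))"
    unfolding finsum_ldistr[OF finite_atMost assms(1), of ?f, simplified Pi_iff, simplified]
    by (rule finsum_cong') (auto simp: add_pow_ldistr add_pow_rdistr Suc_diff_le m_ac)
  also have "(\<Oplus>k\<in>{..n}. ?f k) \<otimes> b = (\<Oplus>k\<in>{..n}. add_pow R (n choose k) (a [^] (n - k) \<otimes> b [^] Suc k))"
    unfolding finsum_ldistr[OF finite_atMost assms(2), of ?f, simplified Pi_iff, simplified]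
    by (rule finsum_cong') (auto simp: add_pow_ldistr add_pow_rdistr m_ac)
  finally show ?case using pascal_sum[of "\<lambda>i k. a [^] i \<otimes> b [^] k" n] by simp
qed auto

section \<open>The polynomial \<open>((f + g)\<^sup>p - f\<^sup>p - g\<^sup>p) / p\<close>\<close>

definition frob_defect :: "nat \<Rightarrow> ('a, 'x) ring_scheme \<Rightarrow> 'a \<Rightarrow> 'a \<Rightarrow> 'a" where
  "frob_defect p R f g = (\<Oplus>\<^bsub>R\<^esub>k \<in> {1..p-1}. add_pow R ((p choose k) div p)
             (f [^]\<^bsub>R\<^esub> (p - k) \<otimes>\<^bsub>R\<^esub> g [^]\<^bsub>R\<^esub> k))"

text \<open>The quotient by \<open>e\<close> of \<open>frob_defect p R f (e g)\<close>.\<close>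

definition frob_defect_div :: "nat \<Rightarrow> ('a, 'x) ring_scheme \<Rightarrow> 'a \<Rightarrow> 'a \<Rightarrow> 'a \<Rightarrow> 'a" where
  "frob_defect_div p R e f g = (\<Oplus>\<^bsub>R\<^esub>k \<in> {1..p-1}. add_pow R ((p choose k) div p)
             (f [^]\<^bsub>R\<^esub> (p - k) \<otimes>\<^bsub>R\<^esub> g [^]\<^bsub>R\<^esub> k \<otimes>\<^bsub>R\<^esub> e [^]\<^bsub>R\<^esub> (k - 1)))"

lemma (in cring) frob_defect_closed [simp]:
  "f \<in> carrier R \<Longrightarrow> g \<in> carrier R \<Longrightarrow> frob_defect p R f g \<in> carrier R"
  unfolding frob_defect_def by (rule finsum_closed) auto

lemma (in cring) frob_defect_div_closed [simp]:
  "e \<in> carrier R \<Longrightarrow> f \<in> carrier R \<Longrightarrow> g \<in> carrier R \<Longrightarrow> frob_defect_div p R e f g \<in> carrier R"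
  unfolding frob_defect_div_def by (rule finsum_closed) auto

text \<open>Every monomial has total degree \<open>p\<close> in the two arguments.\<close>

lemma (in cring) frob_defect_scale:
  assumes [simp]: "c \<in> carrier R" "f \<in> carrier R" "g \<in> carrier R"
  shows "frob_defect p R (c \<otimes> f) (c \<otimes> g) = c [^] p \<otimes> frob_defect p R f g"
  unfolding frob_defect_def
  apply (subst finsum_rdistr)
     apply (auto intro!: finsum_cong' simp: add_pow_rdistr nat_pow_distrib)
  subgoal for k
    apply (rule arg_cong[where f="add_pow R _"])
    apply (subgoal_tac "c [^] p = c [^] (p - k) \<otimes> c [^] k")
     apply (simp add: m_ac)
    apply (simp add: nat_pow_mult)
    done
  done

text \<open>The second argument occurs with exponents \<open>k \<ge> 1\<close> only, so a factor
  \<open>e\<close> can be taken out formally, even where \<open>e\<close> is a zero divisor.\<close>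

lemma (in cring) frob_defect_scale_right:
  assumes [simp]: "e \<in> carrier R" "f \<in> carrier R" "g \<in> carrier R"
  shows "frob_defect p R f (e \<otimes> g) = e \<otimes> frob_defect_div p R e f g"
  unfolding frob_defect_def frob_defect_div_def
  apply (subst finsum_rdistr)
     apply (auto intro!: finsum_cong' simp: add_pow_rdistr nat_pow_distrib)
  subgoal for k
    apply (rule arg_cong[where f="add_pow R _"])
    apply (subgoal_tac "e [^] k = e \<otimes> e [^] (k - Suc 0)")
     apply (simp add: m_ac)
    apply (cases k; simp add: m_ac)
    done
  done

lemma (in cring) frob_defect_zero [simp]:
  assumes [simp]: "f \<in> carrier R"
  shows "frob_defect p R f \<zero> = \<zero>" "frob_defect p R \<zero> f = \<zero>"
  unfolding frob_defect_def
  by (auto intro!: add.finprod_one_eqI simp: nat_pow_zero)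

lemma (in cring) frob_defect_div_zero [simp]:
  assumes [simp]: "f \<in> carrier R" "e \<in> carrier R"
  shows "frob_defect_div p R e f \<zero> = \<zero>" "frob_defect_div p R e \<zero> f = \<zero>"
  unfolding frob_defect_div_def
  by (auto intro!: add.finprod_one_eqI simp: nat_pow_zero)

lemma p_times_choose_div:
  fixes p :: nat
  assumes "Factorial_Ring.prime p" "0 < k" "k < p"
  shows "p * ((p choose k) div p) = p choose k"
  using assms by (intro dvd_mult_div_cancel dvd_choose_prime) auto

lemma (in cring) frob_defect_p:
  assumes [simp]: "f \<in> carrier R" "g \<in> carrier R" and p: "Factorial_Ring.prime p"
  shows "(f \<oplus> g) [^] p = f [^] p \<oplus> g [^] p \<oplus> add_pow R p (frob_defect p R f g)"
proof -
  let ?h = "\<lambda>k. add_pow R (p choose k) (f [^] (p - k) \<otimes> g [^] k)"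
  have p0: "0 < p" using prime_gt_0_nat[OF p] .
  have "{..p} = insert 0 (insert p {1..p-1})" using p0 by auto
  then have "(f \<oplus> g) [^] p = (\<Oplus>k\<in>insert 0 (insert p {1..p-1}). ?h k)"
    by (simp add: binomial)
  also have "\<dots> = ?h 0 \<oplus> (?h p \<oplus> (\<Oplus>k\<in>{1..p-1}. ?h k))"
    using p0 by (subst finsum_insert, simp, simp, simp, simp)+ simp
  also have "(\<Oplus>k\<in>{1..p-1}. ?h k) = add_pow R p (frob_defect p R f g)"
    unfolding frob_defect_def
    by (subst add_pow_finsum)
      (auto intro!: finsum_cong' simp: add.nat_pow_pow mult.commute p_times_choose_div[OF p])
  finally show ?thesis by (simp add: a_ac)
qed

lemma (in cring) frob_defect_comm:
  assumes [simp]: "f \<in> carrier R" "g \<in> carrier R"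
  shows "frob_defect p R f g = frob_defect p R g f"
proof -
  let ?h = "\<lambda>k. add_pow R ((p choose k) div p) (g [^] (p - k) \<otimes> f [^] k)"
  have im: "(\<lambda>k. p - k) ` {1..p-1} = {1..p-1}"
  proof (intro equalityI subsetI)
    fix x assume "x \<in> {1..p-1}"
    then have "x = p - (p - x)" "p - x \<in> {1..p-1}" by auto
    then show "x \<in> (\<lambda>k. p - k) ` {1..p-1}" by blast
  qed auto
  have inj: "inj_on (\<lambda>k. p - k) {1..p-1}" by (auto simp: inj_on_def)
  have "(\<Oplus>k\<in>{1..p-1}. ?h k) = (\<Oplus>k\<in>{1..p-1}. ?h (p - k))"
    using finsum_reindex[of ?h "\<lambda>k. p - k" "{1..p-1}"] inj unfolding im by auto
  also have "\<dots> = frob_defect p R f g"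
    unfolding frob_defect_def
    by (rule finsum_cong') (auto simp: m_comm binomial_symmetric[symmetric])
  finally show ?thesis unfolding frob_defect_def by simp
qed

text \<open>The end terms may be added because their coefficient is \<open>1 div p = 0\<close>. A
  full range of summation is easier to expand again.\<close>

lemma (in cring) frob_defect_atMost:
  assumes [simp]: "f \<in> carrier R" "g \<in> carrier R" and p: "Factorial_Ring.prime p"
  shows "frob_defect p R f g =
    (\<Oplus>k\<in>{..p}. add_pow R ((p choose k) div p) (f [^] (p - k) \<otimes> g [^] k))" (is "_ = (\<Oplus>k\<in>_. ?h k)")
proof -
  have p0: "1 < p" using prime_gt_1_nat[OF p] .
  then have "{..p} = insert 0 (insert p {1..p-1})" by auto
  then have "(\<Oplus>k\<in>{..p}. ?h k) = (\<Oplus>k\<in>insert 0 (insert p {1..p-1}). ?h k)"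
    by simp
  also have "\<dots> = ?h 0 \<oplus> (?h p \<oplus> (\<Oplus>k\<in>{1..p-1}. ?h k))"
    using p0 by (subst finsum_insert, simp, simp, simp, simp)+ simp
  also have "\<dots> = frob_defect p R f g"
    unfolding frob_defect_def using p0 by simp
  finally show ?thesis by simp
qed

text \<open>The coefficients are \<open>(p - 1)! / (i! j! l!)\<close>, hence symmetric.\<close>

lemma (in cring) frob_defect_trinomial:
  assumes [simp]: "a \<in> carrier R" "b \<in> carrier R" "c \<in> carrier R" and p: "Factorial_Ring.prime p"
  shows "frob_defect p R b a \<oplus> frob_defect p R (b \<oplus> a) c =
    (\<Oplus>l\<in>{..p}. \<Oplus>i\<in>{..p}. if l + i \<le> p then
       add_pow R (if l = 0 then (p choose i) div p else ((p choose l) div p) * ((p - l) choose i)) (b [^] (p - l - i) \<otimes> a [^] i \<otimes> c [^] l) else \<zero>)"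
proof -
  \<comment> \<open>Terms with \<open>l = 0\<close> make up the first summand; those with
    \<open>l > 0\<close> come from expanding the powers of \<open>b \<oplus> a\<close> in the
    second.\<close>
  define F where "F l i = (if l + i \<le> p then
       add_pow R (if l = 0 then (p choose i) div p else ((p choose l) div p) * ((p - l) choose i)) (b [^] (p - l - i) \<otimes> a [^] i \<otimes> c [^] l) else \<zero>)" for l i
  have [simp]: "F l i \<in> carrier R" for l i unfolding F_def by auto
  have p1: "1 < p" using prime_gt_1_nat[OF p] .
  have 0: "frob_defect p R b a = (\<Oplus>i\<in>{..p}. F 0 i)"
    unfolding frob_defect_atMost[OF assms(2,1) p] by (rule finsum_cong') (auto simp: F_def)
  have S: "add_pow R ((p choose Suc l) div p) ((b \<oplus> a) [^] (p - Suc l) \<otimes> c [^] Suc l) =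
      (\<Oplus>i\<in>{..p}. F (Suc l) i)" if "Suc l \<le> p" for l
  proof -
    let ?C = "(p choose Suc l) div p"
    let ?f = "\<lambda>i. add_pow R ((p - Suc l) choose i) (b [^] (p - Suc l - i) \<otimes> a [^] i)"
    have "add_pow R (?C) ((b \<oplus> a) [^] (p - Suc l) \<otimes> c [^] Suc l)
      = (add_pow R (?C) (c [^] Suc l)) \<otimes> (\<Oplus>i\<in>{..p - Suc l}. ?f i)"
      by (subst binomial) (simp_all add: add_pow_ldistr m_comm)
    also have "\<dots> = (\<Oplus>i\<in>{..p - Suc l}. (add_pow R (?C) (c [^] Suc l)) \<otimes> ?f i)"
      by (rule finsum_rdistr) auto
    also have "\<dots> = (\<Oplus>i\<in>{..p}. F (Suc l) i)"
      using that
      by (intro add.finprod_mono_neutral_cong)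
        (auto simp: F_def add_pow_ldistr add_pow_rdistr add.nat_pow_pow m_ac Pi_iff mult.commute
          simp del: nat_pow_Suc)
    finally show ?thesis .
  qed
  have "frob_defect p R (b \<oplus> a) c =
     (\<Oplus>k\<in>{..Suc (p - 1)}. add_pow R ((p choose k) div p) ((b \<oplus> a) [^] (p - k) \<otimes> c [^] k))"
    using p1 by (subst frob_defect_atMost[OF _ _ p]) auto
  also have "\<dots> = (\<Oplus>l\<in>{..p-1}. \<Oplus>i\<in>{..p}. F (Suc l) i)"
    using p1 by (subst finsum_Suc2) (use S in \<open>auto intro!: finsum_cong' simp del: nat_pow_Suc\<close>)
  finally have "frob_defect p R b a \<oplus> frob_defect p R (b \<oplus> a) c =
     (\<Oplus>l\<in>{..Suc (p - 1)}. \<Oplus>i\<in>{..p}. F l i)"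
    unfolding 0 by (subst finsum_Suc2) (auto simp: a_comm)
  then show ?thesis using p1 unfolding F_def by simp
qed

text \<open>Exchanging the roles of \<open>l\<close> and \<open>i\<close> in the trinomial expansion
  exchanges \<open>a\<close> and \<open>c\<close>. The symmetry \<open>K\<close> of the coefficients
  is checked after multiplication by \<open>p\<close>, which can be cancelled among the natural
  numbers although not in the ring.\<close>

lemma (in cring) frob_defect_cocycle_aux:
  assumes [simp]: "a \<in> carrier R" "b \<in> carrier R" "c \<in> carrier R" and p: "Factorial_Ring.prime p"
  shows "frob_defect p R b a \<oplus> frob_defect p R (b \<oplus> a) c =
    frob_defect p R b c \<oplus> frob_defect p R (b \<oplus> c) a"
proof -
  have K: "(if l = 0 then (p choose i) div p else ((p choose l) div p) * ((p - l) choose i)) =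
    (if i = 0 then (p choose l) div p else ((p choose i) div p) * ((p - i) choose l))"
    if "l + i \<le> p" for l i
  proof (cases "l = 0 \<or> i = 0")
    case True
    have "1 div p = 0" using prime_gt_1_nat[OF p] by simp
    with True show ?thesis by auto
  next
    case False
    have "p * ((p choose l) div p * ((p - l) choose i)) = (p choose l) * ((p - l) choose i)"
      using False that by (subst p_times_choose_div[OF p, symmetric]) auto
    also have "\<dots> = (p choose i) * ((p - i) choose l)"
      using that choose_mult[of l "l + i" p] choose_mult[of i "l + i" p]
      using binomial_symmetric[of l "l + i"] by (simp add: add.commute)
    also have "\<dots> = p * ((p choose i) div p * ((p - i) choose l))"
      using False that by (subst p_times_choose_div[OF p, symmetric]) auto
    finally show ?thesis using prime_gt_0_nat[OF p] False by simp
  qed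
  show ?thesis
    unfolding frob_defect_trinomial[OF assms] frob_defect_trinomial[OF assms(3,2,1) p]
    apply (subst finsum_swap)
     apply simp
    apply (rule finsum_cong')
      apply simp
     apply (auto simp: Pi_iff)[1]
    apply (rule finsum_cong')
      apply simp
     apply (auto simp: Pi_iff)[1]
    using K by (auto simp: add.commute m_ac diff_commute)
qed

text \<open>The 2-cocycle identity that makes the sum rule of a \<delta>-structure consistent with
  associativity.\<close>

lemma (in cring) frob_defect_cocycle:
  assumes [simp]: "a \<in> carrier R" "b \<in> carrier R" "c \<in> carrier R" and p: "Factorial_Ring.prime p"
  shows "frob_defect p R a b \<oplus> frob_defect p R (a \<oplus> b) c =
    frob_defect p R b c \<oplus> frob_defect p R a (b \<oplus> c)"
  using frob_defect_cocycle_aux[OF assms] by (simp add: frob_defect_comm[of b a] frob_defect_comm[of "b \<oplus> c" a] a_comm)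

text \<open>Four elements arranged in a square are added by rows or by columns; each rearrangement
  is an instance of the cocycle identity. This is what splitting both summands as
  \<open>a + b \<zeta>\<close> requires.\<close>

lemma (in cring) frob_defect_square:
  assumes [simp]: "a \<in> carrier R" "a' \<in> carrier R" "s \<in> carrier R" "s' \<in> carrier R" and p: "Factorial_Ring.prime p"
  shows "frob_defect p R a a' \<oplus> frob_defect p R s s' \<oplus> frob_defect p R (a \<oplus> a') (s \<oplus> s') =
    frob_defect p R a s \<oplus> frob_defect p R a' s' \<oplus> frob_defect p R (a \<oplus> s) (a' \<oplus> s')"
proof -
  let ?P = "frob_defect p R"
  have 1: "?P s s' \<oplus> ?P (a \<oplus> a') (s \<oplus> s') = ?P (a \<oplus> a') s \<oplus> ?P (a \<oplus> a' \<oplus> s) s'"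
    by (intro frob_defect_cocycle[symmetric]) (simp_all add: p)
  have 2: "?P a a' \<oplus> ?P (a \<oplus> a') s = ?P a s \<oplus> ?P (a \<oplus> s) a'"
    using frob_defect_cocycle_aux[of a' a s] p by simp
  have 3: "?P (a \<oplus> s) a' \<oplus> ?P (a \<oplus> a' \<oplus> s) s' = ?P a' s' \<oplus> ?P (a \<oplus> s) (a' \<oplus> s')"
    using frob_defect_cocycle[of "a \<oplus> s" a' s'] p by (simp add: a_ac)
  have chain: "A \<oplus> S \<oplus> T = B \<oplus> D \<oplus> E"
    if "S \<oplus> T = U \<oplus> V" "A \<oplus> U = B \<oplus> C" "C \<oplus> V = D \<oplus> E"
      "{A, B, C, D, E, S, T, U, V} \<subseteq> carrier R" for A B C D E S T U V
    using that by (metis (full_types) a_assoc insert_subset)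
  show ?thesis by (rule chain[OF 1 2 3]) simp
qed

text \<open>With \<open>q = 1 + t\<close> this is \<open>(p)\<^sub>q = t\<^sup>p\<^sup>-\<^sup>1 + p c\<close>, where \<open>c = frob_defect_div p R t 1 1\<close>.\<close>

lemma (in cring) geometric_sum_binomial:
  assumes [simp]: "t \<in> carrier R"
  shows "(\<Oplus>i\<in>{..<n}. (\<one> \<oplus> t) [^] i) = (\<Oplus>k\<in>{..<n}. add_pow R (n choose Suc k) (t [^] k))"
proof (induction n)
  case (Suc n)
  have "(\<Oplus>k\<in>{..<Suc n}. add_pow R (Suc n choose Suc k) (t [^] k)) =
    (\<Oplus>k\<in>{..n}. add_pow R (n choose k) (t [^] k) \<oplus> add_pow R (n choose Suc k) (t [^] k))"
    unfolding lessThan_Suc_atMost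
    by (rule finsum_cong') (auto simp: add.nat_pow_mult)
  also have "\<dots> = (\<Oplus>k\<in>{..n}. add_pow R (n choose k) (t [^] k)) \<oplus> (\<Oplus>k\<in>{..n}. add_pow R (n choose Suc k) (t [^] k))"
    by (rule finsum_addf) auto
  also have "(\<Oplus>k\<in>{..n}. add_pow R (n choose Suc k) (t [^] k)) = (\<Oplus>k\<in>{..<n}. add_pow R (n choose Suc k) (t [^] k))"
    by (simp add: lessThan_Suc_atMost[symmetric] lessThan_Suc Pi_iff binomial_eq_0)
  also have "(\<Oplus>k\<in>{..n}. add_pow R (n choose k) (t [^] k)) = (\<one> \<oplus> t) [^] n"
    unfolding binomial[OF one_closed assms] by (rule finsum_cong') auto
  finally show ?case
    using Suc by (simp add: lessThan_Suc Pi_iff)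
qed simp

lemma (in cring) qnum_expand:
  assumes [simp]: "t \<in> carrier R" and p: "Factorial_Ring.prime p"
  shows "(\<Oplus>i\<in>{..<p}. (\<one> \<oplus> t) [^] i) = t [^] (p - 1) \<oplus> add_pow R p (frob_defect_div p R t \<one> \<one>)"
proof -
  have p1: "1 < p" using prime_gt_1_nat[OF p] .
  have "{..<p} = insert (p - 1) {..<p - 1}" using p1 by auto
  then have "(\<Oplus>i\<in>{..<p}. (\<one> \<oplus> t) [^] i) = (\<Oplus>k\<in>insert (p - 1) {..<p - 1}. add_pow R (p choose Suc k) (t [^] k))"
    unfolding geometric_sum_binomial[OF assms(1)] by simp
  also have "\<dots> = t [^] (p - 1) \<oplus> (\<Oplus>k\<in>{..<p - 1}. add_pow R (p choose Suc k) (t [^] k))"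
    using p1 by (subst finsum_insert) auto
  also have "(\<Oplus>k\<in>{..<p - 1}. add_pow R (p choose Suc k) (t [^] k)) = add_pow R p (frob_defect_div p R t \<one> \<one>)"
  proof -
    have im: "Suc ` {..<p - 1} = {1..p-1}" using p1
      by (auto simp: image_iff) (metis Suc_le_D Suc_less_eq Suc_pred le_imp_less_Suc lessThan_iff less_Suc_eq_le zero_less_Suc less_trans zero_less_one One_nat_def)
    have "(\<Oplus>k\<in>{1..p-1}. add_pow R (p choose k) (t [^] (k - 1))) = (\<Oplus>k\<in>{..<p - 1}. add_pow R (p choose Suc k) (t [^] k))"
      using finsum_reindex[of "\<lambda>k. add_pow R (p choose k) (t [^] (k - 1))" Suc "{..<p-1}"] unfolding im by simp
    moreover have "(\<Oplus>k\<in>{1..p-1}. add_pow R (p choose k) (t [^] (k - 1))) = add_pow R p (frob_defect_div p R t \<one> \<one>)"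
      unfolding frob_defect_div_def
      by (subst add_pow_finsum)
        (auto intro!: finsum_cong' simp: add.nat_pow_pow mult.commute p_times_choose_div[OF p])
    ultimately show ?thesis by simp
  qed
  finally show ?thesis .
qed

text \<open>In the monomial of index \<open>k\<close> the factor \<open>x\<close> occurs
  \<open>(p - k) + (k - 1) = p - 1\<close> times, independently of \<open>k\<close>.\<close>

lemma (in cring) frob_defect_div_mult:
  assumes [simp]: "t \<in> carrier R" "x \<in> carrier R"
  shows "frob_defect_div p R (t \<otimes> x) x \<one> = frob_defect_div p R t \<one> \<one> \<otimes> x [^] (p - 1)"
  unfolding frob_defect_div_def
  apply (subst finsum_ldistr)
     apply (auto intro!: finsum_cong' simp: add_pow_ldistr nat_pow_distrib)
  subgoal for k
    apply (rule arg_cong[where f="add_pow R _"])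
    apply (subgoal_tac "x [^] (p - Suc 0) = x [^] (p - k) \<otimes> x [^] (k - Suc 0)")
     apply (simp add: m_ac)
    apply (simp add: nat_pow_mult)
    done
  done

text \<open>\<open>\<partial>(\<phi> g) = qtwist \<phi>(\<partial> g)\<close> for the Frobenius lift of the rings below.\<close>

definition qtwist :: "nat \<Rightarrow> ('a, 'x) ring_scheme \<Rightarrow> 'a \<Rightarrow> 'a \<Rightarrow> 'a" where
  "qtwist p R q x = (\<Oplus>\<^bsub>R\<^esub>i \<in> {..<p}. q [^]\<^bsub>R\<^esub> i) \<otimes>\<^bsub>R\<^esub> x [^]\<^bsub>R\<^esub> (p - 1)"

text \<open>With \<open>e = (q - 1) x\<close> this is \<open>u = e^(p-1) + p c\<close>, the factor
  by which the Frobenius lift multiplies \<zeta> when \<open>\<zeta>^2 = e \<zeta>\<close> and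
  \<open>\<delta>(\<zeta>) = c \<zeta>\<close>.\<close>

lemma (in cring) qtwist_expand:
  assumes [simp]: "q \<in> carrier R" "x \<in> carrier R" and p: "Factorial_Ring.prime p"
  shows "qtwist p R q x = ((q \<ominus> \<one>) \<otimes> x) [^] (p - 1) \<oplus>
    add_pow R p (frob_defect_div p R ((q \<ominus> \<one>) \<otimes> x) x \<one>)"
proof -
  have "\<one> \<oplus> (q \<ominus> \<one>) = q"
    by (rule ring_eqI[of _ "[q]"], (rule reify)+, code_simp, simp add: carrier_list)
  then have "(\<Oplus>i\<in>{..<p}. q [^] i) = (q \<ominus> \<one>) [^] (p - 1) \<oplus> add_pow R p (frob_defect_div p R (q \<ominus> \<one>) \<one> \<one>)"
    using qnum_expand[of "q \<ominus> \<one>", OF _ p] by simp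
  then show ?thesis
    unfolding qtwist_def
    by (simp add: frob_defect_div_mult l_distr nat_pow_distrib add_pow_ldistr)
qed

lemma (in ring_hom_cring) hom_add_pow:
  "a \<in> carrier R \<Longrightarrow> h (add_pow R (n::nat) a) = add_pow S n (h a)"
  by (induction n) auto

lemma (in ring_hom_cring) hom_frob_defect:
  "a \<in> carrier R \<Longrightarrow> b \<in> carrier R \<Longrightarrow> h (frob_defect p R a b) = frob_defect p S (h a) (h b)"
  unfolding frob_defect_def
  by (subst hom_finsum) (auto intro!: S.finsum_cong' simp: hom_add_pow)

lemma (in ring_hom_cring) hom_frob_defect_div:
  "e \<in> carrier R \<Longrightarrow> a \<in> carrier R \<Longrightarrow> b \<in> carrier R \<Longrightarrow>
   h (frob_defect_div p R e a b) = frob_defect_div p S (h e) (h a) (h b)"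
  unfolding frob_defect_div_def
  by (subst hom_finsum) (auto intro!: S.finsum_cong' simp: hom_add_pow)

lemma (in ring_hom_cring) hom_qtwist:
  "q \<in> carrier R \<Longrightarrow> a \<in> carrier R \<Longrightarrow> h (qtwist p R q a) = qtwist p S (h q) (h a)"
  unfolding qtwist_def by (subst hom_mult) (auto intro!: arg_cong2[where f="mult S"] S.finsum_cong')

section \<open>Delta-structures on rings \<open>R[\<zeta>]/(\<zeta>\<^sup>2 - \<eta>\<zeta>)\<close>\<close>

text \<open>The map is a separate argument, because the auxiliary rings (series, truncations, rings
  in \<zeta>) are plain rings without a field for \<delta>.\<close>

definition is_delta :: "nat \<Rightarrow> ('a, 'x) ring_scheme \<Rightarrow> ('a \<Rightarrow> 'a) \<Rightarrow> bool" where
  "is_delta p B D \<longleftrightarrow>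
     D \<in> carrier B \<rightarrow> carrier B \<and> D \<zero>\<^bsub>B\<^esub> = \<zero>\<^bsub>B\<^esub> \<and> D \<one>\<^bsub>B\<^esub> = \<zero>\<^bsub>B\<^esub> \<and>
     (\<forall>f\<in>carrier B. \<forall>g\<in>carrier B.
        D (f \<oplus>\<^bsub>B\<^esub> g) = (D f \<oplus>\<^bsub>B\<^esub> D g) \<ominus>\<^bsub>B\<^esub> frob_defect p B f g) \<and>
     (\<forall>f\<in>carrier B. \<forall>g\<in>carrier B.
        D (f \<otimes>\<^bsub>B\<^esub> g) =
          f [^]\<^bsub>B\<^esub> p \<otimes>\<^bsub>B\<^esub> D g \<oplus>\<^bsub>B\<^esub> D f \<otimes>\<^bsub>B\<^esub> g [^]\<^bsub>B\<^esub> p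
          \<oplus>\<^bsub>B\<^esub> add_pow B p (D f \<otimes>\<^bsub>B\<^esub> D g))"

lemma delta_structure_iff: "delta_structure p B \<longleftrightarrow> is_delta p B (delta B)"
  unfolding delta_structure_def is_delta_def frob_defect_def by simp

lemma is_delta_closed: "is_delta p B D \<Longrightarrow> f \<in> carrier B \<Longrightarrow> D f \<in> carrier B"
  unfolding is_delta_def by auto

lemma is_delta_zero: "is_delta p B D \<Longrightarrow> D \<zero>\<^bsub>B\<^esub> = \<zero>\<^bsub>B\<^esub>"
  and is_delta_one: "is_delta p B D \<Longrightarrow> D \<one>\<^bsub>B\<^esub> = \<zero>\<^bsub>B\<^esub>"
  unfolding is_delta_def by auto

lemma is_delta_add:
  "is_delta p B D \<Longrightarrow> f \<in> carrier B \<Longrightarrow> g \<in> carrier B \<Longrightarrow>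
    D (f \<oplus>\<^bsub>B\<^esub> g) = (D f \<oplus>\<^bsub>B\<^esub> D g) \<ominus>\<^bsub>B\<^esub> frob_defect p B f g"
  unfolding is_delta_def by auto

lemma is_delta_mult:
  "is_delta p B D \<Longrightarrow> f \<in> carrier B \<Longrightarrow> g \<in> carrier B \<Longrightarrow>
    D (f \<otimes>\<^bsub>B\<^esub> g) = f [^]\<^bsub>B\<^esub> p \<otimes>\<^bsub>B\<^esub> D g \<oplus>\<^bsub>B\<^esub> D f \<otimes>\<^bsub>B\<^esub> g [^]\<^bsub>B\<^esub> p
          \<oplus>\<^bsub>B\<^esub> add_pow B p (D f \<otimes>\<^bsub>B\<^esub> D g)"
  unfolding is_delta_def by auto

text \<open>A map that corresponds to a \<delta>-structure of the target satisfies each axiom after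
  application of \<open>h\<close>. Injectivity of one or several such \<open>h\<close> then gives
  the axioms themselves.\<close>

lemma (in ring_hom_cring) hom_delta:
  assumes D: "D \<in> carrier R \<rightarrow> carrier R" and D': "is_delta p S D'"
    and comp: "\<And>a. a \<in> carrier R \<Longrightarrow> h (D a) = D' (h a)"
  shows "h (D \<zero>) = h \<zero>" "h (D \<one>) = h \<zero>"
    "f \<in> carrier R \<Longrightarrow> g \<in> carrier R \<Longrightarrow>
      h (D (f \<oplus> g)) = h ((D f \<oplus> D g) \<ominus> frob_defect p R f g)"
    "f \<in> carrier R \<Longrightarrow> g \<in> carrier R \<Longrightarrow>
      h (D (f \<otimes> g)) = h (f [^] p \<otimes> D g \<oplus> D f \<otimes> g [^] p \<oplus> add_pow R p (D f \<otimes> D g))"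
proof -
  have [simp]: "D f \<in> carrier R" if "f \<in> carrier R" for f using D that by auto
  show "h (D \<zero>) = h \<zero>" "h (D \<one>) = h \<zero>"
    by (simp_all add: comp is_delta_zero[OF D'] is_delta_one[OF D'])
  show "f \<in> carrier R \<Longrightarrow> g \<in> carrier R \<Longrightarrow>
      h (D (f \<oplus> g)) = h ((D f \<oplus> D g) \<ominus> frob_defect p R f g)"
    by (simp add: comp hom_sub hom_frob_defect is_delta_add[OF D'])
  show "f \<in> carrier R \<Longrightarrow> g \<in> carrier R \<Longrightarrow>
      h (D (f \<otimes> g)) = h (f [^] p \<otimes> D g \<oplus> D f \<otimes> g [^] p \<oplus> add_pow R p (D f \<otimes> D g))"
    by (simp add: comp hom_add_pow is_delta_mult[OF D'])
qed

text \<open>A jointly injective family is allowed, since the truncations of a series determine it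
  only together.\<close>

lemma is_delta_pullback:
  assumes "cring R" and D: "D \<in> carrier R \<rightarrow> carrier R"
    and hom: "\<And>i. i \<in> I \<Longrightarrow> cring (S i) \<and> is_delta p (S i) (D' i) \<and> h i \<in> ring_hom R (S i)"
    and comp: "\<And>i a. i \<in> I \<Longrightarrow> a \<in> carrier R \<Longrightarrow> h i (D a) = D' i (h i a)"
    and inj: "\<And>a b. a \<in> carrier R \<Longrightarrow> b \<in> carrier R \<Longrightarrow> (\<And>i. i \<in> I \<Longrightarrow> h i a = h i b) \<Longrightarrow> a = b"
  shows "is_delta p R D"
proof -
  interpret R: cring R by fact
  have [simp]: "D f \<in> carrier R" if "f \<in> carrier R" for f using D that by auto
  have rh: "ring_hom_cring R (S i) (h i)" if "i \<in> I" for i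
    using hom[OF that] R.is_cring by (simp add: ring_hom_cring_def ring_hom_cring_axioms_def)
  note hd = ring_hom_cring.hom_delta[OF rh D, OF _ _ comp]
  show ?thesis
    unfolding is_delta_def
    by (intro conjI ballI D inj; (rule hd)?; use hom in auto)
qed

text \<open>From \<delta>(q) = 0 and \<open>q = t + 1\<close> the sum rule gives
  \<open>\<delta>(t) = t c'\<close> with \<open>c' = frob_defect_div p R t \<one> \<one>\<close>;
  multiplication by the rank one element \<open>x\<close> only adds the factor \<open>x^p\<close>,
  which is distributed as \<open>x^(p-1)\<close> and \<open>x\<close>.\<close>

lemma (in cring) delta_eta:
  assumes D: "is_delta p R D" and [simp]: "q \<in> carrier R" "x \<in> carrier R"
    and "D q = \<zero>" "D x = \<zero>" and p: "Factorial_Ring.prime p"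
  shows "D ((q \<ominus> \<one>) \<otimes> x) = frob_defect_div p R ((q \<ominus> \<one>) \<otimes> x) x \<one> \<otimes> ((q \<ominus> \<one>) \<otimes> x)"
proof -
  define t where "t = q \<ominus> \<one>"
  define c where "c = frob_defect_div p R t \<one> \<one>"
  have [simp]: "t \<in> carrier R" "c \<in> carrier R" unfolding t_def c_def by auto
  have [simp]: "D t \<in> carrier R" by (rule is_delta_closed[OF D]) simp
  have qt: "q = t \<oplus> \<one>" unfolding t_def
    by (rule ring_eqI[of _ "[q]"], (rule reify)+, code_simp, simp add: carrier_list)
  have "D q = D t \<ominus> frob_defect p R t \<one>"
    unfolding qt by (simp add: is_delta_add[OF D] is_delta_one[OF D])
  also have "frob_defect p R t \<one> = t \<otimes> c"
    unfolding c_def using frob_defect_scale_right[of t \<one> \<one>] frob_defect_comm[of t \<one>] by simp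
  finally have Dt: "D t = t \<otimes> c"
    using assms(4) r_right_minus_eq[of "D t" "t \<otimes> c"] by simp
  have "D (t \<otimes> x) = t \<otimes> c \<otimes> x [^] p"
    unfolding is_delta_mult[OF D \<open>t \<in> _\<close> \<open>x \<in> _\<close>] assms(5) Dt by simp
  also have "x [^] p = x [^] (p - 1) \<otimes> x"
    using prime_gt_0_nat[OF p] by (metis Suc_diff_1 nat_pow_Suc)
  finally show ?thesis
    unfolding t_def[symmetric] by (simp add: frob_defect_div_mult c_def m_ac)
qed

text \<open>The pair \<open>(a, b)\<close> stands for \<open>a + b \<zeta>\<close> with
  \<open>\<zeta>^2 = e \<zeta>\<close>. At \<open>e = 0\<close> these are the dual numbers; the
  points \<zeta> = 0 and \<zeta> = \<open>e\<close> give the maps \<open>a\<close> and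
  \<open>a + e b\<close>.\<close>

definition dual_ring :: "('a, 'x) ring_scheme \<Rightarrow> 'a \<Rightarrow> ('a \<times> 'a) ring" where
  "dual_ring R e = \<lparr>carrier = carrier R \<times> carrier R,
     monoid.mult = (\<lambda>(a, b) (a', b'). (a \<otimes>\<^bsub>R\<^esub> a', a \<otimes>\<^bsub>R\<^esub> b' \<oplus>\<^bsub>R\<^esub> b \<otimes>\<^bsub>R\<^esub> a' \<oplus>\<^bsub>R\<^esub> e \<otimes>\<^bsub>R\<^esub> (b \<otimes>\<^bsub>R\<^esub> b'))),
     monoid.one = (\<one>\<^bsub>R\<^esub>, \<zero>\<^bsub>R\<^esub>), ring.zero = (\<zero>\<^bsub>R\<^esub>, \<zero>\<^bsub>R\<^esub>),
     ring.add = (\<lambda>(a, b) (a', b'). (a \<oplus>\<^bsub>R\<^esub> a', b \<oplus>\<^bsub>R\<^esub> b'))\<rparr>"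

text \<open>The formula is forced by \<open>\<delta>(\<zeta>) = c \<zeta>\<close>: the product rule
  gives \<open>\<delta>(b \<zeta>) = (u \<delta>(b) + c b^p) \<zeta>\<close> with
  \<open>\<phi>(\<zeta>) = u \<zeta>\<close>, and the sum rule for \<open>a\<close> and
  \<open>b \<zeta>\<close> contributes the last term.\<close>

definition dual_delta :: "nat \<Rightarrow> ('a, 'x) ring_scheme \<Rightarrow> ('a \<Rightarrow> 'a) \<Rightarrow> 'a \<Rightarrow> 'a \<Rightarrow> 'a \<Rightarrow> 'a \<times> 'a \<Rightarrow> 'a \<times> 'a" where
  "dual_delta p R D e c u = (\<lambda>(a, b). (D a,
     u \<otimes>\<^bsub>R\<^esub> D b \<oplus>\<^bsub>R\<^esub> c \<otimes>\<^bsub>R\<^esub> b [^]\<^bsub>R\<^esub> p \<ominus>\<^bsub>R\<^esub> frob_defect_div p R e a b))"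

lemma dual_ring_simps [simp]:
  "carrier (dual_ring R e) = carrier R \<times> carrier R"
  "(a, b) \<otimes>\<^bsub>dual_ring R e\<^esub> (a', b') =
     (a \<otimes>\<^bsub>R\<^esub> a', a \<otimes>\<^bsub>R\<^esub> b' \<oplus>\<^bsub>R\<^esub> b \<otimes>\<^bsub>R\<^esub> a' \<oplus>\<^bsub>R\<^esub> e \<otimes>\<^bsub>R\<^esub> (b \<otimes>\<^bsub>R\<^esub> b'))"
  "\<one>\<^bsub>dual_ring R e\<^esub> = (\<one>\<^bsub>R\<^esub>, \<zero>\<^bsub>R\<^esub>)"
  "\<zero>\<^bsub>dual_ring R e\<^esub> = (\<zero>\<^bsub>R\<^esub>, \<zero>\<^bsub>R\<^esub>)"
  "(a, b) \<oplus>\<^bsub>dual_ring R e\<^esub> (a', b') = (a \<oplus>\<^bsub>R\<^esub> a', b \<oplus>\<^bsub>R\<^esub> b')"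
  by (simp_all add: dual_ring_def)

lemma (in cring) cring_dual_ring:
  assumes [simp]: "e \<in> carrier R"
  shows "cring (dual_ring R e)"
proof (rule cringI)
  show "abelian_group (dual_ring R e)"
  proof (rule abelian_groupI)
    fix x assume "x \<in> carrier (dual_ring R e)"
    then show "\<exists>y\<in>carrier (dual_ring R e). y \<oplus>\<^bsub>dual_ring R e\<^esub> x = \<zero>\<^bsub>dual_ring R e\<^esub>"
      by (cases x) (auto intro!: bexI[of _ "(\<ominus> fst x, \<ominus> snd x)"] simp: l_neg)
  qed (auto simp: a_ac)
  show "Group.comm_monoid (dual_ring R e)"
  proof (rule comm_monoidI)
    fix v w z assume "v \<in> carrier (dual_ring R e)" "w \<in> carrier (dual_ring R e)" "z \<in> carrier (dual_ring R e)"
    then obtain a b a' b' a'' b'' where [simp]: "v = (a, b)" "w = (a', b')" "z = (a'', b'')"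
      "a \<in> carrier R" "b \<in> carrier R" "a' \<in> carrier R" "b' \<in> carrier R" "a'' \<in> carrier R" "b'' \<in> carrier R"
      by auto
    have "(a \<otimes> a') \<otimes> b'' \<oplus> (a \<otimes> b' \<oplus> b \<otimes> a' \<oplus> e \<otimes> (b \<otimes> b')) \<otimes> a''
      \<oplus> e \<otimes> ((a \<otimes> b' \<oplus> b \<otimes> a' \<oplus> e \<otimes> (b \<otimes> b')) \<otimes> b'')
      = a \<otimes> (a' \<otimes> b'' \<oplus> b' \<otimes> a'' \<oplus> e \<otimes> (b' \<otimes> b'')) \<oplus> b \<otimes> (a' \<otimes> a'')
      \<oplus> e \<otimes> (b \<otimes> (a' \<otimes> b'' \<oplus> b' \<otimes> a'' \<oplus> e \<otimes> (b' \<otimes> b'')))"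
      by (rule ring_eqI[of _ "[a,b,a',b',a'',b'',e]"], (rule reify)+, code_simp, simp add: carrier_list)
    then show "v \<otimes>\<^bsub>dual_ring R e\<^esub> w \<otimes>\<^bsub>dual_ring R e\<^esub> z = v \<otimes>\<^bsub>dual_ring R e\<^esub> (w \<otimes>\<^bsub>dual_ring R e\<^esub> z)"
      by (simp add: m_assoc)
    show "v \<otimes>\<^bsub>dual_ring R e\<^esub> w = w \<otimes>\<^bsub>dual_ring R e\<^esub> v"
      by (simp add: m_ac a_ac)
  qed auto
  fix v w z assume "v \<in> carrier (dual_ring R e)" "w \<in> carrier (dual_ring R e)" "z \<in> carrier (dual_ring R e)"
  then obtain a b a' b' a'' b'' where [simp]: "v = (a, b)" "w = (a', b')" "z = (a'', b'')"
    "a \<in> carrier R" "b \<in> carrier R" "a' \<in> carrier R" "b' \<in> carrier R" "a'' \<in> carrier R" "b'' \<in> carrier R"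
    by auto
  show "(v \<oplus>\<^bsub>dual_ring R e\<^esub> w) \<otimes>\<^bsub>dual_ring R e\<^esub> z =
    v \<otimes>\<^bsub>dual_ring R e\<^esub> z \<oplus>\<^bsub>dual_ring R e\<^esub> w \<otimes>\<^bsub>dual_ring R e\<^esub> z"
    by (simp add: l_distr r_distr a_ac)
qed

locale dual_cring = cring R for R (structure) +
  fixes e
  assumes e [simp]: "e \<in> carrier R"
begin

abbreviation "Z \<equiv> dual_ring R e"

sublocale Z: cring Z by (rule cring_dual_ring) simp

lemma dual_minus [simp]:
  "a \<in> carrier R \<Longrightarrow> b \<in> carrier R \<Longrightarrow> a' \<in> carrier R \<Longrightarrow> b' \<in> carrier R \<Longrightarrow>
   (a, b) \<ominus>\<^bsub>Z\<^esub> (a', b') = (a \<ominus> a', b \<ominus> b')"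
proof -
  assume [simp]: "a \<in> carrier R" "b \<in> carrier R" "a' \<in> carrier R" "b' \<in> carrier R"
  have "\<ominus>\<^bsub>Z\<^esub> (a', b') = (\<ominus> a', \<ominus> b')"
    by (rule Z.minus_equality) (auto simp: l_neg)
  then show ?thesis by (simp add: a_minus_def)
qed

lemma hom_left: "ring_hom_cring R Z (\<lambda>a. (a, \<zero>))"
  by (rule ring_hom_cringI, rule is_cring, rule Z.is_cring) (auto intro!: ring_hom_memI)

lemma hom_fst: "ring_hom_cring Z R fst"
  by (rule ring_hom_cringI, rule Z.is_cring, rule is_cring) (auto intro!: ring_hom_memI)

lemma dual_add_pow [simp]:
  "a \<in> carrier R \<Longrightarrow> b \<in> carrier R \<Longrightarrow> add_pow Z (n::nat) (a, b) = (add_pow R n a, add_pow R n b)"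
  by (induction n) auto

lemma dual_pow_left [simp]: "a \<in> carrier R \<Longrightarrow> (a, \<zero>) [^]\<^bsub>Z\<^esub> (n::nat) = (a [^] n, \<zero>)"
  by (induction n) auto

text \<open>Because \<open>\<zeta>^n = e^(n-1) \<zeta>\<close> for positive
  \<open>n\<close>.\<close>

lemma dual_pow_right:
  "b \<in> carrier R \<Longrightarrow> 0 < n \<Longrightarrow> (\<zero>, b) [^]\<^bsub>Z\<^esub> (n::nat) = (\<zero>, e [^] (n - 1) \<otimes> b [^] n)"
proof (induction n)
  case (Suc n)
  then show ?case by (cases n) (auto simp: m_ac)
qed simp

lemma dual_finsum_right:
  "f \<in> S \<rightarrow> carrier R \<Longrightarrow> finsum Z (\<lambda>i. (\<zero>, f i)) S = (\<zero>, finsum R f S)"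
proof (induction S rule: infinite_finite_induct)
  case (insert x F)
  then show ?case by (auto simp: Pi_iff)
qed auto

text \<open>Each monomial contains \<open>\<zeta>^k = e^(k-1) \<zeta>\<close> with
  \<open>k \<ge> 1\<close>, which is the origin of the powers of \<open>e\<close> in
  \<open>frob_defect_div\<close>.\<close>

lemma dual_defect_mixed:
  assumes [simp]: "a \<in> carrier R" "b \<in> carrier R"
  shows "frob_defect p Z (a, \<zero>) (\<zero>, b) = (\<zero>, frob_defect_div p R e a b)"
  unfolding frob_defect_def frob_defect_div_def
  by (subst dual_finsum_right[symmetric]) (auto intro!: Z.finsum_cong' simp: dual_pow_right m_ac simp del: nat_pow_Suc)

text \<open>Homogeneity takes out the factor \<open>\<zeta>^p = e^(p-1) \<zeta>\<close>.\<close>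

lemma dual_defect_right:
  assumes [simp]: "a \<in> carrier R" "b \<in> carrier R" and "0 < p"
  shows "frob_defect p Z (\<zero>, a) (\<zero>, b) = (\<zero>, e [^] (p - 1) \<otimes> frob_defect p R a b)"
proof -
  have "frob_defect p Z (\<zero>, a) (\<zero>, b) = (\<zero>, \<one>) [^]\<^bsub>Z\<^esub> p \<otimes>\<^bsub>Z\<^esub> frob_defect p Z (a, \<zero>) (b, \<zero>)"
    by (subst Z.frob_defect_scale[symmetric]) auto
  then show ?thesis
    using assms(3)
    by (simp add: ring_hom_cring.hom_frob_defect[OF hom_left assms(1,2), symmetric])
      (simp add: dual_pow_right[of \<one>, simplified])
qed

end

text \<open>Multiplicativity of a \<open>\<delta>\<close>-map is biadditive, because \<open>f \<mapsto> f\<^sup>p + p \<delta> f\<close> is additive.\<close>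

lemma (in cring) delta_mult_add:
  assumes D [simp]: "\<And>f. f \<in> carrier R \<Longrightarrow> D f \<in> carrier R"
    and add: "\<And>f g. f \<in> carrier R \<Longrightarrow> g \<in> carrier R \<Longrightarrow>
      D (f \<oplus> g) = (D f \<oplus> D g) \<ominus> frob_defect p R f g"
    and [simp]: "f \<in> carrier R" "f' \<in> carrier R" "g \<in> carrier R"
    and m: "D (f \<otimes> g) = f [^] p \<otimes> D g \<oplus> D f \<otimes> g [^] p \<oplus> add_pow R p (D f \<otimes> D g)"
    and m': "D (f' \<otimes> g) = f' [^] p \<otimes> D g \<oplus> D f' \<otimes> g [^] p \<oplus> add_pow R p (D f' \<otimes> D g)"
    and p: "Factorial_Ring.prime p"
  shows "D ((f \<oplus> f') \<otimes> g) =
    (f \<oplus> f') [^] p \<otimes> D g \<oplus> D (f \<oplus> f') \<otimes> g [^] p \<oplus> add_pow R p (D (f \<oplus> f') \<otimes> D g)"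
proof -
  define \<pi> where "\<pi> = add_pow R p \<one>"
  have \<pi>: "add_pow R p y = \<pi> \<otimes> y" if "y \<in> carrier R" for y
    unfolding \<pi>_def using that by (rule add_pow_one)
  have [simp]: "\<pi> \<in> carrier R" unfolding \<pi>_def by simp
  define F F' G P d d' c where "F = f [^] p" and "F' = f' [^] p" and "G = g [^] p"
    and "P = frob_defect p R f f'" and "d = D f" and "d' = D f'" and "c = D g"
  have [simp]: "F \<in> carrier R" "F' \<in> carrier R" "G \<in> carrier R" "P \<in> carrier R"
    "d \<in> carrier R" "d' \<in> carrier R" "c \<in> carrier R"
    unfolding F_def F'_def G_def P_def d_def d'_def c_def by auto
  have fg: "frob_defect p R (f \<otimes> g) (f' \<otimes> g) = G \<otimes> P"
    using frob_defect_scale[of g f f'] unfolding G_def P_def by (simp add: m_comm[of _ g])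
  have "D ((f \<oplus> f') \<otimes> g) = (F \<otimes> c \<oplus> d \<otimes> G \<oplus> \<pi> \<otimes> (d \<otimes> c)) \<oplus>
    (F' \<otimes> c \<oplus> d' \<otimes> G \<oplus> \<pi> \<otimes> (d' \<otimes> c)) \<ominus> G \<otimes> P"
    unfolding l_distr[OF assms(3,4,5)]
    by (simp add: add m m' \<pi> fg) (simp add: F_def F'_def G_def d_def d'_def c_def)
  also have "\<dots> = (F \<oplus> F' \<oplus> \<pi> \<otimes> P) \<otimes> c \<oplus> (d \<oplus> d' \<ominus> P) \<otimes> G \<oplus> \<pi> \<otimes> ((d \<oplus> d' \<ominus> P) \<otimes> c)"
    by (rule ring_eqI[of _ "[F,F',G,P,d,d',c,\<pi>]"], (rule reify)+, code_simp, simp add: carrier_list)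
  also have "\<dots> = (f \<oplus> f') [^] p \<otimes> D g \<oplus> D (f \<oplus> f') \<otimes> g [^] p \<oplus> add_pow R p (D (f \<oplus> f') \<otimes> D g)"
    using frob_defect_p[OF assms(3,4) p]
    by (simp add: add \<pi>) (simp add: F_def F'_def G_def P_def d_def d'_def c_def \<pi>)
  finally show ?thesis .
qed

context dual_cring
begin

text \<open>The sum rule is reduced by \<open>frob_defect_square\<close> to summands of the same
  kind, and the product rule, being biadditive, to the products of ring elements and multiples of
  \<zeta>. The relation between \<open>D e\<close> and \<open>c\<close> enters for two multiples of
  \<zeta>, whose product is \<open>e b b' \<zeta>\<close>.\<close>

lemma is_delta_dual:
  assumes D: "is_delta p R D" and [simp]: "c \<in> carrier R" and De: "D e = c \<otimes> e"
    and u: "u = e [^] (p - 1) \<oplus> add_pow R p c" and p: "Factorial_Ring.prime p"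
  shows "is_delta p Z (dual_delta p R D e c u)"
proof -
  let ?D = "dual_delta p R D e c u"
  note [simp] = is_delta_closed[OF D] is_delta_zero[OF D] is_delta_one[OF D]
  have p0: "0 < p" using prime_gt_0_nat[OF p] .
  define \<pi> where "\<pi> = add_pow R p \<one>"
  have \<pi>: "add_pow R p y = \<pi> \<otimes> y" if "y \<in> carrier R" for y
    unfolding \<pi>_def using that by (rule add_pow_one)
  have [simp]: "\<pi> \<in> carrier R" unfolding \<pi>_def by simp
  define N where "N = e [^] (p - 1)"
  have [simp]: "N \<in> carrier R" unfolding N_def by simp
  have u': "u = N \<oplus> \<pi> \<otimes> c" unfolding u N_def by (simp add: \<pi>)
  have [simp]: "u \<in> carrier R" unfolding u' by simp
  have ep: "e [^] p = N \<otimes> e" unfolding N_def using p0 by (metis Suc_diff_1 nat_pow_Suc)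
  have z [simp]: "\<zero> [^] p = \<zero>" using p0 by (simp add: nat_pow_zero)
  \<comment> \<open>On multiples of \<zeta> the map is
    \<open>b \<zeta> \<mapsto> (L b) \<zeta>\<close>.\<close>
  define L where "L b = u \<otimes> D b \<oplus> c \<otimes> b [^] p" for b
  have [simp]: "L b \<in> carrier R" if "b \<in> carrier R" for b using that unfolding L_def by simp
  have DL: "?D (a, \<zero>) = (D a, \<zero>)" if "a \<in> carrier R" for a
    using that unfolding dual_delta_def by simp
  have DR: "?D (\<zero>, b) = (\<zero>, L b)" if "b \<in> carrier R" for b
    using that unfolding dual_delta_def L_def by (simp add: a_minus_def)
  have closed: "?D w \<in> carrier Z" if "w \<in> carrier Z" for w
    using that unfolding dual_delta_def by (cases w) auto
  have split: "?D (a, b) = (D a, L b) \<ominus>\<^bsub>Z\<^esub> frob_defect p Z (a, \<zero>) (\<zero>, b)"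
    if "a \<in> carrier R" "b \<in> carrier R" for a b
    using that by (simp add: dual_defect_mixed) (simp add: dual_delta_def L_def a_minus_def)
  have Ladd: "L (b \<oplus> b') = L b \<oplus> L b' \<ominus> N \<otimes> frob_defect p R b b'"
    if [simp]: "b \<in> carrier R" "b' \<in> carrier R" for b b'
  proof -
    define P B B' d d' where "P = frob_defect p R b b'" and "B = b [^] p" and "B' = b' [^] p"
      and "d = D b" and "d' = D b'"
    have [simp]: "P \<in> carrier R" "B \<in> carrier R" "B' \<in> carrier R" "d \<in> carrier R" "d' \<in> carrier R"
      unfolding P_def B_def B'_def d_def d'_def by auto
    have "L (b \<oplus> b') = (N \<oplus> \<pi> \<otimes> c) \<otimes> (d \<oplus> d' \<ominus> P) \<oplus> c \<otimes> (B \<oplus> B' \<oplus> \<pi> \<otimes> P)"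
      unfolding L_def u' frob_defect_p[OF that p] is_delta_add[OF D that]
      by (simp add: P_def B_def B'_def d_def d'_def \<pi>)
    also have "\<dots> = ((N \<oplus> \<pi> \<otimes> c) \<otimes> d \<oplus> c \<otimes> B) \<oplus> ((N \<oplus> \<pi> \<otimes> c) \<otimes> d' \<oplus> c \<otimes> B') \<ominus> N \<otimes> P"
      by (rule ring_eqI[of _ "[N,\<pi>,c,d,d',P,B,B']"], (rule reify)+, code_simp, simp add: carrier_list)
    finally show ?thesis unfolding L_def u' P_def B_def B'_def d_def d'_def .
  qed
  have add: "?D (f \<oplus>\<^bsub>Z\<^esub> g) = (?D f \<oplus>\<^bsub>Z\<^esub> ?D g) \<ominus>\<^bsub>Z\<^esub> frob_defect p Z f g"
    if fg: "f \<in> carrier Z" "g \<in> carrier Z" for f g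
  proof -
    obtain a b a' b' where w: "f = (a, b)" "g = (a', b')" and
      [simp]: "a \<in> carrier R" "b \<in> carrier R" "a' \<in> carrier R" "b' \<in> carrier R"
      using fg by auto
    let ?P = "frob_defect p Z"
    have 1: "(D (a \<oplus> a'), L (b \<oplus> b')) =
      (D a, L b) \<oplus>\<^bsub>Z\<^esub> (D a', L b') \<ominus>\<^bsub>Z\<^esub> (?P (a, \<zero>) (a', \<zero>) \<oplus>\<^bsub>Z\<^esub> ?P (\<zero>, b) (\<zero>, b'))"
      by (simp add: ring_hom_cring.hom_frob_defect[OF hom_left, of a a' p, symmetric] dual_defect_right[OF _ _ p0] Ladd is_delta_add[OF D] N_def)
    \<comment> \<open>The four pieces of \<open>f\<close> and \<open>g\<close> are added either
      first within the ring elements and within the multiples of \<zeta>, or first within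
      \<open>f\<close> and within \<open>g\<close>.\<close>
    have sq: "?P (a, \<zero>) (a', \<zero>) \<oplus>\<^bsub>Z\<^esub> ?P (\<zero>, b) (\<zero>, b') \<oplus>\<^bsub>Z\<^esub> ?P (a \<oplus> a', \<zero>) (\<zero>, b \<oplus> b') =
      ?P (a, \<zero>) (\<zero>, b) \<oplus>\<^bsub>Z\<^esub> ?P (a', \<zero>) (\<zero>, b') \<oplus>\<^bsub>Z\<^esub> ?P f g"
      using Z.frob_defect_square[of "(a, \<zero>)" "(a', \<zero>)" "(\<zero>, b)" "(\<zero>, b')" p] p unfolding w by simp
    have abs: "X1 \<oplus>\<^bsub>Z\<^esub> X2 \<ominus>\<^bsub>Z\<^esub> Y1 \<ominus>\<^bsub>Z\<^esub> Y2 = X1 \<ominus>\<^bsub>Z\<^esub> Y3 \<oplus>\<^bsub>Z\<^esub> (X2 \<ominus>\<^bsub>Z\<^esub> Y4) \<ominus>\<^bsub>Z\<^esub> Y5"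
      if "Y1 \<oplus>\<^bsub>Z\<^esub> Y2 = Y3 \<oplus>\<^bsub>Z\<^esub> Y4 \<oplus>\<^bsub>Z\<^esub> Y5" and
        c: "X1 \<in> carrier Z" "X2 \<in> carrier Z" "Y1 \<in> carrier Z" "Y2 \<in> carrier Z" "Y3 \<in> carrier Z" "Y4 \<in> carrier Z" "Y5 \<in> carrier Z"
      for X1 X2 Y1 Y2 Y3 Y4 Y5
    proof -
      have "X1 \<oplus>\<^bsub>Z\<^esub> X2 \<ominus>\<^bsub>Z\<^esub> Y1 \<ominus>\<^bsub>Z\<^esub> Y2 = X1 \<oplus>\<^bsub>Z\<^esub> X2 \<ominus>\<^bsub>Z\<^esub> (Y1 \<oplus>\<^bsub>Z\<^esub> Y2)"
        by (rule Z.ring_eqI[of _ "[X1,X2,Y1,Y2]"], (rule Z.reify)+, code_simp, simp only: Z.carrier_list c)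
      also have "\<dots> = X1 \<ominus>\<^bsub>Z\<^esub> Y3 \<oplus>\<^bsub>Z\<^esub> (X2 \<ominus>\<^bsub>Z\<^esub> Y4) \<ominus>\<^bsub>Z\<^esub> Y5" unfolding that(1)
        by (rule Z.ring_eqI[of _ "[X1,X2,Y3,Y4,Y5]"], (rule Z.reify)+, code_simp, simp only: Z.carrier_list c)
      finally show ?thesis .
    qed
    have "?D (f \<oplus>\<^bsub>Z\<^esub> g) = (D a, L b) \<oplus>\<^bsub>Z\<^esub> (D a', L b') \<ominus>\<^bsub>Z\<^esub>
      (?P (a, \<zero>) (a', \<zero>) \<oplus>\<^bsub>Z\<^esub> ?P (\<zero>, b) (\<zero>, b')) \<ominus>\<^bsub>Z\<^esub> ?P (a \<oplus> a', \<zero>) (\<zero>, b \<oplus> b')"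
      unfolding 1[symmetric] unfolding w by (simp only: dual_ring_simps split a_closed \<open>a \<in> _\<close> \<open>a' \<in> _\<close> \<open>b \<in> _\<close> \<open>b' \<in> _\<close>)
    also have "\<dots> = (D a, L b) \<ominus>\<^bsub>Z\<^esub> ?P (a, \<zero>) (\<zero>, b) \<oplus>\<^bsub>Z\<^esub>
      ((D a', L b') \<ominus>\<^bsub>Z\<^esub> ?P (a', \<zero>) (\<zero>, b')) \<ominus>\<^bsub>Z\<^esub> ?P f g"
      using fg by (intro abs sq Z.a_closed Z.frob_defect_closed) auto
    finally show ?thesis unfolding w by (simp only: split \<open>a \<in> _\<close> \<open>a' \<in> _\<close> \<open>b \<in> _\<close> \<open>b' \<in> _\<close>)
  qed
  let ?M = "\<lambda>f g. ?D (f \<otimes>\<^bsub>Z\<^esub> g) = f [^]\<^bsub>Z\<^esub> p \<otimes>\<^bsub>Z\<^esub> ?D g \<oplus>\<^bsub>Z\<^esub> ?D f \<otimes>\<^bsub>Z\<^esub> g [^]\<^bsub>Z\<^esub> p \<oplus>\<^bsub>Z\<^esub>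
    add_pow Z p (?D f \<otimes>\<^bsub>Z\<^esub> ?D g)"
  have M1: "?M (a, \<zero>) (a', \<zero>)" if "a \<in> carrier R" "a' \<in> carrier R" for a a'
    using that by (simp add: DL is_delta_mult[OF D])
  have M2: "?M (a, \<zero>) (\<zero>, b)" if [simp]: "a \<in> carrier R" "b \<in> carrier R" for a b
  proof -
    define B A d d' where "B = b [^] p" and "A = a [^] p" and "d = D a" and "d' = D b"
    have [simp]: "B \<in> carrier R" "A \<in> carrier R" "d \<in> carrier R" "d' \<in> carrier R"
      unfolding B_def A_def d_def d'_def by auto
    have "L (a \<otimes> b) = (N \<oplus> \<pi> \<otimes> c) \<otimes> (A \<otimes> d' \<oplus> d \<otimes> B \<oplus> \<pi> \<otimes> (d \<otimes> d')) \<oplus> c \<otimes> (A \<otimes> B)"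
      unfolding L_def is_delta_mult[OF D that] u' B_def A_def d_def d'_def
      by (simp add: nat_pow_distrib \<pi>)
    also have "\<dots> = A \<otimes> ((N \<oplus> \<pi> \<otimes> c) \<otimes> d' \<oplus> c \<otimes> B) \<oplus> d \<otimes> (N \<otimes> B)
       \<oplus> \<pi> \<otimes> (d \<otimes> ((N \<oplus> \<pi> \<otimes> c) \<otimes> d' \<oplus> c \<otimes> B))"
      by (rule ring_eqI[of _ "[N,\<pi>,c,d,d',A,B]"], (rule reify)+, code_simp, simp add: carrier_list)
    also have "\<dots> = A \<otimes> L b \<oplus> d \<otimes> (N \<otimes> B) \<oplus> add_pow R p (d \<otimes> L b)"
      unfolding L_def u' B_def d'_def by (simp add: \<pi>)
    finally show ?thesis
      using p0 unfolding B_def A_def d_def N_def by (simp add: DL DR dual_pow_right)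
  qed
  have M3: "?M (\<zero>, b) (\<zero>, b')" if [simp]: "b \<in> carrier R" "b' \<in> carrier R" for b b'
  proof -
    define B B' d d' where "B = b [^] p" and "B' = b' [^] p" and "d = D b" and "d' = D b'"
    have [simp]: "B \<in> carrier R" "B' \<in> carrier R" "d \<in> carrier R" "d' \<in> carrier R"
      unfolding B_def B'_def d_def d'_def by auto
    define Y where "Y = B \<otimes> d' \<oplus> d \<otimes> B' \<oplus> \<pi> \<otimes> (d \<otimes> d')"
    have [simp]: "Y \<in> carrier R" unfolding Y_def by simp
    have Dbb: "D (b \<otimes> b') = Y"
      unfolding is_delta_mult[OF D that] Y_def B_def B'_def d_def d'_def by (simp add: \<pi>)
    have "D (e \<otimes> (b \<otimes> b')) = (N \<otimes> e) \<otimes> Y \<oplus> (c \<otimes> e) \<otimes> (B \<otimes> B') \<oplus> \<pi> \<otimes> ((c \<otimes> e) \<otimes> Y)"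
      by (simp add: is_delta_mult[OF D] Dbb De ep nat_pow_distrib \<pi> B_def B'_def)
        (simp add: is_delta_mult[OF D, symmetric] Dbb)?
    then have "L (e \<otimes> (b \<otimes> b')) = (N \<oplus> \<pi> \<otimes> c) \<otimes> ((N \<otimes> e) \<otimes> Y \<oplus> (c \<otimes> e) \<otimes> (B \<otimes> B') \<oplus> \<pi> \<otimes> ((c \<otimes> e) \<otimes> Y))
      \<oplus> c \<otimes> ((N \<otimes> e) \<otimes> (B \<otimes> B'))"
      unfolding L_def by (simp add: ep nat_pow_distrib u' B_def B'_def)
    also have "\<dots> = e \<otimes> ((N \<otimes> B) \<otimes> ((N \<oplus> \<pi> \<otimes> c) \<otimes> d' \<oplus> c \<otimes> B')) \<oplus>
      e \<otimes> (((N \<oplus> \<pi> \<otimes> c) \<otimes> d \<oplus> c \<otimes> B) \<otimes> (N \<otimes> B')) \<oplus>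
      \<pi> \<otimes> (e \<otimes> (((N \<oplus> \<pi> \<otimes> c) \<otimes> d \<oplus> c \<otimes> B) \<otimes> ((N \<oplus> \<pi> \<otimes> c) \<otimes> d' \<oplus> c \<otimes> B')))"
      unfolding Y_def
      by (rule ring_eqI[of _ "[N,\<pi>,c,d,d',e,B,B']"], (rule reify)+, code_simp, simp add: carrier_list)
    also have "\<dots> = e \<otimes> ((N \<otimes> B) \<otimes> L b') \<oplus> e \<otimes> (L b \<otimes> (N \<otimes> B')) \<oplus> add_pow R p (e \<otimes> (L b \<otimes> L b'))"
      unfolding L_def u' B_def B'_def d_def d'_def by (simp add: \<pi>)
    finally show ?thesis
      using p0 unfolding B_def B'_def N_def by (simp add: DR dual_pow_right)
  qed
  have Msym: "?M g f" if "?M f g" "f \<in> carrier Z" "g \<in> carrier Z" for f g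
  proof -
    have cl: "?D f \<in> carrier Z" "?D g \<in> carrier Z" "f [^]\<^bsub>Z\<^esub> p \<in> carrier Z" "g [^]\<^bsub>Z\<^esub> p \<in> carrier Z"
      by (rule closed Z.nat_pow_closed, rule that)+
    show ?thesis using that(1) cl that(2,3)
      by (simp only: Z.m_comm[of g f] Z.m_comm[of "?D g"] Z.m_comm[of "g [^]\<^bsub>Z\<^esub> p"] Z.a_comm Z.m_closed)
  qed
  have Madd: "?M (f \<oplus>\<^bsub>Z\<^esub> f') g" if "?M f g" "?M f' g" "f \<in> carrier Z" "f' \<in> carrier Z" "g \<in> carrier Z" for f f' g
    by (rule Z.delta_mult_add[OF closed add that(3,4,5,1,2) p])
  have mult: "?M f g" if fg: "f \<in> carrier Z" "g \<in> carrier Z" for f g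
  proof -
    obtain a b a' b' where w: "f = (a, \<zero>) \<oplus>\<^bsub>Z\<^esub> (\<zero>, b)" "g = (a', \<zero>) \<oplus>\<^bsub>Z\<^esub> (\<zero>, b')" and
      [simp]: "a \<in> carrier R" "b \<in> carrier R" "a' \<in> carrier R" "b' \<in> carrier R"
      using fg by auto
    have L: "?M (a, \<zero>) g"
      unfolding w by (rule Msym[OF Madd]; (rule M1 Msym[OF M2])?; simp)
    have R: "?M (\<zero>, b) g"
      unfolding w by (rule Msym[OF Madd]; (rule M2 M3)?; simp)
    show ?thesis unfolding w(1) by (rule Madd[OF L R]) (use fg in auto)
  qed
  show ?thesis
    unfolding is_delta_def
    using closed add mult DL[of \<zero>] DL[of \<one>] by auto
qed

end

section \<open>The ring of twisted divided power series\<close>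

text \<open>A sequence \<open>(g\<^sub>k)\<close> stands for the formal sum \<open>\<Sum>\<^sub>k g\<^sub>k \<xi>\<^sup>[\<^sup>k\<^sup>]\<close> in the twisted divided powers of
  \<open>\<xi>\<close>, where \<open>y = x + \<xi>\<close> is the second coordinate.  The shift \<open>\<partial>\<close> is the twisted derivation with respect
  to \<open>y\<close>, and \<open>ts_sigma\<close> the corresponding endomorphism \<open>y \<mapsto> q y\<close>; the product is the only one for
  which \<open>\<partial>(g h) = \<partial>g h + \<sigma>(g) \<partial>h\<close> and \<open>g \<mapsto> g\<^sub>0\<close> is multiplicative.\<close>

definition ts_shift :: "(nat \<Rightarrow> 'a) \<Rightarrow> nat \<Rightarrow> 'a" where
  "ts_shift g k = g (Suc k)"

definition ts_sigma :: "('a, 'z) ring_scheme \<Rightarrow> 'a \<Rightarrow> 'a \<Rightarrow> (nat \<Rightarrow> 'a) \<Rightarrow> nat \<Rightarrow> 'a" where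
  "ts_sigma R q x g k = q [^]\<^bsub>R\<^esub> k \<otimes>\<^bsub>R\<^esub> (g k \<oplus>\<^bsub>R\<^esub> (q \<ominus>\<^bsub>R\<^esub> \<one>\<^bsub>R\<^esub>) \<otimes>\<^bsub>R\<^esub> x \<otimes>\<^bsub>R\<^esub> g (Suc k))"

primrec ts_mult :: "('a, 'z) ring_scheme \<Rightarrow> 'a \<Rightarrow> 'a \<Rightarrow> (nat \<Rightarrow> 'a) \<Rightarrow> (nat \<Rightarrow> 'a) \<Rightarrow> nat \<Rightarrow> 'a" where
  "ts_mult R q x g h 0 = g 0 \<otimes>\<^bsub>R\<^esub> h 0"
| "ts_mult R q x g h (Suc k) = ts_mult R q x (ts_shift g) h k \<oplus>\<^bsub>R\<^esub> ts_mult R q x (ts_sigma R q x g) (ts_shift h) k"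

definition ts_const :: "('a, 'z) ring_scheme \<Rightarrow> 'a \<Rightarrow> nat \<Rightarrow> 'a" where
  "ts_const R a k = (if k = 0 then a else \<zero>\<^bsub>R\<^esub>)"

definition ts_coord :: "('a, 'z) ring_scheme \<Rightarrow> 'a \<Rightarrow> nat \<Rightarrow> 'a" where
  "ts_coord R x k = (if k = 0 then x else if k = 1 then \<one>\<^bsub>R\<^esub> else \<zero>\<^bsub>R\<^esub>)"

definition ts_ring :: "('a, 'z) ring_scheme \<Rightarrow> 'a \<Rightarrow> 'a \<Rightarrow> (nat \<Rightarrow> 'a) ring" where
  "ts_ring R q x = \<lparr>carrier = {g. \<forall>k. g k \<in> carrier R},
     monoid.mult = ts_mult R q x, monoid.one = ts_const R \<one>\<^bsub>R\<^esub>,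
     ring.zero = (\<lambda>_. \<zero>\<^bsub>R\<^esub>), ring.add = (\<lambda>g h k. g k \<oplus>\<^bsub>R\<^esub> h k)\<rparr>"

locale twisted_series = cring R for R (structure) +
  fixes q x
  assumes q [simp]: "q \<in> carrier R" and x [simp]: "x \<in> carrier R"
begin

abbreviation "H \<equiv> ts_ring R q x"
abbreviation "S \<equiv> ts_sigma R q x"
abbreviation "mlt \<equiv> ts_mult R q x"

abbreviation t where "t \<equiv> q \<ominus> \<one>"

primrec qn where
  "qn 0 = \<zero>"
| "qn (Suc k) = \<one> \<oplus> q \<otimes> qn k"

text \<open>Multiplication by \<open>y\<close>, by the rule
  \<open>y \<xi>^[k] = (k+1)_q \<xi>^[k+1] + q^k x \<xi>^[k]\<close>, where \<open>qn k\<close> is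
  the q-integer \<open>(k)_q\<close>. At \<open>k = 0\<close> the entry
  \<open>g (0 - 1) = g 0\<close> is harmless because \<open>(0)_q = 0\<close>. As an operator it is
  available before the product is known to be commutative; \<open>mul_coord\<close> identifies the
  two.\<close>

definition Y where "Y g k = qn k \<otimes> g (k - 1) \<oplus> q [^] k \<otimes> x \<otimes> g k"

definition sm where "sm a g k = a \<otimes> g k"

definition ad where "ad g h k = g k \<oplus> h k"

lemma qn_closed [simp]: "qn k \<in> carrier R" by (induction k) auto

lemma H_carrier: "carrier H = {g. \<forall>k. g k \<in> carrier R}"
  by (simp add: ts_ring_def)

lemma in_H [simp]: "g \<in> carrier H \<Longrightarrow> g k \<in> carrier R"
  by (simp add: H_carrier)

lemma H_I: "(\<And>k. g k \<in> carrier R) \<Longrightarrow> g \<in> carrier H"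
  unfolding H_carrier by blast

lemma shift_closed [simp]: "g \<in> carrier H \<Longrightarrow> ts_shift g \<in> carrier H"
  by (rule H_I) (simp add: ts_shift_def)

lemma S_closed [simp]: "g \<in> carrier H \<Longrightarrow> S g \<in> carrier H"
  by (rule H_I) (simp add: ts_sigma_def)

lemma Y_closed [simp]: "g \<in> carrier H \<Longrightarrow> Y g \<in> carrier H"
  by (rule H_I) (simp add: Y_def)

lemma sm_closed [simp]: "a \<in> carrier R \<Longrightarrow> g \<in> carrier H \<Longrightarrow> sm a g \<in> carrier H"
  by (rule H_I) (simp add: sm_def)

lemma ad_closed [simp]: "g \<in> carrier H \<Longrightarrow> h \<in> carrier H \<Longrightarrow> ad g h \<in> carrier H"
  by (rule H_I) (simp add: ad_def)

lemma const_closed [simp]: "a \<in> carrier R \<Longrightarrow> ts_const R a \<in> carrier H"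
  by (rule H_I) (simp add: ts_const_def)

lemma coord_closed [simp]: "ts_coord R x \<in> carrier H"
  by (rule H_I) (simp add: ts_coord_def)

lemma mul_nth_closed [simp]: "g \<in> carrier H \<Longrightarrow> h \<in> carrier H \<Longrightarrow> mlt g h k \<in> carrier R"
proof (induction k arbitrary: g h)
  case 0
  then show ?case by simp
next
  case (Suc k)
  then show ?case by simp
qed

lemma mul_closed [simp]: "g \<in> carrier H \<Longrightarrow> h \<in> carrier H \<Longrightarrow> mlt g h \<in> carrier H"
  by (rule H_I) simp

lemma shift_ad: "ts_shift (ad g h) = ad (ts_shift g) (ts_shift h)"
  by (simp add: fun_eq_iff ts_shift_def ad_def)

lemma shift_sm: "ts_shift (sm a g) = sm a (ts_shift g)"
  by (simp add: fun_eq_iff ts_shift_def sm_def)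

lemma S_ad: "g \<in> carrier H \<Longrightarrow> h \<in> carrier H \<Longrightarrow> S (ad g h) = ad (S g) (S h)"
  by (simp add: fun_eq_iff ts_sigma_def ad_def r_distr a_ac)

lemma S_sm: "a \<in> carrier R \<Longrightarrow> g \<in> carrier H \<Longrightarrow> S (sm a g) = sm a (S g)"
  by (simp add: fun_eq_iff ts_sigma_def sm_def r_distr m_ac)

lemma Y_ad: "g \<in> carrier H \<Longrightarrow> h \<in> carrier H \<Longrightarrow> Y (ad g h) = ad (Y g) (Y h)"
  by (simp add: fun_eq_iff Y_def ad_def r_distr a_ac)

lemma Y_sm: "a \<in> carrier R \<Longrightarrow> g \<in> carrier H \<Longrightarrow> Y (sm a g) = sm a (Y g)"
  by (simp add: fun_eq_iff Y_def sm_def r_distr m_ac)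

text \<open>The twisted Leibniz rule for \<open>y g\<close>, with \<open>\<partial>(y) = 1\<close>
  and \<open>\<sigma>(y) = q y\<close>.\<close>

lemma shift_Y: "g \<in> carrier H \<Longrightarrow> ts_shift (Y g) = ad g (sm q (Y (ts_shift g)))"
proof
  fix k assume [simp]: "g \<in> carrier H"
  show "ts_shift (Y g) k = ad g (sm q (Y (ts_shift g))) k"
    by (cases k) (simp_all add: ts_shift_def Y_def ad_def sm_def r_distr l_distr m_ac a_ac)
qed

lemma t_qn: "t \<otimes> qn k = q [^] k \<ominus> \<one>"
proof (induction k)
  case 0
  show ?case by (simp add: r_neg a_minus_def)
next
  case (Suc k)
  define u v where "u = qn k" and "v = q [^] k"
  have [simp]: "u \<in> carrier R" "v \<in> carrier R" unfolding u_def v_def by auto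
  have "t \<otimes> (\<one> \<oplus> q \<otimes> u) = t \<oplus> q \<otimes> (t \<otimes> u)"
    by (rule ring_eqI[of _ "[q,u]"], (rule reify)+, code_simp, simp add: carrier_list)
  also have "t \<otimes> u = v \<ominus> \<one>" using Suc unfolding u_def v_def .
  also have "t \<oplus> q \<otimes> (v \<ominus> \<one>) = v \<otimes> q \<ominus> \<one>"
    by (rule ring_eqI[of _ "[q,v]"], (rule reify)+, code_simp, simp add: carrier_list)
  finally show ?case unfolding u_def v_def by simp
qed

text \<open>The formula \<open>\<sigma> = 1 + (q - 1) y \<partial>\<close>. The entries of
  \<open>ts_sigma\<close> are obtained from it by \<open>(q - 1) (k)_q = q^k - 1\<close>.\<close>

lemma S_eq: "g \<in> carrier H \<Longrightarrow> S g = ad g (sm t (Y (ts_shift g)))"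
proof
  fix k assume [simp]: "g \<in> carrier H"
  have 1: "t \<otimes> (qn k \<otimes> ts_shift g (k - 1)) = (q [^] k \<ominus> \<one>) \<otimes> g k"
  proof (cases k)
    case 0
    have "(\<one> \<ominus> \<one>) \<otimes> g 0 = \<zero>" by (simp add: a_minus_def r_neg)
    with 0 show ?thesis by (simp add: ts_shift_def)
  next
    case (Suc j)
    then show ?thesis by (simp add: ts_shift_def m_assoc[symmetric] t_qn del: qn.simps)
  qed
  define v a b where "v = q [^] k" and "a = g k" and "b = g (Suc k)"
  have [simp]: "v \<in> carrier R" "a \<in> carrier R" "b \<in> carrier R" unfolding v_def a_def b_def by auto
  have "v \<otimes> (a \<oplus> t \<otimes> x \<otimes> b) = a \<oplus> ((v \<ominus> \<one>) \<otimes> a \<oplus> t \<otimes> (v \<otimes> x \<otimes> b))"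
    by (rule ring_eqI[of _ "[q,v,a,b,x]"], (rule reify)+, code_simp, simp add: carrier_list)
  then show "S g k = ad g (sm t (Y (ts_shift g))) k"
    using 1 by (simp add: ts_sigma_def ad_def sm_def Y_def r_distr v_def a_def b_def ts_shift_def)
qed

lemma S_Y: "g \<in> carrier H \<Longrightarrow> S (Y g) = sm q (Y (S g))"
proof -
  assume [simp]: "g \<in> carrier H"
  have "S (Y g) = ad (Y g) (ad (sm t (Y g)) (sm (t \<otimes> q) (Y (Y (ts_shift g)))))"
    by (simp add: S_eq shift_Y Y_ad Y_sm) (simp add: fun_eq_iff ad_def sm_def r_distr m_ac)
  also have "\<dots> = sm q (Y (S g))"
  proof
    fix k
    define a b where "a = Y g k" and "b = Y (Y (ts_shift g)) k"
    have [simp]: "a \<in> carrier R" "b \<in> carrier R" unfolding a_def b_def by auto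
    have "a \<oplus> (t \<otimes> a \<oplus> (t \<otimes> q) \<otimes> b) = q \<otimes> (a \<oplus> t \<otimes> b)"
      by (rule ring_eqI[of _ "[q,a,b]"], (rule reify)+, code_simp, simp add: carrier_list)
    then show "ad (Y g) (ad (sm t (Y g)) (sm (t \<otimes> q) (Y (Y (ts_shift g))))) k = sm q (Y (S g)) k"
      by (simp add: S_eq Y_ad Y_sm) (simp add: ad_def sm_def a_def b_def)
  qed
  finally show ?thesis .
qed

lemma mul_ad_left:
  "g \<in> carrier H \<Longrightarrow> g' \<in> carrier H \<Longrightarrow> h \<in> carrier H \<Longrightarrow> mlt (ad g g') h = ad (mlt g h) (mlt g' h)"
proof
  fix k show "g \<in> carrier H \<Longrightarrow> g' \<in> carrier H \<Longrightarrow> h \<in> carrier H \<Longrightarrow>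
    mlt (ad g g') h k = ad (mlt g h) (mlt g' h) k"
  proof (induction k arbitrary: g g' h)
    case 0
    then show ?case by (simp add: ad_def l_distr)
  next
    case (Suc k)
    then show ?case by (simp add: shift_ad S_ad) (simp add: ad_def a_ac)
  qed
qed

lemma mul_ad_right:
  "g \<in> carrier H \<Longrightarrow> h \<in> carrier H \<Longrightarrow> h' \<in> carrier H \<Longrightarrow> mlt g (ad h h') = ad (mlt g h) (mlt g h')"
proof
  fix k show "g \<in> carrier H \<Longrightarrow> h \<in> carrier H \<Longrightarrow> h' \<in> carrier H \<Longrightarrow>
    mlt g (ad h h') k = ad (mlt g h) (mlt g h') k"
  proof (induction k arbitrary: g h h')
    case 0
    then show ?case by (simp add: ad_def r_distr)
  next
    case (Suc k)
    then show ?case by (simp add: shift_ad) (simp add: ad_def a_ac)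
  qed
qed

lemma mul_sm_left:
  "a \<in> carrier R \<Longrightarrow> g \<in> carrier H \<Longrightarrow> h \<in> carrier H \<Longrightarrow> mlt (sm a g) h = sm a (mlt g h)"
proof
  fix k show "a \<in> carrier R \<Longrightarrow> g \<in> carrier H \<Longrightarrow> h \<in> carrier H \<Longrightarrow> mlt (sm a g) h k = sm a (mlt g h) k"
  proof (induction k arbitrary: g h)
    case 0
    then show ?case by (simp add: sm_def m_ac)
  next
    case (Suc k)
    then show ?case by (simp add: shift_sm S_sm) (simp add: sm_def r_distr)
  qed
qed

lemma mul_sm_right:
  "a \<in> carrier R \<Longrightarrow> g \<in> carrier H \<Longrightarrow> h \<in> carrier H \<Longrightarrow> mlt g (sm a h) = sm a (mlt g h)"
proof
  fix k show "a \<in> carrier R \<Longrightarrow> g \<in> carrier H \<Longrightarrow> h \<in> carrier H \<Longrightarrow> mlt g (sm a h) k = sm a (mlt g h) k"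
  proof (induction k arbitrary: g h)
    case 0
    then show ?case by (simp add: sm_def m_ac)
  next
    case (Suc k)
    then show ?case by (simp add: shift_sm) (simp add: sm_def r_distr)
  qed
qed

lemma shift_mul: "ts_shift (mlt g h) = ad (mlt (ts_shift g) h) (mlt (S g) (ts_shift h))"
  by (simp add: fun_eq_iff ts_shift_def ad_def)

lemma ext_shift: "g 0 = h 0 \<Longrightarrow> (\<And>k. ts_shift g k = ts_shift h k) \<Longrightarrow> g = h"
  unfolding ts_shift_def by (metis ext not0_implies_Suc)

text \<open>Induction on the index: both sides have the same shift, because \<open>y\<close>
  commutes with \<sigma> up to the factor \<open>q\<close>, which is also the factor in
  \<open>shift_Y\<close>.\<close>

lemma Y_mul_left: "g \<in> carrier H \<Longrightarrow> h \<in> carrier H \<Longrightarrow> mlt (Y g) h = Y (mlt g h)"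
proof
  fix k show "g \<in> carrier H \<Longrightarrow> h \<in> carrier H \<Longrightarrow> mlt (Y g) h k = Y (mlt g h) k"
  proof (induction k arbitrary: g h)
    case 0
    then show ?case by (simp add: Y_def m_ac)
  next
    case (Suc k)
    note [simp] = Suc.prems
    have "mlt (Y g) h (Suc k) = ad (mlt g h) (ad (sm q (mlt (Y (ts_shift g)) h)) (sm q (mlt (Y (S g)) (ts_shift h)))) k"
      by (simp add: shift_Y S_Y mul_ad_left mul_sm_left) (simp add: ad_def a_ac)
    also have "\<dots> = ad (mlt g h) (ad (sm q (Y (mlt (ts_shift g) h))) (sm q (Y (mlt (S g) (ts_shift h))))) k"
      using Suc.IH by (simp add: ad_def sm_def)
    also have "\<dots> = ts_shift (Y (mlt g h)) k"
      by (simp add: shift_Y shift_mul Y_ad) (simp add: ad_def sm_def r_distr)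
    finally show ?case by (simp add: ts_shift_def)
  qed
qed

lemma Y_mul_right: "g \<in> carrier H \<Longrightarrow> h \<in> carrier H \<Longrightarrow> mlt g (Y h) = Y (mlt g h)"
proof
  fix k show "g \<in> carrier H \<Longrightarrow> h \<in> carrier H \<Longrightarrow> mlt g (Y h) k = Y (mlt g h) k"
  proof (induction k arbitrary: g h)
    case 0
    then show ?case by (simp add: Y_def m_ac)
  next
    case (Suc k)
    note [simp] = Suc.prems
    define a b c where "a = mlt g h k" and "b = Y (mlt (ts_shift g) h) k" and
      "c = Y (mlt (S g) (ts_shift h)) k"
    have [simp]: "a \<in> carrier R" "b \<in> carrier R" "c \<in> carrier R" unfolding a_def b_def c_def by auto
    have "mlt g (Y h) (Suc k) = mlt (ts_shift g) (Y h) k \<oplus> (mlt (S g) h k \<oplus> q \<otimes> mlt (S g) (Y (ts_shift h)) k)"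
      by (simp add: shift_Y mul_ad_right mul_sm_right) (simp add: ad_def sm_def)
    also have "mlt (S g) h k = a \<oplus> t \<otimes> b"
      by (subst S_eq) (simp_all add: mul_ad_left mul_sm_left Y_mul_left, simp add: ad_def sm_def a_def b_def)
    also have "mlt (ts_shift g) (Y h) k = b"
      using Suc.IH by (simp add: b_def)
    also have "mlt (S g) (Y (ts_shift h)) k = c"
      using Suc.IH by (simp add: c_def)
    also have "b \<oplus> ((a \<oplus> t \<otimes> b) \<oplus> q \<otimes> c) = a \<oplus> q \<otimes> (b \<oplus> c)"
      by (rule ring_eqI[of _ "[q,a,b,c]"], (rule reify)+, code_simp, simp add: carrier_list)
    also have "\<dots> = ts_shift (Y (mlt g h)) k"
      by (simp add: shift_Y shift_mul Y_ad) (simp add: ad_def sm_def a_def b_def c_def)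
    finally show ?case by (simp add: ts_shift_def)
  qed
qed

text \<open>Inserting \<open>\<sigma> = 1 + (q - 1) y \<partial>\<close> makes the Leibniz rule
  symmetric in \<open>g\<close> and \<open>h\<close>. Commutativity of the product results from this
  form, and so does the ring map into the ring in \<zeta>.\<close>

lemma shift_mul':
  "g \<in> carrier H \<Longrightarrow> h \<in> carrier H \<Longrightarrow> ts_shift (mlt g h) =
    ad (mlt (ts_shift g) h) (ad (mlt g (ts_shift h)) (sm t (Y (mlt (ts_shift g) (ts_shift h)))))"
  by (simp add: shift_mul) (simp add: S_eq mul_ad_left mul_sm_left Y_mul_left)

lemma mul_comm: "g \<in> carrier H \<Longrightarrow> h \<in> carrier H \<Longrightarrow> mlt g h = mlt h g"
proof
  fix k show "g \<in> carrier H \<Longrightarrow> h \<in> carrier H \<Longrightarrow> mlt g h k = mlt h g k"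
  proof (induction k arbitrary: g h)
    case 0
    then show ?case by (simp add: m_ac)
  next
    case (Suc k)
    note [simp] = Suc.prems
    \<comment> \<open>Coefficient \<open>k\<close> of \<open>Y w\<close> involves two coefficients
      of \<open>w\<close>, so \<open>Y\<close> is moved into the product before the induction
      hypothesis is applied at the single index \<open>k\<close>.\<close>
    have "Y (mlt (ts_shift g) (ts_shift h)) k = Y (mlt (ts_shift h) (ts_shift g)) k"
      using Suc.IH[of "Y (ts_shift g)" "ts_shift h"] by (simp add: Y_mul_left Y_mul_right)
    moreover have "mlt (ts_shift g) h k = mlt h (ts_shift g) k" "mlt g (ts_shift h) k = mlt (ts_shift h) g k"
      using Suc.IH by auto
    ultimately have "ts_shift (mlt g h) k = ts_shift (mlt h g) k"
      by (simp add: shift_mul') (simp add: ad_def sm_def a_ac)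
    then show ?case by (simp add: ts_shift_def)
  qed
qed

lemma S_mul: "g \<in> carrier H \<Longrightarrow> h \<in> carrier H \<Longrightarrow> S (mlt g h) = mlt (S g) (S h)"
proof -
  assume [simp]: "g \<in> carrier H" "h \<in> carrier H"
  have "S (mlt g h) = ad (mlt g h) (sm t (Y (ad (mlt (ts_shift g) h) (mlt (S g) (ts_shift h)))))"
    by (simp add: S_eq shift_mul)
  also have "\<dots> = ad (ad (mlt g h) (sm t (Y (mlt (ts_shift g) h)))) (sm t (Y (mlt (S g) (ts_shift h))))"
    by (simp add: Y_ad) (simp add: fun_eq_iff ad_def sm_def r_distr a_ac)
  also have "ad (mlt g h) (sm t (Y (mlt (ts_shift g) h))) = mlt (S g) h"
    by (simp add: S_eq mul_ad_left mul_sm_left Y_mul_left)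
  also have "ad (mlt (S g) h) (sm t (Y (mlt (S g) (ts_shift h)))) = mlt (S g) (S h)"
    by (simp add: S_eq[of h] mul_ad_right mul_sm_right Y_mul_right)
  finally show ?thesis .
qed

lemma mul_assoc:
  "g \<in> carrier H \<Longrightarrow> h \<in> carrier H \<Longrightarrow> l \<in> carrier H \<Longrightarrow> mlt (mlt g h) l = mlt g (mlt h l)"
proof
  fix k show "g \<in> carrier H \<Longrightarrow> h \<in> carrier H \<Longrightarrow> l \<in> carrier H \<Longrightarrow>
    mlt (mlt g h) l k = mlt g (mlt h l) k"
  proof (induction k arbitrary: g h l)
    case 0
    then show ?case by (simp add: m_ac)
  next
    case (Suc k)
    then show ?case
      by (simp add: shift_mul S_mul mul_ad_left mul_ad_right) (simp add: ad_def a_ac)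
  qed
qed

lemma mul_const: "a \<in> carrier R \<Longrightarrow> g \<in> carrier H \<Longrightarrow> mlt (ts_const R a) g = sm a g"
proof
  have 0: "mlt (\<lambda>_. \<zero>) h k = \<zero>" if "h \<in> carrier H" for h k
    using that
  proof (induction k arbitrary: h)
    case (Suc k)
    have "ts_shift (\<lambda>_. \<zero>) = (\<lambda>_. \<zero>)" "S (\<lambda>_. \<zero>) = (\<lambda>_. \<zero>)"
      by (auto simp: ts_shift_def ts_sigma_def)
    with Suc show ?case by simp
  qed simp
  fix k show "a \<in> carrier R \<Longrightarrow> g \<in> carrier H \<Longrightarrow> mlt (ts_const R a) g k = sm a g k"
  proof (induction k arbitrary: g)
    case 0
    then show ?case by (simp add: ts_const_def sm_def)
  next
    case (Suc k)
    have "ts_shift (ts_const R a) = (\<lambda>_. \<zero>)" by (auto simp: ts_shift_def ts_const_def)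
    moreover have "S (ts_const R a) = ts_const R a" using Suc.prems
      by (auto simp: fun_eq_iff ts_sigma_def ts_const_def)
    ultimately show ?case using Suc by (simp add: 0) (simp add: sm_def ts_shift_def)
  qed
qed

lemma H_simps [simp]:
  "g \<otimes>\<^bsub>H\<^esub> h = mlt g h" "\<one>\<^bsub>H\<^esub> = ts_const R \<one>" "\<zero>\<^bsub>H\<^esub> = (\<lambda>_. \<zero>)" "g \<oplus>\<^bsub>H\<^esub> h = ad g h"
proof -
  show "g \<oplus>\<^bsub>H\<^esub> h = ad g h" unfolding ts_ring_def by (rule ext) (simp add: ad_def)
qed (simp_all only: ts_ring_def monoid.simps ring.simps)

lemma cring_H: "cring H"
proof (rule cringI)
  show "abelian_group H"
  proof (rule abelian_groupI)
    fix g assume "g \<in> carrier H"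
    then show "\<exists>h\<in>carrier H. h \<oplus>\<^bsub>H\<^esub> g = \<zero>\<^bsub>H\<^esub>"
      by (intro bexI[of _ "\<lambda>k. \<ominus> g k"]) (auto simp: ad_def l_neg fun_eq_iff intro!: H_I)
  qed (auto simp: ad_def fun_eq_iff a_ac intro!: H_I)
  have "sm \<one> g = g" if "g \<in> carrier H" for g
    using that by (simp add: sm_def fun_eq_iff)
  then show "Group.comm_monoid H"
    by (intro comm_monoidI) (auto simp: mul_assoc mul_const intro: mul_comm)
qed (auto simp: mul_ad_left)

sublocale H: cring H by (rule cring_H)

lemma H_minus: "g \<in> carrier H \<Longrightarrow> h \<in> carrier H \<Longrightarrow> g \<ominus>\<^bsub>H\<^esub> h = (\<lambda>k. g k \<ominus> h k)"
proof -
  assume [simp]: "g \<in> carrier H" "h \<in> carrier H"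
  have "\<ominus>\<^bsub>H\<^esub> h = (\<lambda>k. \<ominus> h k)"
    by (rule H.minus_equality) (auto simp: ad_def l_neg fun_eq_iff intro!: H_I)
  then show ?thesis by (simp add: a_minus_def) (simp add: ad_def fun_eq_iff)
qed

lemma H_add_pow: "g \<in> carrier H \<Longrightarrow> add_pow H (n::nat) g = (\<lambda>k. add_pow R n (g k))"
  by (induction n) (auto simp: ad_def)

lemma const_hom: "ring_hom_cring R H (ts_const R)"
proof (rule ring_hom_cringI, rule is_cring, rule cring_H, rule ring_hom_memI)
  fix a b assume [simp]: "a \<in> carrier R" "b \<in> carrier R"
  show "ts_const R (a \<otimes> b) = ts_const R a \<otimes>\<^bsub>H\<^esub> ts_const R b"
    by (simp add: mul_const) (simp add: sm_def ts_const_def fun_eq_iff)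
  show "ts_const R (a \<oplus> b) = ts_const R a \<oplus>\<^bsub>H\<^esub> ts_const R b"
    by (simp add: ad_def ts_const_def fun_eq_iff)
qed auto

sublocale const: ring_hom_cring R H "ts_const R" by (rule const_hom)

declare const.hom_one [simp del]

lemma head_hom: "ring_hom_cring H R (\<lambda>g. g 0)"
  by (rule ring_hom_cringI, rule cring_H, rule is_cring, rule ring_hom_memI)
    (auto simp: ad_def ts_const_def)

sublocale head: ring_hom_cring H R "\<lambda>g. g 0" by (rule head_hom)

lemma mul_coord: "g \<in> carrier H \<Longrightarrow> mlt (ts_coord R x) g = Y g"
proof -
  assume [simp]: "g \<in> carrier H"
  have "ts_coord R x k = Y (ts_const R \<one>) k" for k
  proof (cases k)
    case (Suc j)
    have "qn (Suc 0) = \<one>" by simp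
    with Suc show ?thesis by (cases j) (auto simp: ts_coord_def Y_def ts_const_def)
  qed (auto simp: ts_coord_def Y_def ts_const_def)
  then have "ts_coord R x = Y (ts_const R \<one>)" by (rule ext)
  moreover have "sm \<one> g = g" by (simp add: sm_def fun_eq_iff)
  ultimately show ?thesis by (simp add: Y_mul_left mul_const)
qed

definition eta where "eta = (ts_const R q \<ominus>\<^bsub>H\<^esub> \<one>\<^bsub>H\<^esub>) \<otimes>\<^bsub>H\<^esub> ts_coord R x"

lemma eta_closed [simp]: "eta \<in> carrier H"
  unfolding eta_def by (intro H.m_closed H.minus_closed const_closed coord_closed H.one_closed) simp

lemma const_t: "ts_const R q \<ominus>\<^bsub>H\<^esub> ts_const R \<one> = ts_const R t"
  using const.hom_sub[OF q one_closed] by simp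

lemma mul_eta: "g \<in> carrier H \<Longrightarrow> mlt eta g = sm t (Y g)"
proof -
  assume [simp]: "g \<in> carrier H"
  have "eta = sm t (ts_coord R x)"
    unfolding eta_def H_simps const_t by (rule mul_const) auto
  then show ?thesis by (simp add: mul_sm_left mul_coord)
qed

lemma S_eta: "g \<in> carrier H \<Longrightarrow> S g = ad g (mlt eta (ts_shift g))"
  by (simp add: mul_eta S_eq)

text \<open>The map \<open>g \<mapsto> g + \<partial>g \<zeta>\<close>; multiplicativity is the
  symmetric Leibniz rule. At \<zeta> = 0 it becomes the identity and at \<zeta> = \<eta> it becomes
  \<sigma>, by \<open>S_eta\<close>.\<close>

lemma dual_hom: "ring_hom_cring H (dual_ring H eta) (\<lambda>g. (g, ts_shift g))"
proof (rule ring_hom_cringI, rule cring_H, rule H.cring_dual_ring, simp, rule ring_hom_memI)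
  fix g h assume [simp]: "g \<in> carrier H" "h \<in> carrier H"
  show "(g \<otimes>\<^bsub>H\<^esub> h, ts_shift (g \<otimes>\<^bsub>H\<^esub> h)) = (g, ts_shift g) \<otimes>\<^bsub>dual_ring H eta\<^esub> (h, ts_shift h)"
    by (simp add: shift_mul' mul_eta) (simp add: fun_eq_iff ad_def a_ac)
qed (auto simp: shift_ad ts_const_def ts_shift_def fun_eq_iff)

end

text \<open>The two target rings may have different types, which a single indexed family does not
  permit.\<close>

lemma is_delta_pullback2:
  assumes D: "D \<in> carrier R \<rightarrow> carrier R"
    and h: "ring_hom_cring R S h" "is_delta p S DS" "\<And>a. a \<in> carrier R \<Longrightarrow> h (D a) = DS (h a)"
    and h': "ring_hom_cring R S' h'" "is_delta p S' DS'" "\<And>a. a \<in> carrier R \<Longrightarrow> h' (D a) = DS' (h' a)"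
    and inj: "\<And>a b. a \<in> carrier R \<Longrightarrow> b \<in> carrier R \<Longrightarrow> h a = h b \<Longrightarrow> h' a = h' b \<Longrightarrow> a = b"
  shows "is_delta p R D"
proof -
  interpret h: ring_hom_cring R S h by fact
  have [simp]: "D f \<in> carrier R" if "f \<in> carrier R" for f using D that by auto
  note d = h.hom_delta[OF D h(2,3)] and d' = ring_hom_cring.hom_delta[OF h'(1) D h'(2,3)]
  show ?thesis
    unfolding is_delta_def
    by (intro conjI ballI D inj; (rule d d')?; auto)
qed

lemma (in dual_cring) dual_pow_prime:
  assumes [simp]: "a \<in> carrier R" "b \<in> carrier R" and p: "Factorial_Ring.prime p"
  shows "(a, b) [^]\<^bsub>Z\<^esub> p = (a [^] p, e [^] (p - 1) \<otimes> b [^] p \<oplus> add_pow R p (frob_defect_div p R e a b))"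
proof -
  have "(a, b) = (a, \<zero>) \<oplus>\<^bsub>Z\<^esub> (\<zero>, b)" by simp
  then have "(a, b) [^]\<^bsub>Z\<^esub> p = ((a, \<zero>) \<oplus>\<^bsub>Z\<^esub> (\<zero>, b)) [^]\<^bsub>Z\<^esub> p" by simp
  also have "\<dots> = (a [^] p, e [^] (p - 1) \<otimes> b [^] p \<oplus> add_pow R p (frob_defect_div p R e a b))"
    using prime_gt_0_nat[OF p]
    by (subst Z.frob_defect_p[OF _ _ p]) (simp_all add: dual_pow_right dual_defect_mixed)
  finally show ?thesis .
qed

section \<open>Truncated series\<close>

context twisted_series
begin

definition trunc :: "nat \<Rightarrow> (nat \<Rightarrow> 'a) \<Rightarrow> nat \<Rightarrow> 'a" where
  "trunc k g = (\<lambda>j. if j \<le> k then g j else \<zero>)"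

text \<open>The quotient of \<open>H\<close> by the series whose coefficients up to \<open>k\<close>
  vanish, each class being represented by its member with zero tail.\<close>

definition T :: "nat \<Rightarrow> (nat \<Rightarrow> 'a) ring" where
  "T k = \<lparr>carrier = {g \<in> carrier H. trunc k g = g}, monoid.mult = (\<lambda>g h. trunc k (g \<otimes>\<^bsub>H\<^esub> h)),
     monoid.one = \<one>\<^bsub>H\<^esub>, ring.zero = \<zero>\<^bsub>H\<^esub>, ring.add = ring.add H\<rparr>"

lemma T_carrier: "carrier (T k) = {g \<in> carrier H. trunc k g = g}" by (simp add: T_def)

lemma T_simps: "g \<otimes>\<^bsub>T k\<^esub> h = trunc k (mlt g h)" "\<one>\<^bsub>T k\<^esub> = ts_const R \<one>"
  "\<zero>\<^bsub>T k\<^esub> = (\<lambda>_. \<zero>)" "g \<oplus>\<^bsub>T k\<^esub> h = ad g h"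
  by (simp_all add: T_def)

lemma trunc_closed_H [simp]: "g \<in> carrier H \<Longrightarrow> trunc k g \<in> carrier H"
  by (rule H_I) (simp add: trunc_def)

lemma trunc_trunc [simp]: "trunc k (trunc k g) = trunc k g"
  by (simp add: trunc_def fun_eq_iff)

lemma trunc_closed [simp]: "g \<in> carrier H \<Longrightarrow> trunc k g \<in> carrier (T k)"
  by (simp add: T_carrier)

lemma trunc_0 [simp]: "trunc k g 0 = g 0" by (simp add: trunc_def)

lemma trunc_eq: "trunc k g = trunc k h \<longleftrightarrow> (\<forall>j\<le>k. g j = h j)"
  by (auto simp: trunc_def fun_eq_iff)

text \<open>The recursion for the product looks one index ahead through \<open>S\<close> and the
  shifts, but lowers the index of the result by one at the same time, so nothing beyond
  \<open>k\<close> is reached.\<close>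

lemma mul_cong:
  "\<forall>j\<le>k. g j = g' j \<Longrightarrow> \<forall>j\<le>k. h j = h' j \<Longrightarrow> j \<le> k \<Longrightarrow> mlt g h j = mlt g' h' j"
proof (induction j arbitrary: g g' h h' k)
  case (Suc j)
  then obtain k' where k: "k = Suc k'" "j \<le> k'" by (cases k) auto
  have "mlt (ts_shift g) h j = mlt (ts_shift g') h' j"
    by (rule Suc.IH[OF _ _ k(2)]) (use Suc.prems k in \<open>auto simp: ts_shift_def\<close>)
  moreover have "mlt (S g) (ts_shift h) j = mlt (S g') (ts_shift h') j"
    by (rule Suc.IH[OF _ _ k(2)]) (use Suc.prems k in \<open>auto simp: ts_shift_def ts_sigma_def\<close>)
  ultimately show ?case by simp
qed simp

lemma trunc_mul: "trunc k (mlt (trunc k g) (trunc k h)) = trunc k (mlt g h)"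
  unfolding trunc_eq by (intro allI impI mul_cong[of k]) (auto simp: trunc_def)

lemma trunc_mul_left: "trunc k (mlt (trunc k g) h) = trunc k (mlt g h)"
  unfolding trunc_eq by (intro allI impI mul_cong[of k]) (auto simp: trunc_def)

lemma trunc_mul_right: "trunc k (mlt g (trunc k h)) = trunc k (mlt g h)"
  unfolding trunc_eq by (intro allI impI mul_cong[of k]) (auto simp: trunc_def)

lemma trunc_ad: "trunc k (ad g h) = ad (trunc k g) (trunc k h)"
  by (auto simp: trunc_def ad_def fun_eq_iff)

lemma trunc_const [simp]: "trunc k (ts_const R a) = ts_const R a"
  by (auto simp: trunc_def ts_const_def)

lemma trunc_zero [simp]: "trunc k (\<lambda>_. \<zero>) = (\<lambda>_. \<zero>)"
  by (auto simp: trunc_def)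

lemma cring_T: "cring (T k)"
proof (rule cringI)
  have z: "ad (\<lambda>_. \<zero>) g = g" if "g \<in> carrier H" for g using H.l_zero[OF that] by simp
  have zH: "(\<lambda>_. \<zero>) \<in> carrier H" by (rule H_I) simp
  show "abelian_group (T k)"
  proof (rule abelian_groupI)
    fix g assume "g \<in> carrier (T k)"
    then have g: "g \<in> carrier H" "trunc k g = g" by (auto simp: T_carrier)
    have "trunc k (\<ominus>\<^bsub>H\<^esub> g) \<in> carrier (T k)" using g by simp
    moreover have "ad (trunc k (\<ominus>\<^bsub>H\<^esub> g)) g = (\<lambda>_. \<zero>)"
      using H.l_neg[OF g(1)] trunc_ad[of k "\<ominus>\<^bsub>H\<^esub> g" g] g by simp
    ultimately show "\<exists>h\<in>carrier (T k). h \<oplus>\<^bsub>T k\<^esub> g = \<zero>\<^bsub>T k\<^esub>"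
      by (auto simp: T_simps)
  next
    fix f g h assume "f \<in> carrier (T k)" "g \<in> carrier (T k)" "h \<in> carrier (T k)"
    then show "f \<oplus>\<^bsub>T k\<^esub> g \<oplus>\<^bsub>T k\<^esub> h = f \<oplus>\<^bsub>T k\<^esub> (g \<oplus>\<^bsub>T k\<^esub> h)"
      using H.a_assoc[of f g h] by (simp add: T_simps T_carrier)
  next
    fix f g assume "f \<in> carrier (T k)" "g \<in> carrier (T k)"
    then show "f \<oplus>\<^bsub>T k\<^esub> g = g \<oplus>\<^bsub>T k\<^esub> f"
      using H.a_comm[of f g] by (simp add: T_simps T_carrier)
  qed (auto simp: T_simps T_carrier trunc_ad z zH)
  have o: "mlt (ts_const R \<one>) g = g" if "g \<in> carrier H" for g using H.l_one[OF that] by simp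
  show "Group.comm_monoid (T k)"
  proof (rule comm_monoidI)
    fix f g h assume "f \<in> carrier (T k)" "g \<in> carrier (T k)" "h \<in> carrier (T k)"
    then show "f \<otimes>\<^bsub>T k\<^esub> g \<otimes>\<^bsub>T k\<^esub> h = f \<otimes>\<^bsub>T k\<^esub> (g \<otimes>\<^bsub>T k\<^esub> h)"
      by (simp add: T_simps T_carrier trunc_mul_left trunc_mul_right mul_assoc)
  qed (auto simp: T_simps T_carrier o intro: arg_cong[OF mul_comm])
qed (auto simp: T_simps T_carrier mul_ad_left trunc_ad)

lemma trunc_hom: "ring_hom_cring H (T k) (trunc k)"
  by (rule ring_hom_cringI, rule cring_H, rule cring_T, rule ring_hom_memI)
    (auto simp: T_simps trunc_mul trunc_ad)

end

section \<open>The \<delta>-structure on twisted divided power series\<close>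

locale twisted_delta = twisted_series +
  fixes p :: nat and D
  assumes p: "Factorial_Ring.prime p" and D: "is_delta p R D" and Dq: "D q = \<zero>" and Dx: "D x = \<zero>"
begin

lemma D_closed [simp]: "a \<in> carrier R \<Longrightarrow> D a \<in> carrier R"
  by (rule is_delta_closed[OF D])

lemma p0: "0 < p" using prime_gt_0_nat[OF p] .

text \<open>The element \<open>c\<close> that \<open>delta_eta\<close> attaches to the coordinate
  \<open>y\<close>. The choice also makes \<delta>(y) vanish, see \<open>del_coord\<close>.\<close>

definition cc where "cc = frob_defect_div p H eta (ts_coord R x) (ts_const R \<one>)"

definition uu where "uu = qtwist p H (ts_const R q) (ts_coord R x)"

text \<open>The \<zeta>-component of \<open>dual_delta\<close> at
  \<open>g + \<partial>g \<zeta>\<close>, with the value \<delta>(\<partial>g) as a separate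
  argument \<open>w\<close>, so that approximations can be put in its place.\<close>

definition L where "L w g = (uu \<otimes>\<^bsub>H\<^esub> w \<oplus>\<^bsub>H\<^esub> cc \<otimes>\<^bsub>H\<^esub> ts_shift g [^]\<^bsub>H\<^esub> p) \<ominus>\<^bsub>H\<^esub>
  frob_defect_div p H eta g (ts_shift g)"

text \<open>The recursion \<open>\<partial>(\<delta> g) = u \<delta>(\<partial>g) + c (\<partial>g)\<^sup>p - ((g + \<eta>\<partial>g)\<^sup>p - g\<^sup>p - (\<eta>\<partial>g)\<^sup>p) / (p\<eta>)\<close> determines \<open>\<delta>\<close>;
  \<open>delN n\<close> is correct up to the index \<open>n\<close>.\<close>

primrec delN where
  "delN 0 g = (\<lambda>j. if j = 0 then D (g 0) else \<zero>)"
| "delN (Suc n) g = (\<lambda>j. case j of 0 \<Rightarrow> D (g 0) | Suc i \<Rightarrow> L (delN n (ts_shift g)) g i)"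

definition del where "del g k = delN k g k"

lemma cc_closed [simp]: "cc \<in> carrier H"
  unfolding cc_def by (rule H.frob_defect_div_closed) auto

lemma uu_expand: "uu = eta [^]\<^bsub>H\<^esub> (p - 1) \<oplus>\<^bsub>H\<^esub> add_pow H p cc"
  unfolding uu_def cc_def eta_def using H.qtwist_expand[OF const_closed[OF q] coord_closed p] by simp

lemma uu_closed [simp]: "uu \<in> carrier H"
  unfolding uu_expand by (intro H.a_closed H.nat_pow_closed H.add.nat_pow_closed) auto

lemma L_closed [simp]: "w \<in> carrier H \<Longrightarrow> g \<in> carrier H \<Longrightarrow> L w g \<in> carrier H"
  unfolding L_def by (intro H.minus_closed H.a_closed H.m_closed H.frob_defect_div_closed H.nat_pow_closed) auto

lemma trunc_L:
  "w \<in> carrier H \<Longrightarrow> g \<in> carrier H \<Longrightarrow> trunc k (L w g) =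
    (trunc k uu \<otimes>\<^bsub>T k\<^esub> trunc k w \<oplus>\<^bsub>T k\<^esub> trunc k cc \<otimes>\<^bsub>T k\<^esub> trunc k (ts_shift g) [^]\<^bsub>T k\<^esub> p) \<ominus>\<^bsub>T k\<^esub>
      frob_defect_div p (T k) (trunc k eta) (trunc k g) (trunc k (ts_shift g))"
proof -
  assume [simp]: "w \<in> carrier H" "g \<in> carrier H"
  interpret h: ring_hom_cring H "T k" "trunc k" by (rule trunc_hom)
  have 1: "uu \<otimes>\<^bsub>H\<^esub> w \<in> carrier H" "cc \<otimes>\<^bsub>H\<^esub> ts_shift g [^]\<^bsub>H\<^esub> p \<in> carrier H"
    "frob_defect_div p H eta g (ts_shift g) \<in> carrier H" "ts_shift g [^]\<^bsub>H\<^esub> p \<in> carrier H"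
    by (intro H.m_closed H.frob_defect_div_closed H.nat_pow_closed; simp)+
  show ?thesis
    unfolding L_def
    by (simp only: h.hom_sub h.hom_add h.hom_mult h.hom_pow h.hom_frob_defect_div 1
      H.a_closed shift_closed uu_closed cc_closed eta_closed \<open>w \<in> _\<close> \<open>g \<in> _\<close>)
qed

text \<open>\<open>L\<close> is built from ring operations and hence commutes with the ring map
  \<open>trunc k\<close>. Agreement of \<open>g\<close> is required up to \<open>Suc k\<close>
  because its shift occurs.\<close>

lemma L_cong:
  assumes "w \<in> carrier H" "w' \<in> carrier H" "g \<in> carrier H" "g' \<in> carrier H"
    and "\<forall>j\<le>k. w j = w' j" "\<forall>j\<le>Suc k. g j = g' j" and "j \<le> k"
  shows "L w g j = L w' g' j"
proof -
  have "trunc k w = trunc k w'" "trunc k g = trunc k g'" "trunc k (ts_shift g) = trunc k (ts_shift g')"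
    using assms(5,6) unfolding trunc_eq by (auto simp: ts_shift_def)
  then have "trunc k (L w g) = trunc k (L w' g')" using assms(1-4) by (simp add: trunc_L)
  then show ?thesis using assms(7) unfolding trunc_eq by auto
qed

lemma delN_closed [simp]: "g \<in> carrier H \<Longrightarrow> delN n g \<in> carrier H"
proof (induction n arbitrary: g)
  case 0
  then show ?case by (auto intro!: H_I)
next
  case (Suc n)
  then show ?case by (auto intro!: H_I split: nat.split)
qed

lemma del_closed [simp]: "g \<in> carrier H \<Longrightarrow> del g \<in> carrier H"
  by (rule H_I) (simp add: del_def)

lemma delN_step: "g \<in> carrier H \<Longrightarrow> j \<le> n \<Longrightarrow> delN n g j = delN (Suc n) g j"
proof (induction n arbitrary: g j)
  case (Suc n)
  show ?case
  proof (cases j)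
    case (Suc i)
    have "L (delN n (ts_shift g)) g i = L (delN (Suc n) (ts_shift g)) g i"
      by (rule L_cong[where k=n]) (use Suc Suc.prems Suc.IH in \<open>auto simp del: delN.simps\<close>)
    with Suc show ?thesis by simp
  qed simp
qed simp

lemma delN_del: "g \<in> carrier H \<Longrightarrow> j \<le> n \<Longrightarrow> delN n g j = del g j"
proof (induction n)
  case (Suc n)
  then show ?case by (cases "j = Suc n") (auto simp: del_def delN_step[of g j n, symmetric] simp del: delN.simps)
qed (simp add: del_def)

lemma del_0: "del g 0 = D (g 0)" by (simp add: del_def)

lemma shift_del: "g \<in> carrier H \<Longrightarrow> ts_shift (del g) = L (del (ts_shift g)) g"
proof
  fix i assume g: "g \<in> carrier H"
  have "L (delN i (ts_shift g)) g i = L (del (ts_shift g)) g i"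
    by (rule L_cong[where k=i]) (use g in \<open>auto simp: delN_del\<close>)
  then show "ts_shift (del g) i = L (del (ts_shift g)) g i"
    by (simp add: ts_shift_def del_def)
qed

lemma del_cong:
  "g \<in> carrier H \<Longrightarrow> g' \<in> carrier H \<Longrightarrow> \<forall>j\<le>k. g j = g' j \<Longrightarrow> j \<le> k \<Longrightarrow> del g j = del g' j"
proof (induction k arbitrary: g g' j)
  case 0
  then show ?case by (simp add: del_0)
next
  case (Suc k)
  show ?case
  proof (cases j)
    case 0
    then show ?thesis using Suc.prems by (simp add: del_0)
  next
    case (Suc i)
    have "L (del (ts_shift g)) g i = L (del (ts_shift g')) g' i"
    proof (rule L_cong[where k=k])
      have "\<forall>j\<le>k. ts_shift g j = ts_shift g' j" using Suc.prems by (auto simp: ts_shift_def)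
      then show "\<forall>j\<le>k. del (ts_shift g) j = del (ts_shift g') j"
        by (intro allI impI Suc.IH) (use Suc.prems in auto)
    qed (use Suc Suc.prems in auto)
    then show ?thesis
      using Suc Suc.prems shift_del[of g] shift_del[of g'] by (simp add: ts_shift_def fun_eq_iff)
  qed
qed

lemma zero_H [simp]: "(\<lambda>_. \<zero>) \<in> carrier H" using H.zero_closed by simp

lemma mul_zero [simp]: "g \<in> carrier H \<Longrightarrow> mlt g (\<lambda>_. \<zero>) = (\<lambda>_. \<zero>)"
  using H.r_null[of g] by simp

lemma ad_zero [simp]: "ad (\<lambda>_::nat. \<zero>) (\<lambda>_. \<zero>) = (\<lambda>_. \<zero>)"
  using H.l_zero[OF H.zero_closed] by simp

lemma shift_const: "ts_shift (ts_const R a) = (\<lambda>_. \<zero>)" by (auto simp: ts_shift_def ts_const_def)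

lemma zero_pow: "(\<lambda>_. \<zero>) [^]\<^bsub>H\<^esub> p = (\<lambda>_. \<zero>)"
  using H.nat_pow_zero[of p] p0 by simp

lemma L_zero: "g \<in> carrier H \<Longrightarrow> ts_shift g = (\<lambda>_. \<zero>) \<Longrightarrow> L (\<lambda>_. \<zero>) g = (\<lambda>_. \<zero>)"
  using H.frob_defect_div_zero(1)[of g eta p] by (simp add: L_def zero_pow H_minus)

lemma del_zero: "del (\<lambda>_. \<zero>) = (\<lambda>_. \<zero>)"
proof -
  have s: "ts_shift (\<lambda>_. \<zero>) = (\<lambda>_. \<zero>)" by (auto simp: ts_shift_def)
  have "\<forall>j\<le>k. del (\<lambda>_. \<zero>) j = \<zero>" for k
  proof (induction k)
    case 0
    then show ?case using is_delta_zero[OF D] by (simp add: del_0)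
  next
    case (Suc k)
    have "L (del (\<lambda>_. \<zero>)) (\<lambda>_. \<zero>) k = L (\<lambda>_. \<zero>) (\<lambda>_. \<zero>) k"
      by (rule L_cong[where k=k]) (use Suc in auto)
    then have "del (\<lambda>_. \<zero>) (Suc k) = \<zero>"
      using shift_del[of "\<lambda>_. \<zero>"] L_zero[of "\<lambda>_. \<zero>"] s by (simp add: ts_shift_def fun_eq_iff)
    with Suc show ?case by (auto simp: le_Suc_eq)
  qed
  then show ?thesis by auto
qed

lemma del_const: "a \<in> carrier R \<Longrightarrow> del (ts_const R a) = ts_const R (D a)"
proof (rule ext_shift)
  fix k assume a: "a \<in> carrier R"
  show "ts_shift (del (ts_const R a)) k = ts_shift (ts_const R (D a)) k"
    using a by (simp add: shift_del shift_const del_zero L_zero)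
qed (simp add: del_0 ts_const_def)

text \<open>The shift of \<open>y\<close> is \<open>1\<close>, and \<open>cc\<close> is by
  definition the value of the last term of \<open>L\<close> there, so the two terms cancel.\<close>

lemma del_coord: "del (ts_coord R x) = (\<lambda>_. \<zero>)"
proof (rule ext_shift)
  fix k
  have s: "ts_shift (ts_coord R x) = ts_const R \<one>"
    by (auto simp: ts_shift_def ts_coord_def ts_const_def)
  have o: "ts_const R \<one> [^]\<^bsub>H\<^esub> p = ts_const R \<one>" using H.nat_pow_one[of p] by simp
  have d1: "del (ts_const R \<one>) = (\<lambda>_. \<zero>)"
    using is_delta_one[OF D] by (simp add: del_const)
  have "mlt cc (ts_const R \<one>) = cc" using H.r_one[of cc] by simp
  moreover have "ad (\<lambda>_. \<zero>) cc = cc" using H.l_zero[of cc] by simp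
  ultimately have "ts_shift (del (ts_coord R x)) = cc \<ominus>\<^bsub>H\<^esub> cc"
    by (simp add: shift_del s o d1 L_def cc_def)
  also have "\<dots> = (\<lambda>_. \<zero>)" using H.r_right_minus_eq[of cc cc] by simp
  finally show "ts_shift (del (ts_coord R x)) k = ts_shift (\<lambda>_. \<zero>) k" by (simp add: ts_shift_def)
qed (simp add: del_0 ts_coord_def Dx)

lemma trunc_del: "g \<in> carrier H \<Longrightarrow> trunc k (del (trunc k g)) = trunc k (del g)"
  unfolding trunc_eq by (intro allI impI del_cong[of _ _ k] trunc_closed_H) (auto simp: trunc_def)

text \<open>Induction on \<open>k\<close>: a series truncated after \<open>Suc k\<close> is
  determined by its constant coefficient and by its image \<open>g + \<partial>g \<zeta>\<close> in
  the ring in \<zeta> over \<open>T k\<close>. The recursion for \<open>del\<close> says exactly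
  that both maps are compatible with the \<delta>-structures of their targets.\<close>

lemma is_delta_T: "is_delta p (T k) (\<lambda>g. trunc k (del g))"
proof (induction k)
  case 0
  show ?case
  proof (rule is_delta_pullback[where I="{()}" and S="\<lambda>_. R" and D'="\<lambda>_. D" and h="\<lambda>_ g. g 0"])
    have "(\<lambda>g. g 0) \<in> ring_hom (T 0) R"
      by (rule ring_hom_memI) (auto simp: T_carrier T_simps trunc_def ad_def ts_const_def)
    then show "cring R \<and> is_delta p R D \<and> (\<lambda>g. g 0) \<in> ring_hom (T 0) R"
      using D is_cring by simp
    fix a b assume "a \<in> carrier (T 0)" "b \<in> carrier (T 0)" "\<And>i. i \<in> {()} \<Longrightarrow> a 0 = b 0"
    then show "a = b" by (simp add: T_carrier) (metis trunc_eq le_zero_eq)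
  qed (auto simp: cring_T T_carrier del_0)
next
  case (Suc k)
  interpret h: ring_hom_cring H "T k" "trunc k" by (rule trunc_hom)
  interpret h': ring_hom_cring H "T (Suc k)" "trunc (Suc k)" by (rule trunc_hom)
  interpret du: dual_cring "T k" "trunc k eta" by unfold_locales simp
  let ?D = "\<lambda>g. trunc k (del g)"
  have cc: "frob_defect_div p (T k) (trunc k eta) (trunc k (ts_coord R x)) \<one>\<^bsub>T k\<^esub> = trunc k cc"
    unfolding cc_def by (subst h.hom_frob_defect_div) (auto simp: T_simps)
  have et: "(ts_const R q \<ominus>\<^bsub>T k\<^esub> \<one>\<^bsub>T k\<^esub>) \<otimes>\<^bsub>T k\<^esub> trunc k (ts_coord R x) = trunc k eta"
    unfolding eta_def
    by (subst h.hom_mult, rule H.minus_closed, simp, simp, simp, subst h.hom_sub) (simp_all add: T_simps)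
  \<comment> \<open>The relation \<open>\<delta>(\<eta>) = c \<eta>\<close> is taken from the
    induction hypothesis in \<open>T k\<close>; on \<open>H\<close> it could not be used before the
    theorem is known.\<close>
  have De: "?D (trunc k eta) = trunc k cc \<otimes>\<^bsub>T k\<^esub> trunc k eta"
    using h.S.delta_eta[OF Suc _ _ _ _ p, of "ts_const R q" "trunc k (ts_coord R x)"]
    unfolding et cc
    by (simp add: T_carrier del_const Dq trunc_del del_coord) (simp add: T_simps ts_const_def)
  have u: "trunc k uu = trunc k eta [^]\<^bsub>T k\<^esub> (p - 1) \<oplus>\<^bsub>T k\<^esub> add_pow (T k) p (trunc k cc)"
    unfolding uu_expand
    by (subst h.hom_add; (rule H.nat_pow_closed H.add.nat_pow_closed)?; simp add: h.hom_add_pow del: H_simps)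
  have dual: "is_delta p du.Z (dual_delta p (T k) ?D (trunc k eta) (trunc k cc) (trunc k uu))"
    by (rule du.is_delta_dual[OF Suc _ De u p]) simp
  have sub: "g \<in> carrier H" "trunc (Suc k) g = g" if "g \<in> carrier (T (Suc k))" for g
    using that by (auto simp: T_carrier)
  have tt: "trunc k (trunc (Suc k) g) = trunc k g" "trunc k (ts_shift (trunc (Suc k) g)) = trunc k (ts_shift g)" for g
    unfolding trunc_eq by (auto simp: trunc_def ts_shift_def)
  interpret dz: ring_hom_cring H "dual_ring H eta" "\<lambda>g. (g, ts_shift g)" by (rule dual_hom)
  show ?case
  proof (rule is_delta_pullback2[where S=R and h="\<lambda>g. g 0" and DS=D and S'=du.Z and
        h'="\<lambda>g. (trunc k g, trunc k (ts_shift g))"])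
    show "ring_hom_cring (T (Suc k)) R (\<lambda>g. g 0)"
      by (rule ring_hom_cringI, rule cring_T, rule is_cring, rule ring_hom_memI)
        (auto simp: T_carrier T_simps trunc_def ad_def ts_const_def)
    show "ring_hom_cring (T (Suc k)) du.Z (\<lambda>g. (trunc k g, trunc k (ts_shift g)))"
    proof (rule ring_hom_cringI, rule cring_T, rule du.Z.is_cring, rule ring_hom_memI)
      fix f g assume "f \<in> carrier (T (Suc k))" "g \<in> carrier (T (Suc k))"
      then have [simp]: "f \<in> carrier H" "g \<in> carrier H" by (auto dest: sub)
      have "ts_shift (mlt f g) = f \<otimes>\<^bsub>H\<^esub> ts_shift g \<oplus>\<^bsub>H\<^esub> ts_shift f \<otimes>\<^bsub>H\<^esub> g \<oplus>\<^bsub>H\<^esub> eta \<otimes>\<^bsub>H\<^esub> (ts_shift f \<otimes>\<^bsub>H\<^esub> ts_shift g)"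
        using dz.hom_mult[of f g] by simp
      then have "trunc k (ts_shift (mlt f g)) = trunc k f \<otimes>\<^bsub>T k\<^esub> trunc k (ts_shift g)
        \<oplus>\<^bsub>T k\<^esub> trunc k (ts_shift f) \<otimes>\<^bsub>T k\<^esub> trunc k g
        \<oplus>\<^bsub>T k\<^esub> trunc k eta \<otimes>\<^bsub>T k\<^esub> (trunc k (ts_shift f) \<otimes>\<^bsub>T k\<^esub> trunc k (ts_shift g))"
        by (simp only: h.hom_add h.hom_mult H.m_closed H.a_closed shift_closed eta_closed \<open>f \<in> carrier H\<close> \<open>g \<in> carrier H\<close>)
      then show "(trunc k (f \<otimes>\<^bsub>T (Suc k)\<^esub> g), trunc k (ts_shift (f \<otimes>\<^bsub>T (Suc k)\<^esub> g))) =
        (trunc k f, trunc k (ts_shift f)) \<otimes>\<^bsub>du.Z\<^esub> (trunc k g, trunc k (ts_shift g))"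
        by (simp add: T_simps tt trunc_mul)
    qed (auto simp: T_simps shift_ad trunc_ad shift_const dest: sub)
    fix g assume g: "g \<in> carrier (T (Suc k))"
    note [simp] = sub(1)[OF g]
    show "(trunc k (trunc (Suc k) (del g)), trunc k (ts_shift (trunc (Suc k) (del g)))) =
      dual_delta p (T k) ?D (trunc k eta) (trunc k cc) (trunc k uu) (trunc k g, trunc k (ts_shift g))"
      unfolding tt dual_delta_def by (simp add: trunc_del shift_del trunc_L)
  next
    fix a b assume "a \<in> carrier (T (Suc k))" "b \<in> carrier (T (Suc k))" "a 0 = b 0"
      "(trunc k a, trunc k (ts_shift a)) = (trunc k b, trunc k (ts_shift b))"
    then have "trunc (Suc k) a = trunc (Suc k) b"
      unfolding prod.inject trunc_eq ts_shift_def by (metis Suc_le_mono not0_implies_Suc)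
    then show "a = b" using \<open>a \<in> _\<close> \<open>b \<in> _\<close> by (simp add: sub)
  qed (use D dual in \<open>auto simp: del_0 dest: sub\<close>)
qed

theorem is_delta_del: "is_delta p H del"
proof (rule is_delta_pullback[where I=UNIV and S=T and D'="\<lambda>k g. trunc k (del g)" and h=trunc])
  fix k show "cring (T k) \<and> is_delta p (T k) (\<lambda>g. trunc k (del g)) \<and> trunc k \<in> ring_hom H (T k)"
    using cring_T is_delta_T ring_hom_cring.homh[OF trunc_hom] by auto
next
  fix a b :: "nat \<Rightarrow> 'a" assume "\<And>i. i \<in> UNIV \<Longrightarrow> trunc i a = trunc i b"
  then show "a = b" unfolding trunc_eq by auto
qed (auto simp: cring_H trunc_del)

definition frobH where "frobH g = g [^]\<^bsub>H\<^esub> p \<oplus>\<^bsub>H\<^esub> add_pow H p (del g)"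

text \<open>The \<zeta>-component of the \<open>p\<close>-th power is \<open>N B + p F\<close>, and
  \<open>p\<close> times the recursion for \<delta> is \<open>p (u d + c B - F)\<close>. The terms
  in \<open>F\<close> cancel and \<open>u = N + p c\<close> can be factored out.\<close>

lemma shift_frobH:
  assumes [simp]: "g \<in> carrier H"
  shows "ts_shift (frobH g) = uu \<otimes>\<^bsub>H\<^esub> frobH (ts_shift g)"
proof -
  interpret dz: ring_hom_cring H "dual_ring H eta" "\<lambda>g. (g, ts_shift g)" by (rule dual_hom)
  interpret du: dual_cring H eta by unfold_locales simp
  define \<pi> where "\<pi> = add_pow H p \<one>\<^bsub>H\<^esub>"
  have \<pi>: "add_pow H p y = \<pi> \<otimes>\<^bsub>H\<^esub> y" if "y \<in> carrier H" for y
    unfolding \<pi>_def using that by (rule H.add_pow_one)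
  have c1: "\<pi> \<in> carrier H" unfolding \<pi>_def by (rule H.add.nat_pow_closed) (rule H.one_closed)
  define N B d F where "N = eta [^]\<^bsub>H\<^esub> (p - 1)" and "B = ts_shift g [^]\<^bsub>H\<^esub> p" and
    "d = del (ts_shift g)" and "F = frob_defect_div p H eta g (ts_shift g)"
  have cl: "\<pi> \<in> carrier H" "N \<in> carrier H" "B \<in> carrier H" "d \<in> carrier H" "F \<in> carrier H" "cc \<in> carrier H"
    unfolding N_def B_def d_def F_def
    by (rule c1 H.nat_pow_closed del_closed H.frob_defect_div_closed cc_closed; simp)+
  have "(g [^]\<^bsub>H\<^esub> p, ts_shift (g [^]\<^bsub>H\<^esub> p)) = (g, ts_shift g) [^]\<^bsub>dual_ring H eta\<^esub> p"
    by (rule dz.hom_pow) simp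
  then have "ts_shift (g [^]\<^bsub>H\<^esub> p) = N \<otimes>\<^bsub>H\<^esub> B \<oplus>\<^bsub>H\<^esub> add_pow H p F"
    using trans[OF _ du.dual_pow_prime[OF assms shift_closed[OF assms] p]] unfolding N_def B_def F_def by blast
  moreover have "ts_shift (add_pow H p (del g)) = add_pow H p (ts_shift (del g))"
    by (simp add: H_add_pow) (simp add: ts_shift_def fun_eq_iff)
  moreover have "ts_shift (del g) = uu \<otimes>\<^bsub>H\<^esub> d \<oplus>\<^bsub>H\<^esub> cc \<otimes>\<^bsub>H\<^esub> B \<ominus>\<^bsub>H\<^esub> F"
    unfolding shift_del[OF assms] L_def d_def B_def F_def ..
  moreover have "ts_shift (g [^]\<^bsub>H\<^esub> p \<oplus>\<^bsub>H\<^esub> add_pow H p (del g)) =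
    ts_shift (g [^]\<^bsub>H\<^esub> p) \<oplus>\<^bsub>H\<^esub> ts_shift (add_pow H p (del g))"
    by (simp add: shift_ad)
  ultimately have "ts_shift (frobH g) =
    (N \<otimes>\<^bsub>H\<^esub> B \<oplus>\<^bsub>H\<^esub> \<pi> \<otimes>\<^bsub>H\<^esub> F) \<oplus>\<^bsub>H\<^esub> \<pi> \<otimes>\<^bsub>H\<^esub> (uu \<otimes>\<^bsub>H\<^esub> d \<oplus>\<^bsub>H\<^esub> cc \<otimes>\<^bsub>H\<^esub> B \<ominus>\<^bsub>H\<^esub> F)"
    unfolding frobH_def
    by (simp only: \<pi> cl H.m_closed H.a_closed H.minus_closed uu_closed)
  also have "uu = N \<oplus>\<^bsub>H\<^esub> \<pi> \<otimes>\<^bsub>H\<^esub> cc" unfolding uu_expand N_def by (simp only: \<pi> cl)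
  also have "(N \<otimes>\<^bsub>H\<^esub> B \<oplus>\<^bsub>H\<^esub> \<pi> \<otimes>\<^bsub>H\<^esub> F) \<oplus>\<^bsub>H\<^esub> \<pi> \<otimes>\<^bsub>H\<^esub> ((N \<oplus>\<^bsub>H\<^esub> \<pi> \<otimes>\<^bsub>H\<^esub> cc) \<otimes>\<^bsub>H\<^esub> d \<oplus>\<^bsub>H\<^esub> cc \<otimes>\<^bsub>H\<^esub> B \<ominus>\<^bsub>H\<^esub> F)
    = (N \<oplus>\<^bsub>H\<^esub> \<pi> \<otimes>\<^bsub>H\<^esub> cc) \<otimes>\<^bsub>H\<^esub> (B \<oplus>\<^bsub>H\<^esub> \<pi> \<otimes>\<^bsub>H\<^esub> d)"
    by (rule H.ring_eqI[of _ "[N,B,\<pi>,F,cc,d]"], (rule H.reify)+, code_simp, simp only: H.carrier_list cl)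
  finally show ?thesis
    unfolding frobH_def B_def[symmetric] d_def[symmetric] \<open>uu = _\<close> by (simp only: \<pi> cl)
qed

end

section \<open>Powers of the ideal \<open>(p, q - 1)\<close>\<close>

context ideal
begin

lemma I_minus: "a \<in> I \<Longrightarrow> b \<in> I \<Longrightarrow> a \<ominus> b \<in> I"
  by (simp add: a_minus_def)

lemma I_finsum: "(\<And>i. i \<in> S \<Longrightarrow> f i \<in> I) \<Longrightarrow> finsum R f S \<in> I"
proof (induction S rule: infinite_finite_induct)
  case (insert x F)
  then show ?case by (subst finsum_insert) (auto intro: Icarr)
qed auto

lemma I_add_pow: "a \<in> I \<Longrightarrow> add_pow R (n::nat) a \<in> I"
  by (induction n) auto

lemma I_pow: "a \<in> I \<Longrightarrow> 0 < n \<Longrightarrow> a [^] (n::nat) \<in> I"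
  by (cases n) (auto intro: I_l_closed Icarr)

lemma mem_coset_iff: "a \<in> carrier R \<Longrightarrow> b \<in> I +> a \<longleftrightarrow> b \<in> carrier R \<and> b \<ominus> a \<in> I"
proof
  assume a: "a \<in> carrier R" and "b \<in> I +> a"
  then obtain i where i: "i \<in> I" "b = i \<oplus> a" unfolding a_r_coset_def' by auto
  then have "b \<ominus> a = i" using a Icarr[OF i(1)] by (simp add: a_minus_def a_assoc r_neg)
  then show "b \<in> carrier R \<and> b \<ominus> a \<in> I" using i a Icarr by auto
next
  assume a: "a \<in> carrier R" and b: "b \<in> carrier R \<and> b \<ominus> a \<in> I"
  then have "b = (b \<ominus> a) \<oplus> a" by (simp add: a_minus_def a_assoc l_neg)
  then show "b \<in> I +> a" using b unfolding a_r_coset_def' by auto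
qed

lemma coset_eq_iff: "a \<in> carrier R \<Longrightarrow> b \<in> carrier R \<Longrightarrow> I +> a = I +> b \<longleftrightarrow> a \<ominus> b \<in> I"
proof
  assume ab: "a \<in> carrier R" "b \<in> carrier R" and "I +> a = I +> b"
  then have "a \<in> I +> b" using a_rcos_self by blast
  then show "a \<ominus> b \<in> I" using ab by (simp add: mem_coset_iff)
next
  assume ab: "a \<in> carrier R" "b \<in> carrier R" and "a \<ominus> b \<in> I"
  then have "a \<in> I +> b" by (simp add: mem_coset_iff)
  then show "I +> a = I +> b"
    using a_repr_independence[OF _ ab(2) a_subgroup] by metis
qed

lemma carrier_Quot: "carrier (R Quot I) = (+>) I ` carrier R"
  by (auto simp: FactRing_def A_RCOSETS_def RCOSETS_def a_r_coset_def)

end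

lemma (in cring) frob_defect_in_ideal:
  assumes "ideal I R" "a \<in> I" "b \<in> carrier R"
  shows "frob_defect p R a b \<in> I"
proof -
  interpret ideal I R by fact
  show ?thesis unfolding frob_defect_def
    by (rule I_finsum, rule I_add_pow, rule I_r_closed, rule I_pow) (use assms in auto)
qed

lemma (in cring) frob_defect_div_in_ideal:
  assumes "ideal I R" "a \<in> I" "b \<in> carrier R" "e \<in> carrier R"
  shows "frob_defect_div p R e a b \<in> I"
proof -
  interpret ideal I R by fact
  show ?thesis unfolding frob_defect_div_def
    by (rule I_finsum, rule I_add_pow, rule I_r_closed, rule I_r_closed, rule I_pow) (use assms in auto)
qed

lemma (in cring) ideal_ideal_pow: "ideal I R \<Longrightarrow> ideal (ideal_pow R I n) R"
  by (induction n) (auto intro: oneideal ideal_prod_is_ideal)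

lemma (in cring) ideal_pow_Suc_subset: "ideal I R \<Longrightarrow> ideal_pow R I (Suc n) \<subseteq> ideal_pow R I n"
  using ideal_prod_inter[OF _ ideal_ideal_pow[of I n], of I] by auto

lemma (in cring) ideal_pow_mono: "ideal I R \<Longrightarrow> m \<le> n \<Longrightarrow> ideal_pow R I n \<subseteq> ideal_pow R I m"
  by (induction n rule: nat_induct) (use ideal_pow_Suc_subset in \<open>auto simp: le_Suc_eq\<close>)

lemma (in cring) ideal_pow_1: "ideal I R \<Longrightarrow> ideal_pow R I (Suc 0) = I"
  by (simp add: ideal_prod_one)

lemma (in cring) ideal_pow_mult:
  assumes I: "ideal I R" and "a \<in> ideal_pow R I m" "b \<in> ideal_pow R I n"
  shows "a \<otimes> b \<in> ideal_pow R I (m + n)"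
  using assms(2)
proof (induction m arbitrary: a)
  case 0
  then show ?case using assms(3) ideal.I_l_closed[OF ideal_ideal_pow[OF I, of n]] by auto
next
  case (Suc m)
  have sub: "c \<in> carrier R" if "c \<in> ideal_pow R I k" for c k
    using that ideal.Icarr[OF ideal_ideal_pow[OF I]] by auto
  have "c \<otimes> b \<in> ideal_prod R I (ideal_pow R I (m + n))" if "c \<in> ideal_prod R I (ideal_pow R I m)" for c
    using that
  proof (induction c rule: ideal_prod.induct)
    case (prod i j)
    then have "i \<otimes> j \<otimes> b = i \<otimes> (j \<otimes> b)" using sub assms(3) ideal.Icarr[OF I] by (simp add: m_assoc)
    then show ?case using ideal_prod.prod[OF prod(1) Suc.IH[OF prod(2)]] by simp
  next
    case (sum s1 s2)
    then have "s1 \<in> carrier R" "s2 \<in> carrier R"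
      using ideal_prod_in_carrier[OF I ideal_ideal_pow[OF I, of m]] by auto
    then show ?case using ideal_prod.sum[OF sum(3,4)] sub[OF assms(3)] by (simp add: l_distr)
  qed
  then show ?case using Suc.prems by simp
qed

lemma (in cring) ideal_pow_pow:
  "ideal I R \<Longrightarrow> a \<in> I \<Longrightarrow> a [^] n \<in> ideal_pow R I n"
proof (induction n)
  case (Suc n)
  then have "a \<otimes> a [^] n \<in> ideal_pow R I (Suc 0 + n)"
    by (intro ideal_pow_mult) (auto simp: ideal_prod_one)
  then show ?case using Suc.prems ideal.Icarr[OF Suc.prems(1,2)] by (simp add: m_comm)
qed simp

lemma (in cring) ideal_pow_image:
  assumes "ring_hom_cring R S f" "ideal I R" "ideal J S" "f ` I \<subseteq> J" "a \<in> ideal_pow R I n"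
  shows "f a \<in> ideal_pow S J n"
  using assms(5)
proof (induction n arbitrary: a)
  case 0
  interpret f: ring_hom_cring R S f by fact
  from 0 show ?case by simp
next
  case (Suc n)
  interpret f: ring_hom_cring R S f by fact
  have sub: "c \<in> carrier R" if "c \<in> ideal_pow R I k" for c k
    using that ideal.Icarr[OF ideal_ideal_pow[OF assms(2)]] by auto
  from Suc.prems have "a \<in> ideal_prod R I (ideal_pow R I n)" by simp
  then show ?case
  proof (induction a rule: ideal_prod.induct)
    case (prod i j)
    then have "f (i \<otimes> j) = f i \<otimes>\<^bsub>S\<^esub> f j" using sub ideal.Icarr[OF assms(2)] by simp
    then show ?case using prod Suc.IH assms(4) by (auto intro: ideal_prod.prod)
  next
    case (sum s1 s2)
    then have "s1 \<in> carrier R" "s2 \<in> carrier R"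
      using ideal_prod_in_carrier[OF assms(2) ideal_ideal_pow[OF assms(2), of n]] by auto
    with sum show ?case by (auto intro: ideal_prod.sum)
  qed
qed

lemma (in cring) genideal_pair:
  assumes [simp]: "a \<in> carrier R" "b \<in> carrier R"
  shows "genideal R {a, b} = {a \<otimes> r \<oplus> b \<otimes> s | r s. r \<in> carrier R \<and> s \<in> carrier R}" (is "_ = ?K")
proof
  have "ideal ?K R"
  proof (rule idealI)
    show "subgroup ?K (add_monoid R)"
    proof (rule subgroup.intro; simp)
      show "?K \<subseteq> carrier R" by auto
      show "\<exists>r s. \<zero> = a \<otimes> r \<oplus> b \<otimes> s \<and> r \<in> carrier R \<and> s \<in> carrier R"
        by (intro exI[of _ \<zero>]) simp
    next
      fix c d assume "\<exists>r s. c = a \<otimes> r \<oplus> b \<otimes> s \<and> r \<in> carrier R \<and> s \<in> carrier R"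
        "\<exists>r s. d = a \<otimes> r \<oplus> b \<otimes> s \<and> r \<in> carrier R \<and> s \<in> carrier R"
      then obtain r s r' s' where [simp]: "r \<in> carrier R" "s \<in> carrier R" "r' \<in> carrier R" "s' \<in> carrier R"
        "c = a \<otimes> r \<oplus> b \<otimes> s" "d = a \<otimes> r' \<oplus> b \<otimes> s'" by auto
      have "c \<oplus> d = a \<otimes> (r \<oplus> r') \<oplus> b \<otimes> (s \<oplus> s')" by (simp add: r_distr a_ac)
      then show "\<exists>r s. c \<oplus> d = a \<otimes> r \<oplus> b \<otimes> s \<and> r \<in> carrier R \<and> s \<in> carrier R"
        by (metis a_closed \<open>r \<in> carrier R\<close> \<open>s \<in> carrier R\<close> \<open>r' \<in> carrier R\<close> \<open>s' \<in> carrier R\<close>)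
    next
      fix c assume "\<exists>r s. c = a \<otimes> r \<oplus> b \<otimes> s \<and> r \<in> carrier R \<and> s \<in> carrier R"
      then obtain r s where [simp]: "r \<in> carrier R" "s \<in> carrier R" and c: "c = a \<otimes> r \<oplus> b \<otimes> s" by auto
      have "\<ominus> c = a \<otimes> (\<ominus> r) \<oplus> b \<otimes> (\<ominus> s)" by (simp add: c r_minus minus_add)
      then show "\<exists>r s. inv\<^bsub>add_monoid R\<^esub> c = a \<otimes> r \<oplus> b \<otimes> s \<and> r \<in> carrier R \<and> s \<in> carrier R"
        unfolding a_inv_def[symmetric] by (metis a_inv_closed \<open>r \<in> carrier R\<close> \<open>s \<in> carrier R\<close>)
    qed
    fix c y assume "c \<in> ?K" and [simp]: "y \<in> carrier R"
    then obtain r s where [simp]: "r \<in> carrier R" "s \<in> carrier R" and c: "c = a \<otimes> r \<oplus> b \<otimes> s" by auto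
    have 1: "y \<otimes> c = a \<otimes> (y \<otimes> r) \<oplus> b \<otimes> (y \<otimes> s)" by (simp add: c r_distr m_ac)
    have "y \<otimes> r \<in> carrier R" "y \<otimes> s \<in> carrier R" by simp_all
    with 1 show "y \<otimes> c \<in> ?K" by blast
    moreover have "c \<otimes> y = y \<otimes> c" by (rule m_comm) (simp_all add: c)
    ultimately show "c \<otimes> y \<in> ?K" by simp
  qed (rule ring_axioms)
  moreover have "{a, b} \<subseteq> ?K"
  proof -
    have "a = a \<otimes> \<one> \<oplus> b \<otimes> \<zero>" "b = a \<otimes> \<zero> \<oplus> b \<otimes> \<one>" by simp_all
    then show ?thesis by blast
  qed
  ultimately show "genideal R {a, b} \<subseteq> ?K" by (rule genideal_minimal)
  show "?K \<subseteq> genideal R {a, b}"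
  proof
    fix c assume "c \<in> ?K"
    then obtain r s where [simp]: "r \<in> carrier R" "s \<in> carrier R" and c: "c = a \<otimes> r \<oplus> b \<otimes> s" by auto
    interpret J: ideal "genideal R {a, b}" R by (rule genideal_ideal) simp
    have "a \<in> genideal R {a, b}" "b \<in> genideal R {a, b}"
      using genideal_self[of "{a, b}"] by auto
    then show "c \<in> genideal R {a, b}" unfolding c by (simp add: J.a_closed J.I_r_closed)
  qed
qed

lemma (in cring) ideal_pow_pair:
  assumes [simp]: "a \<in> carrier R" "b \<in> carrier R" and I: "I = genideal R {a, b}"
    and c: "c \<in> ideal_pow R I (Suc n)"
  shows "\<exists>r s. r \<in> ideal_pow R I n \<and> s \<in> ideal_pow R I n \<and> c = a \<otimes> r \<oplus> b \<otimes> s"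
proof -
  have id: "ideal I R" unfolding I by (rule genideal_ideal) simp
  interpret J: ideal "ideal_pow R I n" R by (rule ideal_ideal_pow[OF id])
  from c have "c \<in> ideal_prod R I (ideal_pow R I n)" by simp
  then show ?thesis
  proof (induction c rule: ideal_prod.induct)
    case (prod i j)
    then obtain r s where rs [simp]: "r \<in> carrier R" "s \<in> carrier R" and i: "i = a \<otimes> r \<oplus> b \<otimes> s"
      unfolding I genideal_pair[OF assms(1,2)] by auto
    have j [simp]: "j \<in> carrier R" using prod(2) by (rule J.Icarr)
    have "i \<otimes> j = a \<otimes> (r \<otimes> j) \<oplus> b \<otimes> (s \<otimes> j)" by (simp add: i l_distr m_assoc)
    then show ?case using J.I_l_closed[OF prod(2)] rs by blast
  next
    case (sum c d)
    then obtain r s r' s' where *: "r \<in> ideal_pow R I n" "s \<in> ideal_pow R I n" "c = a \<otimes> r \<oplus> b \<otimes> s"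
      "r' \<in> ideal_pow R I n" "s' \<in> ideal_pow R I n" "d = a \<otimes> r' \<oplus> b \<otimes> s'" by auto
    have "c \<oplus> d = a \<otimes> (r \<oplus> r') \<oplus> b \<otimes> (s \<oplus> s')"
      using *(1,2,4,5)[THEN J.Icarr] by (simp add: *(3,6) r_distr a_ac)
    then show ?case
      using J.a_closed[OF *(1,4)] J.a_closed[OF *(2,5)] by (intro exI[of _ "r \<oplus> r'"] exI[of _ "s \<oplus> s'"]) simp
  qed
qed

context cring
begin

text \<open>Continuity of \<delta> with the loss of one power: in
  \<open>D (i \<otimes> j) = \<phi>(i) D j + D i j^p\<close> the factor \<open>\<phi>(i)\<close>
  stays in the ideal since \<open>p\<close> lies in it.\<close>

lemma delta_ideal_pow:
  assumes D: "is_delta p R D" and I: "ideal I R" and pI: "add_pow R p \<one> \<in> I"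
    and p: "Factorial_Ring.prime p" and "a \<in> ideal_pow R I (Suc n)"
  shows "D a \<in> ideal_pow R I n"
  using assms(5)
proof (induction n arbitrary: a)
  case 0
  then show ?case using is_delta_closed[OF D ideal.Icarr[OF ideal_ideal_pow[OF I] 0]] by simp
next
  case (Suc n)
  have p0: "0 < p" using prime_gt_0_nat[OF p] .
  interpret I: ideal I R by fact
  interpret J: ideal "ideal_pow R I (Suc n)" R by (rule ideal_ideal_pow[OF I])
  note cl [simp] = is_delta_closed[OF D]
  from Suc.prems have "a \<in> ideal_prod R I (ideal_pow R I (Suc n))" by simp
  then show ?case
  proof (induction a rule: ideal_prod.induct)
    case (prod i j)
    have [simp]: "i \<in> carrier R" "j \<in> carrier R" using prod by (auto intro: I.Icarr J.Icarr)
    have ph: "i [^] p \<oplus> add_pow R p (D i) \<in> I"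
      using I.I_pow[OF prod(1) p0] I.I_r_closed[OF pI, of "D i"] by (simp add: add_pow_one[of "D i"])
    have "D (i \<otimes> j) = (i [^] p \<oplus> add_pow R p (D i)) \<otimes> D j \<oplus> D i \<otimes> j [^] p"
      by (simp add: is_delta_mult[OF D] l_distr add_pow_ldistr a_ac)
    moreover have "(i [^] p \<oplus> add_pow R p (D i)) \<otimes> D j \<in> ideal_pow R I (Suc n)"
      using ideal_prod.prod[OF ph Suc.IH[OF prod(2)]] by simp
    moreover have "D i \<otimes> j [^] p \<in> ideal_pow R I (Suc n)"
      using J.I_l_closed[OF J.I_pow[OF prod(2) p0]] by simp
    ultimately show ?case using J.a_closed by metis
  next
    case (sum c d)
    interpret J': ideal "ideal_pow R I (Suc (Suc n))" R by (rule ideal_ideal_pow[OF I])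
    have cd: "c \<in> ideal_pow R I (Suc (Suc n))" "d \<in> ideal_pow R I (Suc (Suc n))" using sum by auto
    have "frob_defect p R c d \<in> ideal_pow R I (Suc (Suc n))"
      by (rule frob_defect_in_ideal[OF J'.is_ideal cd(1) J'.Icarr[OF cd(2)]])
    then have "frob_defect p R c d \<in> ideal_pow R I (Suc n)"
      using ideal_pow_Suc_subset[OF I] by blast
    then show ?case
      using sum(3,4) cd[THEN J'.Icarr] is_delta_add[OF D, of c d] J.I_minus J.a_closed by metis
  qed
qed

lemma finsum_in_subset:
  assumes "K \<subseteq> carrier R" "\<zero> \<in> K" "\<And>a b. a \<in> K \<Longrightarrow> b \<in> K \<Longrightarrow> a \<oplus> b \<in> K"
  shows "(\<And>i. i \<in> S \<Longrightarrow> f i \<in> K) \<Longrightarrow> finsum R f S \<in> K"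
proof (induction S rule: infinite_finite_induct)
  case (insert x F)
  then show ?case using assms by (subst finsum_insert) auto
qed (use assms in auto)

lemma nat_pow_in_subset:
  assumes "K \<subseteq> carrier R" "\<one> \<in> K" "\<And>a b. a \<in> K \<Longrightarrow> b \<in> K \<Longrightarrow> a \<otimes> b \<in> K"
  shows "a \<in> K \<Longrightarrow> a [^] (n::nat) \<in> K"
  by (induction n) (use assms in auto)

lemma add_pow_in_subset:
  assumes "K \<subseteq> carrier R" "\<zero> \<in> K" "\<And>a b. a \<in> K \<Longrightarrow> b \<in> K \<Longrightarrow> a \<oplus> b \<in> K"
  shows "a \<in> K \<Longrightarrow> add_pow R (n::nat) a \<in> K"
  by (induction n) (use assms in auto)

lemma frob_defect_div_in_subset:
  assumes K: "K \<subseteq> carrier R" "\<zero> \<in> K" "\<one> \<in> K" "\<And>a b. a \<in> K \<Longrightarrow> b \<in> K \<Longrightarrow> a \<oplus> b \<in> K"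
    "\<And>a b. a \<in> K \<Longrightarrow> b \<in> K \<Longrightarrow> a \<otimes> b \<in> K" and "e \<in> K" "a \<in> K" "b \<in> K"
  shows "frob_defect_div p R e a b \<in> K"
  unfolding frob_defect_div_def
  by (rule finsum_in_subset[OF K(1,2,4)], assumption, assumption, rule add_pow_in_subset[OF K(1,2,4)],
      assumption, assumption) (intro K(5) nat_pow_in_subset[OF K(1,3,5)] assms(6-); assumption)

end

section \<open>Null sequences\<close>

context twisted_series
begin

definition coefs_in :: "'a set \<Rightarrow> (nat \<Rightarrow> 'a) set" where
  "coefs_in J = {g. \<forall>k. g k \<in> J}"

text \<open>Null sequences are the intersection of these sets for \<open>J\<close> running through
  the powers of an ideal, so closure properties can be proved for one ideal at a time.\<close>

definition ev_in :: "'a set \<Rightarrow> (nat \<Rightarrow> 'a) set" where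
  "ev_in J = {g \<in> carrier H. \<exists>K. \<forall>k\<ge>K. g k \<in> J}"

lemma S_coefs_in: "ideal J R \<Longrightarrow> g \<in> coefs_in J \<Longrightarrow> S g \<in> coefs_in J"
proof -
  assume J: "ideal J R" and g: "g \<in> coefs_in J"
  interpret J: ideal J R by fact
  show "S g \<in> coefs_in J"
    using g unfolding coefs_in_def ts_sigma_def by (auto intro!: J.I_l_closed J.a_closed)
qed

lemma coefs_in_mul:
  assumes J: "ideal J R" "ideal K R" "ideal M R" and JK: "\<And>a b. a \<in> J \<Longrightarrow> b \<in> K \<Longrightarrow> a \<otimes> b \<in> M"
    and "g \<in> coefs_in J" "h \<in> coefs_in K"
  shows "mlt g h \<in> coefs_in M"
proof -
  interpret M: ideal M R by fact
  have "mlt g h k \<in> M" for k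
    using assms(5,6)
  proof (induction k arbitrary: g h)
    case 0
    then show ?case by (simp add: coefs_in_def JK)
  next
    case (Suc k)
    have "ts_shift g \<in> coefs_in J" "ts_shift h \<in> coefs_in K" "S g \<in> coefs_in J"
      using Suc.prems S_coefs_in[OF J(1)] by (auto simp: coefs_in_def ts_shift_def)
    then show ?case using Suc by simp
  qed
  then show ?thesis by (simp add: coefs_in_def)
qed

lemma ideal_coefs_in:
  assumes J: "ideal J R"
  shows "ideal (coefs_in J) H"
proof -
  interpret J: ideal J R by fact
  show ?thesis
  proof (rule idealI)
    have sub: "coefs_in J \<subseteq> carrier H" by (auto simp: coefs_in_def intro!: H_I J.Icarr)
    have inv: "\<ominus>\<^bsub>H\<^esub> g \<in> coefs_in J" if "g \<in> coefs_in J" for g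
    proof -
      have g: "g \<in> carrier H" using that sub by auto
      have "\<ominus>\<^bsub>H\<^esub> g = \<zero>\<^bsub>H\<^esub> \<ominus>\<^bsub>H\<^esub> g" using g by (simp add: a_minus_def H.l_zero[simplified])
      also have "\<dots> = (\<lambda>k. \<zero> \<ominus> g k)" using g H_minus[OF H.zero_closed g] by simp
      finally show ?thesis using that by (auto simp: coefs_in_def intro!: J.I_minus)
    qed
    show "subgroup (coefs_in J) (add_monoid H)"
      using sub inv by (intro subgroup.intro) (auto simp: a_inv_def, auto simp: coefs_in_def ad_def)
    fix g h assume g: "g \<in> coefs_in J" and h: "h \<in> carrier H"
    have "h \<in> coefs_in (carrier R)" using h by (simp add: coefs_in_def)
    then show "h \<otimes>\<^bsub>H\<^esub> g \<in> coefs_in J"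
      using coefs_in_mul[OF oneideal J J, of h g] g by (auto intro: J.I_l_closed)
    then show "g \<otimes>\<^bsub>H\<^esub> h \<in> coefs_in J" using H.m_comm[OF h] g sub by auto
  qed (rule H.ring_axioms)
qed

context
  fixes J assumes J: "ideal J R"
begin

interpretation J: ideal J R by (rule J)

lemma ev_in_closed: "g \<in> ev_in J \<Longrightarrow> g \<in> carrier H" by (simp add: ev_in_def)

lemma ev_in_coefs: "coefs_in J \<subseteq> ev_in J"
  by (auto simp: coefs_in_def ev_in_def intro!: H_I J.Icarr)

lemma ev_in_shift_iff: "g \<in> carrier H \<Longrightarrow> ts_shift g \<in> ev_in J \<longleftrightarrow> g \<in> ev_in J"
  unfolding ev_in_def ts_shift_def mem_Collect_eq
  by (metis Suc_le_D Suc_le_mono le_SucI shift_closed[unfolded ts_shift_def] H_I in_H)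

lemma ev_in_ad: "g \<in> ev_in J \<Longrightarrow> h \<in> ev_in J \<Longrightarrow> ad g h \<in> ev_in J"
  unfolding ev_in_def
proof safe
  fix K K' assume "\<forall>k\<ge>K. g k \<in> J" "\<forall>k\<ge>K'. h k \<in> J"
  then show "\<exists>K. \<forall>k\<ge>K. ad g h k \<in> J"
    by (intro exI[of _ "max K K'"]) (auto simp: ad_def)
qed auto

lemma ev_in_sm: "a \<in> carrier R \<Longrightarrow> g \<in> ev_in J \<Longrightarrow> sm a g \<in> ev_in J"
  unfolding ev_in_def by (auto simp: sm_def intro: J.I_l_closed)

lemma ev_in_Y: "g \<in> ev_in J \<Longrightarrow> Y g \<in> ev_in J"
  unfolding ev_in_def
proof safe
  fix K assume "\<forall>k\<ge>K. g k \<in> J"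
  then show "\<exists>K. \<forall>k\<ge>K. Y g k \<in> J"
    by (intro exI[of _ "Suc K"]) (auto simp: Y_def intro!: J.a_closed J.I_l_closed)
qed auto

text \<open>Induction on the sum of the two indices from which the factors lie in \<open>J\<close>.
  Every term of the symmetric Leibniz rule has a smaller sum; if one of the indices is 0, that
  factor lies in the ideal of series with all coefficients in \<open>J\<close>.\<close>

lemma ev_in_mul: "g \<in> ev_in J \<Longrightarrow> h \<in> ev_in J \<Longrightarrow> mlt g h \<in> ev_in J"
proof -
  have coefs: "mlt g h \<in> ev_in J" if "\<forall>k\<ge>0. g k \<in> J" "h \<in> carrier H" for g h
    using ideal.I_r_closed[OF ideal_coefs_in[OF J], of g h] that ev_in_coefs by (auto simp: coefs_in_def)
  have "mlt g h \<in> ev_in J"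
    if "m + n \<le> N" "g \<in> carrier H" "h \<in> carrier H" "\<forall>k\<ge>m. g k \<in> J" "\<forall>k\<ge>n. h k \<in> J" for N m n g h
    using that
  proof (induction N arbitrary: m n g h)
    case 0
    then show ?case using coefs by auto
  next
    case (Suc N)
    show ?case
    proof (cases "m = 0 \<or> n = 0")
      case True
      then show ?thesis using Suc.prems coefs[of g h] coefs[of h g] mul_comm[of g h] by auto
    next
      case False
      then obtain m' n' where mn: "m = Suc m'" "n = Suc n'" by (cases m; cases n) auto
      have g: "\<forall>k\<ge>m'. ts_shift g k \<in> J" and h: "\<forall>k\<ge>n'. ts_shift h k \<in> J"
        using Suc.prems mn by (auto simp: ts_shift_def)
      have "mlt (ts_shift g) h \<in> ev_in J"
        by (rule Suc.IH[of m' n]) (use Suc.prems mn g in auto)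
      moreover have "mlt g (ts_shift h) \<in> ev_in J"
        by (rule Suc.IH[of m n']) (use Suc.prems mn h in auto)
      moreover have "mlt (ts_shift g) (ts_shift h) \<in> ev_in J"
        by (rule Suc.IH[of m' n']) (use Suc.prems mn h g in auto)
      ultimately have "ts_shift (mlt g h) \<in> ev_in J"
        unfolding shift_mul'[OF Suc.prems(2,3)] by (intro ev_in_ad ev_in_sm ev_in_Y) auto
      then show ?thesis using Suc.prems by (simp add: ev_in_shift_iff)
    qed
  qed
  then show "g \<in> ev_in J \<Longrightarrow> h \<in> ev_in J \<Longrightarrow> mlt g h \<in> ev_in J"
    unfolding ev_in_def[of J] mem_Collect_eq by blast
qed

lemma ev_in_const: "a \<in> carrier R \<Longrightarrow> ts_const R a \<in> ev_in J"
  unfolding ev_in_def by (auto simp: ts_const_def intro!: exI[of _ 1])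

lemma ev_in_coord: "ts_coord R x \<in> ev_in J"
  unfolding ev_in_def by (auto simp: ts_coord_def intro!: exI[of _ 2])

lemma ev_in_zero: "(\<lambda>_. \<zero>) \<in> ev_in J"
  using ev_in_const[OF zero_closed] by (simp add: ts_const_def ev_in_def)

lemma ev_in_minus: "g \<in> ev_in J \<Longrightarrow> h \<in> ev_in J \<Longrightarrow> g \<ominus>\<^bsub>H\<^esub> h \<in> ev_in J"
proof -
  assume "g \<in> ev_in J" "h \<in> ev_in J"
  then obtain K K' where *: "g \<in> carrier H" "h \<in> carrier H" "\<forall>k\<ge>K. g k \<in> J" "\<forall>k\<ge>K'. h k \<in> J"
    unfolding ev_in_def by auto
  have "g \<ominus>\<^bsub>H\<^esub> h \<in> carrier H" using * by (intro H.minus_closed)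
  moreover have "\<forall>k\<ge>max K K'. (g \<ominus>\<^bsub>H\<^esub> h) k \<in> J" using * by (auto simp: H_minus intro: J.I_minus)
  ultimately show ?thesis unfolding ev_in_def by blast
qed

lemma ev_in_subset:
  shows "ev_in J \<subseteq> carrier H" "\<zero>\<^bsub>H\<^esub> \<in> ev_in J" "\<one>\<^bsub>H\<^esub> \<in> ev_in J"
    "\<And>a b. a \<in> ev_in J \<Longrightarrow> b \<in> ev_in J \<Longrightarrow> a \<oplus>\<^bsub>H\<^esub> b \<in> ev_in J"
    "\<And>a b. a \<in> ev_in J \<Longrightarrow> b \<in> ev_in J \<Longrightarrow> a \<otimes>\<^bsub>H\<^esub> b \<in> ev_in J"
  by (auto simp: ev_in_closed ev_in_zero ev_in_const ev_in_ad ev_in_mul)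

lemma ev_in_eta: "eta \<in> ev_in J"
  unfolding eta_def by (intro ev_in_subset ev_in_minus ev_in_const ev_in_coord) simp

end

end

context twisted_delta
begin

lemma ev_in_cc: "ideal J R \<Longrightarrow> cc \<in> ev_in J"
  unfolding cc_def
  by (rule H.frob_defect_div_in_subset[OF ev_in_subset]) (auto intro: ev_in_eta ev_in_coord ev_in_const)

lemma ev_in_uu: "ideal J R \<Longrightarrow> uu \<in> ev_in J"
  unfolding uu_expand
  by (intro ev_in_subset H.nat_pow_in_subset H.add_pow_in_subset ev_in_cc ev_in_eta; assumption?)

lemma ev_in_L: "ideal J R \<Longrightarrow> w \<in> ev_in J \<Longrightarrow> g \<in> ev_in J \<Longrightarrow> L w g \<in> ev_in J"
  unfolding L_def
  apply (rule ev_in_minus, assumption)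
   apply (intro ev_in_subset ev_in_cc ev_in_uu; assumption?)
   apply (rule H.nat_pow_in_subset[OF ev_in_subset(1,3,5)]; assumption?)
   apply (simp add: ev_in_shift_iff ev_in_closed)
  apply (rule H.frob_defect_div_in_subset[OF ev_in_subset]; assumption?)
   apply (erule ev_in_eta)
  apply (simp add: ev_in_shift_iff ev_in_closed)
  done

text \<open>Two ideals are needed because \<delta> loses a power: the case of interest is
  \<open>J' = I^(n+1)\<close> and \<open>J = I^n\<close>.\<close>

lemma del_coefs_in:
  assumes J: "ideal J R" and J': "ideal J' R" "J' \<subseteq> J" and DJ: "\<And>a. a \<in> J' \<Longrightarrow> D a \<in> J"
    and "g \<in> coefs_in J'"
  shows "del g \<in> coefs_in J"
proof -
  interpret J: ideal J R by fact
  interpret C: ideal "coefs_in J" H by (rule ideal_coefs_in[OF J])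
  have "\<forall>j\<le>k. del g j \<in> J" for k
    using assms(5)
  proof (induction k arbitrary: g)
    case 0
    then show ?case by (auto simp: del_0 coefs_in_def DJ)
  next
    case (Suc k)
    have gJ: "g \<in> coefs_in J" "ts_shift g \<in> coefs_in J" "ts_shift g \<in> coefs_in J'"
      using Suc.prems J'(2) by (auto simp: coefs_in_def ts_shift_def)
    have g: "g \<in> carrier H" using gJ(1) by (rule C.Icarr)
    \<comment> \<open>The induction hypothesis controls the coefficients up to \<open>k\<close>
      only, so the tail is replaced by zeros; coefficient \<open>k\<close> of \<open>L\<close> does
      not change.\<close>
    define w where "w = trunc k (del (ts_shift g))"
    have w: "w \<in> coefs_in J" using Suc.IH[OF gJ(3)] by (auto simp: w_def trunc_def coefs_in_def)
    have "L w g \<in> coefs_in J"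
      unfolding L_def
      by (intro C.I_minus C.a_closed C.I_l_closed C.I_pow H.frob_defect_div_in_ideal[OF C.is_ideal]
          w gJ p0 uu_closed cc_closed eta_closed shift_closed g)
    moreover have "L (del (ts_shift g)) g k = L w g k"
      by (rule L_cong[where k=k]) (use g C.Icarr[OF w] in \<open>auto simp: w_def trunc_def\<close>)
    ultimately have "del g (Suc k) \<in> J"
      using shift_del[OF g] by (auto simp: ts_shift_def coefs_in_def fun_eq_iff)
    then show ?case using Suc.IH[OF gJ(3)] Suc.prems Suc by (auto simp: le_Suc_eq)
  qed
  then show ?thesis by (auto simp: coefs_in_def)
qed

lemma ev_in_del:
  assumes J: "ideal J R" and J': "ideal J' R" "J' \<subseteq> J" and DJ: "\<And>a. a \<in> J' \<Longrightarrow> D a \<in> J"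
    and "g \<in> ev_in J'"
  shows "del g \<in> ev_in J"
proof -
  have sub: "ev_in J' \<subseteq> ev_in J" using J'(2) by (auto simp: ev_in_def)
  have "del g \<in> ev_in J" if "g \<in> carrier H" "\<forall>k\<ge>m. g k \<in> J'" for m g
    using that
  proof (induction m arbitrary: g)
    case 0
    then have "g \<in> coefs_in J'" by (simp add: coefs_in_def)
    then show ?case using del_coefs_in[OF J J' DJ] ev_in_coefs[OF J] by auto
  next
    case (Suc m)
    have "del (ts_shift g) \<in> ev_in J"
    proof (rule Suc.IH)
      show "\<forall>k\<ge>m. ts_shift g k \<in> J'" using Suc.prems by (auto simp: ts_shift_def)
    qed (use Suc.prems in simp)
    moreover have "g \<in> ev_in J" using Suc.prems sub unfolding ev_in_def by blast
    ultimately have "ts_shift (del g) \<in> ev_in J"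
      unfolding shift_del[OF Suc.prems(1)] by (intro ev_in_L J)
    then show ?case using Suc.prems ev_in_shift_iff[OF J] by simp
  qed
  then show ?thesis using assms(5) unfolding ev_in_def[of J'] by blast
qed

end

section \<open>Bounded pairs\<close>

text \<open>Torsion in the quotient becomes a divisibility statement in the ring, which can be
  tested on coefficients.\<close>

lemma (in cring) bounded_pair_quot:
  fixes p :: nat
  assumes [simp]: "v \<in> carrier R"
  shows "(let Q = R Quot cgenideal R v in \<exists>N::nat. \<forall>y\<in>carrier Q.
      (\<exists>n::nat. add_pow Q (p ^ n) y = \<zero>\<^bsub>Q\<^esub>) \<longrightarrow> add_pow Q (p ^ N) y = \<zero>\<^bsub>Q\<^esub>) \<longleftrightarrow>
    (\<exists>N::nat. \<forall>y\<in>carrier R. (\<exists>n::nat. \<exists>c\<in>carrier R. add_pow R (p ^ n) y = c \<otimes> v) \<longrightarrow>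
       (\<exists>c\<in>carrier R. add_pow R (p ^ N) y = c \<otimes> v))"
proof -
  let ?J = "cgenideal R v"
  have mem: "y \<in> ?J \<longleftrightarrow> (\<exists>c\<in>carrier R. y = c \<otimes> v)" for y by (auto simp: cgenideal_def)
  interpret J: ideal ?J R by (rule cgenideal_ideal) simp
  interpret Q: ring_hom_cring R "R Quot ?J" "(+>) ?J" by (rule J.rcos_ring_hom_cring[OF is_cring])
  have z: "add_pow (R Quot ?J) (n::nat) (?J +> y) = \<zero>\<^bsub>R Quot ?J\<^esub> \<longleftrightarrow> (\<exists>c\<in>carrier R. add_pow R n y = c \<otimes> v)"
    if "y \<in> carrier R" for y n
  proof -
    have "add_pow (R Quot ?J) n (?J +> y) = ?J +> add_pow R n y"
      by (rule Q.hom_add_pow[symmetric, OF that])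
    moreover have "\<zero>\<^bsub>R Quot ?J\<^esub> = ?J +> \<zero>" by (rule Q.hom_zero[symmetric])
    moreover have "?J +> add_pow R n y = ?J +> \<zero> \<longleftrightarrow> add_pow R n y \<in> ?J"
      using J.coset_eq_iff[of "add_pow R n y" \<zero>] that by (simp add: a_minus_def)
    ultimately have "add_pow (R Quot ?J) n (?J +> y) = \<zero>\<^bsub>R Quot ?J\<^esub> \<longleftrightarrow> add_pow R n y \<in> ?J"
      by (simp only:)
    then show ?thesis by (simp only: mem)
  qed
  show ?thesis
    unfolding Let_def J.carrier_Quot ball_simps
    by (rule ex_cong1, rule ball_cong[OF refl], simp only: z)
qed

lemma (in cring) qnum_closed:
  fixes B :: "'u dpair"
  assumes "cring B" "qel B \<in> carrier B"
  shows "qnum B n \<in> carrier B"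
proof -
  interpret B: cring B by fact
  show ?thesis unfolding qnum_def by (rule B.finsum_closed) (use assms in auto)
qed

lemma (in ring_hom_cring) hom_ring: "ring_hom_ring R S h"
  by (intro ring_hom_ringI2 R.ring_axioms S.ring_axioms homh)

text \<open>Transport of structure along an injection: \<open>B\<close> is not assumed to be a ring.
  It serves for rings that are coded anew on another type.\<close>

lemma cring_pullback:
  assumes "cring H" and f: "f \<in> carrier B \<rightarrow> carrier H" "inj_on f (carrier B)"
    and closed: "\<And>a b. a \<in> carrier B \<Longrightarrow> b \<in> carrier B \<Longrightarrow> a \<oplus>\<^bsub>B\<^esub> b \<in> carrier B"
      "\<And>a b. a \<in> carrier B \<Longrightarrow> b \<in> carrier B \<Longrightarrow> a \<otimes>\<^bsub>B\<^esub> b \<in> carrier B"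
      "\<zero>\<^bsub>B\<^esub> \<in> carrier B" "\<one>\<^bsub>B\<^esub> \<in> carrier B"
      "\<And>a. a \<in> carrier B \<Longrightarrow> \<exists>b\<in>carrier B. f b = \<ominus>\<^bsub>H\<^esub> f a"
    and hom: "\<And>a b. a \<in> carrier B \<Longrightarrow> b \<in> carrier B \<Longrightarrow> f (a \<oplus>\<^bsub>B\<^esub> b) = f a \<oplus>\<^bsub>H\<^esub> f b"
      "\<And>a b. a \<in> carrier B \<Longrightarrow> b \<in> carrier B \<Longrightarrow> f (a \<otimes>\<^bsub>B\<^esub> b) = f a \<otimes>\<^bsub>H\<^esub> f b"
      "f \<zero>\<^bsub>B\<^esub> = \<zero>\<^bsub>H\<^esub>" "f \<one>\<^bsub>B\<^esub> = \<one>\<^bsub>H\<^esub>"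
  shows "ring_hom_cring B H f"
proof -
  interpret H: cring H by fact
  have [simp]: "f a \<in> carrier H" if "a \<in> carrier B" for a using f(1) that by auto
  note inj = inj_onD[OF f(2)]
  have "cring B"
  proof (rule cringI)
    show "abelian_group B"
    proof (rule abelian_groupI)
      fix a assume a: "a \<in> carrier B"
      then obtain b where b: "b \<in> carrier B" "f b = \<ominus>\<^bsub>H\<^esub> f a" using closed(5) by blast
      then have "b \<oplus>\<^bsub>B\<^esub> a = \<zero>\<^bsub>B\<^esub>" by (intro inj) (use a in \<open>auto simp: closed hom H.l_neg\<close>)
      then show "\<exists>b\<in>carrier B. b \<oplus>\<^bsub>B\<^esub> a = \<zero>\<^bsub>B\<^esub>" using b by blast
    qed (intro inj; auto simp: closed hom H.a_ac; fail | auto simp: closed)+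
    show "Group.comm_monoid B"
      by (rule comm_monoidI) (intro inj; auto simp: closed hom H.m_ac; fail | auto simp: closed)+
    fix a b c assume "a \<in> carrier B" "b \<in> carrier B" "c \<in> carrier B"
    then show "(a \<oplus>\<^bsub>B\<^esub> b) \<otimes>\<^bsub>B\<^esub> c = a \<otimes>\<^bsub>B\<^esub> c \<oplus>\<^bsub>B\<^esub> b \<otimes>\<^bsub>B\<^esub> c"
      by (intro inj) (auto simp: closed hom H.l_distr)
  qed
  then show ?thesis
    by (rule ring_hom_cringI) (auto intro!: ring_hom_memI simp: assms(1) hom)
qed

section \<open>The pair of null sequences\<close>

text \<open>Some injection, meaningful as soon as one exists. It brings the ring of sequences back
  to the type on which the site is formed, and allows the construction to be repeated over that
  ring.\<close>

definition seq_code :: "(nat \<Rightarrow> 'u) \<Rightarrow> 'u" where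
  "seq_code = (SOME e. inj e)"

definition seq_of :: "'u \<Rightarrow> nat \<Rightarrow> 'u" where
  "seq_of = inv_into UNIV seq_code"

definition ts_nulls :: "nat \<Rightarrow> 'u dpair \<Rightarrow> (nat \<Rightarrow> 'u) set" where
  "ts_nulls p A = {g. (\<forall>k. g k \<in> carrier A) \<and> (\<forall>n. \<exists>K. \<forall>k\<ge>K. g k \<in> ideal_pow A (pq_ideal p A) n)}"

definition ts_pair :: "nat \<Rightarrow> 'u dpair \<Rightarrow> 'u \<Rightarrow> 'u dpair" where
  "ts_pair p A x = \<lparr>carrier = seq_code ` ts_nulls p A,
     monoid.mult = (\<lambda>a b. seq_code (ts_mult A (qel A) x (seq_of a) (seq_of b))),
     monoid.one = seq_code (ts_const A \<one>\<^bsub>A\<^esub>),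
     ring.zero = seq_code (\<lambda>_. \<zero>\<^bsub>A\<^esub>),
     ring.add = (\<lambda>a b. seq_code (\<lambda>k. seq_of a k \<oplus>\<^bsub>A\<^esub> seq_of b k)),
     delta = (\<lambda>a. seq_code (twisted_delta.del A (qel A) x p (delta A) (seq_of a))),
     qel = seq_code (ts_const A (qel A)),
     pd_ideal = seq_code ` {g \<in> ts_nulls p A. g 0 \<in> pd_ideal A}\<rparr>"

locale pq_pair =
  fixes p :: nat and A :: "'u dpair" (structure)
  assumes p: "Factorial_Ring.prime p" and qPD: "qPD_pair p A" and bounded: "bounded_pair p A"
    and complete: "complete_pair p A"
begin

lemma A_cring: "cring A" and A_delta: "is_delta p A (delta A)"
  and A_q: "qel A \<in> carrier A" "delta A (qel A) = \<zero>" and A_ideal: "ideal (pd_ideal A) A"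
  using qPD unfolding qPD_pair_def delta_pair_def over_base_def delta_structure_iff by auto

sublocale cring A by (rule A_cring)

abbreviation "I \<equiv> pq_ideal p A"
abbreviation "Ip n \<equiv> ideal_pow A I n"
abbreviation "v \<equiv> qnum A p"
definition "\<pi> = add_pow A p \<one>"

lemma A_pi [simp]: "\<pi> \<in> carrier A" unfolding \<pi>_def by simp

lemma add_pow_pi: "a \<in> carrier A \<Longrightarrow> add_pow A p a = \<pi> \<otimes> a"
  unfolding \<pi>_def by (rule add_pow_one)

lemma add_pow_pi_pow: "a \<in> carrier A \<Longrightarrow> add_pow A (p ^ n) a = \<pi> [^] n \<otimes> a"
proof (induction n arbitrary: a)
  case (Suc n)
  have "add_pow A (p ^ Suc n) a = add_pow A (p ^ n) (add_pow A p a)"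
    by (simp add: add.nat_pow_pow Suc.prems mult.commute)
  then show ?case using Suc by (simp add: add_pow_pi m_assoc)
qed simp

lemma I_eq: "I = genideal A {\<pi>, qel A \<ominus> \<one>}" unfolding pq_ideal_def \<pi>_def ..

lemma I_ideal: "ideal I A" unfolding I_eq by (rule genideal_ideal) (simp add: A_q)

lemma Ip_ideal: "ideal (Ip n) A" by (rule ideal_ideal_pow[OF I_ideal])

lemma pi_I: "\<pi> \<in> I" and t_I: "qel A \<ominus> \<one> \<in> I"
  unfolding I_eq using genideal_self[of "{\<pi>, qel A \<ominus> \<one>}"] A_q by auto

lemma v_closed [simp]: "v \<in> carrier A" by (rule qnum_closed[OF A_cring A_q(1)])

lemma v_torsion_free: "b \<in> carrier A \<Longrightarrow> v \<otimes> b = \<zero> \<Longrightarrow> b = \<zero>"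
  using qPD unfolding qPD_pair_def qnum_torsion_free_def by blast

text \<open>By \<open>qnum_expand\<close>, \<open>(q - 1)^(p-1)\<close> agrees with
  \<open>(p)_q\<close> modulo \<open>p\<close>. Hence \<open>p\<close> and \<open>(p)_q\<close>
  generate the same topology as \<open>p\<close> and \<open>q - 1\<close>.\<close>

lemma v_expand: "\<exists>c\<in>carrier A. (qel A \<ominus> \<one>) [^] (p - 1) = v \<ominus> \<pi> \<otimes> c"
proof -
  let ?t = "qel A \<ominus> \<one>"
  let ?c = "frob_defect_div p A ?t \<one> \<one>"
  have [simp]: "qel A \<in> carrier A" by (rule A_q)
  have "\<one> \<oplus> ?t = qel A"
    by (rule ring_eqI[of _ "[qel A]"], (rule reify)+, code_simp, simp add: carrier_list)
  then have "v = ?t [^] (p - 1) \<oplus> \<pi> \<otimes> ?c"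
    using qnum_expand[of ?t, OF _ p] unfolding qnum_def by (simp add: add_pow_pi)
  moreover have "a = (a \<oplus> b) \<ominus> b" if [simp]: "a \<in> carrier A" "b \<in> carrier A" for a b
    by (rule ring_eqI[of _ "[a,b]"], (rule reify)+, code_simp, simp add: carrier_list)
  ultimately show ?thesis by (intro bexI[of _ ?c]) auto
qed

lemma Ip_carrier: "a \<in> Ip n \<Longrightarrow> a \<in> carrier A"
  by (rule ideal.Icarr[OF Ip_ideal])

lemma Ip_mono: "m \<le> n \<Longrightarrow> a \<in> Ip n \<Longrightarrow> a \<in> Ip m"
  using ideal_pow_mono[OF I_ideal] by blast

lemma Ip_Suc: "c \<in> Ip (Suc n) \<Longrightarrow> \<exists>r\<in>Ip n. \<exists>s\<in>Ip n. c = \<pi> \<otimes> r \<oplus> (qel A \<ominus> \<one>) \<otimes> s"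
  using ideal_pow_pair[OF A_pi _ I_eq, of c n] A_q by auto

text \<open>One factor of the ideal is split off at a time; everything divisible by \<open>p\<close>
  is collected in the first term and a pure power of \<open>q - 1\<close> is left in the
  second.\<close>

lemma Ip_split: "c \<in> Ip (j + r) \<Longrightarrow> \<exists>a\<in>Ip j. \<exists>b\<in>Ip j. c = \<pi> \<otimes> a \<oplus> (qel A \<ominus> \<one>) [^] r \<otimes> b"
proof (induction r arbitrary: c)
  case 0
  have "c = \<pi> \<otimes> \<zero> \<oplus> (qel A \<ominus> \<one>) [^] (0::nat) \<otimes> c" using 0 Ip_carrier by simp
  moreover have "\<zero> \<in> Ip j" using additive_subgroup.zero_closed[OF ideal.axioms(1)[OF Ip_ideal]] by blast
  ultimately show ?case using 0 by (intro bexI[of _ \<zero>] bexI[of _ c]) auto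
next
  case (Suc r)
  define t where "t = qel A \<ominus> \<one>"
  have [simp]: "t \<in> carrier A" unfolding t_def using A_q by simp
  interpret J: ideal "Ip j" A by (rule Ip_ideal)
  obtain a' b' where a': "a' \<in> Ip (j + r)" and b': "b' \<in> Ip (j + r)" and c: "c = \<pi> \<otimes> a' \<oplus> t \<otimes> b'"
    using Ip_Suc[of c "j + r"] Suc.prems unfolding t_def by auto
  obtain a b where ab: "a \<in> Ip j" "b \<in> Ip j" "b' = \<pi> \<otimes> a \<oplus> t [^] r \<otimes> b"
    using Suc.IH[OF b'] unfolding t_def by auto
  have [simp]: "a \<in> carrier A" "b \<in> carrier A" "a' \<in> carrier A" using ab a' Ip_carrier by auto
  have "c = \<pi> \<otimes> (a' \<oplus> t \<otimes> a) \<oplus> t [^] Suc r \<otimes> b"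
    unfolding c ab(3) by (simp add: r_distr m_ac a_ac)
  moreover have "a' \<oplus> t \<otimes> a \<in> Ip j"
    using Ip_mono[of j "j + r" a'] a' ab by (intro J.a_closed J.I_l_closed) auto
  ultimately show ?case using ab(2) unfolding t_def by blast
qed

lemma Ip_split_v: "c \<in> Ip (j + (p - 1)) \<Longrightarrow> \<exists>a\<in>Ip j. \<exists>b\<in>Ip j. c = \<pi> \<otimes> a \<oplus> v \<otimes> b"
proof -
  assume "c \<in> Ip (j + (p - 1))"
  then obtain a b where ab: "a \<in> Ip j" "b \<in> Ip j" "c = \<pi> \<otimes> a \<oplus> (qel A \<ominus> \<one>) [^] (p - 1) \<otimes> b"
    using Ip_split by blast
  obtain d where d [simp]: "d \<in> carrier A" and t: "(qel A \<ominus> \<one>) [^] (p - 1) = v \<ominus> \<pi> \<otimes> d"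
    using v_expand by blast
  interpret J: ideal "Ip j" A by (rule Ip_ideal)
  have [simp]: "a \<in> carrier A" "b \<in> carrier A" using ab by (auto intro: J.Icarr)
  have "\<pi> \<otimes> a \<oplus> (v \<ominus> \<pi> \<otimes> d) \<otimes> b = \<pi> \<otimes> (a \<ominus> d \<otimes> b) \<oplus> v \<otimes> b"
    by (rule ring_eqI[of _ "[\<pi>,a,v,d,b]"], (rule reify)+, code_simp, simp add: carrier_list)
  moreover have "a \<ominus> d \<otimes> b \<in> Ip j" using ab by (intro J.I_minus J.I_l_closed) auto
  ultimately show ?thesis using ab unfolding t by auto
qed

text \<open>Every \<open>p - 1\<close> factors of the ideal yield a factor \<open>p\<close> or a
  factor \<open>(p)_q\<close>; the part divisible by \<open>p\<close> is split again,
  \<open>M\<close> times in all.\<close>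

lemma Ip_split_power: "c \<in> Ip (n + M * (p - 1)) \<Longrightarrow> \<exists>a\<in>Ip n. \<exists>b\<in>Ip n. c = \<pi> [^] M \<otimes> a \<oplus> v \<otimes> b"
proof (induction M arbitrary: c)
  case 0
  have "c = \<pi> [^] (0::nat) \<otimes> c \<oplus> v \<otimes> \<zero>" using 0 Ip_carrier by simp
  moreover have "\<zero> \<in> Ip n" using additive_subgroup.zero_closed[OF ideal.axioms(1)[OF Ip_ideal]] by blast
  ultimately show ?case using 0 by (intro bexI[of _ c] bexI[of _ \<zero>]) auto
next
  case (Suc M)
  interpret J: ideal "Ip n" A by (rule Ip_ideal)
  have "n + Suc M * (p - 1) = n + M * (p - 1) + (p - 1)" by simp
  then have "c \<in> Ip (n + M * (p - 1) + (p - 1))" using Suc.prems by (simp only:)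
  then obtain a' b' where a': "a' \<in> Ip (n + M * (p - 1))" and b': "b' \<in> Ip (n + M * (p - 1))"
    and c: "c = \<pi> \<otimes> a' \<oplus> v \<otimes> b'" using Ip_split_v by blast
  obtain a b where ab: "a \<in> Ip n" "b \<in> Ip n" "a' = \<pi> [^] M \<otimes> a \<oplus> v \<otimes> b"
    using Suc.IH[OF a'] by blast
  have b'n: "b' \<in> Ip n" using Ip_mono[OF _ b'] by simp
  have [simp]: "a \<in> carrier A" "b \<in> carrier A" "b' \<in> carrier A" using ab b' Ip_carrier by auto
  have "c = \<pi> [^] Suc M \<otimes> a \<oplus> v \<otimes> (\<pi> \<otimes> b \<oplus> b')"
    unfolding c ab(3) by (simp add: r_distr m_ac a_ac)
  moreover have "\<pi> \<otimes> b \<oplus> b' \<in> Ip n" using ab b'n by (intro J.a_closed J.I_l_closed) auto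
  ultimately show ?case using ab(1) by blast
qed

lemma bounded_torsion:
  "\<exists>N::nat. \<forall>y\<in>carrier A. (\<exists>n::nat. \<exists>c\<in>carrier A. \<pi> [^] n \<otimes> y = c \<otimes> v) \<longrightarrow>
    (\<exists>c\<in>carrier A. \<pi> [^] N \<otimes> y = c \<otimes> v)"
  using bounded bounded_pair_quot[OF v_closed, of p]
  unfolding bounded_pair_def by (simp add: add_pow_pi_pow cong: ball_cong)

text \<open>Boundedness enters through the continuity of the division by \<open>(p)\<^sub>q\<close>.\<close>

lemma v_division: "\<exists>m. \<forall>h\<in>carrier A. v \<otimes> h \<in> Ip m \<longrightarrow> h \<in> Ip n"
proof -
  obtain N where N: "\<And>y n c. y \<in> carrier A \<Longrightarrow> c \<in> carrier A \<Longrightarrow> \<pi> [^] (n::nat) \<otimes> y = c \<otimes> v \<Longrightarrow>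
    \<exists>c\<in>carrier A. \<pi> [^] (N::nat) \<otimes> y = c \<otimes> v"
    using bounded_torsion by blast
  interpret J: ideal "Ip n" A by (rule Ip_ideal)
  \<comment> \<open>The exponent allows \<open>M = n + N\<close> in \<open>Ip_split_power\<close>.
    Then \<open>\<pi> [^] (n + N) \<otimes> a\<close> is a multiple of \<open>v\<close>; the torsion
    bound \<open>N\<close> makes \<open>\<pi> [^] N \<otimes> a\<close> one already, and the
    remaining \<open>\<pi> [^] n\<close> puts the quotient into \<open>Ip n\<close>.\<close>
  have "h \<in> Ip n" if h [simp]: "h \<in> carrier A" and vh: "v \<otimes> h \<in> Ip (n + (n + N) * (p - 1))" for h
  proof -
    obtain a b where ab: "a \<in> Ip n" "b \<in> Ip n" "v \<otimes> h = \<pi> [^] (n + N) \<otimes> a \<oplus> v \<otimes> b"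
      using Ip_split_power[OF vh] by blast
    have [simp]: "a \<in> carrier A" "b \<in> carrier A" using ab by (auto intro: J.Icarr)
    have "\<pi> [^] (n + N) \<otimes> a = (\<pi> [^] (n + N) \<otimes> a \<oplus> v \<otimes> b) \<ominus> v \<otimes> b"
      by (rule ring_eqI[of _ "[\<pi> [^] (n + N),a,v,b]"], (rule reify)+, code_simp, simp add: carrier_list)
    also have "\<dots> = (h \<ominus> b) \<otimes> v" unfolding ab(3)[symmetric]
      by (rule ring_eqI[of _ "[h,v,b]"], (rule reify)+, code_simp, simp add: carrier_list)
    finally have "\<exists>c\<in>carrier A. \<pi> [^] N \<otimes> a = c \<otimes> v" by (intro N[of a "h \<ominus> b"]) auto
    then obtain c where c [simp]: "c \<in> carrier A" and cv: "\<pi> [^] N \<otimes> a = c \<otimes> v" by blast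
    define P where "P = \<pi> [^] n"
    have [simp]: "P \<in> carrier A" unfolding P_def by simp
    have "v \<otimes> h = P \<otimes> (\<pi> [^] N \<otimes> a) \<oplus> v \<otimes> b"
      unfolding ab(3) P_def by (simp add: nat_pow_mult[symmetric] m_assoc)
    also have "\<dots> = v \<otimes> (P \<otimes> c \<oplus> b)" unfolding cv by (simp add: r_distr m_ac)
    finally have vz: "v \<otimes> h = v \<otimes> (P \<otimes> c \<oplus> b)" .
    define z where "z = P \<otimes> c \<oplus> b"
    have [simp]: "z \<in> carrier A" unfolding z_def by simp
    have "v \<otimes> (h \<ominus> z) = v \<otimes> h \<ominus> v \<otimes> z"
      by (rule ring_eqI[of _ "[h,v,z]"], (rule reify)+, code_simp, simp add: carrier_list)
    also have "\<dots> = \<zero>" unfolding vz z_def[symmetric] using r_right_minus_eq[of "v \<otimes> z" "v \<otimes> z"] by simp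
    finally have "h \<ominus> z = \<zero>" by (rule v_torsion_free[rotated]) simp
    then have "h = P \<otimes> c \<oplus> b"
      using r_right_minus_eq[of h z] unfolding z_def by simp
    moreover have "P \<otimes> c \<oplus> b \<in> Ip n"
      using ab ideal_pow_pow[OF I_ideal pi_I, of n] unfolding P_def by (intro J.a_closed J.I_r_closed) auto
    ultimately show ?thesis by simp
  qed
  then show ?thesis by blast
qed

lemma complete_zero: "a \<in> carrier A \<Longrightarrow> (\<And>n. a \<in> Ip n) \<Longrightarrow> a = \<zero>"
proof -
  assume a: "a \<in> carrier A" "\<And>n. a \<in> Ip n"
  have "to_completion A I a = to_completion A I \<zero>"
    unfolding to_completion_def
    using a ideal.coset_eq_iff[OF Ip_ideal] by (auto simp: fun_eq_iff a_minus_def)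
  then show ?thesis
    using complete a(1) unfolding complete_pair_def adic_complete_def bij_betw_def
    by (auto dest: inj_onD)
qed

lemma complete_limit:
  assumes "\<And>n. b n \<in> carrier A" "\<And>n. b (Suc n) \<ominus> b n \<in> Ip n"
  shows "\<exists>a\<in>carrier A. \<forall>n. a \<ominus> b n \<in> Ip n"
proof -
  have "(\<lambda>n. Ip n +> b n) \<in> carrier (adic_completion A I)"
  proof -
    have "Ip (Suc n) +> b (Suc n) \<subseteq> Ip n +> b n" for n
    proof
      fix c assume "c \<in> Ip (Suc n) +> b (Suc n)"
      then have c': "c \<in> carrier A \<and> c \<ominus> b (Suc n) \<in> Ip (Suc n)"
        using ideal.mem_coset_iff[OF Ip_ideal assms(1), of c "Suc n" "Suc n"] by blast
      have c: "c \<in> carrier A" "c \<ominus> b (Suc n) \<in> Ip n"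
        using c' Ip_mono[OF le_SucI[OF le_refl] conjunct2[OF c']] by blast+
      have "c \<ominus> b n = (c \<ominus> b (Suc n)) \<oplus> (b (Suc n) \<ominus> b n)"
        by (rule ring_eqI[of _ "[c, b n, b (Suc n)]"], (rule reify)+, code_simp, simp add: carrier_list c assms)
      then have "c \<ominus> b n \<in> Ip n"
        using additive_subgroup.a_closed[OF ideal.axioms(1)[OF Ip_ideal] c(2) assms(2)] by simp
      then show "c \<in> Ip n +> b n" using ideal.mem_coset_iff[OF Ip_ideal assms(1)] c by blast
    qed
    then show ?thesis
      unfolding adic_completion_def using assms(1) ideal.carrier_Quot[OF Ip_ideal] by auto
  qed
  then have "(\<lambda>n. Ip n +> b n) \<in> to_completion A I ` carrier A"
    using bij_betw_imp_surj_on[OF conjunct1[OF complete[unfolded complete_pair_def adic_complete_def]]] by simp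
  then obtain a where a: "(\<lambda>n. Ip n +> b n) = to_completion A I a" "a \<in> carrier A"
    by (rule imageE)
  have "a \<ominus> b n \<in> Ip n" for n
    using fun_cong[OF a(1)[symmetric], of n]
    unfolding to_completion_def ideal.coset_eq_iff[OF Ip_ideal a(2) assms(1)] .
  then show ?thesis using a(2) by blast
qed

end

locale coord_pair = pq_pair +
  fixes x
  assumes codes: "\<exists>e :: (nat \<Rightarrow> 'a) \<Rightarrow> 'a. inj e"
    and x_in: "x \<in> carrier A" and Dx: "delta A x = \<zero>"

sublocale coord_pair \<subseteq> twisted_delta A "qel A" x p "delta A"
  by unfold_locales (use A_q x_in p A_delta Dx in auto)

context coord_pair
begin

abbreviation "B \<equiv> ts_pair p A x"
abbreviation "nulls \<equiv> ts_nulls p A"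

lemma seq_of_code [simp]: "seq_of (seq_code g) = (g :: nat \<Rightarrow> 'a)"
  unfolding seq_of_def seq_code_def by (rule inv_f_f) (rule someI_ex[OF codes])

lemma nulls_eq: "nulls = (\<Inter>n. ev_in (Ip n))"
  unfolding ts_nulls_def ev_in_def H_carrier by auto

lemma nulls_H: "g \<in> nulls \<Longrightarrow> g \<in> carrier H"
  unfolding ts_nulls_def H_carrier by auto

lemma nulls_closed:
  "g \<in> nulls \<Longrightarrow> h \<in> nulls \<Longrightarrow> ad g h \<in> nulls"
  "g \<in> nulls \<Longrightarrow> h \<in> nulls \<Longrightarrow> mlt g h \<in> nulls"
  "g \<in> nulls \<Longrightarrow> h \<in> nulls \<Longrightarrow> g \<ominus>\<^bsub>H\<^esub> h \<in> nulls"
  "a \<in> carrier A \<Longrightarrow> ts_const A a \<in> nulls"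
  "ts_coord A x \<in> nulls"
  unfolding nulls_eq
  using Ip_ideal ev_in_ad ev_in_mul ev_in_minus ev_in_const ev_in_coord by auto

lemma nulls_shift_iff: "g \<in> carrier H \<Longrightarrow> ts_shift g \<in> nulls \<longleftrightarrow> g \<in> nulls"
  unfolding nulls_eq using ev_in_shift_iff[OF Ip_ideal] by auto

lemma nulls_zero: "(\<lambda>_. \<zero>) \<in> nulls"
  using nulls_closed(4)[of \<zero>] by (simp add: ts_const_def)

lemma nulls_del: "g \<in> nulls \<Longrightarrow> del g \<in> nulls"
proof -
  assume g: "g \<in> nulls"
  have "del g \<in> ev_in (Ip n)" for n
  proof (rule ev_in_del[OF Ip_ideal Ip_ideal])
    show "Ip (Suc n) \<subseteq> Ip n" using Ip_mono[of n "Suc n"] by auto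
    show "g \<in> ev_in (Ip (Suc n))" using g unfolding nulls_eq by blast
  qed (rule delta_ideal_pow[OF A_delta I_ideal _ p], use pi_I in \<open>simp add: \<pi>_def\<close>)
  then show ?thesis unfolding nulls_eq by auto
qed

lemma B_simps:
  "carrier B = seq_code ` nulls"
  "a \<otimes>\<^bsub>B\<^esub> b = seq_code (mlt (seq_of a) (seq_of b))"
  "\<one>\<^bsub>B\<^esub> = seq_code (ts_const A \<one>)" "\<zero>\<^bsub>B\<^esub> = seq_code (\<lambda>_. \<zero>)"
  "a \<oplus>\<^bsub>B\<^esub> b = seq_code (ad (seq_of a) (seq_of b))"
  "delta B a = seq_code (del (seq_of a))"
  "qel B = seq_code (ts_const A (qel A))"
  "pd_ideal B = seq_code ` {g \<in> nulls. g 0 \<in> pd_ideal A}"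
  by (simp_all add: ts_pair_def ad_def[abs_def])

lemma seq_of_nulls: "b \<in> carrier B \<Longrightarrow> seq_of b \<in> nulls"
  by (auto simp: B_simps)

lemma seq_of_H [simp]: "b \<in> carrier B \<Longrightarrow> seq_of b \<in> carrier H"
  using seq_of_nulls nulls_H by auto

lemma seq_code_closed: "g \<in> nulls \<Longrightarrow> seq_code g \<in> carrier B"
  by (auto simp: B_simps)

lemma seq_code_of [simp]: "b \<in> carrier B \<Longrightarrow> seq_code (seq_of b) = b"
  by (auto simp: B_simps)

lemma B_eqI: "a \<in> carrier B \<Longrightarrow> b \<in> carrier B \<Longrightarrow> (\<And>k. seq_of a k = seq_of b k) \<Longrightarrow> a = b"
  by (metis ext seq_code_of)

lemma seq_hom: "ring_hom_cring B H seq_of"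
proof (rule cring_pullback[OF cring_H])
  show "inj_on seq_of (carrier B)" by (rule inj_onI) (metis seq_code_of)
  fix a assume "a \<in> carrier B"
  then have a: "seq_of a \<in> nulls" by (rule seq_of_nulls)
  have "\<ominus>\<^bsub>H\<^esub> seq_of a = \<zero>\<^bsub>H\<^esub> \<ominus>\<^bsub>H\<^esub> seq_of a"
    using nulls_H[OF a] H.l_zero[OF H.a_inv_closed] unfolding a_minus_def by simp
  also have "\<dots> \<in> nulls" using nulls_closed(3)[OF nulls_zero a] by simp
  finally show "\<exists>b\<in>carrier B. seq_of b = \<ominus>\<^bsub>H\<^esub> seq_of a"
    by (intro bexI[of _ "seq_code (\<ominus>\<^bsub>H\<^esub> seq_of a)"]) (auto intro: seq_code_closed)
qed (auto simp: B_simps nulls_closed nulls_zero nulls_H intro!: seq_code_closed[unfolded B_simps])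

sublocale sq: ring_hom_cring B H seq_of by (rule seq_hom)

declare sq.hom_one [simp del] sq.hom_zero [simp del] sq.hom_mult [simp del] sq.hom_add [simp del] sq.hom_sub [simp del]

lemma seq_mult: "a \<in> carrier B \<Longrightarrow> b \<in> carrier B \<Longrightarrow> seq_of (a \<otimes>\<^bsub>B\<^esub> b) = mlt (seq_of a) (seq_of b)"
  and seq_add: "a \<in> carrier B \<Longrightarrow> b \<in> carrier B \<Longrightarrow> seq_of (a \<oplus>\<^bsub>B\<^esub> b) = ad (seq_of a) (seq_of b)"
  and seq_minus: "a \<in> carrier B \<Longrightarrow> b \<in> carrier B \<Longrightarrow> seq_of (a \<ominus>\<^bsub>B\<^esub> b) = (\<lambda>k. seq_of a k \<ominus> seq_of b k)"
  by (simp_all add: B_simps H_minus[symmetric] sq.hom_sub)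

lemma seq_zero: "seq_of \<zero>\<^bsub>B\<^esub> = (\<lambda>_. \<zero>)" by (simp add: B_simps(4))

definition iota where "iota a = seq_code (ts_const A a)"

definition aug where "aug b = seq_of b 0"

lemma iota_hom: "ring_hom_cring A B iota"
proof (rule ring_hom_cringI, rule is_cring, rule sq.R.is_cring, rule ring_hom_memI)
  fix a b assume ab: "a \<in> carrier A" "b \<in> carrier A"
  show "iota a \<in> carrier B" unfolding iota_def by (rule seq_code_closed nulls_closed ab)+
  show "iota (a \<otimes> b) = iota a \<otimes>\<^bsub>B\<^esub> iota b" "iota (a \<oplus> b) = iota a \<oplus>\<^bsub>B\<^esub> iota b"
    using const.hom_mult[OF ab] const.hom_add[OF ab] unfolding iota_def B_simps by simp_all
qed (simp add: iota_def B_simps)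

sublocale iota: ring_hom_cring A B iota by (rule iota_hom)

lemma aug_hom: "ring_hom_cring B A aug"
  by (rule ring_hom_cringI, rule sq.R.is_cring, rule is_cring, rule ring_hom_memI)
    (auto simp: aug_def B_simps ad_def ts_const_def nulls_H)

sublocale aug: ring_hom_cring B A aug by (rule aug_hom)

declare iota.hom_sub [simp del] const.hom_sub [simp del]

lemma seq_iota [simp]: "seq_of (iota a) = ts_const A a" by (simp add: iota_def)

lemma aug_iota [simp]: "aug (iota a) = a" by (simp add: aug_def ts_const_def)

lemma seq_iota_mult: "a \<in> carrier A \<Longrightarrow> b \<in> carrier B \<Longrightarrow> seq_of (iota a \<otimes>\<^bsub>B\<^esub> b) k = a \<otimes> seq_of b k"
  by (simp add: seq_mult mul_const) (simp add: sm_def)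

lemma iota_q: "iota (qel A) = qel B" by (simp add: iota_def B_simps)

lemma B_q [simp]: "qel B \<in> carrier B" using iota.hom_closed[OF A_q(1)] unfolding iota_q .

lemma iota_qnum: "iota (qnum A n) = qnum B n"
  unfolding qnum_def
  by (subst iota.hom_finsum) (auto intro!: sq.R.finsum_cong' simp: iota_q)

lemma delta_B: "is_delta p B (delta B)"
  by (rule is_delta_pullback[where I="{()}" and S="\<lambda>_. H" and D'="\<lambda>_. del" and h="\<lambda>_. seq_of"])
    (auto simp: sq.R.is_cring cring_H is_delta_del sq.homh nulls_del seq_of_nulls intro: B_eqI,
      auto simp: B_simps intro!: nulls_del)

lemma delta_iota: "a \<in> carrier A \<Longrightarrow> delta B (iota a) = iota (delta A a)"
  by (simp add: iota_def B_simps del_const)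

lemma delta_aug: "b \<in> carrier B \<Longrightarrow> aug (delta B b) = delta A (aug b)"
  by (simp add: aug_def B_simps del_0)

lemma pd_B: "pd_ideal B = {b \<in> carrier B. aug b \<in> pd_ideal A}"
  by (auto simp: B_simps aug_def)

lemma ideal_pd_B: "ideal (pd_ideal B) B"
  unfolding pd_B by (rule ring_hom_ring.ideal_vimage[OF aug.hom_ring A_ideal])

text \<open>Evaluating a polynomial at \<open>q\<close> in \<open>B\<close> is evaluating it in
  \<open>A\<close> and taking the constant series, and a ring map preserves units.\<close>

lemma over_base_B: "over_base p B"
proof -
  have "UnivPoly.eval \<Z> B (\<lambda>k. add_pow B k \<one>\<^bsub>B\<^esub>) (qel B) f = iota (UnivPoly.eval \<Z> A (\<lambda>k. add_pow A k \<one>\<^bsub>A\<^esub>) (qel A) f)"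
    if f: "f \<in> carrier (UP \<Z>)" for f
  proof -
    have "iota (add_pow A (k::int) \<one>) = add_pow B k \<one>\<^bsub>B\<^esub>" for k
    proof (cases "k \<ge> 0")
      case True
      then show ?thesis by (simp add: add_pow_int_ge iota.hom_add_pow)
    next
      case False
      then show ?thesis by (simp add: add_pow_int_lt iota.hom_add_pow)
    qed
    then show ?thesis
      using f A_q(1) unfolding UnivPoly.eval_def
      by (simp add: Pi_iff) (auto intro!: sq.R.finsum_cong' simp: iota_q)
  qed
  moreover have "iota u \<in> Units B" if u: "u \<in> Units A" for u
  proof -
    obtain w where w: "w \<in> carrier A" "w \<otimes> u = \<one>" "u \<otimes> w = \<one>" "u \<in> carrier A"
      using Units_inv_closed[OF u] Units_l_inv[OF u] Units_r_inv[OF u] Units_closed[OF u]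
      by metis
    have 1: "iota w \<otimes>\<^bsub>B\<^esub> iota u = \<one>\<^bsub>B\<^esub>" "iota u \<otimes>\<^bsub>B\<^esub> iota w = \<one>\<^bsub>B\<^esub>"
      unfolding iota.hom_mult[OF w(1,4), symmetric] iota.hom_mult[OF w(4,1), symmetric] w(2,3)
      by (rule iota.hom_one)+
    show ?thesis unfolding Units_def mem_Collect_eq
      by (intro conjI bexI[of _ "iota w"] 1 iota.hom_closed w)
  qed
  ultimately show ?thesis
    using qPD A_q delta_iota[of "qel A"] iota.hom_closed[of "qel A"] iota.hom_zero
    unfolding qPD_pair_def delta_pair_def over_base_def iota_q[symmetric] by auto
qed

lemma torsion_free_B: "qnum_torsion_free p B"
  unfolding qnum_torsion_free_def
proof safe
  fix b assume b: "b \<in> carrier B" and 0: "qnum B p \<otimes>\<^bsub>B\<^esub> b = \<zero>\<^bsub>B\<^esub>"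
  have "v \<otimes> seq_of b k = \<zero>" for k
    using seq_iota_mult[OF v_closed b, of k] unfolding iota_qnum 0 seq_zero by simp
  then have "seq_of b k = \<zero>" for k using b by (intro v_torsion_free[rotated, OF \<open>v \<otimes> seq_of b k = \<zero>\<close>]) auto
  then show "b = \<zero>\<^bsub>B\<^esub>" by (intro B_eqI[OF b]) (auto simp: seq_zero)
qed

lemma seq_frob: "b \<in> carrier B \<Longrightarrow> seq_of (frob p B b) = frobH (seq_of b)"
proof -
  assume b: "b \<in> carrier B"
  have d: "delta B b \<in> carrier B" using is_delta_closed[OF delta_B b] .
  have "seq_of (frob p B b) = seq_of b [^]\<^bsub>H\<^esub> p \<oplus>\<^bsub>H\<^esub> add_pow H p (seq_of (delta B b))"
    unfolding frob_def using b d
    by (subst sq.hom_add) (simp_all add: sq.hom_add_pow del: H_simps)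
  then show ?thesis unfolding frobH_def by (simp add: B_simps)
qed

lemma frobH_nulls: "g \<in> nulls \<Longrightarrow> frobH g \<in> nulls"
proof -
  assume g: "g \<in> nulls"
  let ?b = "seq_code g"
  have b: "?b \<in> carrier B" using g by (rule seq_code_closed)
  have "frob p B ?b \<in> carrier B" unfolding frob_def using b is_delta_closed[OF delta_B b] by auto
  then show ?thesis using seq_of_nulls seq_frob[OF b] by fastforce
qed

text \<open>The formula \<open>\<partial>(\<phi> g) = (p)\<^sub>q y\<^sup>p\<^sup>-\<^sup>1 \<phi>(\<partial>g)\<close> shows that \<open>\<phi>(g) - \<phi>(g\<^sub>0)\<close> is divisible by \<open>(p)\<^sub>q\<close>.\<close>

lemma qPD_B: "qPD_pair p B"
  unfolding qPD_pair_def delta_pair_def delta_structure_iff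
proof (intro conjI ballI delta_B over_base_B ideal_pd_B torsion_free_B sq.R.is_cring)
  fix f assume "f \<in> pd_ideal B"
  then have f: "f \<in> carrier B" "aug f \<in> pd_ideal A" by (auto simp: pd_B)
  define g where "g = seq_of f"
  have g: "g \<in> nulls" "g \<in> carrier H" using f seq_of_nulls by (auto simp: g_def)
  have g0: "g 0 \<in> pd_ideal A" "g 0 \<in> carrier A" using f g by (auto simp: g_def aug_def)
  have sg: "ts_shift g \<in> nulls" using g nulls_shift_iff by simp
  obtain j where j: "j \<in> pd_ideal A" and jj: "frob p A (g 0) \<ominus> v \<otimes> delta A (g 0) = v \<otimes> j"
    using qPD g0 unfolding qPD_pair_def by blast
  have jA [simp]: "j \<in> carrier A" using j ideal.Icarr[OF A_ideal] by blast
  let ?Yp = "ts_coord A x [^]\<^bsub>H\<^esub> (p - 1)"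
  define w where "w = mlt ?Yp (frobH (ts_shift g))"
  have Yp: "?Yp \<in> nulls"
    by (rule H.nat_pow_in_subset) (auto simp: nulls_closed nulls_H)
  have w: "w \<in> nulls" unfolding w_def by (intro nulls_closed Yp frobH_nulls sg)
  have uu: "uu = ts_const A v \<otimes>\<^bsub>H\<^esub> ?Yp"
  proof -
    have "ts_const A v = (\<Oplus>\<^bsub>H\<^esub>i\<in>{..<p}. ts_const A (qel A) [^]\<^bsub>H\<^esub> i)"
      unfolding qnum_def by (subst const.hom_finsum) (auto intro!: H.finsum_cong' simp: A_q simp del: H_simps)
    then show ?thesis unfolding uu_def qtwist_def by simp
  qed
  have shift: "ts_shift (frobH g) = sm v w"
    unfolding shift_frobH[OF g(2)] uu w_def
    using nulls_H[OF Yp] nulls_H[OF frobH_nulls[OF sg]] by (simp add: mul_assoc mul_const mul_sm_left)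
  \<comment> \<open>The constant coefficient is the element given by the q-PD condition of
    \<open>A\<close>, and it alone decides membership in the ideal. The other coefficients come from
    the divisibility of the shift by \<open>v\<close>.\<close>
  define l where "l = (\<lambda>k. case k of 0 \<Rightarrow> j | Suc i \<Rightarrow> w i \<ominus> del g (Suc i))"
  have wH: "w i \<in> carrier A" and dH: "del g i \<in> carrier A" for i
    using nulls_H[OF w] g by auto
  have l: "l \<in> nulls"
  proof -
    have 1: "l \<in> carrier H" by (rule H_I) (auto simp: l_def wH dH split: nat.split)
    have "ts_shift l = w \<ominus>\<^bsub>H\<^esub> ts_shift (del g)"
      using nulls_H[OF w] g by (simp add: H_minus) (simp add: l_def ts_shift_def fun_eq_iff)
    also have "\<dots> \<in> nulls"
      using nulls_del[OF g(1)] by (intro nulls_closed w) (simp add: nulls_shift_iff g)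
    finally show ?thesis using nulls_shift_iff[OF 1] by simp
  qed
  have B1: "frob p B f \<in> carrier B" "delta B f \<in> carrier B" "qnum B p \<in> carrier B" "seq_code l \<in> carrier B"
    unfolding frob_def using f is_delta_closed[OF delta_B f(1)] iota.hom_closed[OF v_closed] seq_code_closed[OF l]
    by (auto simp: iota_qnum)
  have "frob p B f \<ominus>\<^bsub>B\<^esub> qnum B p \<otimes>\<^bsub>B\<^esub> delta B f = qnum B p \<otimes>\<^bsub>B\<^esub> seq_code l"
  proof (rule B_eqI)
    fix k
    have "frobH g k \<ominus> v \<otimes> del g k = v \<otimes> l k"
    proof (cases k)
      case 0
      have "frobH g 0 = frob p A (g 0)"
        unfolding frobH_def frob_def using g head.hom_pow[OF g(2), of p] head.hom_add_pow[of "del g" p]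
        by (simp add: ad_def del_0)
      then show ?thesis using jj 0 by (simp add: l_def del_0)
    next
      case (Suc i)
      have "frobH g k = v \<otimes> w i" using shift Suc by (simp add: ts_shift_def sm_def fun_eq_iff)
      then show ?thesis using Suc wH[of i] dH[of k] by (simp add: l_def a_minus_def r_distr r_minus)
    qed
    then show "seq_of (frob p B f \<ominus>\<^bsub>B\<^esub> qnum B p \<otimes>\<^bsub>B\<^esub> delta B f) k = seq_of (qnum B p \<otimes>\<^bsub>B\<^esub> seq_code l) k"
      using B1 f(1) unfolding iota_qnum[symmetric]
      by (simp add: seq_minus seq_iota_mult seq_frob g_def[symmetric]) (simp add: B_simps g_def)
  qed (use B1 in auto)
  moreover have "seq_code l \<in> pd_ideal B"
    using l j by (auto simp: B_simps l_def)
  ultimately show "\<exists>j\<in>pd_ideal B. frob p B f \<ominus>\<^bsub>B\<^esub> qnum B p \<otimes>\<^bsub>B\<^esub> delta B f = qnum B p \<otimes>\<^bsub>B\<^esub> j"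
    by blast
qed

section \<open>Adic topology, boundedness and completeness of the ring of null sequences\<close>

abbreviation "IB \<equiv> pq_ideal p B"

lemma IB_eq: "IB = genideal B {iota \<pi>, iota (qel A \<ominus> \<one>)}"
proof -
  have "iota (qel A \<ominus> \<one>) = qel B \<ominus>\<^bsub>B\<^esub> \<one>\<^bsub>B\<^esub>"
    using iota.hom_sub[OF A_q(1) one_closed] by (simp add: iota_q)
  then show ?thesis unfolding pq_ideal_def \<pi>_def by (simp add: iota.hom_add_pow)
qed

lemma IB_ideal: "ideal IB B"
  unfolding IB_eq by (rule sq.R.genideal_ideal) (use A_q in auto)

lemma coefs_ideal_B: "ideal {b \<in> carrier B. seq_of b \<in> coefs_in (Ip n)} B"
  by (rule ring_hom_ring.ideal_vimage[OF sq.hom_ring ideal_coefs_in[OF Ip_ideal]])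

lemma IB_coefs: "b \<in> IB \<Longrightarrow> seq_of b \<in> coefs_in I"
proof -
  have "IB \<subseteq> {b \<in> carrier B. seq_of b \<in> coefs_in (Ip 1)}"
    unfolding IB_eq
  proof (rule sq.R.genideal_minimal[OF coefs_ideal_B])
    have "a \<in> I \<Longrightarrow> ts_const A a k \<in> I" for a k
      using additive_subgroup.zero_closed[OF ideal.axioms(1)[OF I_ideal]] by (simp add: ts_const_def)
    then show "{iota \<pi>, iota (qel A \<ominus> \<one>)} \<subseteq> {b \<in> carrier B. seq_of b \<in> coefs_in (Ip 1)}"
      using pi_I t_I A_q by (auto simp: ideal_pow_1[OF I_ideal] coefs_in_def ideal_prod_one[OF I_ideal])
  qed
  then show "b \<in> IB \<Longrightarrow> seq_of b \<in> coefs_in I" by (auto simp: ideal_prod_one[OF I_ideal])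
qed

lemma ideal_pow_B_coefs: "b \<in> ideal_pow B IB n \<Longrightarrow> seq_of b \<in> coefs_in (Ip n)"
proof (induction n arbitrary: b)
  case 0
  then show ?case by (simp add: coefs_in_def)
next
  case (Suc n)
  then have "b \<in> ideal_prod B IB (ideal_pow B IB n)" by simp
  then have "b \<in> carrier B \<and> seq_of b \<in> coefs_in (Ip (Suc n))"
  proof (induction b rule: ideal_prod.induct)
    case (prod i j)
    have ij: "i \<in> carrier B" "j \<in> carrier B"
      using prod ideal.Icarr[OF IB_ideal] ideal.Icarr[OF sq.R.ideal_ideal_pow[OF IB_ideal]] by auto
    have "mlt (seq_of i) (seq_of j) \<in> coefs_in (Ip (Suc n))"
      by (rule coefs_in_mul[OF I_ideal Ip_ideal Ip_ideal _ IB_coefs[OF prod(1)] Suc.IH[OF prod(2)]])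
        (auto intro: ideal_prod.prod)
    then show ?case using ij by (simp add: seq_mult)
  next
    case (sum b c)
    then show ?case
      using additive_subgroup.a_closed[OF ideal.axioms(1)[OF ideal_coefs_in[OF Ip_ideal]], of "seq_of b" "Suc n" "seq_of c"]
      by (simp add: seq_add)
  qed
  then show ?case by simp
qed

text \<open>Each coefficient is a combination of the two generators, but the quotients must again
  form null sequences. They are therefore taken in a power \<open>m k\<close> of the ideal that is
  as high as the coefficient allows.\<close>

lemma coefs_ideal_pow_B: "g \<in> nulls \<Longrightarrow> g \<in> coefs_in (Ip n) \<Longrightarrow> seq_code g \<in> ideal_pow B IB n"
proof (induction n arbitrary: g)
  case 0
  then show ?case by (simp add: seq_code_closed)
next
  case (Suc n)
  \<comment> \<open>The bound \<open>n + k\<close> makes the maximum exist even if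
    \<open>g k\<close> lies in all powers, and it tends to infinity with \<open>k\<close>.\<close>
  define m where "m k = Max {m. m \<le> n + k \<and> g k \<in> Ip (Suc m)}" for k
  have fin: "finite {m. m \<le> n + k \<and> g k \<in> Ip (Suc m)}" for k by (rule finite_subset[of _ "{..n+k}"]) auto
  have n_in: "n \<in> {m. m \<le> n + k \<and> g k \<in> Ip (Suc m)}" for k
    using Suc.prems(2) by (auto simp: coefs_in_def)
  have gm: "g k \<in> Ip (Suc (m k))" for k
    using Max_in[OF fin, of k] n_in[of k] unfolding m_def by blast
  have mn: "n \<le> m k" for k using Max_ge[OF fin n_in] unfolding m_def .
  have mM: "\<exists>K. \<forall>k\<ge>K. M \<le> m k" for M
  proof -
    obtain K where "\<forall>k\<ge>K. g k \<in> Ip (Suc M)" using Suc.prems(1) unfolding ts_nulls_def by blast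
    then have "\<forall>k\<ge>max K M. M \<le> m k" unfolding m_def by (intro allI impI Max_ge[OF fin]) auto
    then show ?thesis by blast
  qed
  have "\<forall>k. \<exists>r s. r \<in> Ip (m k) \<and> s \<in> Ip (m k) \<and> g k = \<pi> \<otimes> r \<oplus> (qel A \<ominus> \<one>) \<otimes> s"
    using Ip_Suc[OF gm] by blast
  then obtain r s where rs: "\<And>k. r k \<in> Ip (m k)" "\<And>k. s k \<in> Ip (m k)"
    "\<And>k. g k = \<pi> \<otimes> r k \<oplus> (qel A \<ominus> \<one>) \<otimes> s k" by metis
  have nul: "r \<in> nulls \<and> r \<in> coefs_in (Ip n)" if "\<And>k. r k \<in> Ip (m k)" for r
    using that mn mM Ip_mono Ip_carrier unfolding ts_nulls_def coefs_in_def by (simp, metis)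
  let ?r = "seq_code r" and ?s = "seq_code s"
  have IH: "?r \<in> ideal_pow B IB n" "?s \<in> ideal_pow B IB n"
    using Suc.IH nul rs by auto
  have c: "?r \<in> carrier B" "?s \<in> carrier B" "iota \<pi> \<in> carrier B" "iota (qel A \<ominus> \<one>) \<in> carrier B"
    using nul rs seq_code_closed A_q by auto
  have "seq_code g = iota \<pi> \<otimes>\<^bsub>B\<^esub> ?r \<oplus>\<^bsub>B\<^esub> iota (qel A \<ominus> \<one>) \<otimes>\<^bsub>B\<^esub> ?s"
  proof (rule B_eqI)
    fix k
    show "seq_of (seq_code g) k = seq_of (iota \<pi> \<otimes>\<^bsub>B\<^esub> ?r \<oplus>\<^bsub>B\<^esub> iota (qel A \<ominus> \<one>) \<otimes>\<^bsub>B\<^esub> ?s) k"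
      using c A_q rs(3)[of k] by (simp add: seq_add ad_def seq_iota_mult)
  qed (use c Suc.prems seq_code_closed in auto)
  moreover have "iota \<pi> \<in> IB" "iota (qel A \<ominus> \<one>) \<in> IB"
    unfolding IB_eq using sq.R.genideal_self[of "{iota \<pi>, iota (qel A \<ominus> \<one>)}"] c by auto
  ultimately show ?case using IH by (auto intro: ideal_prod.intros)
qed

lemma ideal_pow_B: "b \<in> ideal_pow B IB n \<longleftrightarrow> b \<in> carrier B \<and> (\<forall>k. seq_of b k \<in> Ip n)"
  using ideal_pow_B_coefs[of b n] coefs_ideal_pow_B[of "seq_of b" n] seq_of_nulls[of b]
    ideal.Icarr[OF sq.R.ideal_ideal_pow[OF IB_ideal]]
  by (auto simp: coefs_in_def)

lemma bounded_B: "bounded_pair p B"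
proof -
  obtain N where N: "\<And>y n c. y \<in> carrier A \<Longrightarrow> c \<in> carrier A \<Longrightarrow> \<pi> [^] (n::nat) \<otimes> y = c \<otimes> v \<Longrightarrow>
    \<exists>c\<in>carrier A. \<pi> [^] (N::nat) \<otimes> y = c \<otimes> v"
    using bounded_torsion by blast
  have vB: "qnum B p \<in> carrier B" using iota.hom_closed[OF v_closed] by (simp add: iota_qnum)
  have pw: "seq_of (add_pow B (p ^ n) y) k = \<pi> [^] n \<otimes> seq_of y k" if "y \<in> carrier B" for y n k
    using that by (simp add: sq.hom_add_pow H_add_pow add_pow_pi_pow)
  have mv: "seq_of (c \<otimes>\<^bsub>B\<^esub> qnum B p) k = seq_of c k \<otimes> v" if "c \<in> carrier B" for c k
    using that vB seq_iota_mult[OF v_closed that] by (simp add: sq.R.m_comm[of c] iota_qnum m_comm[of v])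
  have "\<exists>c\<in>carrier B. add_pow B (p ^ N) y = c \<otimes>\<^bsub>B\<^esub> qnum B p"
    if y: "y \<in> carrier B" and c: "c \<in> carrier B" "add_pow B (p ^ n) y = c \<otimes>\<^bsub>B\<^esub> qnum B p" for y n c
  proof -
    have "\<pi> [^] n \<otimes> seq_of y k = seq_of c k \<otimes> v" for k
      using pw[OF y] mv[OF c(1)] c(2) by metis
    then have "\<forall>k. \<exists>c\<in>carrier A. \<pi> [^] N \<otimes> seq_of y k = c \<otimes> v"
      using y c by (intro allI N[of _ _ n]) auto
    then obtain d where d: "\<And>k. d k \<in> carrier A" "\<And>k. \<pi> [^] N \<otimes> seq_of y k = d k \<otimes> v" by metis
    \<comment> \<open>The quotients exist coefficient by coefficient; that they converge to zero is
      the continuity of the division by \<open>v\<close>.\<close>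
    have "\<exists>K. \<forall>k\<ge>K. d k \<in> Ip m" for m
    proof -
      obtain m' where m': "\<And>h. h \<in> carrier A \<Longrightarrow> v \<otimes> h \<in> Ip m' \<Longrightarrow> h \<in> Ip m"
        using v_division by blast
      obtain K where K: "\<And>k. k \<ge> K \<Longrightarrow> seq_of y k \<in> Ip m'"
        using seq_of_nulls[OF y] unfolding ts_nulls_def by blast
      have "d k \<in> Ip m" if "k \<ge> K" for k
      proof (rule m'[OF d(1)])
        have "\<pi> [^] N \<otimes> seq_of y k \<in> Ip m'" using ideal.I_l_closed[OF Ip_ideal K[OF that]] by simp
        then show "v \<otimes> d k \<in> Ip m'" using d by (simp add: m_comm)
      qed
      then show ?thesis by blast
    qed
    then have dn: "d \<in> nulls" using d unfolding ts_nulls_def by auto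
    have "add_pow B (p ^ N) y = seq_code d \<otimes>\<^bsub>B\<^esub> qnum B p"
      by (rule B_eqI) (use y vB seq_code_closed[OF dn] d in \<open>auto simp: pw mv simp del: sq.hom_add_pow\<close>)
    then show ?thesis using seq_code_closed[OF dn] by blast
  qed
  then show ?thesis
    unfolding bounded_pair_def sq.R.bounded_pair_quot[OF vB] using torsion_free_B by blast
qed

lemma complete_B: "complete_pair p B"
  unfolding complete_pair_def
proof
  have Bp: "ideal (ideal_pow B IB n) B" for n by (rule sq.R.ideal_ideal_pow[OF IB_ideal])
  show "adic_complete B IB"
    unfolding adic_complete_def bij_betw_def
  proof
    show "inj_on (to_completion B IB) (carrier B)"
    proof (rule inj_onI)
      fix b c assume bc: "b \<in> carrier B" "c \<in> carrier B" "to_completion B IB b = to_completion B IB c"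
      have "b \<ominus>\<^bsub>B\<^esub> c \<in> ideal_pow B IB n" for n
        using fun_cong[OF bc(3), of n] unfolding to_completion_def ideal.coset_eq_iff[OF Bp bc(1,2)] .
      then have "seq_of b k \<ominus> seq_of c k \<in> Ip n" for n k
        using bc(1,2) unfolding ideal_pow_B by (auto simp: seq_minus)
      then have "seq_of b k \<ominus> seq_of c k = \<zero>" for k
        using bc(1,2) complete_zero[of "seq_of b k \<ominus> seq_of c k"] by simp
      then show "b = c" using bc(1,2) by (intro B_eqI[OF bc(1,2)]) (simp add: r_right_minus_eq)
    qed
    show "to_completion B IB ` carrier B = carrier (adic_completion B IB)"
    proof
      show "to_completion B IB ` carrier B \<subseteq> carrier (adic_completion B IB)"
      proof
        fix s assume "s \<in> to_completion B IB ` carrier B"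
        then obtain b where b: "b \<in> carrier B" and s: "s = to_completion B IB b" by (rule imageE)
        have "ideal_pow B IB (Suc n) +>\<^bsub>B\<^esub> b \<subseteq> ideal_pow B IB n +>\<^bsub>B\<^esub> b" for n
          using sq.R.ideal_pow_Suc_subset[OF IB_ideal, of n]
          unfolding subset_iff ideal.mem_coset_iff[OF Bp b] by blast
        moreover have "ideal_pow B IB n +>\<^bsub>B\<^esub> b \<in> carrier (B Quot ideal_pow B IB n)" for n
          unfolding ideal.carrier_Quot[OF Bp] using b by (rule imageI)
        ultimately show "s \<in> carrier (adic_completion B IB)"
          unfolding s adic_completion_def to_completion_def partial_object.simps mem_Collect_eq by blast
      qed
      show "carrier (adic_completion B IB) \<subseteq> to_completion B IB ` carrier B"
      proof
        fix s assume "s \<in> carrier (adic_completion B IB)"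
        then have s: "\<And>n. s n \<in> carrier (B Quot ideal_pow B IB n)" "\<And>n. s (Suc n) \<subseteq> s n"
          unfolding adic_completion_def by auto
        then have "\<forall>n. \<exists>b\<in>carrier B. s n = ideal_pow B IB n +>\<^bsub>B\<^esub> b"
          using ideal.carrier_Quot[OF Bp] by (metis imageE)
        then obtain b where b: "\<And>n. b n \<in> carrier B" "\<And>n. s n = ideal_pow B IB n +>\<^bsub>B\<^esub> b n" by metis
        have "b (Suc n) \<in> s (Suc n)" for n
          unfolding b(2) using b(1) abelian_subgroup.a_rcos_self[OF _ b(1)]
          by (metis Bp abelian_subgroupI3 ideal.axioms(1) ideal.axioms(2) ring_def sq.R.abelian_group_axioms)
        then have "b (Suc n) \<in> s n" for n using s(2) by blast
        then have diff: "b (Suc n) \<ominus>\<^bsub>B\<^esub> b n \<in> ideal_pow B IB n" for n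
          unfolding b(2) using ideal.mem_coset_iff[OF Bp b(1)] by blast
        have "\<exists>a\<in>carrier A. \<forall>n. a \<ominus> seq_of (b n) k \<in> Ip n" for k
          by (rule complete_limit) (use diff b(1) in \<open>auto simp: ideal_pow_B seq_minus\<close>)
        then obtain a where a: "\<And>k. a k \<in> carrier A" "\<And>k n. a k \<ominus> seq_of (b n) k \<in> Ip n" by metis
        \<comment> \<open>The coefficientwise limit differs from the null sequence
          \<open>b n\<close> by elements of \<open>Ip n\<close> at all indices simultaneously, hence
          is itself eventually in \<open>Ip n\<close>.\<close>
        have "\<exists>K. \<forall>k\<ge>K. a k \<in> Ip n" for n
        proof -
          obtain K where K: "\<And>k. k \<ge> K \<Longrightarrow> seq_of (b n) k \<in> Ip n"
            using seq_of_nulls[OF b(1)] unfolding ts_nulls_def by blast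
          have "a k \<in> Ip n" if "k \<ge> K" for k
          proof -
            have "a k = (a k \<ominus> seq_of (b n) k) \<oplus> seq_of (b n) k"
              using a(1) b(1) by (simp add: a_minus_def a_assoc l_neg)
            then show ?thesis
              using additive_subgroup.a_closed[OF ideal.axioms(1)[OF Ip_ideal] a(2) K[OF that]] by metis
          qed
          then show ?thesis by blast
        qed
        then have an: "a \<in> nulls" using a unfolding ts_nulls_def by auto
        have "to_completion B IB (seq_code a) = s"
        proof
          fix n
          have "seq_code a \<ominus>\<^bsub>B\<^esub> b n \<in> ideal_pow B IB n"
            unfolding ideal_pow_B using a b seq_code_closed[OF an] by (simp add: seq_minus)
          then show "to_completion B IB (seq_code a) n = s n"
            unfolding to_completion_def b(2) ideal.coset_eq_iff[OF Bp seq_code_closed[OF an] b(1)] .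
        qed
        then show "s \<in> to_completion B IB ` carrier B" using seq_code_closed[OF an] by blast
      qed
    qed
  qed
  show "adic_closed B IB (pd_ideal B)"
    unfolding adic_closed_def
  proof safe
    fix b assume b: "b \<in> carrier B" and *: "\<forall>n. \<exists>j\<in>pd_ideal B. b \<ominus>\<^bsub>B\<^esub> j \<in> ideal_pow B IB n"
    have "\<exists>j\<in>pd_ideal A. aug b \<ominus> j \<in> Ip n" for n
    proof -
      obtain j where "j \<in> pd_ideal B" "b \<ominus>\<^bsub>B\<^esub> j \<in> ideal_pow B IB n" using * by blast
      then show ?thesis using b by (intro bexI[of _ "aug j"]) (auto simp: pd_B ideal_pow_B seq_minus aug_def)
    qed
    moreover have "aug b \<in> carrier A" using b by simp
    ultimately have "aug b \<in> pd_ideal A"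
      using complete unfolding complete_pair_def adic_closed_def by blast
    then show "b \<in> pd_ideal B" using b by (simp add: pd_B)
  qed
qed

lemma pq_pair_B: "pq_pair p B"
  using p qPD_B bounded_B complete_B by unfold_locales

end

section \<open>Taylor maps\<close>

text \<open>What a derivation must satisfy for its Taylor series to give a map of \<delta>-rings
  into null sequences; \<open>d_delta\<close> is the recursion \<open>L\<close> for
  \<open>del\<close>. The conditions hold for an etale coordinate and again for the shift on null
  sequences, so the construction can be iterated.\<close>

locale qderiv_pair = coord_pair +
  fixes d :: "'a \<Rightarrow> 'a"
  assumes d_closed [simp]: "a \<in> carrier A \<Longrightarrow> d a \<in> carrier A"
    and d_add: "a \<in> carrier A \<Longrightarrow> b \<in> carrier A \<Longrightarrow> d (a \<oplus> b) = d a \<oplus> d b"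
    and d_mult: "a \<in> carrier A \<Longrightarrow> b \<in> carrier A \<Longrightarrow>
      d (a \<otimes> b) = d a \<otimes> b \<oplus> (a \<oplus> (qel A \<ominus> \<one>) \<otimes> x \<otimes> d a) \<otimes> d b"
    and d_q: "a \<in> carrier A \<Longrightarrow> d (qel A \<otimes> a) = qel A \<otimes> d a"
    and d_x: "d x = \<one>" and d_one: "d \<one> = \<zero>"
    and d_delta: "a \<in> carrier A \<Longrightarrow> d (delta A a) =
      (qtwist p A (qel A) x \<otimes> delta A (d a) \<oplus>
       frob_defect_div p A ((qel A \<ominus> \<one>) \<otimes> x) x \<one> \<otimes> d a [^] p) \<ominus>
      frob_defect_div p A ((qel A \<ominus> \<one>) \<otimes> x) a (d a)"
    and d_null: "a \<in> carrier A \<Longrightarrow> \<exists>K. \<forall>k\<ge>K. (d ^^ k) a \<in> ideal_pow A (pq_ideal p A) n"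
begin

definition sig where "sig a = a \<oplus> (qel A \<ominus> \<one>) \<otimes> x \<otimes> d a"

definition tay where "tay a k = (d ^^ k) a"

lemma sig_closed [simp]: "a \<in> carrier A \<Longrightarrow> sig a \<in> carrier A"
  unfolding sig_def by simp

lemma d_pow_closed [simp]: "a \<in> carrier A \<Longrightarrow> (d ^^ k) a \<in> carrier A"
  by (induction k) auto

lemma d_pow_add: "a \<in> carrier A \<Longrightarrow> b \<in> carrier A \<Longrightarrow> (d ^^ k) (a \<oplus> b) = (d ^^ k) a \<oplus> (d ^^ k) b"
  by (induction k) (auto simp: d_add)

lemma d_zero: "d \<zero> = \<zero>"
  using d_add[of \<zero> \<zero>] by (simp add: add.l_cancel_one)

lemma d_pow_zero: "(d ^^ k) \<zero> = \<zero>" by (induction k) (auto simp: d_zero)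

lemma d_t: "a \<in> carrier A \<Longrightarrow> d (t \<otimes> a) = t \<otimes> d a"
proof -
  assume [simp]: "a \<in> carrier A"
  have neg: "d (\<ominus> a) = \<ominus> d a"
  proof -
    have "d (\<ominus> a) \<oplus> d a = \<zero>" using d_add[of "\<ominus> a" a] by (simp add: l_neg d_zero)
    then show ?thesis by (intro minus_equality[symmetric]) auto
  qed
  have "t \<otimes> a = qel A \<otimes> a \<oplus> \<ominus> a"
    by (rule ring_eqI[of _ "[qel A,a]"], (rule reify)+, code_simp, simp add: carrier_list)
  then have "d (t \<otimes> a) = qel A \<otimes> d a \<oplus> \<ominus> d a" by (simp add: d_add d_q neg)
  also have "\<dots> = t \<otimes> d a"
    by (rule ring_eqI[of _ "[qel A,d a]"], (rule reify)+, code_simp, simp add: carrier_list)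
  finally show ?thesis .
qed

text \<open>The commutation \<open>\<partial> \<sigma> = q \<sigma> \<partial>\<close>, which is
  responsible for the factor \<open>q^k\<close> in \<open>ts_sigma\<close>.\<close>

lemma d_sig: "a \<in> carrier A \<Longrightarrow> d (sig a) = qel A \<otimes> sig (d a)"
proof -
  assume [simp]: "a \<in> carrier A"
  have xA [simp]: "x \<in> carrier A" by (rule x)
  have "d (sig a) = d a \<oplus> d (t \<otimes> (x \<otimes> d a))" unfolding sig_def by (simp add: d_add m_assoc)
  also have "d (t \<otimes> (x \<otimes> d a)) = t \<otimes> (\<one> \<otimes> d a \<oplus> (x \<oplus> t \<otimes> x \<otimes> \<one>) \<otimes> d (d a))"
    by (subst d_t) (simp_all add: d_mult d_x)
  also have "d a \<oplus> t \<otimes> (\<one> \<otimes> d a \<oplus> (x \<oplus> t \<otimes> x \<otimes> \<one>) \<otimes> d (d a)) = qel A \<otimes> (d a \<oplus> t \<otimes> x \<otimes> d (d a))"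
    by (rule ring_eqI[of _ "[qel A,x,d a,d (d a)]"], (rule reify)+, code_simp, simp add: carrier_list)
  finally show ?thesis unfolding sig_def .
qed

lemma d_qpow: "a \<in> carrier A \<Longrightarrow> d (qel A [^] (n::nat) \<otimes> a) = qel A [^] n \<otimes> d a"
proof (induction n arbitrary: a)
  case (Suc n)
  have "d (qel A [^] Suc n \<otimes> a) = d (qel A [^] n \<otimes> (qel A \<otimes> a))" using Suc.prems by (simp add: m_assoc)
  then show ?case using Suc by (simp add: d_q m_assoc)
qed simp

lemma d_pow_sig: "a \<in> carrier A \<Longrightarrow> (d ^^ k) (sig a) = qel A [^] k \<otimes> sig ((d ^^ k) a)"
proof (induction k)
  case (Suc k)
  have "(d ^^ Suc k) (sig a) = d (qel A [^] k \<otimes> sig ((d ^^ k) a))" using Suc by simp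
  also have "\<dots> = qel A [^] k \<otimes> (qel A \<otimes> sig (d ((d ^^ k) a)))" using Suc.prems by (simp add: d_qpow d_sig)
  finally show ?case using Suc.prems by (simp add: m_assoc)
qed simp

lemma tay_H [simp]: "a \<in> carrier A \<Longrightarrow> tay a \<in> carrier H"
  by (rule H_I) (simp add: tay_def)

lemma shift_tay: "ts_shift (tay a) = tay (d a)"
  by (rule ext) (simp add: ts_shift_def tay_def funpow_swap1)

lemma tay_Suc: "tay a (Suc k) = tay (d a) k"
  by (simp add: tay_def funpow_swap1)

lemma S_tay: "a \<in> carrier A \<Longrightarrow> S (tay a) = tay (sig a)"
  by (rule ext) (simp add: ts_sigma_def tay_def d_pow_sig, simp add: sig_def)

text \<open>Taylor series turn \<open>d\<close> into the shift and \<open>sig\<close> into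
  \<open>ts_sigma\<close>, so the Leibniz rule in \<open>A\<close> becomes the recursion that
  defines the product of series.\<close>

lemma tay_hom: "ring_hom_cring A H tay"
proof (rule ring_hom_cringI, rule is_cring, rule cring_H, rule ring_hom_memI)
  fix a b assume ab: "a \<in> carrier A" "b \<in> carrier A"
  show "tay (a \<oplus> b) = tay a \<oplus>\<^bsub>H\<^esub> tay b"
    using ab by (simp add: ad_def tay_def fun_eq_iff d_pow_add)
  have "tay (a \<otimes> b) k = mlt (tay a) (tay b) k" for k
    using ab
  proof (induction k arbitrary: a b)
    case 0
    then show ?case by (simp add: tay_def)
  next
    case (Suc k)
    have "tay (a \<otimes> b) (Suc k) = tay (d a \<otimes> b \<oplus> sig a \<otimes> d b) k"
      using Suc.prems by (simp only: tay_Suc d_mult sig_def)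
    also have "\<dots> = tay (d a \<otimes> b) k \<oplus> tay (sig a \<otimes> d b) k"
      using Suc.prems by (simp add: tay_def d_pow_add)
    also have "\<dots> = mlt (tay a) (tay b) (Suc k)"
      using Suc by (simp add: shift_tay S_tay)
    finally show ?case .
  qed
  then show "tay (a \<otimes> b) = tay a \<otimes>\<^bsub>H\<^esub> tay b" by auto
next
  have "(d ^^ Suc k) \<one> = \<zero>" for k by (simp only: funpow_Suc_right o_apply d_one d_pow_zero)
  then have "tay \<one> k = ts_const A \<one> k" for k by (cases k) (auto simp: tay_def ts_const_def)
  then show "tay \<one> = \<one>\<^bsub>H\<^esub>" by auto
qed simp

lemma tay_q: "tay (qel A) = ts_const A (qel A)"
proof
  fix k
  have "d (qel A) = \<zero>" using d_q[of \<one>] by (simp add: d_one)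
  then have "(d ^^ Suc k) (qel A) = \<zero>" for k by (simp only: funpow_Suc_right o_apply d_pow_zero)
  then show "tay (qel A) k = ts_const A (qel A) k" by (cases k) (auto simp: tay_def ts_const_def)
qed

lemma tay_x: "tay x = ts_coord A x"
proof
  fix k
  have "(d ^^ Suc (Suc k)) x = \<zero>" for k by (simp only: funpow_Suc_right o_apply d_x d_one d_pow_zero)
  moreover have "(d ^^ Suc 0) x = \<one>" by (simp add: d_x)
  ultimately show "tay x k = ts_coord A x k"
    by (cases k; cases "k - 1") (auto simp: tay_def ts_coord_def simp del: funpow.simps(2))
qed

text \<open>By \<open>d_delta\<close>, both sides have the same constant coefficient and satisfy the
  same recursion.\<close>

lemma del_tay: "a \<in> carrier A \<Longrightarrow> del (tay a) = tay (delta A a)"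
proof
  fix k assume "a \<in> carrier A"
  interpret ta: ring_hom_cring A H tay by (rule tay_hom)
  have xA [simp]: "x \<in> carrier A" by (rule x)
  define e where "e = t \<otimes> x"
  have [simp]: "e \<in> carrier A" unfolding e_def by simp
  have te: "tay e = eta"
    unfolding e_def eta_def by (subst ta.hom_mult, simp, simp, subst ta.hom_sub) (simp_all add: tay_q tay_x del: H_simps)
  have L: "L (tay b) (tay a) = tay ((qtwist p A (qel A) x \<otimes> b \<oplus>
       frob_defect_div p A e x \<one> \<otimes> d a [^] p) \<ominus> frob_defect_div p A e a (d a))"
    if [simp]: "a \<in> carrier A" "b \<in> carrier A" for a b
  proof -
    have 1: "qtwist p A (qel A) x \<in> carrier A" unfolding qtwist_def by simp
    have "tay (qtwist p A (qel A) x) = uu" unfolding uu_def by (simp add: ta.hom_qtwist tay_q tay_x)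
    moreover have "tay (frob_defect_div p A e x \<one>) = cc"
      unfolding cc_def by (simp add: ta.hom_frob_defect_div te tay_x del: ta.hom_one) (simp add: ta.hom_one)
    ultimately show ?thesis unfolding L_def shift_tay
      using 1 by (simp add: ta.hom_sub ta.hom_frob_defect_div te del: H_simps)
  qed
  have "\<forall>j\<le>k. del (tay a) j = tay (delta A a) j" if "a \<in> carrier A" for a
    using that
  proof (induction k arbitrary: a)
    case 0
    then show ?case by (simp add: del_0 tay_def)
  next
    case (Suc k)
    note [simp] = Suc.prems
    have "del (tay a) (Suc k) = L (del (tay (d a))) (tay a) k"
      using shift_del[of "tay a"] by (simp add: shift_tay) (simp add: ts_shift_def fun_eq_iff)
    also have "\<dots> = L (tay (delta A (d a))) (tay a) k"
      by (rule L_cong[where k=k]) (use Suc.IH[of "d a"] in auto)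
    also have "\<dots> = tay (d (delta A a)) k"
      by (simp add: L d_delta e_def)
    also have "\<dots> = tay (delta A a) (Suc k)"
      by (simp add: tay_def funpow_swap1)
    finally show ?case using Suc.IH[of a] by (auto simp: le_Suc_eq)
  qed
  then show "del (tay a) k = tay (delta A a) k" using \<open>a \<in> carrier A\<close> by auto
qed

lemma tay_nulls: "a \<in> carrier A \<Longrightarrow> tay a \<in> nulls"
  unfolding ts_nulls_def tay_def using d_null by auto

definition f1 where "f1 a = seq_code (tay a)"

lemma f1_hom: "ring_hom_cring A B f1"
proof (rule ring_hom_cringI, rule is_cring, rule sq.R.is_cring, rule ring_hom_memI)
  interpret ta: ring_hom_cring A H tay by (rule tay_hom)
  fix a b assume ab: "a \<in> carrier A" "b \<in> carrier A"
  show "f1 a \<in> carrier B" unfolding f1_def using ab by (intro seq_code_closed tay_nulls)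
  show "f1 (a \<otimes> b) = f1 a \<otimes>\<^bsub>B\<^esub> f1 b" "f1 (a \<oplus> b) = f1 a \<oplus>\<^bsub>B\<^esub> f1 b"
    using ta.hom_mult[OF ab] ta.hom_add[OF ab] unfolding f1_def B_simps by simp_all
next
  interpret ta: ring_hom_cring A H tay by (rule tay_hom)
  show "f1 \<one> = \<one>\<^bsub>B\<^esub>" using ta.hom_one unfolding f1_def B_simps by simp
qed

lemma delta_f1: "a \<in> carrier A \<Longrightarrow> delta B (f1 a) = f1 (delta A a)"
  by (simp add: f1_def B_simps del_tay)

lemma f1_q: "f1 (qel A) = qel B" by (simp add: f1_def B_simps tay_q)

lemma seq_f1 [simp]: "seq_of (f1 a) = tay a" by (simp add: f1_def)

lemma aug_f1 [simp]: "aug (f1 a) = a" by (simp add: aug_def tay_def)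

lemma f1_const: "a \<in> carrier A \<Longrightarrow> d a = \<zero> \<Longrightarrow> f1 a = iota a"
proof -
  assume a: "a \<in> carrier A" "d a = \<zero>"
  have "(d ^^ Suc k) a = \<zero>" for k by (simp only: funpow_Suc_right o_apply a d_pow_zero)
  then have "tay a k = ts_const A a k" for k by (cases k) (auto simp: tay_def ts_const_def)
  then show ?thesis unfolding f1_def iota_def by presburger
qed

end

section \<open>The shift as a twisted derivation of the ring of null sequences\<close>

context coord_pair
begin

definition yB where "yB = seq_code (ts_coord A x)"

definition dB where "dB (b :: 'a) = seq_code (ts_shift (seq_of b))"

lemma yB_closed: "yB \<in> carrier B"
  unfolding yB_def by (intro seq_code_closed nulls_closed)

lemma dB_closed: "b \<in> carrier B \<Longrightarrow> dB b \<in> carrier B"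
  unfolding dB_def by (intro seq_code_closed) (simp add: nulls_shift_iff seq_of_nulls)

lemma seq_dB [simp]: "seq_of (dB (b :: 'a)) = ts_shift (seq_of b)" by (simp add: dB_def)

lemma seq_dB_pow: "seq_of ((dB ^^ k) b) j = seq_of b (k + j)"
  by (induction k arbitrary: j) (simp_all add: ts_shift_def)

lemma dB_iota: "dB (iota a) = \<zero>\<^bsub>B\<^esub>"
  by (simp add: dB_def B_simps shift_const)

lemma coord_pair_B: "coord_pair p B yB"
proof -
  interpret BB: pq_pair p B by (rule pq_pair_B)
  show ?thesis
    by unfold_locales (use codes yB_closed in \<open>auto simp: B_simps yB_def del_coord\<close>)
qed

text \<open>The rules for products and for \<delta> are the recursions by which these were defined
  on sequences, and iterated shifts of a null sequence tend to zero by the description of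
  \<open>IB\<close> through coefficients.\<close>

lemma qderiv_pair_B: "qderiv_pair p B yB dB"
proof -
  interpret BB: coord_pair p B yB by (rule coord_pair_B)
  note [simp] = yB_closed dB_closed
  define e where "e = (qel B \<ominus>\<^bsub>B\<^esub> \<one>\<^bsub>B\<^esub>) \<otimes>\<^bsub>B\<^esub> yB"
  have e [simp]: "e \<in> carrier B" unfolding e_def by simp
  have se: "seq_of e = eta"
  proof -
    have "seq_of e = seq_of (qel B \<ominus>\<^bsub>B\<^esub> \<one>\<^bsub>B\<^esub>) \<otimes>\<^bsub>H\<^esub> seq_of yB"
      unfolding e_def by (rule sq.hom_mult) auto
    also have "seq_of (qel B \<ominus>\<^bsub>B\<^esub> \<one>\<^bsub>B\<^esub>) = seq_of (qel B) \<ominus>\<^bsub>H\<^esub> seq_of \<one>\<^bsub>B\<^esub>"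
      by (rule sq.hom_sub) auto
    finally show ?thesis unfolding eta_def by (simp add: B_simps yB_def)
  qed
  show ?thesis
  proof (unfold_locales)
    fix a b assume ab: "a \<in> carrier B" "b \<in> carrier B"
    show "dB (a \<oplus>\<^bsub>B\<^esub> b) = dB a \<oplus>\<^bsub>B\<^esub> dB b"
      using ab by (simp add: dB_def B_simps shift_ad)
    show "dB (a \<otimes>\<^bsub>B\<^esub> b) = dB a \<otimes>\<^bsub>B\<^esub> b \<oplus>\<^bsub>B\<^esub> (a \<oplus>\<^bsub>B\<^esub> (qel B \<ominus>\<^bsub>B\<^esub> \<one>\<^bsub>B\<^esub>) \<otimes>\<^bsub>B\<^esub> yB \<otimes>\<^bsub>B\<^esub> dB a) \<otimes>\<^bsub>B\<^esub> dB b"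
      unfolding e_def[symmetric]
      by (rule B_eqI) (use ab in \<open>simp_all add: seq_add seq_mult se shift_mul S_eta\<close>)
  next
    fix a assume a: "a \<in> carrier B"
    show "dB (qel B \<otimes>\<^bsub>B\<^esub> a) = qel B \<otimes>\<^bsub>B\<^esub> dB a"
      by (rule B_eqI) (use a A_q in \<open>simp_all add: seq_mult iota_q[symmetric] mul_const shift_sm\<close>)
    show "dB (delta B a) = (qtwist p B (qel B) yB \<otimes>\<^bsub>B\<^esub> delta B (dB a) \<oplus>\<^bsub>B\<^esub>
       frob_defect_div p B ((qel B \<ominus>\<^bsub>B\<^esub> \<one>\<^bsub>B\<^esub>) \<otimes>\<^bsub>B\<^esub> yB) yB \<one>\<^bsub>B\<^esub> \<otimes>\<^bsub>B\<^esub> dB a [^]\<^bsub>B\<^esub> p) \<ominus>\<^bsub>B\<^esub>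
      frob_defect_div p B ((qel B \<ominus>\<^bsub>B\<^esub> \<one>\<^bsub>B\<^esub>) \<otimes>\<^bsub>B\<^esub> yB) a (dB a)" (is "_ = ?r")
    proof -
      have 1: "qtwist p B (qel B) yB \<in> carrier B" unfolding qtwist_def by simp
      have 2: "frob_defect_div p B e yB \<one>\<^bsub>B\<^esub> \<in> carrier B" by simp
      have 3: "delta B (dB a) \<in> carrier B" "delta B a \<in> carrier B"
        using is_delta_closed[OF delta_B] a by auto
      have sy: "seq_of yB = ts_coord A x" "seq_of (qel B) = ts_const A (qel A)" "seq_of \<one>\<^bsub>B\<^esub> = ts_const A \<one>"
        by (simp_all add: yB_def B_simps)
      have 4: "seq_of (qtwist p B (qel B) yB) = uu" "seq_of (frob_defect_div p B e yB \<one>\<^bsub>B\<^esub>) = cc"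
        unfolding uu_def cc_def by (simp_all add: sq.hom_qtwist sq.hom_frob_defect_div sy se)
      have "seq_of ?r = L (del (ts_shift (seq_of a))) (seq_of a)"
        unfolding e_def[symmetric] L_def using a 1 2 3
        by (simp add: sq.hom_sub sq.hom_add sq.hom_mult 4 sq.hom_frob_defect_div se del: H_simps)
          (simp add: B_simps)
      also have "\<dots> = seq_of (dB (delta B a))" using a by (simp add: shift_del B_simps)
      finally have "seq_of (dB (delta B a)) = seq_of ?r" ..
      moreover have "?r \<in> carrier B" unfolding e_def[symmetric] using a 1 2 3 by simp
      ultimately show ?thesis using dB_closed[OF 3(2)] by (metis seq_code_of)
    qed
    fix n
    obtain K where K: "\<And>k. k \<ge> K \<Longrightarrow> seq_of a k \<in> Ip n"
      using seq_of_nulls[OF a] unfolding ts_nulls_def by blast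
    have "(dB ^^ k) a \<in> carrier B" for k by (induction k) (use a in auto)
    then show "\<exists>K. \<forall>k\<ge>K. (dB ^^ k) a \<in> ideal_pow B IB n"
      using K by (intro exI[of _ K]) (auto simp: ideal_pow_B seq_dB_pow)
  next
    show "dB yB = \<one>\<^bsub>B\<^esub>"
      by (auto simp: dB_def yB_def B_simps ts_shift_def ts_coord_def ts_const_def intro!: arg_cong[where f=seq_code])
    show "dB \<one>\<^bsub>B\<^esub> = \<zero>\<^bsub>B\<^esub>" using dB_iota[of \<one>] iota.hom_one by simp
  qed (rule dB_closed)
qed

end

section \<open>Uniqueness of derivations along an etale coordinate\<close>

text \<open>Two lifts of the same map along a square-zero ideal coincide. The test ring
  \<open>C\<close> may live on another type, from which \<open>j\<close> embeds it into the type of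
  \<open>A\<close>, the one over which formal etaleness is expressed.\<close>

lemma formally_etale_unique:
  fixes S :: "('s, 'z) ring_scheme" and A :: "('a, 'y) ring_scheme" and C :: "'c ring" and j :: "'c \<Rightarrow> 'a"
  assumes et: "formally_etale S I A f" and "cring S" "ideal I S" "cring A" and C: "cring C" and j: "inj_on j (carrier C)"
    and N: "ideal N C" "\<And>a b. a \<in> N \<Longrightarrow> b \<in> N \<Longrightarrow> a \<otimes>\<^bsub>C\<^esub> b = \<zero>\<^bsub>C\<^esub>"
    and w: "w \<in> ring_hom A C" "w' \<in> ring_hom A C"
    and agree: "\<And>s. s \<in> carrier S \<Longrightarrow> w (f s) = w' (f s)"
    and mod: "\<And>a. a \<in> carrier A \<Longrightarrow> w a \<ominus>\<^bsub>C\<^esub> w' a \<in> N"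
    and kill: "\<And>s. s \<in> ideal_pow S I k \<Longrightarrow> w (f s) = \<zero>\<^bsub>C\<^esub>"
    and a: "a \<in> carrier A"
  shows "w a = w' a"
proof -
  interpret S: cring S by fact
  interpret A: cring A by fact
  interpret C: cring C by fact
  define i where "i = inv_into (carrier C) j"
  have ij [simp]: "i (j c) = c" if "c \<in> carrier C" for c
    unfolding i_def using inv_into_f_f[OF j that] .
  \<comment> \<open>The copy of \<open>C\<close> on the image of \<open>j\<close>.\<close>
  define C' where "C' = \<lparr>carrier = j ` carrier C, monoid.mult = (\<lambda>a b. j (i a \<otimes>\<^bsub>C\<^esub> i b)),
     monoid.one = j \<one>\<^bsub>C\<^esub>, ring.zero = j \<zero>\<^bsub>C\<^esub>, ring.add = (\<lambda>a b. j (i a \<oplus>\<^bsub>C\<^esub> i b))\<rparr>"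
  have C'_simps: "carrier C' = j ` carrier C" "\<And>a b. a \<otimes>\<^bsub>C'\<^esub> b = j (i a \<otimes>\<^bsub>C\<^esub> i b)"
     "\<one>\<^bsub>C'\<^esub> = j \<one>\<^bsub>C\<^esub>" "\<zero>\<^bsub>C'\<^esub> = j \<zero>\<^bsub>C\<^esub>" "\<And>a b. a \<oplus>\<^bsub>C'\<^esub> b = j (i a \<oplus>\<^bsub>C\<^esub> i b)"
    by (simp_all add: C'_def)
  have ihom: "ring_hom_cring C' C i"
  proof (rule cring_pullback[OF C])
    show "inj_on i (carrier C')" by (auto simp: C'_simps inj_on_def)
    show "\<exists>b\<in>carrier C'. i b = \<ominus>\<^bsub>C\<^esub> i a" if "a \<in> carrier C'" for a
      using that by (auto simp: C'_simps)
  qed (auto simp: C'_simps)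
  interpret i: ring_hom_cring C' C i by (rule ihom)
  have jhom: "j \<in> ring_hom C C'"
    by (rule ring_hom_memI) (auto simp: C'_simps)
  define N' where "N' = {c \<in> carrier C'. i c \<in> N}"
  have N': "ideal N' C'" unfolding N'_def by (rule ring_hom_ring.ideal_vimage[OF i.hom_ring N(1)])
  interpret N': ideal N' C' by (rule N')
  have prod0: "ideal_prod C' N' N' = {\<zero>\<^bsub>C'\<^esub>}"
  proof
    have "c = \<zero>\<^bsub>C'\<^esub>" if "c \<in> ideal_prod C' N' N'" for c
      using that
    proof (induction c rule: ideal_prod.induct)
      case (prod a b)
      then show ?case by (simp add: N'_def C'_simps N(2))
    qed (simp add: C'_simps)
    then show "ideal_prod C' N' N' \<subseteq> {\<zero>\<^bsub>C'\<^esub>}" by auto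
    have "\<zero>\<^bsub>C'\<^esub> \<otimes>\<^bsub>C'\<^esub> \<zero>\<^bsub>C'\<^esub> \<in> ideal_prod C' N' N'" by (intro ideal_prod.prod N'.zero_closed)
    then show "{\<zero>\<^bsub>C'\<^esub>} \<subseteq> ideal_prod C' N' N'" by simp
  qed
  have fS: "f \<in> ring_hom S A" using et unfolding formally_etale_def by blast
  define u where "u s = j (w (f s))" for s
  define v where "v a = N' +>\<^bsub>C'\<^esub> j (w a)" for a
  have jw: "(\<lambda>a. j (w a)) \<in> ring_hom A C'" and jw': "(\<lambda>a. j (w' a)) \<in> ring_hom A C'"
    using ring_hom_trans[OF w(1) jhom] ring_hom_trans[OF w(2) jhom] by (simp_all add: o_def)
  have u: "u \<in> ring_hom S C'"
    unfolding u_def using ring_hom_trans[OF fS jw] by (simp add: o_def)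
  have v: "v \<in> ring_hom A (C' Quot N')"
    unfolding v_def using ring_hom_trans[OF jw N'.rcos_ring_hom] by (simp add: o_def)
  have uk: "u ` ideal_pow S I k = {\<zero>\<^bsub>C'\<^esub>}"
  proof -
    have "\<zero>\<^bsub>S\<^esub> \<in> ideal_pow S I k"
      by (rule additive_subgroup.zero_closed[OF ideal.axioms(1)[OF S.ideal_ideal_pow[OF assms(3)]]])
    then show ?thesis using kill by (force simp: u_def C'_simps)
  qed
  have vu: "\<forall>s\<in>carrier S. v (f s) = N' +>\<^bsub>C'\<^esub> u s" by (simp add: u_def v_def)
  have pre: "cring C' \<and> ideal N' C' \<and> ideal_prod C' N' N' = {\<zero>\<^bsub>C'\<^esub>} \<and> u \<in> ring_hom S C' \<and>
      (\<exists>k. u ` ideal_pow S I k = {\<zero>\<^bsub>C'\<^esub>}) \<and>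
      v \<in> ring_hom A (C' Quot N') \<and> (\<forall>s\<in>carrier S. v (f s) = N' +>\<^bsub>C'\<^esub> u s)"
    using i.R.is_cring N' prod0 u uk v vu by metis
  note et1 = conjunct2[OF et[unfolded formally_etale_def]]
  note et2 = et1[THEN spec[where x=C'], THEN spec[where x=N'], THEN spec[where x=u], THEN spec[where x=v]]
  note et3 = mp[OF et2 pre]
  have uniq: "\<And>w1 w2. w1 \<in> ring_hom A C' \<inter> extensional (carrier A) \<and>
           (\<forall>s\<in>carrier S. w1 (f s) = u s) \<and> (\<forall>a\<in>carrier A. N' +>\<^bsub>C'\<^esub> w1 a = v a) \<Longrightarrow>
           w2 \<in> ring_hom A C' \<inter> extensional (carrier A) \<and>
           (\<forall>s\<in>carrier S. w2 (f s) = u s) \<and> (\<forall>a\<in>carrier A. N' +>\<^bsub>C'\<^esub> w2 a = v a) \<Longrightarrow> w1 = w2"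
    by (rule Uniq_D[OF ex1_iff_ex_Uniq[THEN iffD1, THEN conjunct2, OF et3]])
  have res: "restrict g (carrier A) \<in> ring_hom A C' \<inter> extensional (carrier A)" if "g \<in> ring_hom A C'" for g
    using that by (auto simp: ring_hom_def)
  have fc: "f s \<in> carrier A" if "s \<in> carrier S" for s using ring_hom_closed[OF fS that] .
  have wc: "w a \<in> carrier C" "w' a \<in> carrier C" if "a \<in> carrier A" for a
    by (rule ring_hom_closed[OF w(1) that], rule ring_hom_closed[OF w(2) that])
  have jj: "j (w a) \<in> carrier C'" "j (w' a) \<in> carrier C'" if "a \<in> carrier A" for a
    unfolding C'_simps by (rule imageI, rule wc[OF that])+
  have "N' +>\<^bsub>C'\<^esub> j (w' a) = N' +>\<^bsub>C'\<^esub> j (w a)" if a: "a \<in> carrier A" for a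
  proof -
    have "i (j (w a) \<ominus>\<^bsub>C'\<^esub> j (w' a)) = w a \<ominus>\<^bsub>C\<^esub> w' a"
      using jj[OF a] wc[OF a] by (simp add: i.hom_sub)
    then have "j (w a) \<ominus>\<^bsub>C'\<^esub> j (w' a) \<in> N'"
      unfolding N'_def using mod[OF a] i.R.minus_closed[OF jj[OF a]] by simp
    then show ?thesis using N'.coset_eq_iff[OF jj[OF a]] by simp
  qed
  then have "(\<lambda>a\<in>carrier A. j (w a)) = (\<lambda>a\<in>carrier A. j (w' a))"
    by (intro uniq conjI res jw jw') (auto simp: u_def v_def fc agree)
  then have "j (w a) = j (w' a)" using a by (metis restrict_apply')
  then show ?thesis using wc[OF a] ij by metis
qed

section \<open>Frobenius lifts, defects of ring maps and derivations along an etale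
  coordinate\<close>

context cring
begin

lemma frob_add:
  assumes D: "is_delta p R D" and p: "Factorial_Ring.prime p" and [simp]: "a \<in> carrier R" "b \<in> carrier R"
  shows "(a \<oplus> b) [^] p \<oplus> add_pow R p (D (a \<oplus> b)) = (a [^] p \<oplus> add_pow R p (D a)) \<oplus> (b [^] p \<oplus> add_pow R p (D b))"
proof -
  note [simp] = is_delta_closed[OF D]
  define \<pi> P A B d d' where "\<pi> = add_pow R p \<one>" and "P = frob_defect p R a b" and "A = a [^] p" and "B = b [^] p"
    and "d = D a" and "d' = D b"
  have [simp]: "\<pi> \<in> carrier R" "P \<in> carrier R" "A \<in> carrier R" "B \<in> carrier R" "d \<in> carrier R" "d' \<in> carrier R"
    unfolding \<pi>_def P_def A_def B_def d_def d'_def by auto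
  have "(A \<oplus> B \<oplus> \<pi> \<otimes> P) \<oplus> \<pi> \<otimes> (d \<oplus> d' \<ominus> P) = (A \<oplus> \<pi> \<otimes> d) \<oplus> (B \<oplus> \<pi> \<otimes> d')"
    by (rule ring_eqI[of _ "[A,B,\<pi>,P,d,d']"], (rule reify)+, code_simp, simp add: carrier_list)
  then show ?thesis
    unfolding frob_defect_p[OF assms(3,4) p] is_delta_add[OF D assms(3,4)] \<pi>_def P_def A_def B_def d_def d'_def
    by (simp add: add_pow_one[symmetric])
qed

lemma frob_mult:
  assumes D: "is_delta p R D" and [simp]: "a \<in> carrier R" "b \<in> carrier R"
  shows "(a \<otimes> b) [^] p \<oplus> add_pow R p (D (a \<otimes> b)) = (a [^] p \<oplus> add_pow R p (D a)) \<otimes> (b [^] p \<oplus> add_pow R p (D b))"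
proof -
  note [simp] = is_delta_closed[OF D]
  define \<pi> A B d d' where "\<pi> = add_pow R p \<one>" and "A = a [^] p" and "B = b [^] p"
    and "d = D a" and "d' = D b"
  have [simp]: "\<pi> \<in> carrier R" "A \<in> carrier R" "B \<in> carrier R" "d \<in> carrier R" "d' \<in> carrier R"
    unfolding \<pi>_def A_def B_def d_def d'_def by auto
  have "A \<otimes> B \<oplus> \<pi> \<otimes> (A \<otimes> d' \<oplus> d \<otimes> B \<oplus> \<pi> \<otimes> (d \<otimes> d')) = (A \<oplus> \<pi> \<otimes> d) \<otimes> (B \<oplus> \<pi> \<otimes> d')"
    by (rule ring_eqI[of _ "[A,B,\<pi>,d,d']"], (rule reify)+, code_simp, simp add: carrier_list)
  then show ?thesis
    unfolding is_delta_mult[OF D assms(2,3)] \<pi>_def A_def B_def d_def d'_def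
    by (simp add: add_pow_one[symmetric] nat_pow_distrib)
qed

lemma frob_hom:
  assumes D: "is_delta p R D" and p: "Factorial_Ring.prime p"
  shows "ring_hom_cring R R (\<lambda>a. a [^] p \<oplus> add_pow R p (D a))"
  by (rule ring_hom_cringI, rule is_cring, rule is_cring, rule ring_hom_memI)
    (use frob_add[OF D p] frob_mult[OF D] is_delta_closed[OF D] is_delta_one[OF D] in auto)

end

text \<open>The failure of a ring map between \<open>\<delta>\<close>-rings to commute with \<open>\<delta>\<close> is a derivation twisted by the
  Frobenius lifts.\<close>

lemma (in ring_hom_cring) delta_defect_mult:
  assumes D: "is_delta p R D" and D': "is_delta p S D'" and [simp]: "a \<in> carrier R" "b \<in> carrier R"
  shows "h (D (a \<otimes> b)) \<ominus>\<^bsub>S\<^esub> D' (h (a \<otimes> b)) =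
    h (a [^] p \<oplus> add_pow R p (D a)) \<otimes>\<^bsub>S\<^esub> (h (D b) \<ominus>\<^bsub>S\<^esub> D' (h b)) \<oplus>\<^bsub>S\<^esub>
    (h (D a) \<ominus>\<^bsub>S\<^esub> D' (h a)) \<otimes>\<^bsub>S\<^esub> (h (b [^] p \<oplus> add_pow R p (D b)) \<ominus>\<^bsub>S\<^esub>
      add_pow S p (h (D b) \<ominus>\<^bsub>S\<^esub> D' (h b)))"
proof -
  note [simp] = is_delta_closed[OF D] is_delta_closed[OF D']
  define \<pi> A B d d' e e' where "\<pi> = add_pow S p \<one>\<^bsub>S\<^esub>" and "A = h a [^]\<^bsub>S\<^esub> p" and "B = h b [^]\<^bsub>S\<^esub> p"
    and "d = h (D a)" and "d' = h (D b)" and "e = D' (h a)" and "e' = D' (h b)"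
  have [simp]: "\<pi> \<in> carrier S" "A \<in> carrier S" "B \<in> carrier S" "d \<in> carrier S" "d' \<in> carrier S" "e \<in> carrier S" "e' \<in> carrier S"
    unfolding \<pi>_def A_def B_def d_def d'_def e_def e'_def by auto
  have "(A \<otimes>\<^bsub>S\<^esub> d' \<oplus>\<^bsub>S\<^esub> d \<otimes>\<^bsub>S\<^esub> B \<oplus>\<^bsub>S\<^esub> \<pi> \<otimes>\<^bsub>S\<^esub> (d \<otimes>\<^bsub>S\<^esub> d')) \<ominus>\<^bsub>S\<^esub>
      (A \<otimes>\<^bsub>S\<^esub> e' \<oplus>\<^bsub>S\<^esub> e \<otimes>\<^bsub>S\<^esub> B \<oplus>\<^bsub>S\<^esub> \<pi> \<otimes>\<^bsub>S\<^esub> (e \<otimes>\<^bsub>S\<^esub> e')) =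
    (A \<oplus>\<^bsub>S\<^esub> \<pi> \<otimes>\<^bsub>S\<^esub> d) \<otimes>\<^bsub>S\<^esub> (d' \<ominus>\<^bsub>S\<^esub> e') \<oplus>\<^bsub>S\<^esub> (d \<ominus>\<^bsub>S\<^esub> e) \<otimes>\<^bsub>S\<^esub> (B \<oplus>\<^bsub>S\<^esub> \<pi> \<otimes>\<^bsub>S\<^esub> d' \<ominus>\<^bsub>S\<^esub> \<pi> \<otimes>\<^bsub>S\<^esub> (d' \<ominus>\<^bsub>S\<^esub> e'))"
    by (rule S.ring_eqI[of _ "[A,B,\<pi>,d,d',e,e']"], (rule S.reify)+, code_simp, simp add: S.carrier_list)
  then show ?thesis
    by (simp add: is_delta_mult[OF D] is_delta_mult[OF D'] hom_add_pow)
      (simp add: \<pi>_def A_def B_def d_def d'_def e_def e'_def S.add_pow_one[symmetric])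
qed

locale etale_pair = coord_pair p A x for p and A :: "'u dpair" and x +
  fixes R :: "'u dpair" and h \<sigma> d :: "'u \<Rightarrow> 'u"
  assumes R: "qPD_pair p R" and h: "h \<in> dpair_hom R A" and etale: "top_etale_coordinate p R A h x"
    and sigma: "is_sigma R A h x \<sigma>" and qderiv: "is_qderiv R A h x \<sigma> d"
begin

lemma R_cring: "cring R" and R_delta: "is_delta p R (delta R)" and R_q: "qel R \<in> carrier R"
  using R unfolding qPD_pair_def delta_pair_def over_base_def delta_structure_iff by auto

lemma h_hom: "ring_hom_cring R A h" and h_delta: "r \<in> carrier R \<Longrightarrow> h (delta R r) = delta A (h r)"
  and h_q: "h (qel R) = qel A"
  using h R_cring A_cring unfolding dpair_hom_def by (auto intro: ring_hom_cringI)

sublocale h: ring_hom_cring R A h by (rule h_hom)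

lemma d_facts:
  "a \<in> carrier A \<Longrightarrow> d a \<in> carrier A"
  "a \<in> carrier A \<Longrightarrow> b \<in> carrier A \<Longrightarrow> d (a \<oplus>\<^bsub>A\<^esub> b) = d a \<oplus>\<^bsub>A\<^esub> d b"
  "r \<in> carrier R \<Longrightarrow> a \<in> carrier A \<Longrightarrow> d (h r \<otimes>\<^bsub>A\<^esub> a) = h r \<otimes>\<^bsub>A\<^esub> d a"
  "a \<in> carrier A \<Longrightarrow> b \<in> carrier A \<Longrightarrow> d (a \<otimes>\<^bsub>A\<^esub> b) = d a \<otimes>\<^bsub>A\<^esub> b \<oplus>\<^bsub>A\<^esub> \<sigma> a \<otimes>\<^bsub>A\<^esub> d b"
  "d x = \<one>\<^bsub>A\<^esub>"
  using qderiv unfolding is_qderiv_def by auto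

lemma s_facts: "\<sigma> \<in> ring_hom A A" "\<sigma> x = qel A \<otimes>\<^bsub>A\<^esub> x"
  using sigma unfolding is_sigma_def by auto

lemma \<sigma>_hom: "ring_hom_cring A A \<sigma>" using s_facts A_cring by (intro ring_hom_cringI)

sublocale \<sigma>: ring_hom_cring A A \<sigma> by (rule \<sigma>_hom)

declare d_facts(1) [simp]

lemma xA [simp]: "x \<in> carrier A" by (rule x)

lemma d_1: "d \<one>\<^bsub>A\<^esub> = \<zero>\<^bsub>A\<^esub>"
  using d_facts(4)[of "\<one>\<^bsub>A\<^esub>" "\<one>\<^bsub>A\<^esub>"] by (simp add: add.l_cancel_one)

lemma d_0: "d \<zero>\<^bsub>A\<^esub> = \<zero>\<^bsub>A\<^esub>"
  using d_facts(2)[of "\<zero>\<^bsub>A\<^esub>" "\<zero>\<^bsub>A\<^esub>"] by (simp add: add.l_cancel_one)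

lemma d_h: "r \<in> carrier R \<Longrightarrow> d (h r) = \<zero>\<^bsub>A\<^esub>"
  using d_facts(3)[of r "\<one>\<^bsub>A\<^esub>"] by (simp add: d_1)

lemma d_qel: "a \<in> carrier A \<Longrightarrow> d (qel A \<otimes>\<^bsub>A\<^esub> a) = qel A \<otimes>\<^bsub>A\<^esub> d a"
  using d_facts(3)[OF R_q] unfolding h_q .

text \<open>Commutativity of \<open>A\<close>: the Leibniz rule for \<open>a x\<close> and for
  \<open>x a\<close> gives two expressions for one derivative, and \<open>\<sigma> x = q x\<close>
  and \<open>d x = 1\<close> allow to solve for \<open>\<sigma> a\<close>.\<close>

lemma sigma_eq: "a \<in> carrier A \<Longrightarrow> \<sigma> a = a \<oplus>\<^bsub>A\<^esub> t \<otimes>\<^bsub>A\<^esub> x \<otimes>\<^bsub>A\<^esub> d a"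
proof -
  assume [simp]: "a \<in> carrier A"
  have 1: "d a \<otimes>\<^bsub>A\<^esub> x \<oplus>\<^bsub>A\<^esub> \<sigma> a = a \<oplus>\<^bsub>A\<^esub> (qel A \<otimes>\<^bsub>A\<^esub> x) \<otimes>\<^bsub>A\<^esub> d a"
    using d_facts(4)[of a x] d_facts(4)[of x a] m_comm[of a x] by (simp add: d_facts s_facts)
  have "\<sigma> a = (d a \<otimes>\<^bsub>A\<^esub> x \<oplus>\<^bsub>A\<^esub> \<sigma> a) \<ominus>\<^bsub>A\<^esub> d a \<otimes>\<^bsub>A\<^esub> x"
    by (rule ring_eqI[of _ "[d a, x, \<sigma> a]"], (rule reify)+, code_simp, simp add: carrier_list)
  also have "\<dots> = a \<oplus>\<^bsub>A\<^esub> t \<otimes>\<^bsub>A\<^esub> x \<otimes>\<^bsub>A\<^esub> d a" unfolding 1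
    by (rule ring_eqI[of _ "[d a, x, a, qel A]"], (rule reify)+, code_simp, simp add: carrier_list)
  finally show ?thesis .
qed

text \<open>A \<open>\<psi>\<close>-derivation \<open>D\<close> gives the lift \<open>\<psi> + D \<epsilon>\<close> of \<open>\<psi>\<close> to the dual numbers over \<open>A / K\<close>, and formal
  etaleness makes this lift unique.\<close>

lemma derivation_zero:
  assumes K: "ideal K A" and \<psi>: "ring_hom_cring A (A Quot K) \<psi>" and kill: "\<And>a. a \<in> Ip m \<Longrightarrow> \<psi> a = \<zero>\<^bsub>A Quot K\<^esub>"
    and D: "\<And>a. a \<in> carrier A \<Longrightarrow> D a \<in> carrier (A Quot K)"
    "\<And>a b. a \<in> carrier A \<Longrightarrow> b \<in> carrier A \<Longrightarrow> D (a \<oplus>\<^bsub>A\<^esub> b) = D a \<oplus>\<^bsub>A Quot K\<^esub> D b"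
    "\<And>a b. a \<in> carrier A \<Longrightarrow> b \<in> carrier A \<Longrightarrow>
      D (a \<otimes>\<^bsub>A\<^esub> b) = \<psi> a \<otimes>\<^bsub>A Quot K\<^esub> D b \<oplus>\<^bsub>A Quot K\<^esub> D a \<otimes>\<^bsub>A Quot K\<^esub> \<psi> b"
    "\<And>r. r \<in> carrier R \<Longrightarrow> D (h r) = \<zero>\<^bsub>A Quot K\<^esub>" "D x = \<zero>\<^bsub>A Quot K\<^esub>"
    and a: "a \<in> carrier A"
  shows "D a = \<zero>\<^bsub>A Quot K\<^esub>"
proof -
  interpret K: ideal K A by fact
  interpret Q: cring "A Quot K" by (rule K.quotient_is_cring[OF A_cring])
  interpret \<psi>: ring_hom_cring A "A Quot K" \<psi> by fact
  interpret du: dual_cring "A Quot K" "\<zero>\<^bsub>A Quot K\<^esub>" by unfold_locales simp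
  interpret UR: UP_pre_univ_prop R A h "UP R" by (simp add: UP_pre_univ_prop_def UP_cring_def h_hom R_cring)
  define I' where "I' = genideal (UP R) ((\<lambda>r. UnivPoly.monom (UP R) r 0) ` pq_ideal p R)"
  have et: "formally_etale (UP R) I' A (UnivPoly.eval R A h x)"
    using etale unfolding top_etale_coordinate_def I'_def Let_def by (elim conjE)
  have RI: "pq_ideal p R \<subseteq> carrier R"
  proof -
    have "ideal (pq_ideal p R) R" unfolding pq_ideal_def
      by (rule h.R.genideal_ideal) (use R_q in auto)
    then show ?thesis by (intro subsetI, rule ideal.Icarr)
  qed
  have I'_sub: "(\<lambda>r. UnivPoly.monom (UP R) r 0) ` pq_ideal p R \<subseteq> carrier (UP R)"
    using RI UR.monom_closed by auto
  have I': "ideal I' (UP R)" unfolding I'_def by (rule UR.P.genideal_ideal[OF I'_sub])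
  have ev: "ring_hom_cring (UP R) A (UnivPoly.eval R A h x)"
    using UR.eval_ring_hom[OF xA] by (intro ring_hom_cringI UR.P.is_cring A_cring)
  interpret ev: ring_hom_cring "UP R" A "UnivPoly.eval R A h x" by (rule ev)
  have hI: "h r \<in> I" if "r \<in> pq_ideal p R" for r
  proof -
    have "pq_ideal p R \<subseteq> {r \<in> carrier R. h r \<in> I}"
      unfolding pq_ideal_def[of p R]
    proof (rule h.R.genideal_minimal[OF ring_hom_ring.ideal_vimage[OF h.hom_ring I_ideal]])
      have "h (qel R \<ominus>\<^bsub>R\<^esub> \<one>\<^bsub>R\<^esub>) = t" using h.hom_sub[OF R_q h.R.one_closed] by (simp add: h_q)
      then show "{add_pow R p \<one>\<^bsub>R\<^esub>, qel R \<ominus>\<^bsub>R\<^esub> \<one>\<^bsub>R\<^esub>} \<subseteq> {r \<in> carrier R. h r \<in> I}"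
        using R_q pi_I t_I by (auto simp: h.hom_add_pow \<pi>_def)
    qed
    then show ?thesis using that by auto
  qed
  have "I' \<subseteq> {s \<in> carrier (UP R). UnivPoly.eval R A h x s \<in> I}"
    unfolding I'_def
    by (rule UR.P.genideal_minimal[OF ring_hom_ring.ideal_vimage[OF ev.hom_ring I_ideal]])
      (use RI I'_sub in \<open>auto simp: UR.eval_const hI subset_iff\<close>)
  then have evI: "UnivPoly.eval R A h x s \<in> Ip k" if "s \<in> ideal_pow (UP R) I' k" for s k
    by (intro UR.P.ideal_pow_image[OF ev I' I_ideal _ that]) auto
  \<comment> \<open>The test ring consists of pairs of cosets; chosen representatives make it
    possible to code it on the type of \<open>A\<close>.\<close>
  define rep where "rep = (\<lambda>V :: 'u set. SOME a. a \<in> V)"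
  have rep: "rep V \<in> V \<and> rep V \<in> carrier A \<and> V = K +>\<^bsub>A\<^esub> rep V" if V: "V \<in> carrier (A Quot K)" for V
  proof -
    obtain b where b: "b \<in> carrier A" "V = K +>\<^bsub>A\<^esub> b" using V K.carrier_Quot by auto
    then have "b \<in> V" using K.a_rcos_self by blast
    then have r: "rep V \<in> V" unfolding rep_def by (rule someI)
    then have r': "rep V \<in> carrier A" "rep V \<ominus>\<^bsub>A\<^esub> b \<in> K" using K.mem_coset_iff[OF b(1)] b(2) by blast+
    then show ?thesis using r b K.coset_eq_iff[OF r'(1) b(1)] by blast
  qed
  \<comment> \<open>A pair is stored as a sequence with entry 0 and a constant tail, so that
    \<open>seq_code\<close> can be used again.\<close>
  define j where "j V = seq_code (\<lambda>i::nat. if i = 0 then rep (fst V) else rep (snd V))" for V :: "'u set \<times> 'u set"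
  have j: "inj_on j (carrier du.Z)"
  proof (rule inj_onI)
    fix V V' assume V: "V \<in> carrier du.Z" "V' \<in> carrier du.Z" and "j V = j V'"
    then have "(\<lambda>i::nat. if i = 0 then rep (fst V) else rep (snd V)) = (\<lambda>i. if i = 0 then rep (fst V') else rep (snd V'))"
      unfolding j_def by (metis seq_of_code)
    from fun_cong[OF this, of 0] fun_cong[OF this, of 1] have "rep (fst V) = rep (fst V')" "rep (snd V) = rep (snd V')"
      by auto
    moreover have "fst V \<in> carrier (A Quot K)" "snd V \<in> carrier (A Quot K)"
      "fst V' \<in> carrier (A Quot K)" "snd V' \<in> carrier (A Quot K)" using V by auto
    ultimately show "V = V'" using rep by (metis prod.expand)
  qed
  define w where "w a = (\<psi> a, \<zero>\<^bsub>A Quot K\<^esub>)" for a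
  define w' where "w' a = (\<psi> a, D a)" for a
  have D0: "D \<one>\<^bsub>A\<^esub> = \<zero>\<^bsub>A Quot K\<^esub>" using D(4)[of "\<one>\<^bsub>R\<^esub>"] by simp
  have w: "w \<in> ring_hom A du.Z" unfolding w_def by (rule ring_hom_memI) auto
  have w': "w' \<in> ring_hom A du.Z" unfolding w'_def by (rule ring_hom_memI) (auto simp: D D0)
  interpret w: ring_hom_cring A du.Z w by (rule ring_hom_cringI[OF A_cring du.Z.is_cring w])
  interpret w': ring_hom_cring A du.Z w' by (rule ring_hom_cringI[OF A_cring du.Z.is_cring w'])
  let ?N = "{V \<in> carrier du.Z. fst V \<in> {\<zero>\<^bsub>A Quot K\<^esub>}}"
  have N: "ideal ?N du.Z"
    by (rule ring_hom_ring.ideal_vimage[OF ring_hom_cring.hom_ring[OF du.hom_fst] Q.zeroideal])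
  have "w a = w' a"
  proof (rule formally_etale_unique[OF et UR.P.is_cring I' A_cring du.Z.is_cring j N _ w w'])
    show "V \<otimes>\<^bsub>du.Z\<^esub> Y = \<zero>\<^bsub>du.Z\<^esub>" if "V \<in> ?N" "Y \<in> ?N" for V Y using that by auto
    show "w (UnivPoly.eval R A h x s) = w' (UnivPoly.eval R A h x s)" if s: "s \<in> carrier (UP R)" for s
    proof -
      have c: "w (h r) = w' (h r)" if "r \<in> carrier R" for r using that D(4) by (simp add: w_def w'_def)
      have wx: "w x = w' x" by (simp add: w_def w'_def D)
      show ?thesis
        using s unfolding UR.eval_on_carrier[OF s]
        by (simp add: Pi_iff UR.coeff_closed c wx o_def)
    qed
    show "w a \<ominus>\<^bsub>du.Z\<^esub> w' a \<in> ?N" if "a \<in> carrier A" for a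
      using that D(1) Q.r_right_minus_eq[of "\<psi> a" "\<psi> a"] by (simp add: w_def w'_def)
    show "w (UnivPoly.eval R A h x s) = \<zero>\<^bsub>du.Z\<^esub>" if "s \<in> ideal_pow (UP R) I' m" for s
      using evI[OF that] kill by (simp add: w_def)
  qed (rule a)
  then show ?thesis by (simp add: w_def w'_def)
qed

end

section \<open>Iterates of the derivation and its compatibility with \<delta>\<close>

context etale_pair
begin

lemma pi_d: "a \<in> carrier A \<Longrightarrow> d (\<pi> \<otimes>\<^bsub>A\<^esub> a) = \<pi> \<otimes>\<^bsub>A\<^esub> d a"
proof -
  assume [simp]: "a \<in> carrier A"
  have "h (add_pow R p \<one>\<^bsub>R\<^esub>) = \<pi>" unfolding \<pi>_def by (simp add: h.hom_add_pow)
  then show ?thesis using d_facts(3)[of "add_pow R p \<one>\<^bsub>R\<^esub>" a] by simp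
qed

lemma t_d: "a \<in> carrier A \<Longrightarrow> d (t \<otimes>\<^bsub>A\<^esub> a) = t \<otimes>\<^bsub>A\<^esub> d a"
proof -
  assume [simp]: "a \<in> carrier A"
  have "h (qel R \<ominus>\<^bsub>R\<^esub> \<one>\<^bsub>R\<^esub>) = t" using h.hom_sub[OF R_q h.R.one_closed] by (simp add: h_q)
  then show ?thesis using d_facts(3)[of "qel R \<ominus>\<^bsub>R\<^esub> \<one>\<^bsub>R\<^esub>" a] R_q by simp
qed

lemma dpow_closed [simp]: "a \<in> carrier A \<Longrightarrow> (d ^^ k) a \<in> carrier A"
  by (induction k) auto

lemma dpow_add: "a \<in> carrier A \<Longrightarrow> b \<in> carrier A \<Longrightarrow> (d ^^ k) (a \<oplus>\<^bsub>A\<^esub> b) = (d ^^ k) a \<oplus>\<^bsub>A\<^esub> (d ^^ k) b"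
  by (induction k) (auto simp: d_facts)

lemma dpow_pi: "a \<in> carrier A \<Longrightarrow> (d ^^ k) (\<pi> \<otimes>\<^bsub>A\<^esub> a) = \<pi> \<otimes>\<^bsub>A\<^esub> (d ^^ k) a"
  by (induction k) (auto simp: pi_d)

lemma dpow_t: "a \<in> carrier A \<Longrightarrow> (d ^^ k) (t \<otimes>\<^bsub>A\<^esub> a) = t \<otimes>\<^bsub>A\<^esub> (d ^^ k) a"
  by (induction k) (auto simp: t_d)

lemma dpow_0: "(d ^^ k) \<zero>\<^bsub>A\<^esub> = \<zero>\<^bsub>A\<^esub>" by (induction k) (auto simp: d_0)

text \<open>The derivation is linear over \<open>p\<close> and \<open>q - 1\<close>, which come from
  \<open>R\<close>, so a gain of \<open>r\<close> powers on all of \<open>A\<close> is a gain of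
  \<open>r\<close> powers on each power of the ideal.\<close>

lemma dpow_shift:
  assumes "\<And>a. a \<in> carrier A \<Longrightarrow> (d ^^ k) a \<in> Ip r"
  shows "a \<in> Ip n \<Longrightarrow> (d ^^ k) a \<in> Ip (n + r)"
proof (induction n arbitrary: a)
  case 0
  then show ?case using assms by simp
next
  case (Suc n)
  obtain b c where bc: "b \<in> Ip n" "c \<in> Ip n" "a = \<pi> \<otimes>\<^bsub>A\<^esub> b \<oplus>\<^bsub>A\<^esub> t \<otimes>\<^bsub>A\<^esub> c"
    using Ip_Suc[OF Suc.prems] by blast
  have [simp]: "b \<in> carrier A" "c \<in> carrier A" using bc Ip_carrier by blast+
  have "(d ^^ k) a = \<pi> \<otimes>\<^bsub>A\<^esub> (d ^^ k) b \<oplus>\<^bsub>A\<^esub> t \<otimes>\<^bsub>A\<^esub> (d ^^ k) c"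
    unfolding bc(3) by (simp add: dpow_add dpow_pi dpow_t)
  moreover have "\<pi> \<otimes>\<^bsub>A\<^esub> (d ^^ k) b \<in> Ip (Suc n + r)" "t \<otimes>\<^bsub>A\<^esub> (d ^^ k) c \<in> Ip (Suc n + r)"
    using ideal_prod.prod[OF pi_I Suc.IH[OF bc(1)]] ideal_prod.prod[OF t_I Suc.IH[OF bc(2)]] by simp_all
  ultimately show ?case
    using additive_subgroup.a_closed[OF ideal.axioms(1)[OF Ip_ideal]] by metis
qed

lemma d_Ip: "a \<in> Ip n \<Longrightarrow> (d ^^ k) a \<in> Ip n"
  using dpow_shift[of k 0 a n] by simp

text \<open>\<open>\<partial>\<^sup>p\<close> is a derivation modulo \<open>(p, q - 1)\<close> by Leibniz' rule, and it kills the coordinate.\<close>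

lemma leibniz_mod:
  assumes "a \<in> carrier A" "b \<in> carrier A"
  shows "I +>\<^bsub>A\<^esub> (d ^^ n) (a \<otimes>\<^bsub>A\<^esub> b) = (\<Oplus>\<^bsub>A Quot I\<^esub>k\<in>{..n}. add_pow (A Quot I) (n choose k)
      ((I +>\<^bsub>A\<^esub> (d ^^ (n - k)) a) \<otimes>\<^bsub>A Quot I\<^esub> (I +>\<^bsub>A\<^esub> (d ^^ k) b)))"
  using assms
proof (induction n arbitrary: a b)
  interpret I: ideal I A by (rule I_ideal)
  interpret Q: ring_hom_cring A "A Quot I" "(+>\<^bsub>A\<^esub>) I" by (rule I.rcos_ring_hom_cring[OF A_cring])
  case 0
  then show ?case by (simp add: Q.hom_mult[symmetric] del: Q.hom_mult)
next
  interpret I: ideal I A by (rule I_ideal)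
  interpret Q: ring_hom_cring A "A Quot I" "(+>\<^bsub>A\<^esub>) I" by (rule I.rcos_ring_hom_cring[OF A_cring])
  case (Suc n)
  note ab [simp] = Suc.prems
  define F where "F i k = (I +>\<^bsub>A\<^esub> (d ^^ i) a) \<otimes>\<^bsub>A Quot I\<^esub> (I +>\<^bsub>A\<^esub> (d ^^ k) b)" for i k
  have F: "F i k \<in> carrier (A Quot I)" for i k unfolding F_def by (intro Q.S.m_closed Q.hom_closed) auto
  \<comment> \<open>The difference between \<sigma> and the identity; it is a multiple of
    \<open>q - 1\<close> and remains one under all further derivatives.\<close>
  let ?c = "t \<otimes>\<^bsub>A\<^esub> (x \<otimes>\<^bsub>A\<^esub> d a \<otimes>\<^bsub>A\<^esub> d b)"
  have "d (a \<otimes>\<^bsub>A\<^esub> b) = d a \<otimes>\<^bsub>A\<^esub> b \<oplus>\<^bsub>A\<^esub> a \<otimes>\<^bsub>A\<^esub> d b \<oplus>\<^bsub>A\<^esub> ?c"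
    by (simp add: d_facts(4) sigma_eq l_distr m_assoc a_assoc)
  then have "(d ^^ Suc n) (a \<otimes>\<^bsub>A\<^esub> b) = (d ^^ n) (d a \<otimes>\<^bsub>A\<^esub> b) \<oplus>\<^bsub>A\<^esub> (d ^^ n) (a \<otimes>\<^bsub>A\<^esub> d b) \<oplus>\<^bsub>A\<^esub> (d ^^ n) ?c"
    by (simp only: funpow_Suc_right o_apply) (simp add: dpow_add)
  moreover have "(d ^^ n) ?c \<in> I"
    using dpow_t[of "x \<otimes>\<^bsub>A\<^esub> d a \<otimes>\<^bsub>A\<^esub> d b" n] I.I_r_closed[OF t_I, of "(d ^^ n) (x \<otimes>\<^bsub>A\<^esub> d a \<otimes>\<^bsub>A\<^esub> d b)"] by simp
  ultimately have "I +>\<^bsub>A\<^esub> (d ^^ Suc n) (a \<otimes>\<^bsub>A\<^esub> b) =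
      I +>\<^bsub>A\<^esub> ((d ^^ n) (d a \<otimes>\<^bsub>A\<^esub> b) \<oplus>\<^bsub>A\<^esub> (d ^^ n) (a \<otimes>\<^bsub>A\<^esub> d b))"
  proof -
    assume 1: "(d ^^ Suc n) (a \<otimes>\<^bsub>A\<^esub> b) = (d ^^ n) (d a \<otimes>\<^bsub>A\<^esub> b) \<oplus>\<^bsub>A\<^esub> (d ^^ n) (a \<otimes>\<^bsub>A\<^esub> d b) \<oplus>\<^bsub>A\<^esub> (d ^^ n) ?c"
      and 2: "(d ^^ n) ?c \<in> I"
    define u w where "u = (d ^^ n) (d a \<otimes>\<^bsub>A\<^esub> b) \<oplus>\<^bsub>A\<^esub> (d ^^ n) (a \<otimes>\<^bsub>A\<^esub> d b)" and "w = (d ^^ n) ?c"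
    have uw [simp]: "u \<in> carrier A" "w \<in> carrier A" unfolding u_def w_def by simp_all
    have "(u \<oplus>\<^bsub>A\<^esub> w) \<ominus>\<^bsub>A\<^esub> u = w"
      by (rule ring_eqI[of _ "[u,w]"], (rule reify)+, code_simp, simp add: carrier_list)
    then show ?thesis using I.coset_eq_iff[of "u \<oplus>\<^bsub>A\<^esub> w" u] 2 unfolding 1 u_def[symmetric] w_def[symmetric]
      by (simp only: a_closed uw simp_thms)
  qed
  also have "\<dots> = (I +>\<^bsub>A\<^esub> (d ^^ n) (d a \<otimes>\<^bsub>A\<^esub> b)) \<oplus>\<^bsub>A Quot I\<^esub> (I +>\<^bsub>A\<^esub> (d ^^ n) (a \<otimes>\<^bsub>A\<^esub> d b))"
    by (rule Q.hom_add) auto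
  also have "I +>\<^bsub>A\<^esub> (d ^^ n) (d a \<otimes>\<^bsub>A\<^esub> b) = (\<Oplus>\<^bsub>A Quot I\<^esub>k\<in>{..n}. add_pow (A Quot I) (n choose k) (F (Suc n - k) k))"
    unfolding Suc.IH[OF d_facts(1)[OF ab(1)] ab(2)]
  proof (rule Q.S.finsum_cong')
    fix k assume "k \<in> {..n}"
    then have "(d ^^ (n - k)) (d a) = (d ^^ (Suc n - k)) a"
      by (simp add: Suc_diff_le funpow_swap1)
    then show "add_pow (A Quot I) (n choose k) ((I +>\<^bsub>A\<^esub> (d ^^ (n - k)) (d a)) \<otimes>\<^bsub>A Quot I\<^esub> (I +>\<^bsub>A\<^esub> (d ^^ k) b)) =
      add_pow (A Quot I) (n choose k) (F (Suc n - k) k)"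
      unfolding F_def by simp
  qed (use F Q.S.add.nat_pow_closed in auto)
  also have "I +>\<^bsub>A\<^esub> (d ^^ n) (a \<otimes>\<^bsub>A\<^esub> d b) = (\<Oplus>\<^bsub>A Quot I\<^esub>k\<in>{..n}. add_pow (A Quot I) (n choose k) (F (n - k) (Suc k)))"
    unfolding Suc.IH[OF ab(1) d_facts(1)[OF ab(2)]]
  proof (rule Q.S.finsum_cong')
    fix k assume "k \<in> {..n}"
    have "(d ^^ k) (d b) = (d ^^ Suc k) b" by (simp add: funpow_swap1)
    then show "add_pow (A Quot I) (n choose k) ((I +>\<^bsub>A\<^esub> (d ^^ (n - k)) a) \<otimes>\<^bsub>A Quot I\<^esub> (I +>\<^bsub>A\<^esub> (d ^^ k) (d b))) =
      add_pow (A Quot I) (n choose k) (F (n - k) (Suc k))"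
      unfolding F_def by (simp only:)
  qed (use F Q.S.add.nat_pow_closed in auto)
  finally show ?case using Q.S.pascal_sum[of F n, OF F] unfolding F_def by (rule trans)
qed

lemma dpow_p: "a \<in> carrier A \<Longrightarrow> (d ^^ p) a \<in> I"
proof -
  interpret I: ideal I A by (rule I_ideal)
  interpret Q: ring_hom_cring A "A Quot I" "(+>\<^bsub>A\<^esub>) I" by (rule I.rcos_ring_hom_cring[OF A_cring])
  let ?D = "\<lambda>a. I +>\<^bsub>A\<^esub> (d ^^ p) a"
  have z: "I +>\<^bsub>A\<^esub> a = \<zero>\<^bsub>A Quot I\<^esub> \<longleftrightarrow> a \<in> I" if "a \<in> carrier A" for a
  proof -
    have "I +>\<^bsub>A\<^esub> a = I +>\<^bsub>A\<^esub> \<zero>\<^bsub>A\<^esub> \<longleftrightarrow> a \<in> I"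
      using I.coset_eq_iff[OF that zero_closed] that by (simp add: a_minus_def del: Q.hom_zero)
    then show ?thesis by (simp only: Q.hom_zero)
  qed
  have p2: "2 \<le> p" using prime_ge_2_nat[OF p] .
  have pz: "add_pow (A Quot I) (p choose k) u = \<zero>\<^bsub>A Quot I\<^esub>"
    if "k \<in> {1..p-1}" and u: "u \<in> carrier (A Quot I)" for k u
  proof -
    have k: "0 < k" "k < p" using that by auto
    have "add_pow (A Quot I) p \<one>\<^bsub>A Quot I\<^esub> = I +>\<^bsub>A\<^esub> \<pi>" unfolding \<pi>_def by (simp add: Q.hom_add_pow)
    also have "\<dots> = \<zero>\<^bsub>A Quot I\<^esub>" using z[OF A_pi] pi_I by simp
    finally have 0: "add_pow (A Quot I) p v = \<zero>\<^bsub>A Quot I\<^esub>" if "v \<in> carrier (A Quot I)" for v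
      using Q.S.add_pow_one[OF that, of p] that by simp
    have "add_pow (A Quot I) (p * ((p choose k) div p)) u = \<zero>\<^bsub>A Quot I\<^esub>"
      using Q.S.add.nat_pow_pow[OF u, of "(p choose k) div p" p] Q.S.add.nat_pow_one[of "(p choose k) div p"]
      unfolding 0[OF u] by simp
    then show ?thesis using p_times_choose_div[OF p k] by simp
  qed
  have "?D a = \<zero>\<^bsub>A Quot I\<^esub>" if "a \<in> carrier A" for a
  proof (rule derivation_zero[OF I_ideal Q.ring_hom_cring_axioms, where m=1 and D="?D"])
    show "I +>\<^bsub>A\<^esub> a = \<zero>\<^bsub>A Quot I\<^esub>" if "a \<in> Ip 1" for a
      using that z[of a] Ip_carrier[OF that] by (simp add: ideal_prod_one[OF I_ideal])
    fix a b assume ab [simp]: "a \<in> carrier A" "b \<in> carrier A"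
    show "?D a \<in> carrier (A Quot I)" by (rule Q.hom_closed) simp
    show "?D (a \<oplus>\<^bsub>A\<^esub> b) = ?D a \<oplus>\<^bsub>A Quot I\<^esub> ?D b" by (simp add: dpow_add)
    let ?f = "\<lambda>k. add_pow (A Quot I) (p choose k) ((I +>\<^bsub>A\<^esub> (d ^^ (p - k)) a) \<otimes>\<^bsub>A Quot I\<^esub> (I +>\<^bsub>A\<^esub> (d ^^ k) b))"
    have fc: "?f k \<in> carrier (A Quot I)" for k
      by (intro Q.S.add.nat_pow_closed Q.S.m_closed Q.hom_closed) auto
    have "{..p} = insert 0 (insert p {1..p-1})" using p2 by auto
    then have "?D (a \<otimes>\<^bsub>A\<^esub> b) = (\<Oplus>\<^bsub>A Quot I\<^esub>k\<in>insert 0 (insert p {1..p-1}). ?f k)"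
      unfolding leibniz_mod[OF ab] by simp
    also have "\<dots> = ?f 0 \<oplus>\<^bsub>A Quot I\<^esub> (?f p \<oplus>\<^bsub>A Quot I\<^esub> (\<Oplus>\<^bsub>A Quot I\<^esub>k\<in>{1..p-1}. ?f k))"
      using p2 fc by (subst Q.S.finsum_insert, simp, simp, simp, simp)+ simp
    also have "(\<Oplus>\<^bsub>A Quot I\<^esub>k\<in>{1..p-1}. ?f k) = \<zero>\<^bsub>A Quot I\<^esub>"
      by (rule Q.S.add.finprod_one_eqI, rule pz) (auto intro!: Q.S.m_closed Q.hom_closed)
    finally show "?D (a \<otimes>\<^bsub>A\<^esub> b) = (I +>\<^bsub>A\<^esub> a) \<otimes>\<^bsub>A Quot I\<^esub> ?D b \<oplus>\<^bsub>A Quot I\<^esub> ?D a \<otimes>\<^bsub>A Quot I\<^esub> (I +>\<^bsub>A\<^esub> b)"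
      using Q.S.a_comm[of "?D a \<otimes>\<^bsub>A Quot I\<^esub> (I +>\<^bsub>A\<^esub> b)" "(I +>\<^bsub>A\<^esub> a) \<otimes>\<^bsub>A Quot I\<^esub> ?D b"] by simp
  next
    fix r assume r: "r \<in> carrier R"
    have "(d ^^ p) (h r) = (d ^^ (p - 1)) (d (h r))"
      using p2 by (metis Suc_pred' funpow_Suc_right o_apply less_le_trans zero_less_numeral)
    then show "?D (h r) = \<zero>\<^bsub>A Quot I\<^esub>" by (simp add: d_h[OF r] dpow_0)
  next
    \<comment> \<open>Already the second derivative of the coordinate vanishes, and \<open>p\<close>
      is at least 2.\<close>
    have "p = Suc (Suc (p - 2))" using p2 by simp
    then have "(d ^^ p) x = (d ^^ (p - 2)) (d (d x))"
      by (metis funpow_Suc_right o_apply)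
    then show "?D x = \<zero>\<^bsub>A Quot I\<^esub>" by (simp add: d_facts(5) d_1 dpow_0)
  qed (rule that)
  then show "a \<in> carrier A \<Longrightarrow> (d ^^ p) a \<in> I" using z by simp
qed

text \<open>A block of \<open>p\<close> derivatives raises the adic order by at least one and single
  derivatives never lower it, so \<open>n * p\<close> of them reach the \<open>n\<close>-th
  power.\<close>

lemma dpow_null: "a \<in> carrier A \<Longrightarrow> \<exists>K. \<forall>k\<ge>K. (d ^^ k) a \<in> Ip n"
proof -
  assume a: "a \<in> carrier A"
  have 1: "(d ^^ p) b \<in> Ip (m + 1)" if "b \<in> Ip m" for b m
    by (rule dpow_shift[OF _ that]) (use dpow_p in \<open>simp add: ideal_prod_one[OF I_ideal]\<close>)
  have m: "(d ^^ (m * p)) a \<in> Ip m" for m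
  proof (induction m)
    case (Suc m)
    have "(d ^^ (Suc m * p)) a = (d ^^ p) ((d ^^ (m * p)) a)" by (simp add: funpow_add)
    then show ?case using 1[OF Suc] by simp
  qed (use a in simp)
  then have "(d ^^ k) a \<in> Ip n" if "k \<ge> n * p" for k
  proof -
    have "(d ^^ k) a = (d ^^ (k - n * p)) ((d ^^ (n * p)) a)"
      using that by (metis funpow_add le_add_diff_inverse2 o_apply)
    then show ?thesis using d_Ip[OF m[of n], of "k - n * p"] by simp
  qed
  then show ?thesis by blast
qed

text \<open>The map \<open>a \<mapsto> a + \<partial>(a) \<zeta>\<close> to \<open>A[\<zeta>]/(\<zeta>\<^sup>2 - (q - 1)x\<zeta>)\<close> commutes with \<open>\<delta>\<close>: the defect is a twisted
  derivation, so it is divisible by all powers of \<open>(p, q - 1)\<close>.\<close>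

definition "ex = t \<otimes>\<^bsub>A\<^esub> x"
definition "ux = qtwist p A (qel A) x"
definition "cx = frob_defect_div p A ex x \<one>\<^bsub>A\<^esub>"
definition "rhs a = (ux \<otimes>\<^bsub>A\<^esub> delta A (d a) \<oplus>\<^bsub>A\<^esub> cx \<otimes>\<^bsub>A\<^esub> d a [^]\<^bsub>A\<^esub> p) \<ominus>\<^bsub>A\<^esub> frob_defect_div p A ex a (d a)"

lemma ex_closed [simp]: "ex \<in> carrier A" unfolding ex_def by simp

lemma ux_closed [simp]: "ux \<in> carrier A" unfolding ux_def qtwist_def by simp

lemma cx_closed [simp]: "cx \<in> carrier A" unfolding cx_def by simp

lemma rhs_closed [simp]: "a \<in> carrier A \<Longrightarrow> rhs a \<in> carrier A" unfolding rhs_def by simp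

definition "defect a = d (delta A a) \<ominus>\<^bsub>A\<^esub> rhs a"

lemma defect_closed [simp]: "a \<in> carrier A \<Longrightarrow> defect a \<in> carrier A" unfolding defect_def by simp

definition "phi a = a [^]\<^bsub>A\<^esub> p \<oplus>\<^bsub>A\<^esub> add_pow A p (delta A a)"

lemma phi_hom: "ring_hom_cring A A phi" unfolding phi_def by (rule frob_hom[OF A_delta p])

text \<open>The defect is the \<zeta>-component of the failure of \<open>F\<close>, the ring map
  \<open>a \<mapsto> a + d a \<zeta>\<close>, to commute with \<delta>; the other component is zero.
  The sum and product rules are those of such a failure for an arbitrary ring map.\<close>

lemma defect_facts:
  shows "a \<in> carrier A \<Longrightarrow> b \<in> carrier A \<Longrightarrow> defect (a \<oplus>\<^bsub>A\<^esub> b) = defect a \<oplus>\<^bsub>A\<^esub> defect b"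
    and "a \<in> carrier A \<Longrightarrow> b \<in> carrier A \<Longrightarrow> defect (a \<otimes>\<^bsub>A\<^esub> b) =
      \<sigma> (phi a) \<otimes>\<^bsub>A\<^esub> defect b \<oplus>\<^bsub>A\<^esub> defect a \<otimes>\<^bsub>A\<^esub> (\<sigma> (phi b) \<ominus>\<^bsub>A\<^esub> \<pi> \<otimes>\<^bsub>A\<^esub> (ex \<otimes>\<^bsub>A\<^esub> defect b))"
    and "r \<in> carrier R \<Longrightarrow> defect (h r) = \<zero>\<^bsub>A\<^esub>" and "defect x = \<zero>\<^bsub>A\<^esub>"
proof -
  interpret du: dual_cring A ex by unfold_locales simp
  interpret phi: ring_hom_cring A A phi by (rule phi_hom)
  define F where "F a = (a, d a)" for a
  let ?D = "dual_delta p A (delta A) ex cx ux"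
  have Z: "is_delta p du.Z ?D"
  proof (rule du.is_delta_dual[OF A_delta cx_closed _ _ p])
    show "delta A ex = cx \<otimes>\<^bsub>A\<^esub> ex"
      using delta_eta[OF A_delta A_q(1) xA A_q(2) Dx p] unfolding ex_def cx_def .
    show "ux = ex [^]\<^bsub>A\<^esub> (p - 1) \<oplus>\<^bsub>A\<^esub> add_pow A p cx"
      using qtwist_expand[OF A_q(1) xA p] unfolding ex_def cx_def ux_def .
  qed
  have F: "ring_hom_cring A du.Z F"
  proof (rule ring_hom_cringI[OF A_cring du.Z.is_cring], rule ring_hom_memI)
    fix a b assume [simp]: "a \<in> carrier A" "b \<in> carrier A"
    show "F (a \<otimes>\<^bsub>A\<^esub> b) = F a \<otimes>\<^bsub>du.Z\<^esub> F b"
      unfolding F_def by (simp add: d_facts(4) sigma_eq ex_def l_distr m_assoc a_ac)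
  qed (auto simp: F_def d_facts d_1)
  interpret F: ring_hom_cring A du.Z F by (rule F)
  have DF: "?D (F a) = (delta A a, rhs a)" for a unfolding F_def dual_delta_def rhs_def by simp
  have df: "F (delta A a) \<ominus>\<^bsub>du.Z\<^esub> ?D (F a) = (\<zero>\<^bsub>A\<^esub>, defect a)" if "a \<in> carrier A" for a
    unfolding DF F_def[of "delta A a"] defect_def using that r_right_minus_eq[of "delta A a" "delta A a"] by simp
  show "defect (a \<oplus>\<^bsub>A\<^esub> b) = defect a \<oplus>\<^bsub>A\<^esub> defect b" if [simp]: "a \<in> carrier A" "b \<in> carrier A"
  proof -
    define P fa fb ga gb where "P = frob_defect p du.Z (F a) (F b)" and "fa = F (delta A a)" and "fb = F (delta A b)"
      and "ga = ?D (F a)" and "gb = ?D (F b)"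
    have cl: "P \<in> carrier du.Z" "fa \<in> carrier du.Z" "fb \<in> carrier du.Z" "ga \<in> carrier du.Z" "gb \<in> carrier du.Z"
      unfolding P_def fa_def fb_def ga_def gb_def
      by (rule du.Z.frob_defect_closed F.hom_closed is_delta_closed[OF Z] D_closed that)+
    have "F (delta A (a \<oplus>\<^bsub>A\<^esub> b)) = (fa \<oplus>\<^bsub>du.Z\<^esub> fb) \<ominus>\<^bsub>du.Z\<^esub> P"
      unfolding is_delta_add[OF A_delta that] P_def fa_def fb_def
      by (simp only: F.hom_sub F.hom_add F.hom_frob_defect that D_closed a_closed frob_defect_closed)
    moreover have "?D (F (a \<oplus>\<^bsub>A\<^esub> b)) = (ga \<oplus>\<^bsub>du.Z\<^esub> gb) \<ominus>\<^bsub>du.Z\<^esub> P"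
      unfolding F.hom_add[OF that] is_delta_add[OF Z F.hom_closed[OF that(1)] F.hom_closed[OF that(2)]] P_def ga_def gb_def ..
    moreover have "((fa \<oplus>\<^bsub>du.Z\<^esub> fb) \<ominus>\<^bsub>du.Z\<^esub> P) \<ominus>\<^bsub>du.Z\<^esub> ((ga \<oplus>\<^bsub>du.Z\<^esub> gb) \<ominus>\<^bsub>du.Z\<^esub> P) =
      (fa \<ominus>\<^bsub>du.Z\<^esub> ga) \<oplus>\<^bsub>du.Z\<^esub> (fb \<ominus>\<^bsub>du.Z\<^esub> gb)"
      by (rule du.Z.ring_eqI[of _ "[fa,fb,ga,gb,P]"], (rule du.Z.reify)+, code_simp, simp only: du.Z.carrier_list cl)
    ultimately have "(\<zero>\<^bsub>A\<^esub>, defect (a \<oplus>\<^bsub>A\<^esub> b)) = (\<zero>\<^bsub>A\<^esub>, defect a) \<oplus>\<^bsub>du.Z\<^esub> (\<zero>\<^bsub>A\<^esub>, defect b)"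
      using df[OF a_closed[OF that]] df[OF that(1)] df[OF that(2)] unfolding fa_def fb_def ga_def gb_def by simp
    then show ?thesis by simp
  qed
  show "defect (a \<otimes>\<^bsub>A\<^esub> b) =
      \<sigma> (phi a) \<otimes>\<^bsub>A\<^esub> defect b \<oplus>\<^bsub>A\<^esub> defect a \<otimes>\<^bsub>A\<^esub> (\<sigma> (phi b) \<ominus>\<^bsub>A\<^esub> \<pi> \<otimes>\<^bsub>A\<^esub> (ex \<otimes>\<^bsub>A\<^esub> defect b))"
    if ab [simp]: "a \<in> carrier A" "b \<in> carrier A"
  proof -
    have phi [simp]: "phi a \<in> carrier A" "phi b \<in> carrier A" by simp_all
    define u v w w' g g' where "u = phi a" and "v = d (phi a)" and "w = phi b" and "w' = d (phi b)"
      and "g = defect a" and "g' = defect b"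
    have cl [simp]: "u \<in> carrier A" "v \<in> carrier A" "w \<in> carrier A" "w' \<in> carrier A" "g \<in> carrier A" "g' \<in> carrier A"
      unfolding u_def v_def w_def w'_def g_def g'_def by simp_all
    have "(\<zero>\<^bsub>A\<^esub>, defect (a \<otimes>\<^bsub>A\<^esub> b)) =
      (u, v) \<otimes>\<^bsub>du.Z\<^esub> (\<zero>\<^bsub>A\<^esub>, g') \<oplus>\<^bsub>du.Z\<^esub> (\<zero>\<^bsub>A\<^esub>, g) \<otimes>\<^bsub>du.Z\<^esub> ((w, w') \<ominus>\<^bsub>du.Z\<^esub> add_pow du.Z p (\<zero>\<^bsub>A\<^esub>, g'))"
      using F.delta_defect_mult[OF A_delta Z ab] df[OF m_closed[OF ab]] df[OF ab(1)] df[OF ab(2)]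
      unfolding u_def v_def w_def w'_def g_def g'_def phi_def[symmetric] F_def by simp
    moreover have "w \<ominus>\<^bsub>A\<^esub> \<zero>\<^bsub>A\<^esub> = w" by (simp add: a_minus_def)
    ultimately have "defect (a \<otimes>\<^bsub>A\<^esub> b) = (u \<otimes>\<^bsub>A\<^esub> g' \<oplus>\<^bsub>A\<^esub> ex \<otimes>\<^bsub>A\<^esub> (v \<otimes>\<^bsub>A\<^esub> g')) \<oplus>\<^bsub>A\<^esub>
      (g \<otimes>\<^bsub>A\<^esub> w \<oplus>\<^bsub>A\<^esub> ex \<otimes>\<^bsub>A\<^esub> (g \<otimes>\<^bsub>A\<^esub> (w' \<ominus>\<^bsub>A\<^esub> \<pi> \<otimes>\<^bsub>A\<^esub> g')))"
      by (simp add: add_pow_pi)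
    \<comment> \<open>An element \<open>u + v \<zeta>\<close> acts on multiples of \<zeta> through
      its value \<open>u + ex v\<close> at \<zeta> = \<open>ex\<close>, which is \<sigma> of
      \<open>u\<close> when \<open>v\<close> is the derivative of \<open>u\<close>.\<close>
    also have "\<dots> = (u \<oplus>\<^bsub>A\<^esub> ex \<otimes>\<^bsub>A\<^esub> v) \<otimes>\<^bsub>A\<^esub> g' \<oplus>\<^bsub>A\<^esub> g \<otimes>\<^bsub>A\<^esub> ((w \<oplus>\<^bsub>A\<^esub> ex \<otimes>\<^bsub>A\<^esub> w') \<ominus>\<^bsub>A\<^esub> \<pi> \<otimes>\<^bsub>A\<^esub> (ex \<otimes>\<^bsub>A\<^esub> g'))"
      by (rule ring_eqI[of _ "[u,v,w,w',g,g',ex,\<pi>]"], (rule reify)+, code_simp, simp add: carrier_list)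
    finally show ?thesis
      unfolding sigma_eq[OF phi(1)] sigma_eq[OF phi(2)] ex_def[symmetric] u_def v_def w_def w'_def g_def g'_def .
  qed
  have p0: "0 < p" using prime_gt_0_nat[OF p] .
  show "defect (h r) = \<zero>\<^bsub>A\<^esub>" if r: "r \<in> carrier R"
  proof -
    have "d (delta A (h r)) = \<zero>\<^bsub>A\<^esub>"
      using d_h[OF is_delta_closed[OF R_delta r]] h_delta[OF r] by simp
    then show ?thesis
      unfolding defect_def rhs_def using r p0 is_delta_zero[OF A_delta]
      by (simp add: d_h nat_pow_zero a_minus_def)
  qed
  show "defect x = \<zero>\<^bsub>A\<^esub>"
    unfolding defect_def rhs_def cx_def[symmetric] d_facts(5) Dx d_0 is_delta_one[OF A_delta]
    using r_right_minus_eq[of cx cx] by (simp add: a_minus_def)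
qed

lemma sigma_phi_Ip: "a \<in> Ip n \<Longrightarrow> \<sigma> (phi a) \<in> Ip n"
proof -
  interpret phi: ring_hom_cring A A phi by (rule phi_hom)
  interpret I: ideal I A by (rule I_ideal)
  have 1: "phi a \<in> I" if "a \<in> I" for a
    using that I.Icarr[OF that] prime_gt_0_nat[OF p] I.I_r_closed[OF pi_I, of "delta A a"]
    unfolding phi_def by (intro I.a_closed I.I_pow) (auto simp: add_pow_pi)
  have 2: "\<sigma> a \<in> I" if "a \<in> I" for a
    unfolding sigma_eq[OF I.Icarr[OF that]]
    by (intro I.a_closed that I.I_r_closed t_I) (use I.Icarr[OF that] in auto)
  have "ring_hom_cring A A (\<lambda>a. \<sigma> (phi a))"
    by (rule ring_hom_cringI[OF A_cring A_cring], rule ring_hom_memI) auto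
  then show "a \<in> Ip n \<Longrightarrow> \<sigma> (phi a) \<in> Ip n"
    by (rule ideal_pow_image[OF _ I_ideal I_ideal]) (use 1 2 in auto)
qed

text \<open>The product rule differs from that of a derivation by a term with a factor
  \<open>p\<close> and two defects. If all defects lie in \<open>I^n\<close>, this term lies in
  \<open>I^(n+1)\<close>, so modulo \<open>I^(n+1)\<close> the defect is a derivation along
  \<sigma>\<phi> that kills \<open>R\<close> and \<open>x\<close>.\<close>

lemma defect_Ip: "a \<in> carrier A \<Longrightarrow> defect a \<in> Ip n"
proof (induction n arbitrary: a)
  case (Suc n)
  interpret phi: ring_hom_cring A A phi by (rule phi_hom)
  interpret K: ideal "Ip (Suc n)" A by (rule Ip_ideal)
  let ?K = "Ip (Suc n)"
  interpret Q: ring_hom_cring A "A Quot ?K" "(+>\<^bsub>A\<^esub>) ?K" by (rule K.rcos_ring_hom_cring[OF A_cring])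
  have z: "?K +>\<^bsub>A\<^esub> a = \<zero>\<^bsub>A Quot ?K\<^esub> \<longleftrightarrow> a \<in> ?K" if "a \<in> carrier A" for a
  proof -
    have "?K +>\<^bsub>A\<^esub> a = ?K +>\<^bsub>A\<^esub> \<zero>\<^bsub>A\<^esub> \<longleftrightarrow> a \<in> ?K"
      using K.coset_eq_iff[OF that zero_closed] that by (simp only: a_minus_def minus_zero r_zero)
    then show ?thesis by (simp only: Q.hom_zero)
  qed
  have sc: "\<sigma> (phi a) \<in> carrier A" if "a \<in> carrier A" for a using that by simp
  have "?K +>\<^bsub>A\<^esub> defect a = \<zero>\<^bsub>A Quot ?K\<^esub>"
  proof (rule derivation_zero[OF Ip_ideal, where m="Suc n" and D="\<lambda>a. ?K +>\<^bsub>A\<^esub> defect a" and \<psi>="\<lambda>a. ?K +>\<^bsub>A\<^esub> \<sigma> (phi a)"])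
    show "ring_hom_cring A (A Quot ?K) (\<lambda>a. ?K +>\<^bsub>A\<^esub> \<sigma> (phi a))"
      by (rule ring_hom_cringI[OF A_cring Q.S.is_cring], rule ring_hom_memI)
        (simp_all only: phi.hom_closed \<sigma>.hom_closed Q.hom_closed phi.hom_mult phi.hom_add phi.hom_one
          \<sigma>.hom_mult \<sigma>.hom_add \<sigma>.hom_one Q.hom_mult Q.hom_add Q.hom_one)
    show "?K +>\<^bsub>A\<^esub> \<sigma> (phi a) = \<zero>\<^bsub>A Quot ?K\<^esub>" if "a \<in> ?K" for a
      using z[OF sc[OF Ip_carrier[OF that]]] sigma_phi_Ip[OF that] by (simp only:)
    fix a b assume ab: "a \<in> carrier A" "b \<in> carrier A"
    show "?K +>\<^bsub>A\<^esub> defect a \<in> carrier (A Quot ?K)" by (rule Q.hom_closed, rule defect_closed, rule ab)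
    show "?K +>\<^bsub>A\<^esub> defect (a \<oplus>\<^bsub>A\<^esub> b) = (?K +>\<^bsub>A\<^esub> defect a) \<oplus>\<^bsub>A Quot ?K\<^esub> (?K +>\<^bsub>A\<^esub> defect b)"
      unfolding defect_facts(1)[OF ab] by (rule Q.hom_add; rule defect_closed, rule ab)
    define e where "e = defect a \<otimes>\<^bsub>A\<^esub> (\<pi> \<otimes>\<^bsub>A\<^esub> (ex \<otimes>\<^bsub>A\<^esub> defect b))"
    have dc [simp]: "defect a \<in> carrier A" "defect b \<in> carrier A" "\<sigma> (phi a) \<in> carrier A" "\<sigma> (phi b) \<in> carrier A"
      using ab by simp_all
    have e: "e \<in> ?K"
    proof -
      have "\<pi> \<otimes>\<^bsub>A\<^esub> defect a \<in> ?K" using ideal_prod.prod[OF pi_I Suc.IH[OF ab(1)]] by simp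
      then have "(\<pi> \<otimes>\<^bsub>A\<^esub> defect a) \<otimes>\<^bsub>A\<^esub> (ex \<otimes>\<^bsub>A\<^esub> defect b) \<in> ?K"
        by (rule K.I_r_closed) simp
      then show ?thesis unfolding e_def by (simp only: m_ac A_pi dc ex_closed m_closed)
    qed
    define u w g g' where "u = \<sigma> (phi a)" and "w = \<sigma> (phi b)" and "g = defect a" and "g' = defect b"
    have [simp]: "u \<in> carrier A" "w \<in> carrier A" "g \<in> carrier A" "g' \<in> carrier A"
      unfolding u_def w_def g_def g'_def by simp_all
    have 1: "defect (a \<otimes>\<^bsub>A\<^esub> b) \<ominus>\<^bsub>A\<^esub> (u \<otimes>\<^bsub>A\<^esub> g' \<oplus>\<^bsub>A\<^esub> g \<otimes>\<^bsub>A\<^esub> w) = \<ominus>\<^bsub>A\<^esub> e"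
      unfolding defect_facts(2)[OF ab] e_def u_def[symmetric] w_def[symmetric] g_def[symmetric] g'_def[symmetric]
      by (rule ring_eqI[of _ "[u,w,g,g',ex,\<pi>]"], (rule reify)+, code_simp, simp add: carrier_list)
    have "?K +>\<^bsub>A\<^esub> defect (a \<otimes>\<^bsub>A\<^esub> b) = ?K +>\<^bsub>A\<^esub> (u \<otimes>\<^bsub>A\<^esub> g' \<oplus>\<^bsub>A\<^esub> g \<otimes>\<^bsub>A\<^esub> w)"
      using K.coset_eq_iff[of "defect (a \<otimes>\<^bsub>A\<^esub> b)" "u \<otimes>\<^bsub>A\<^esub> g' \<oplus>\<^bsub>A\<^esub> g \<otimes>\<^bsub>A\<^esub> w"] ab K.a_inv_closed[OF e]
      unfolding 1 by (simp only: defect_closed m_closed a_closed \<open>u \<in> _\<close> \<open>w \<in> _\<close> \<open>g \<in> _\<close> \<open>g' \<in> _\<close> simp_thms)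
    also have "\<dots> = (?K +>\<^bsub>A\<^esub> u) \<otimes>\<^bsub>A Quot ?K\<^esub> (?K +>\<^bsub>A\<^esub> g') \<oplus>\<^bsub>A Quot ?K\<^esub> (?K +>\<^bsub>A\<^esub> g) \<otimes>\<^bsub>A Quot ?K\<^esub> (?K +>\<^bsub>A\<^esub> w)"
      by (simp only: Q.hom_add Q.hom_mult m_closed \<open>u \<in> _\<close> \<open>w \<in> _\<close> \<open>g \<in> _\<close> \<open>g' \<in> _\<close>)
    finally show "?K +>\<^bsub>A\<^esub> defect (a \<otimes>\<^bsub>A\<^esub> b) = (?K +>\<^bsub>A\<^esub> \<sigma> (phi a)) \<otimes>\<^bsub>A Quot ?K\<^esub> (?K +>\<^bsub>A\<^esub> defect b)
      \<oplus>\<^bsub>A Quot ?K\<^esub> (?K +>\<^bsub>A\<^esub> defect a) \<otimes>\<^bsub>A Quot ?K\<^esub> (?K +>\<^bsub>A\<^esub> \<sigma> (phi b))"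
      unfolding u_def w_def g_def g'_def .
  next
    show "?K +>\<^bsub>A\<^esub> defect (h r) = \<zero>\<^bsub>A Quot ?K\<^esub>" if "r \<in> carrier R" for r
      unfolding defect_facts(3)[OF that] by (rule Q.hom_zero)
    show "?K +>\<^bsub>A\<^esub> defect x = \<zero>\<^bsub>A Quot ?K\<^esub>"
      unfolding defect_facts(4) by (rule Q.hom_zero)
  qed (rule Suc.prems)
  then show ?case using z[OF defect_closed[OF Suc.prems]] by (simp only:)
qed simp

theorem qderiv_pair: "qderiv_pair p A x d"
proof (unfold_locales)
  fix a assume a: "a \<in> carrier A"
  have "defect a = \<zero>\<^bsub>A\<^esub>" by (rule complete_zero) (use a defect_Ip in auto)
  then have "d (delta A a) = rhs a"
    unfolding defect_def using a r_right_minus_eq[of "d (delta A a)" "rhs a"] by simp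
  then show "d (delta A a) = (qtwist p A (qel A) x \<otimes>\<^bsub>A\<^esub> delta A (d a) \<oplus>\<^bsub>A\<^esub>
       frob_defect_div p A (t \<otimes>\<^bsub>A\<^esub> x) x \<one>\<^bsub>A\<^esub> \<otimes>\<^bsub>A\<^esub> d a [^]\<^bsub>A\<^esub> p) \<ominus>\<^bsub>A\<^esub>
      frob_defect_div p A (t \<otimes>\<^bsub>A\<^esub> x) a (d a)"
    unfolding rhs_def ux_def cx_def ex_def .
qed (auto simp: d_facts(1-3) d_facts(5) d_1 d_qel dpow_null, auto simp: d_facts(4) sigma_eq)

end

section \<open>Arrows of the q-crystalline site\<close>

lemma (in coord_pair) dpair_hom_iota: "iota \<in> dpair_hom A B" and dpair_hom_aug: "aug \<in> dpair_hom B A"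
proof -
  have "aug (qel B) = qel A" unfolding iota_q[symmetric] by simp
  then show "iota \<in> dpair_hom A B" "aug \<in> dpair_hom B A"
    unfolding dpair_hom_def using iota.homh aug.homh ideal.Icarr[OF A_ideal]
    by (auto simp: delta_iota delta_aug iota_q pd_B)
qed

lemma (in qderiv_pair) dpair_hom_f1: "f1 \<in> dpair_hom A B"
proof -
  interpret f1: ring_hom_cring A B f1 by (rule f1_hom)
  show ?thesis
    unfolding dpair_hom_def using f1.homh ideal.Icarr[OF A_ideal] f1.hom_closed
    by (auto simp: delta_f1 f1_q pd_B)
qed

text \<open>Functoriality of the ring of null sequences in the pair together with its coordinate, by
  applying \<open>f\<close> to all coefficients. It will be used for the Taylor map, which takes
  \<open>x\<close> to the second coordinate \<open>y\<close>.\<close>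

locale coord_hom = coord_pair p A x + V: coord_pair p A' x' for p and A :: "'a dpair" and x and A' :: "'a dpair" and x' +
  fixes f
  assumes f: "f \<in> dpair_hom A A'" and fx: "f x = x'"
begin

lemma f_hom: "ring_hom_cring A A' f"
  by (rule ring_hom_cringI[OF is_cring V.is_cring]) (use f in \<open>simp add: dpair_hom_def\<close>)

sublocale f: ring_hom_cring A A' f by (rule f_hom)

lemma f_q: "f (qel A) = qel A'" and f_delta: "a \<in> carrier A \<Longrightarrow> f (delta A a) = delta A' (f a)"
  and f_pd: "a \<in> pd_ideal A \<Longrightarrow> f a \<in> pd_ideal A'"
  using f unfolding dpair_hom_def by auto

lemma f_t: "f t = V.t"
  using f.hom_sub[of "qel A" "\<one>\<^bsub>A\<^esub>"] by (simp add: f_q)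

lemma f_Ip: "a \<in> Ip n \<Longrightarrow> f a \<in> V.Ip n"
proof -
  have "I \<subseteq> {a \<in> carrier A. f a \<in> V.I}"
    unfolding I_eq
  proof (rule genideal_minimal[OF ring_hom_ring.ideal_vimage[OF f.hom_ring V.I_ideal]])
    have "f \<pi> = V.\<pi>" unfolding \<pi>_def V.\<pi>_def by (simp add: f.hom_add_pow)
    then show "{\<pi>, t} \<subseteq> {a \<in> carrier A. f a \<in> V.I}"
      using f_t V.pi_I V.t_I by auto
  qed
  then have "f ` I \<subseteq> V.I" by auto
  then show "a \<in> Ip n \<Longrightarrow> f a \<in> V.Ip n" by (rule ideal_pow_image[OF f_hom I_ideal V.I_ideal])
qed

definition fs where "fs g = (\<lambda>k :: nat. f (g k))"

lemma fs_closed [simp]: "g \<in> carrier H \<Longrightarrow> fs g \<in> carrier V.H"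
  by (rule V.H_I) (simp add: fs_def)

lemma fs_shift: "fs (ts_shift g) = ts_shift (fs g)"
  by (simp add: fs_def ts_shift_def fun_eq_iff)

lemma fs_S: "g \<in> carrier H \<Longrightarrow> fs (S g) = V.S (fs g)"
  by (rule ext) (simp add: fs_def ts_sigma_def f_t f_q fx f.hom_pow)

lemma fs_const: "fs (ts_const A a) = ts_const A' (f a)" and fs_coord: "fs (ts_coord A x) = ts_coord A' x'"
  by (auto simp: fs_def ts_const_def ts_coord_def fx)

lemma fs_mlt: "g \<in> carrier H \<Longrightarrow> g' \<in> carrier H \<Longrightarrow> fs (mlt g g') k = V.mlt (fs g) (fs g') k"
proof (induction k arbitrary: g g')
  case (Suc k)
  then have "fs (mlt g g') (Suc k) = fs (mlt (ts_shift g) g') k \<oplus>\<^bsub>A'\<^esub> fs (mlt (S g) (ts_shift g')) k"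
    by (simp add: fs_def)
  then show ?case using Suc by (simp add: fs_shift fs_S)
qed (simp add: fs_def)

lemma fs_hom: "ring_hom_cring H V.H fs"
  by (rule ring_hom_cringI[OF cring_H V.cring_H], rule ring_hom_memI)
    (auto simp: fs_mlt fs_const fun_eq_iff, auto simp: fs_def ad_def V.ad_def)

lemma fs_L: "w \<in> carrier H \<Longrightarrow> g \<in> carrier H \<Longrightarrow> fs (L w g) = V.L (fs w) (fs g)"
proof -
  assume [simp]: "w \<in> carrier H" "g \<in> carrier H"
  interpret fs: ring_hom_cring H V.H fs by (rule fs_hom)
  have e: "fs eta = V.eta"
    unfolding eta_def V.eta_def
    by (simp only: fs.hom_mult fs.hom_sub fs.hom_one H.minus_closed const_closed coord_closed H.one_closed
        fs_const fs_coord f_q q)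
  have "fs uu = V.uu" unfolding uu_def V.uu_def by (simp add: fs.hom_qtwist fs_const fs_coord f_q)
  moreover have "fs cc = V.cc"
    unfolding cc_def V.cc_def by (simp add: fs.hom_frob_defect_div e fs_coord fs_const)
  ultimately show ?thesis unfolding L_def V.L_def
    by (simp add: fs.hom_sub fs.hom_frob_defect_div e fs_shift del: H_simps V.H_simps)
qed

lemma fs_del: "g \<in> carrier H \<Longrightarrow> fs (del g) = V.del (fs g)"
proof
  fix k assume "g \<in> carrier H"
  have "\<forall>j\<le>k. fs (del g) j = V.del (fs g) j" if "g \<in> carrier H" for g
    using that
  proof (induction k arbitrary: g)
    case 0
    then show ?case by (simp add: del_0 V.del_0 fs_def f_delta)
  next
    case (Suc k)
    note [simp] = Suc.prems
    have "fs (del g) (Suc k) = fs (L (del (ts_shift g)) g) k"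
      unfolding shift_del[OF Suc.prems, symmetric] by (simp add: fs_def ts_shift_def)
    also have "\<dots> = V.L (fs (del (ts_shift g))) (fs g) k" by (simp add: fs_L)
    also have "\<dots> = V.L (V.del (ts_shift (fs g))) (fs g) k"
      by (rule V.L_cong[where k=k]) (use Suc.IH[of "ts_shift g"] in \<open>auto simp: fs_shift\<close>)
    also have "\<dots> = V.del (fs g) (Suc k)"
      unfolding V.shift_del[OF fs_closed[OF Suc.prems], symmetric] by (simp add: ts_shift_def)
    finally show ?case using Suc.IH[of g] by (auto simp: le_Suc_eq)
  qed
  then show "fs (del g) k = V.del (fs g) k" using \<open>g \<in> carrier H\<close> by auto
qed

lemma fs_nulls: "g \<in> nulls \<Longrightarrow> fs g \<in> V.nulls"
  unfolding ts_nulls_def fs_def using f_Ip f.hom_closed by blast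

definition Hf where "Hf b = seq_code (fs (seq_of b))"

lemma dpair_hom_Hf: "Hf \<in> dpair_hom B V.B"
proof -
  interpret fs: ring_hom_cring H V.H fs by (rule fs_hom)
  have c: "Hf b \<in> carrier V.B" if "b \<in> carrier B" for b
    unfolding Hf_def by (rule V.seq_code_closed[OF fs_nulls[OF seq_of_nulls[OF that]]])
  have "Hf \<in> ring_hom B V.B"
  proof (rule ring_hom_memI)
    fix a b assume ab: "a \<in> carrier B" "b \<in> carrier B"
    show "Hf (a \<otimes>\<^bsub>B\<^esub> b) = Hf a \<otimes>\<^bsub>V.B\<^esub> Hf b" "Hf (a \<oplus>\<^bsub>B\<^esub> b) = Hf a \<oplus>\<^bsub>V.B\<^esub> Hf b"
      using fs.hom_mult[OF seq_of_H[OF ab(1)] seq_of_H[OF ab(2)]] fs.hom_add[OF seq_of_H[OF ab(1)] seq_of_H[OF ab(2)]]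
      unfolding Hf_def B_simps V.B_simps by simp_all
  next
    show "Hf \<one>\<^bsub>B\<^esub> = \<one>\<^bsub>V.B\<^esub>" unfolding Hf_def B_simps V.B_simps by (simp add: fs_const)
  qed (rule c)
  moreover have "Hf (delta B b) = delta V.B (Hf b)" if "b \<in> carrier B" for b
    using that unfolding Hf_def B_simps(6) V.B_simps(6) by (simp add: fs_del)
  moreover have "Hf (qel B) = qel V.B" unfolding Hf_def B_simps V.B_simps by (simp add: fs_const f_q)
  moreover have "Hf b \<in> pd_ideal V.B" if "b \<in> pd_ideal B" for b
    using that c f_pd unfolding pd_B V.pd_B by (simp add: Hf_def aug_def V.aug_def fs_def)
  ultimately show ?thesis unfolding dpair_hom_def by blast
qed

lemma seq_Hf [simp]: "seq_of (Hf b) k = f (seq_of b k)" by (simp add: Hf_def fs_def)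

end

text \<open>A series lies in the ideal of the new pair iff its constant coefficient lies in the
  ideal of the old one, so the two quotients are isomorphic and a coset is lifted by taking its
  preimage.\<close>

definition ts_obj :: "nat \<Rightarrow> 'u qobj \<Rightarrow> 'u \<Rightarrow> 'u qobj" where
  "ts_obj p U x = \<lparr>opair = ts_pair p (opair U) x, ostr = (\<lambda>r. seq_code (ts_const (opair U) (ostr U r))),
     ospf = (\<lambda>c. {b \<in> carrier (ts_pair p (opair U) x). seq_of b 0 \<in> ospf U c})\<rparr>"

lemma qCRIS_obD:
  assumes "U \<in> ob (qCRIS_op p R A0 h)"
  shows "qPD_pair p (opair U)" "bounded_pair p (opair U)" "complete_pair p (opair U)"
    "ostr U \<in> dpair_hom R (opair U)" "ospf U \<in> ring_hom (quot_pair A0) (quot_pair (opair U))"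
    "r \<in> carrier R \<Longrightarrow> ospf U (pd_ideal A0 +>\<^bsub>A0\<^esub> h r) = pd_ideal (opair U) +>\<^bsub>opair U\<^esub> ostr U r"
  using assms unfolding qCRIS_op_def by auto

lemma dpair_hom_comp: "f \<in> dpair_hom A B \<Longrightarrow> g \<in> dpair_hom B C \<Longrightarrow> (\<lambda>a. g (f a)) \<in> dpair_hom A C"
  unfolding dpair_hom_def mem_Collect_eq using ring_hom_trans[of f A B g C] ring_hom_closed[of f A B]
  by (simp add: o_def image_subset_iff)

text \<open>Every coordinate of an object of the site is allowed here, so that the construction
  \<open>B = ts_pair p A x\<close> can be iterated.\<close>

locale site_pt = coord_pair p "opair U" x for p and U :: "'u qobj" and x +
  fixes R A0 :: "'u dpair" and h :: "'u \<Rightarrow> 'u"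
  assumes U: "U \<in> ob (qCRIS_op p R A0 h)"
begin

abbreviation "C \<equiv> qCRIS_op p R A0 h"
abbreviation "A \<equiv> opair U"
abbreviation "HU \<equiv> ts_obj p U x"
abbreviation "J \<equiv> pd_ideal (opair U)"

lemma opair_HU [simp]: "opair HU = B" and ostr_HU: "ostr HU r = iota (ostr U r)"
  and ospf_HU: "ospf HU c = {b \<in> carrier B. aug b \<in> ospf U c}"
  by (simp_all add: ts_obj_def iota_def aug_def)

lemma str_closed: "r \<in> carrier R \<Longrightarrow> ostr U r \<in> carrier A"
  using ring_hom_closed[of "ostr U" R A r] qCRIS_obD(4)[OF U] unfolding dpair_hom_def mem_Collect_eq by simp

lemma spf_subset: "c \<in> carrier (quot_pair A0) \<Longrightarrow> ospf U c \<subseteq> carrier A"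
proof -
  assume "c \<in> carrier (quot_pair A0)"
  then have "ospf U c \<in> carrier (A Quot J)"
    using ring_hom_closed[OF qCRIS_obD(5)[OF U]] unfolding quot_pair_def by simp
  then obtain a where "a \<in> carrier A" "ospf U c = J +>\<^bsub>A\<^esub> a" using ideal.carrier_Quot[OF A_ideal] by auto
  moreover have "J \<subseteq> carrier A" by (rule subsetI) (rule ideal.Icarr[OF A_ideal])
  ultimately show ?thesis by (simp only: a_r_coset_subset_G)
qed

lemma HU_ob: "HU \<in> ob C"
proof -
  interpret J: ideal J A by (rule A_ideal)
  interpret JB: ideal "pd_ideal B" B by (rule ideal_pd_B)
  interpret q: ring_hom_cring B "B Quot pd_ideal B" "(+>\<^bsub>B\<^esub>) (pd_ideal B)"
    by (rule JB.rcos_ring_hom_cring[OF sq.R.is_cring])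
  interpret q': ring_hom_cring A "A Quot J" "(+>\<^bsub>A\<^esub>) J" by (rule J.rcos_ring_hom_cring[OF is_cring])
  \<comment> \<open>The inverse of the isomorphism of quotients induced by \<open>aug\<close>; on
    cosets it is induced by \<open>iota\<close>, which gives the ring map.\<close>
  define \<Phi> where "\<Phi> W = {b \<in> carrier B. aug b \<in> W}" for W
  have \<Phi>: "\<Phi> (J +>\<^bsub>A\<^esub> a) = pd_ideal B +>\<^bsub>B\<^esub> iota a" if a: "a \<in> carrier A" for a
  proof -
    have "b \<in> \<Phi> (J +>\<^bsub>A\<^esub> a) \<longleftrightarrow> b \<in> pd_ideal B +>\<^bsub>B\<^esub> iota a" for b
      unfolding \<Phi>_def JB.mem_coset_iff[OF iota.hom_closed[OF a]] mem_Collect_eq J.mem_coset_iff[OF a]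
      using aug.hom_sub[OF _ iota.hom_closed[OF a], of b] sq.R.minus_closed[OF _ iota.hom_closed[OF a], of b]
      unfolding pd_B using aug.hom_closed[of b] by (cases "b \<in> carrier B") (simp_all del: aug.hom_sub)
    then show ?thesis by blast
  qed
  have "\<Phi> \<in> ring_hom (quot_pair A) (quot_pair B)"
    unfolding quot_pair_def
  proof (rule ring_hom_memI)
    fix V W assume VW: "V \<in> carrier (A Quot J)" "W \<in> carrier (A Quot J)"
    obtain a b where ab: "a \<in> carrier A" "b \<in> carrier A" "V = J +>\<^bsub>A\<^esub> a" "W = J +>\<^bsub>A\<^esub> b"
      using VW J.carrier_Quot by auto
    show "\<Phi> V \<in> carrier (B Quot pd_ideal B)" unfolding ab \<Phi>[OF ab(1)] by (rule q.hom_closed[OF iota.hom_closed[OF ab(1)]])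
    show "\<Phi> (V \<otimes>\<^bsub>A Quot J\<^esub> W) = \<Phi> V \<otimes>\<^bsub>B Quot pd_ideal B\<^esub> \<Phi> W"
      unfolding ab q'.hom_mult[OF ab(1,2), symmetric] \<Phi>[OF ab(1)] \<Phi>[OF ab(2)] \<Phi>[OF m_closed[OF ab(1,2)]]
        iota.hom_mult[OF ab(1,2)]
      by (rule q.hom_mult[OF iota.hom_closed[OF ab(1)] iota.hom_closed[OF ab(2)]])
    show "\<Phi> (V \<oplus>\<^bsub>A Quot J\<^esub> W) = \<Phi> V \<oplus>\<^bsub>B Quot pd_ideal B\<^esub> \<Phi> W"
      unfolding ab q'.hom_add[OF ab(1,2), symmetric] \<Phi>[OF ab(1)] \<Phi>[OF ab(2)] \<Phi>[OF a_closed[OF ab(1,2)]]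
        iota.hom_add[OF ab(1,2)]
      by (rule q.hom_add[OF iota.hom_closed[OF ab(1)] iota.hom_closed[OF ab(2)]])
  next
    show "\<Phi> \<one>\<^bsub>A Quot J\<^esub> = \<one>\<^bsub>B Quot pd_ideal B\<^esub>"
      using \<Phi>[OF one_closed] q.hom_one iota.hom_one q'.hom_one by metis
  qed
  from ring_hom_trans[OF qCRIS_obD(5)[OF U] this]
  have 1: "ospf HU \<in> ring_hom (quot_pair A0) (quot_pair B)"
    by (simp add: o_def \<Phi>_def ospf_HU[abs_def])
  have 2: "ostr HU \<in> dpair_hom R B"
    using dpair_hom_comp[OF qCRIS_obD(4)[OF U] dpair_hom_iota] by (simp add: ostr_HU[abs_def])
  have 3: "ospf HU (pd_ideal A0 +>\<^bsub>A0\<^esub> h r) = pd_ideal B +>\<^bsub>B\<^esub> ostr HU r" if "r \<in> carrier R" for r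
    using \<Phi>[OF str_closed[OF that]] unfolding ospf_HU ostr_HU qCRIS_obD(6)[OF U that] \<Phi>_def .
  show ?thesis
    unfolding qCRIS_op_def using 1 2 3 qPD_B bounded_B complete_B by simp
qed

lemma coord_pair_HU: "coord_pair p (opair HU) yB" using coord_pair_B by simp

lemma site_pt_HU: "site_pt p HU yB R A0 h"
  using coord_pair_HU HU_ob by (simp add: site_pt_def site_pt_axioms_def)

definition "ar_iota = restrict iota (carrier A)"
definition "ar_aug = restrict aug (carrier B)"

lemma dpair_hom_restrict: "f \<in> dpair_hom D E \<Longrightarrow> delta D \<in> carrier D \<rightarrow> carrier D \<Longrightarrow> qel D \<in> carrier D \<Longrightarrow>
    pd_ideal D \<subseteq> carrier D \<Longrightarrow> ring D \<Longrightarrow> restrict f (carrier D) \<in> dpair_hom D E"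
  unfolding dpair_hom_def ring_hom_def
  by (auto simp: Pi_iff ring.ring_simprules monoid.m_closed[OF ring.is_monoid])

lemma arr_iff: "f \<in> arr C V W \<longleftrightarrow> f \<in> dpair_hom (opair V) (opair W) \<and> f \<in> extensional (carrier (opair V)) \<and>
    (\<forall>r\<in>carrier R. f (ostr V r) = ostr W r) \<and> (\<forall>c\<in>carrier (quot_pair A0). f ` ospf V c \<subseteq> ospf W c)"
  by (auto simp: qCRIS_op_def)

lemma restrict_A: "f \<in> dpair_hom A E \<Longrightarrow> restrict f (carrier A) \<in> dpair_hom A E"
  by (rule dpair_hom_restrict) (use is_delta_closed[OF A_delta] A_q ideal.Icarr[OF A_ideal] ring_axioms in auto)

lemma restrict_B: "f \<in> dpair_hom B E \<Longrightarrow> restrict f (carrier B) \<in> dpair_hom B E"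
  by (rule dpair_hom_restrict)
    (use is_delta_closed[OF delta_B] B_q ideal.Icarr[OF ideal_pd_B] sq.R.ring_axioms in auto)

lemma arr_restrict_A:
  assumes "f \<in> dpair_hom A (opair V)" "\<And>r. r \<in> carrier R \<Longrightarrow> f (ostr U r) = ostr V r"
    and "\<And>a c. c \<in> carrier (quot_pair A0) \<Longrightarrow> a \<in> carrier A \<Longrightarrow> a \<in> ospf U c \<Longrightarrow> f a \<in> ospf V c"
  shows "restrict f (carrier A) \<in> arr C U V"
  unfolding arr_iff using assms restrict_A[OF assms(1)] str_closed spf_subset[THEN subsetD] by auto

lemma arr_restrict_B:
  assumes "f \<in> dpair_hom B (opair V)" "\<And>r. r \<in> carrier R \<Longrightarrow> f (iota (ostr U r)) = ostr V r"
    and "\<And>b c. c \<in> carrier (quot_pair A0) \<Longrightarrow> b \<in> carrier B \<Longrightarrow> aug b \<in> ospf U c \<Longrightarrow> f b \<in> ospf V c"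
  shows "restrict f (carrier B) \<in> arr C HU V"
  unfolding arr_iff using assms restrict_B[OF assms(1)] str_closed by (auto simp: ospf_HU ostr_HU)

lemma ar_iota: "ar_iota \<in> arr C U HU"
  unfolding ar_iota_def by (rule arr_restrict_A) (use dpair_hom_iota in \<open>auto simp: ostr_HU ospf_HU\<close>)

lemma ar_aug: "ar_aug \<in> arr C HU U"
  unfolding ar_aug_def by (rule arr_restrict_B) (use dpair_hom_aug in auto)

end

locale site_qderiv = site_pt p U x R A0 h + qderiv_pair p "opair U" x d for p U x R A0 h d +
  assumes d_str: "r \<in> carrier R \<Longrightarrow> d (ostr U r) = \<zero>\<^bsub>opair U\<^esub>"
begin

definition "ar_f1 = restrict f1 (carrier A)"

text \<open>The derivation kills the image of \<open>R\<close>, so the Taylor map agrees there with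
  the constant map; its constant coefficient is the identity, so it respects the maps from the
  quotient of \<open>A0\<close>.\<close>

lemma ar_f1: "ar_f1 \<in> arr C U HU"
proof -
  interpret f1: ring_hom_cring A B f1 by (rule f1_hom)
  show ?thesis
    unfolding ar_f1_def by (rule arr_restrict_A)
      (use dpair_hom_f1 f1.hom_closed str_closed in \<open>auto simp: ostr_HU ospf_HU f1_const d_str\<close>)
qed

lemma site_qderiv_HU: "site_qderiv p HU yB R A0 h dB"
  unfolding site_qderiv_def site_qderiv_axioms_def
  using site_pt_HU qderiv_pair_B by (simp add: ostr_HU dB_iota)

lemma coord_hom_f1: "coord_hom p A x B yB f1"
proof -
  interpret V: coord_pair p B yB by (rule coord_pair_B)
  show ?thesis by unfold_locales (use dpair_hom_f1 in \<open>auto simp: f1_def yB_def tay_x\<close>)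
qed

text \<open>The Taylor map of \<open>A\<close> applied to every coefficient. Together with the
  constant and the Taylor arrow of \<open>HU\<close>, it is one of the three arrows in the cocycle
  condition.\<close>

definition "ar_Hf1 = restrict (coord_hom.Hf f1) (carrier B)"

lemma ar_Hf1: "ar_Hf1 \<in> arr C HU (ts_obj p HU yB)"
proof -
  interpret V: site_pt p HU yB R A0 h by (rule site_pt_HU)
  interpret c: coord_hom p A x B yB f1 by (rule coord_hom_f1)
  have H: "c.Hf \<in> dpair_hom B (opair (ts_obj p HU yB))" using c.dpair_hom_Hf by simp
  have 1: "c.Hf (iota (ostr U r)) = ostr (ts_obj p HU yB) r" if "r \<in> carrier R" for r
    using str_closed[OF that] d_str[OF that]
    unfolding V.ostr_HU ostr_HU by (simp add: c.Hf_def c.fs_const f1_const c.V.iota_def)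
  show ?thesis unfolding ar_Hf1_def
    by (rule arr_restrict_B[OF H 1])
      (use ring_hom_closed[of c.Hf] c.dpair_hom_Hf c.f.hom_closed in
        \<open>auto simp: V.ospf_HU ospf_HU V.aug_def aug_def dpair_hom_def tay_def\<close>)
qed

end

section \<open>Tensor products and transition maps\<close>

lemma (in comm_group) frag_prod_hom:
  assumes f: "\<And>k. k \<in> S \<Longrightarrow> f k \<in> carrier G"
  shows "(\<lambda>z. \<Otimes>k\<in>Poly_Mapping.keys z. f k [^] Poly_Mapping.lookup z k) \<in> hom (free_Abelian_group S) G"
    (is "?v \<in> _")
proof -
  have fc: "f k [^] n \<in> carrier G" if "k \<in> S" for k and n :: int using f[OF that] by simp
  have ext: "?v z = (\<Otimes>k\<in>T. f k [^] Poly_Mapping.lookup z k)"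
    if "finite T" "Poly_Mapping.keys z \<subseteq> T" "T \<subseteq> S" for z T
    by (rule finprod_mono_neutral_cong_left)
      (use that fc in \<open>auto simp: Poly_Mapping.lookup_eq_zero_in_keys_contradict not_in_keys_iff_lookup_eq_zero\<close>)
  show ?thesis
  proof (rule homI)
    fix z w assume "z \<in> carrier (free_Abelian_group S)" "w \<in> carrier (free_Abelian_group S)"
    then have zw: "Poly_Mapping.keys z \<subseteq> S" "Poly_Mapping.keys w \<subseteq> S" by auto
    let ?T = "Poly_Mapping.keys z \<union> Poly_Mapping.keys w"
    have T: "finite ?T" "?T \<subseteq> S" using zw by auto
    have "?v (z + w) = (\<Otimes>k\<in>?T. f k [^] Poly_Mapping.lookup (z + w) k)"
      by (rule ext) (use T Poly_Mapping.keys_add[of z w] in auto)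
    also have "\<dots> = (\<Otimes>k\<in>?T. f k [^] Poly_Mapping.lookup z k \<otimes> f k [^] Poly_Mapping.lookup w k)"
      by (rule finprod_cong') (use T f fc in \<open>auto simp: Poly_Mapping.lookup_add int_pow_mult subset_iff\<close>)
    also have "\<dots> = (\<Otimes>k\<in>?T. f k [^] Poly_Mapping.lookup z k) \<otimes> (\<Otimes>k\<in>?T. f k [^] Poly_Mapping.lookup w k)"
      by (rule finprod_multf) (use T fc in auto)
    also have "\<dots> = ?v z \<otimes> ?v w" using ext[of ?T z] ext[of ?T w] T by simp
    finally show "?v (z \<otimes>\<^bsub>free_Abelian_group S\<^esub> w) = ?v z \<otimes> ?v w" by simp
  qed (use fc in \<open>auto intro!: finprod_closed\<close>)
qed

lemma (in comm_group) frag_prod_of: "f k \<in> carrier G \<Longrightarrow>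
    (\<Otimes>l\<in>Poly_Mapping.keys (frag_of k). f l [^] Poly_Mapping.lookup (frag_of k) l) = f k"
  by (simp add: finprod_singleton)

text \<open>Closure under the operations puts the defining relations of the tensor product into the
  free abelian group on pairs.\<close>

locale tensor_data =
  fixes B :: "('a, 'x) ring_scheme" and M :: "('a, 'm) module" and N :: "('a, 'n) module"
  assumes M_add: "s \<in> carrier M \<Longrightarrow> s' \<in> carrier M \<Longrightarrow> s \<oplus>\<^bsub>M\<^esub> s' \<in> carrier M"
    and N_add: "t \<in> carrier N \<Longrightarrow> t' \<in> carrier N \<Longrightarrow> t \<oplus>\<^bsub>N\<^esub> t' \<in> carrier N"
    and M_smult: "b \<in> carrier B \<Longrightarrow> s \<in> carrier M \<Longrightarrow> b \<odot>\<^bsub>M\<^esub> s \<in> carrier M"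
    and N_smult: "b \<in> carrier B \<Longrightarrow> t \<in> carrier N \<Longrightarrow> b \<odot>\<^bsub>N\<^esub> t \<in> carrier N"
begin

definition balanced :: "('g, 'y) monoid_scheme \<Rightarrow> ('m \<Rightarrow> 'n \<Rightarrow> 'g) \<Rightarrow> bool" where
  "balanced G \<beta> \<longleftrightarrow> comm_group G \<and> (\<forall>s\<in>carrier M. \<forall>t\<in>carrier N. \<beta> s t \<in> carrier G) \<and>
    (\<forall>s\<in>carrier M. \<forall>s'\<in>carrier M. \<forall>t\<in>carrier N. \<beta> (s \<oplus>\<^bsub>M\<^esub> s') t = \<beta> s t \<otimes>\<^bsub>G\<^esub> \<beta> s' t) \<and>
    (\<forall>s\<in>carrier M. \<forall>t\<in>carrier N. \<forall>t'\<in>carrier N. \<beta> s (t \<oplus>\<^bsub>N\<^esub> t') = \<beta> s t \<otimes>\<^bsub>G\<^esub> \<beta> s t') \<and>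
    (\<forall>b\<in>carrier B. \<forall>s\<in>carrier M. \<forall>t\<in>carrier N. \<beta> (b \<odot>\<^bsub>M\<^esub> s) t = \<beta> s (b \<odot>\<^bsub>N\<^esub> t))"

abbreviation "F \<equiv> free_Abelian_group (carrier M \<times> carrier N)"
abbreviation "K \<equiv> tensor_null B M N"

definition val :: "('g, 'y) monoid_scheme \<Rightarrow> ('m \<Rightarrow> 'n \<Rightarrow> 'g) \<Rightarrow> (('m \<times> 'n) \<Rightarrow>\<^sub>0 int) \<Rightarrow> 'g" where
  "val G \<beta> z = (\<Otimes>\<^bsub>G\<^esub>k \<in> Poly_Mapping.keys z. \<beta> (fst k) (snd k) [^]\<^bsub>G\<^esub> Poly_Mapping.lookup z k)"

lemma val_hom: "balanced G \<beta> \<Longrightarrow> val G \<beta> \<in> hom F G"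
  unfolding val_def[abs_def] balanced_def by (intro comm_group.frag_prod_hom) auto

lemma val_of: "balanced G \<beta> \<Longrightarrow> s \<in> carrier M \<Longrightarrow> t \<in> carrier N \<Longrightarrow> val G \<beta> (frag_of (s, t)) = \<beta> s t"
  unfolding val_def balanced_def by (subst comm_group.frag_prod_of) auto

lemma val_group_hom: "balanced G \<beta> \<Longrightarrow> group_hom F G (val G \<beta>)"
  using val_hom[of G \<beta>] by (simp add: group_hom_def group_hom_axioms_def balanced_def comm_group_def)

lemma val_diff: "balanced G \<beta> \<Longrightarrow> z \<in> carrier F \<Longrightarrow> w \<in> carrier F \<Longrightarrow>
    val G \<beta> (z - w) = val G \<beta> z \<otimes>\<^bsub>G\<^esub> inv\<^bsub>G\<^esub> val G \<beta> w"
proof -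
  assume b: "balanced G \<beta>" and z: "z \<in> carrier F" "w \<in> carrier F"
  interpret v: group_hom F G "val G \<beta>" by (rule val_group_hom[OF b])
  have e: "z - w = z \<otimes>\<^bsub>F\<^esub> inv\<^bsub>F\<^esub> w" using z by simp
  show ?thesis unfolding e v.hom_mult[OF z(1) v.G.inv_closed[OF z(2)]] v.hom_inv[OF z(2)] ..
qed

lemma diff_F: "z \<in> carrier F \<Longrightarrow> w \<in> carrier F \<Longrightarrow> z - w \<in> carrier F"
  using keys_diff[of z w] by auto

lemma rels_F: "tensor_rels B M N \<subseteq> carrier F"
  unfolding tensor_rels_def
  by (intro Un_least subsetI; elim CollectE exE conjE; hypsubst; intro diff_F)
    (auto simp: M_add N_add M_smult N_smult)

lemma K_subgroup: "subgroup K F"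
  unfolding tensor_null_def by (rule group.generate_is_subgroup[OF group_free_Abelian_group rels_F])

lemma val_rels: "balanced G \<beta> \<Longrightarrow> z \<in> tensor_rels B M N \<Longrightarrow> val G \<beta> z = \<one>\<^bsub>G\<^esub>"
proof -
  assume b: "balanced G \<beta>" and z: "z \<in> tensor_rels B M N"
  interpret G: comm_group G using b by (simp add: balanced_def)
  have \<beta>: "\<beta> s t \<in> carrier G" if "s \<in> carrier M" "t \<in> carrier N" for s t using that b by (auto simp: balanced_def)
  have d: "val G \<beta> (frag_of (s, t) - frag_of (s', t')) = \<beta> s t \<otimes>\<^bsub>G\<^esub> inv\<^bsub>G\<^esub> \<beta> s' t'"
    if "s \<in> carrier M" "t \<in> carrier N" "s' \<in> carrier M" "t' \<in> carrier N" for s t s' t'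
    using that val_diff[OF b, of "frag_of (s, t)" "frag_of (s', t')"] by (simp add: val_of[OF b])
  have d3: "val G \<beta> (frag_of (s, t) - frag_of (s', t') - frag_of (s'', t'')) =
      \<beta> s t \<otimes>\<^bsub>G\<^esub> inv\<^bsub>G\<^esub> \<beta> s' t' \<otimes>\<^bsub>G\<^esub> inv\<^bsub>G\<^esub> \<beta> s'' t''"
    if "s \<in> carrier M" "t \<in> carrier N" "s' \<in> carrier M" "t' \<in> carrier N" "s'' \<in> carrier M" "t'' \<in> carrier N"
    for s t s' t' s'' t''
    using that val_diff[OF b diff_F, of "frag_of (s, t)" "frag_of (s', t')" "frag_of (s'', t'')"]
    by (simp add: val_of[OF b] d)
  have c: "u \<otimes>\<^bsub>G\<^esub> w \<otimes>\<^bsub>G\<^esub> inv\<^bsub>G\<^esub> u \<otimes>\<^bsub>G\<^esub> inv\<^bsub>G\<^esub> w = \<one>\<^bsub>G\<^esub>"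
    if "u \<in> carrier G" "w \<in> carrier G" for u w
    using that by (metis G.inv_closed G.m_assoc G.m_closed G.m_comm G.r_inv G.r_one)
  from z consider (l) s s' t where "s \<in> carrier M" "s' \<in> carrier M" "t \<in> carrier N"
      "z = frag_of (s \<oplus>\<^bsub>M\<^esub> s', t) - frag_of (s, t) - frag_of (s', t)"
    | (r) s t t' where "s \<in> carrier M" "t \<in> carrier N" "t' \<in> carrier N"
      "z = frag_of (s, t \<oplus>\<^bsub>N\<^esub> t') - frag_of (s, t) - frag_of (s, t')"
    | (b) a s t where "a \<in> carrier B" "s \<in> carrier M" "t \<in> carrier N"
      "z = frag_of (a \<odot>\<^bsub>M\<^esub> s, t) - frag_of (s, a \<odot>\<^bsub>N\<^esub> t)"
    unfolding tensor_rels_def by blast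
  then show ?thesis
  proof cases
    case l
    then have "\<beta> (s \<oplus>\<^bsub>M\<^esub> s') t = \<beta> s t \<otimes>\<^bsub>G\<^esub> \<beta> s' t" using b unfolding balanced_def by blast
    then show ?thesis using l by (simp add: d3 M_add c \<beta>)
  next
    case r
    then have "\<beta> s (t \<oplus>\<^bsub>N\<^esub> t') = \<beta> s t \<otimes>\<^bsub>G\<^esub> \<beta> s t'" using b unfolding balanced_def by blast
    then show ?thesis using r by (simp add: d3 N_add c \<beta>)
  next
    case b': b
    then have "\<beta> (a \<odot>\<^bsub>M\<^esub> s) t = \<beta> s (a \<odot>\<^bsub>N\<^esub> t)" using b unfolding balanced_def by blast
    then show ?thesis using b' by (simp add: d M_smult N_smult \<beta>)
  qed
qed

lemma val_K: "balanced G \<beta> \<Longrightarrow> z \<in> K \<Longrightarrow> val G \<beta> z = \<one>\<^bsub>G\<^esub>"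
proof -
  assume b: "balanced G \<beta>" and z: "z \<in> K"
  interpret v: group_hom F G "val G \<beta>" by (rule val_group_hom[OF b])
  have "K \<subseteq> kernel F G (val G \<beta>)"
    unfolding tensor_null_def
    by (rule v.G.generate_subgroup_incl[OF _ v.subgroup_kernel], rule subsetI)
      (simp only: kernel_def mem_Collect_eq subsetD[OF rels_F] val_rels[OF b] simp_thms)
  then show ?thesis using z by (auto simp: kernel_def)
qed

lemma val_coset: "balanced G \<beta> \<Longrightarrow> z \<in> carrier F \<Longrightarrow> w \<in> K #>\<^bsub>F\<^esub> z \<Longrightarrow> val G \<beta> w = val G \<beta> z"
proof -
  assume b: "balanced G \<beta>" and z: "z \<in> carrier F" and w: "w \<in> K #>\<^bsub>F\<^esub> z"
  interpret v: group_hom F G "val G \<beta>" by (rule val_group_hom[OF b])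
  obtain k where k: "k \<in> K" "w = k \<otimes>\<^bsub>F\<^esub> z" using w unfolding r_coset_def by blast
  have "val G \<beta> (k \<otimes>\<^bsub>F\<^esub> z) = val G \<beta> k \<otimes>\<^bsub>G\<^esub> val G \<beta> z"
    by (rule v.hom_mult[OF subgroup.mem_carrier[OF K_subgroup k(1)] z])
  then show ?thesis unfolding k(2) val_K[OF b k(1)] using v.hom_closed[OF z] by simp
qed

lemma tensor_lift_coset:
  assumes b: "balanced G \<beta>" and z: "z \<in> carrier F"
  shows "tensor_lift G \<beta> (K #>\<^bsub>F\<^esub> z) = val G \<beta> z"
proof -
  have "z \<in> K #>\<^bsub>F\<^esub> z" by (rule group.rcos_self[OF group_free_Abelian_group z K_subgroup])
  then have "val G \<beta> ` (K #>\<^bsub>F\<^esub> z) = {val G \<beta> z}" using val_coset[OF b z] by blast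
  then show ?thesis unfolding tensor_lift_def val_def[abs_def] by simp
qed

lemma carrier_tensor: "carrier (tensor B M N) = (\<lambda>z. K #>\<^bsub>F\<^esub> z) ` carrier F"
  unfolding tensor_def by (rule carrier_FactGroup)

lemma tensor_bij_surj:
  assumes b: "balanced G \<beta>" and bij: "bij_betw (tensor_lift G \<beta>) (carrier (tensor B M N)) (carrier G)"
    and t: "t \<in> carrier G"
  shows "\<exists>z. z \<in> carrier F \<and> val G \<beta> z = t"
proof -
  have "t \<in> (\<lambda>z. tensor_lift G \<beta> (K #>\<^bsub>F\<^esub> z)) ` carrier F"
    using t unfolding bij_betw_imp_surj_on[OF bij, symmetric] carrier_tensor image_image .
  then obtain z where z: "z \<in> carrier F" "t = tensor_lift G \<beta> (K #>\<^bsub>F\<^esub> z)" by (rule imageE)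
  show ?thesis by (intro exI[of _ z] conjI z(1)) (simp only: z(2) tensor_lift_coset[OF b z(1)])
qed

text \<open>If a balanced map identifies \<open>G\<close> with the tensor product, then
  \<open>G\<close> is generated by the values of that map. Elements of the free group are
  differences of generators, hence the rule for differences.\<close>

lemma tensor_bij_induct [consumes 3, case_names diff pure]:
  assumes b: "balanced G \<beta>" and bij: "bij_betw (tensor_lift G \<beta>) (carrier (tensor B M N)) (carrier G)"
    and t: "t \<in> carrier G"
    and diff: "\<And>x y. x \<in> carrier G \<Longrightarrow> y \<in> carrier G \<Longrightarrow> P x \<Longrightarrow> P y \<Longrightarrow> P (x \<otimes>\<^bsub>G\<^esub> inv\<^bsub>G\<^esub> y)"
    and pure: "\<And>m n. m \<in> carrier M \<Longrightarrow> n \<in> carrier N \<Longrightarrow> P (\<beta> m n)" and "P \<one>\<^bsub>G\<^esub>"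
  shows "P t"
proof -
  interpret v: group_hom F G "val G \<beta>" by (rule val_group_hom[OF b])
  obtain z where z: "z \<in> carrier F" "t = val G \<beta> z"
    using tensor_bij_surj[OF b bij t] by (elim exE conjE) (rule that, auto)
  have "Poly_Mapping.keys z \<subseteq> carrier M \<times> carrier N" using z by simp
  then have "P (val G \<beta> z)"
  proof (rule free_Abelian_group_induct[where P="\<lambda>z. P (val G \<beta> z)"])
    show "P (val G \<beta> 0)" using v.hom_one \<open>P \<one>\<^bsub>G\<^esub>\<close> by simp
    fix x y :: "('m \<times> 'n) \<Rightarrow>\<^sub>0 int"
    assume "Poly_Mapping.keys x \<subseteq> carrier M \<times> carrier N" "Poly_Mapping.keys y \<subseteq> carrier M \<times> carrier N"
      and "P (val G \<beta> x)" "P (val G \<beta> y)"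
    then show "P (val G \<beta> (x - y))" using val_diff[OF b, of x y] diff v.hom_closed by simp
  next
    fix k assume "k \<in> carrier M \<times> carrier N"
    then show "P (val G \<beta> (frag_of k))" using pure by (cases k) (simp add: val_of[OF b])
  qed
  then show ?thesis using z by simp
qed

text \<open>The universal property is transferred to \<open>G\<close> itself: a preimage in the free
  abelian group is chosen and the other balanced map is evaluated on it.\<close>

lemma tensor_bij_lift:
  assumes b: "balanced G \<beta>" and bij: "bij_betw (tensor_lift G \<beta>) (carrier (tensor B M N)) (carrier G)"
    and b': "balanced G' \<beta>'"
  shows "\<exists>\<Lambda>\<in>hom G G'. \<forall>m\<in>carrier M. \<forall>n\<in>carrier N. \<Lambda> (\<beta> m n) = \<beta>' m n"
proof -
  interpret v: group_hom F G "val G \<beta>" by (rule val_group_hom[OF b])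
  interpret v': group_hom F G' "val G' \<beta>'" by (rule val_group_hom[OF b'])
  define zz where "zz t = (SOME z. z \<in> carrier F \<and> val G \<beta> z = t)" for t
  have zz: "zz t \<in> carrier F \<and> val G \<beta> (zz t) = t" if t: "t \<in> carrier G" for t
    unfolding zz_def by (rule someI_ex[OF tensor_bij_surj[OF b bij t]])
  \<comment> \<open>Independence of the choice: by injectivity, two preimages of the same element
    differ by a relation, on which every balanced map vanishes.\<close>
  have key: "val G' \<beta>' (zz (val G \<beta> z)) = val G' \<beta>' z" if z: "z \<in> carrier F" for z
  proof -
    have w: "zz (val G \<beta> z) \<in> carrier F" "val G \<beta> (zz (val G \<beta> z)) = val G \<beta> z"
      using zz[OF v.hom_closed[OF z]] by auto
    have "K #>\<^bsub>F\<^esub> zz (val G \<beta> z) = K #>\<^bsub>F\<^esub> z"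
      by (rule inj_onD[OF bij_betw_imp_inj_on[OF bij]])
        (use z w in \<open>auto simp: carrier_tensor tensor_lift_coset[OF b] simp del: carrier_free_Abelian_group_iff\<close>)
    then have "zz (val G \<beta> z) \<in> K #>\<^bsub>F\<^esub> z"
      using group.rcos_self[OF group_free_Abelian_group w(1) K_subgroup] by simp
    then show ?thesis by (rule val_coset[OF b' z])
  qed
  show ?thesis
  proof (intro bexI[of _ "\<lambda>t. val G' \<beta>' (zz t)"] ballI homI)
    fix t u assume t: "t \<in> carrier G" and u: "u \<in> carrier G"
    have "t \<otimes>\<^bsub>G\<^esub> u = val G \<beta> (zz t \<otimes>\<^bsub>F\<^esub> zz u)" using zz[OF t] zz[OF u] v.hom_mult by metis
    then show "val G' \<beta>' (zz (t \<otimes>\<^bsub>G\<^esub> u)) = val G' \<beta>' (zz t) \<otimes>\<^bsub>G'\<^esub> val G' \<beta>' (zz u)"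
      using key[of "zz t \<otimes>\<^bsub>F\<^esub> zz u"] zz[OF t] zz[OF u] v'.hom_mult v.G.m_closed by metis
  next
    fix m n assume mn: "m \<in> carrier M" "n \<in> carrier N"
    then show "val G' \<beta>' (zz (\<beta> m n)) = \<beta>' m n"
      using key[of "frag_of (m, n)"] by (simp add: val_of[OF b] val_of[OF b'])
  qed (use zz v'.hom_closed in blast)
qed

end

abbreviation "ahom M N \<equiv> hom (add_monoid M) (add_monoid N)"

lemma ahom_iff: "\<Lambda> \<in> ahom M N \<longleftrightarrow> (\<forall>s\<in>carrier M. \<Lambda> s \<in> carrier N) \<and>
    (\<forall>s\<in>carrier M. \<forall>t\<in>carrier M. \<Lambda> (s \<oplus>\<^bsub>M\<^esub> t) = \<Lambda> s \<oplus>\<^bsub>N\<^esub> \<Lambda> t)"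
  by (auto simp: hom_def)

section \<open>Transition maps of a crystal and the extension of scalars that they express\<close>

locale crystal =
  fixes p and R A0 :: "'u dpair" and h and E :: "('u, 'm) omod"
  assumes crystal: "is_crystal (qCRIS_op p R A0 h) E"
begin

abbreviation "C \<equiv> qCRIS_op p R A0 h"

lemma sect_module: "V \<in> ob C \<Longrightarrow> module (opair V) (sect E V)"
  using crystal unfolding is_crystal_def is_omod_def by blast

lemma trans_facts:
  assumes "V \<in> ob C" "W \<in> ob C" "f \<in> arr C V W"
  shows "s \<in> carrier (sect E V) \<Longrightarrow> trans E V W f s \<in> carrier (sect E W)"
    "s \<in> carrier (sect E V) \<Longrightarrow> t \<in> carrier (sect E V) \<Longrightarrow>
      trans E V W f (s \<oplus>\<^bsub>sect E V\<^esub> t) = trans E V W f s \<oplus>\<^bsub>sect E W\<^esub> trans E V W f t"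
    "b \<in> carrier (opair V) \<Longrightarrow> s \<in> carrier (sect E V) \<Longrightarrow>
      trans E V W f (b \<odot>\<^bsub>sect E V\<^esub> s) = f b \<odot>\<^bsub>sect E W\<^esub> trans E V W f s"
  using crystal assms unfolding is_crystal_def is_omod_def by blast+

lemma trans_hom: "V \<in> ob C \<Longrightarrow> W \<in> ob C \<Longrightarrow> f \<in> arr C V W \<Longrightarrow> trans E V W f \<in> ahom (sect E V) (sect E W)"
  using trans_facts unfolding ahom_iff by blast

lemma trans_comp:
  "V \<in> ob C \<Longrightarrow> W \<in> ob C \<Longrightarrow> Y \<in> ob C \<Longrightarrow> f \<in> arr C V W \<Longrightarrow> g \<in> arr C W Y \<Longrightarrow> s \<in> carrier (sect E V) \<Longrightarrow>
    trans E W Y g (trans E V W f s) = trans E V Y (restrict (\<lambda>a. g (f a)) (carrier (opair V))) s"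
  using crystal unfolding is_crystal_def is_omod_def by (simp add: qCRIS_op_def compose_def)

lemma trans_id: "V \<in> ob C \<Longrightarrow> s \<in> carrier (sect E V) \<Longrightarrow> trans E V V (restrict (\<lambda>a. a) (carrier (opair V))) s = s"
  using crystal unfolding is_crystal_def is_omod_def by (simp add: qCRIS_op_def)

context
  fixes V W f
  assumes VW: "V \<in> ob C" "W \<in> ob C" and f: "f \<in> arr C V W"
begin

lemma arr_hom: "f \<in> ring_hom (opair V) (opair W)"
  using f by (simp add: qCRIS_op_def dpair_hom_def)

lemma tensor_data_trans: "tensor_data (opair V) (alg_module (opair W) f) (sect E V)"
proof -
  interpret V: module "opair V" "sect E V" by (rule sect_module[OF VW(1)])
  interpret W: module "opair W" "sect E W" by (rule sect_module[OF VW(2)])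
  show ?thesis by unfold_locales (use ring_hom_closed[OF arr_hom] in \<open>auto simp: alg_module_def\<close>)
qed

lemma balanced_lift:
  assumes "comm_group G" "\<And>b s. b \<in> carrier (opair W) \<Longrightarrow> s \<in> carrier (sect E V) \<Longrightarrow> \<gamma> b s \<in> carrier G"
    "\<And>b b' s. b \<in> carrier (opair W) \<Longrightarrow> b' \<in> carrier (opair W) \<Longrightarrow> s \<in> carrier (sect E V) \<Longrightarrow>
      \<gamma> (b \<oplus>\<^bsub>opair W\<^esub> b') s = \<gamma> b s \<otimes>\<^bsub>G\<^esub> \<gamma> b' s"
    "\<And>b s s'. b \<in> carrier (opair W) \<Longrightarrow> s \<in> carrier (sect E V) \<Longrightarrow> s' \<in> carrier (sect E V) \<Longrightarrow>
      \<gamma> b (s \<oplus>\<^bsub>sect E V\<^esub> s') = \<gamma> b s \<otimes>\<^bsub>G\<^esub> \<gamma> b s'"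
    "\<And>a b s. a \<in> carrier (opair V) \<Longrightarrow> b \<in> carrier (opair W) \<Longrightarrow> s \<in> carrier (sect E V) \<Longrightarrow>
      \<gamma> (f a \<otimes>\<^bsub>opair W\<^esub> b) s = \<gamma> b (a \<odot>\<^bsub>sect E V\<^esub> s)"
  shows "tensor_data.balanced (opair V) (alg_module (opair W) f) (sect E V) G \<gamma>"
  unfolding tensor_data.balanced_def[OF tensor_data_trans] using assms by (auto simp: alg_module_def)

abbreviation (input) "pure b s \<equiv> b \<odot>\<^bsub>sect E W\<^esub> trans E V W f s"

lemma balanced_pure: "tensor_data.balanced (opair V) (alg_module (opair W) f) (sect E V)
    (add_monoid (sect E W)) pure"
proof -
  interpret V: module "opair V" "sect E V" by (rule sect_module[OF VW(1)])
  interpret W: module "opair W" "sect E W" by (rule sect_module[OF VW(2)])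
  show ?thesis
  proof (rule balanced_lift)
    show "comm_group (add_monoid (sect E W))" by (rule W.M.a_comm_group)
  qed (use trans_facts[OF VW f] ring_hom_closed[OF arr_hom] in
    \<open>auto simp: W.smult_l_distr W.smult_r_distr W.smult_assoc1[symmetric] W.R.m_comm\<close>)
qed

lemma bij_pure: "bij_betw (tensor_lift (add_monoid (sect E W)) pure)
    (carrier (tensor (opair V) (alg_module (opair W) f) (sect E V))) (carrier (add_monoid (sect E W)))"
  using crystal VW f unfolding is_crystal_def lin_trans_def by auto

lemma trans_induct:
  assumes t: "t \<in> carrier (sect E W)"
    and add: "\<And>x y. x \<in> carrier (sect E W) \<Longrightarrow> y \<in> carrier (sect E W) \<Longrightarrow> P x \<Longrightarrow> P y \<Longrightarrow> P (x \<oplus>\<^bsub>sect E W\<^esub> y)"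
    and pure: "\<And>b s. b \<in> carrier (opair W) \<Longrightarrow> s \<in> carrier (sect E V) \<Longrightarrow> P (pure b s)"
  shows "P t"
proof -
  interpret V: module "opair V" "sect E V" by (rule sect_module[OF VW(1)])
  interpret W: module "opair W" "sect E W" by (rule sect_module[OF VW(2)])
  interpret T: tensor_data "opair V" "alg_module (opair W) f" "sect E V" by (rule tensor_data_trans)
  have z: "P \<zero>\<^bsub>sect E W\<^esub>"
    using pure[of "\<zero>\<^bsub>opair W\<^esub>" "\<zero>\<^bsub>sect E V\<^esub>"] trans_facts(1)[OF VW f V.M.zero_closed] by simp
  have inv: "inv\<^bsub>add_monoid (sect E W)\<^esub> y = \<ominus>\<^bsub>sect E W\<^esub> y" for y by (simp add: a_inv_def)
  have t': "t \<in> carrier (add_monoid (sect E W))" using t by simp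
  \<comment> \<open>The available induction uses differences, so the property is carried for an
    element and its negative; the negative of a pure element is pure, with the sign moved to the
    scalar.\<close>
  have "P t \<and> P (\<ominus>\<^bsub>sect E W\<^esub> t)"
    using balanced_pure bij_pure t'
  proof (induction t rule: T.tensor_bij_induct)
    case (diff x y)
    then show ?case
      using add[of x "\<ominus>\<^bsub>sect E W\<^esub> y"] add[of "\<ominus>\<^bsub>sect E W\<^esub> x" y] by (simp add: inv W.M.minus_add)
  next
    case (pure b s)
    then have b: "b \<in> carrier (opair W)" by (simp add: alg_module_def)
    have "\<ominus>\<^bsub>sect E W\<^esub> (pure b s) = pure (\<ominus>\<^bsub>opair W\<^esub> b) s"
      using W.smult_l_minus[OF b trans_facts(1)[OF VW f pure(2)]] by simp
    then show ?case using assms(3)[OF b pure(2)] assms(3)[OF W.R.a_inv_closed[OF b] pure(2)] by simp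
  next
    have "\<ominus>\<^bsub>sect E W\<^esub> \<zero>\<^bsub>sect E W\<^esub> = \<zero>\<^bsub>sect E W\<^esub>" by simp
    then show "P \<one>\<^bsub>add_monoid (sect E W)\<^esub> \<and> P (\<ominus>\<^bsub>sect E W\<^esub> \<one>\<^bsub>add_monoid (sect E W)\<^esub>)"
      using z by (simp only: monoid.simps simp_thms)
  qed
  then show ?thesis by simp
qed

lemma trans_ext:
  assumes "\<Lambda> \<in> ahom (sect E W) N" "\<Lambda>' \<in> ahom (sect E W) N"
    and "\<And>b s. b \<in> carrier (opair W) \<Longrightarrow> s \<in> carrier (sect E V) \<Longrightarrow> \<Lambda> (pure b s) = \<Lambda>' (pure b s)"
    and t: "t \<in> carrier (sect E W)"
  shows "\<Lambda> t = \<Lambda>' t"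
  using t by (induction t rule: trans_induct) (use assms in \<open>auto simp: ahom_iff\<close>)

lemma trans_lift:
  assumes "tensor_data.balanced (opair V) (alg_module (opair W) f) (sect E V) (add_monoid N) \<gamma>"
  shows "\<exists>\<Lambda>\<in>ahom (sect E W) N. \<forall>b\<in>carrier (opair W). \<forall>s\<in>carrier (sect E V). \<Lambda> (pure b s) = \<gamma> b s"
  using tensor_data.tensor_bij_lift[OF tensor_data_trans balanced_pure bij_pure assms] by (simp add: alg_module_def)

end

end

section \<open>The twisted derivation of a q-crystal\<close>

lemma span_superset: "s \<in> S \<Longrightarrow> s \<in> mod_span R M S"
  unfolding mod_span_def by blast

lemma span_add: "s \<in> mod_span R M S \<Longrightarrow> t \<in> mod_span R M S \<Longrightarrow> s \<oplus>\<^bsub>M\<^esub> t \<in> mod_span R M S"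
  using subgroup.m_closed[OF submodule.axioms(1)[of _ R M]] unfolding mod_span_def by simp

locale crystal_site = site_qderiv p U x R A0 h d + E: crystal p R A0 h E for p and U :: "'a qobj" and x R A0 h d and E :: "('a, 'm) omod"
begin

abbreviation "M \<equiv> sect E U"
abbreviation "MB \<equiv> sect E HU"
definition "Ei = trans E U HU ar_iota"
definition "Ef = trans E U HU ar_f1"
definition "Ea = trans E HU U ar_aug"

lemma M_module: "module A M" and MB_module: "module B MB"
  using E.sect_module[OF U] E.sect_module[OF HU_ob] by simp_all

sublocale M: module A M by (rule M_module)
sublocale MB: module B MB by (rule MB_module)

lemma Ei_closed [simp]: "s \<in> carrier M \<Longrightarrow> Ei s \<in> carrier MB"
  and Ef_closed [simp]: "s \<in> carrier M \<Longrightarrow> Ef s \<in> carrier MB"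
  and Ea_closed [simp]: "w \<in> carrier MB \<Longrightarrow> Ea w \<in> carrier M"
  unfolding Ei_def Ef_def Ea_def
  by (rule E.trans_facts U HU_ob ar_iota ar_f1 ar_aug | assumption)+

lemma Ef_smult: "a \<in> carrier A \<Longrightarrow> s \<in> carrier M \<Longrightarrow> Ef (a \<odot>\<^bsub>M\<^esub> s) = f1 a \<odot>\<^bsub>MB\<^esub> Ef s"
  using E.trans_facts(3)[OF U HU_ob ar_f1] by (simp add: Ef_def ar_f1_def)

lemma Ea_smult: "b \<in> carrier B \<Longrightarrow> w \<in> carrier MB \<Longrightarrow> Ea (b \<odot>\<^bsub>MB\<^esub> w) = aug b \<odot>\<^bsub>M\<^esub> Ea w"
  using E.trans_facts(3)[OF HU_ob U ar_aug] by (simp add: Ea_def ar_aug_def)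

lemma Ef_hom: "Ef \<in> ahom M MB" and Ea_hom: "Ea \<in> ahom MB M"
  unfolding Ef_def Ea_def by (rule E.trans_hom U HU_ob ar_f1 ar_aug)+

lemma Ef_add: "s \<in> carrier M \<Longrightarrow> s' \<in> carrier M \<Longrightarrow> Ef (s \<oplus>\<^bsub>M\<^esub> s') = Ef s \<oplus>\<^bsub>MB\<^esub> Ef s'"
  using Ef_hom unfolding ahom_iff by blast

lemma Ea_Ei: "s \<in> carrier M \<Longrightarrow> Ea (Ei s) = s" and Ea_Ef: "s \<in> carrier M \<Longrightarrow> Ea (Ef s) = s"
proof -
  interpret f1: ring_hom_cring A B f1 by (rule f1_hom)
  have "restrict (\<lambda>a. ar_aug (ar_iota a)) (carrier A) = restrict (\<lambda>a. a) (carrier A)"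
    "restrict (\<lambda>a. ar_aug (ar_f1 a)) (carrier A) = restrict (\<lambda>a. a) (carrier A)"
    unfolding ar_aug_def ar_iota_def ar_f1_def using iota.hom_closed f1.hom_closed
    by (auto simp: restrict_def fun_eq_iff)
  then show "s \<in> carrier M \<Longrightarrow> Ea (Ei s) = s" "s \<in> carrier M \<Longrightarrow> Ea (Ef s) = s"
    unfolding Ea_def Ei_def Ef_def using E.trans_comp[OF U HU_ob U ar_iota ar_aug] E.trans_comp[OF U HU_ob U ar_f1 ar_aug]
      E.trans_id[OF U] by simp_all
qed

lemmas MB_induct [consumes 1, case_names add pure] = E.trans_induct[OF U HU_ob ar_iota, folded Ei_def, simplified]
lemmas MB_ext = E.trans_ext[OF U HU_ob ar_iota, folded Ei_def, simplified]

text \<open>Taking the coefficient of index \<open>k\<close> is linear over the constants, so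
  \<open>b_k s\<close> is balanced in \<open>b\<close> and \<open>s\<close>; bijectivity of the
  transition map along \<open>iota\<close> then gives the map on sections.\<close>

lemma coef_exists: "\<exists>\<Lambda>\<in>ahom MB M. \<forall>b\<in>carrier B. \<forall>s\<in>carrier M. \<Lambda> (b \<odot>\<^bsub>MB\<^esub> Ei s) = seq_of b k \<odot>\<^bsub>M\<^esub> s"
proof -
  have "tensor_data.balanced A (alg_module (opair HU) ar_iota) M (add_monoid M) (\<lambda>b s. seq_of b k \<odot>\<^bsub>M\<^esub> s)"
  proof (rule E.balanced_lift[OF U HU_ob ar_iota])
    show "comm_group (add_monoid M)" by (rule M.M.a_comm_group)
  next
    fix a b s assume "a \<in> carrier A" "b \<in> carrier (opair HU)" "s \<in> carrier M"
    then show "seq_of (ar_iota a \<otimes>\<^bsub>opair HU\<^esub> b) k \<odot>\<^bsub>M\<^esub> s = seq_of b k \<odot>\<^bsub>M\<^esub> (a \<odot>\<^bsub>M\<^esub> s)"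
      by (simp add: ar_iota_def seq_iota_mult M.smult_assoc1[symmetric] m_comm)
  qed (auto simp: seq_add ad_def M.smult_l_distr M.smult_r_distr)
  then show ?thesis using E.trans_lift[OF U HU_ob ar_iota] unfolding Ei_def by simp
qed

text \<open>The coefficient of \<open>\<xi>\<^sup>[\<^sup>k\<^sup>]\<close> with respect to \<open>E(B) = B \<otimes> E(A)\<close>.\<close>

definition coef where "coef k = (SOME \<Lambda>. \<Lambda> \<in> ahom MB M \<and>
    (\<forall>b\<in>carrier B. \<forall>s\<in>carrier M. \<Lambda> (b \<odot>\<^bsub>MB\<^esub> Ei s) = seq_of b k \<odot>\<^bsub>M\<^esub> s))"

lemma coef: "coef k \<in> ahom MB M"
  "b \<in> carrier B \<Longrightarrow> s \<in> carrier M \<Longrightarrow> coef k (b \<odot>\<^bsub>MB\<^esub> Ei s) = seq_of b k \<odot>\<^bsub>M\<^esub> s"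
  using someI_ex[OF coef_exists[unfolded Bex_def], of k] unfolding coef_def[symmetric] by blast+

lemma coef_closed [simp]: "w \<in> carrier MB \<Longrightarrow> coef k w \<in> carrier M"
  and coef_add: "w \<in> carrier MB \<Longrightarrow> w' \<in> carrier MB \<Longrightarrow> coef k (w \<oplus>\<^bsub>MB\<^esub> w') = coef k w \<oplus>\<^bsub>M\<^esub> coef k w'"
  using coef(1)[of k] unfolding ahom_iff by blast+

lemma coef_0: "w \<in> carrier MB \<Longrightarrow> coef 0 w = Ea w"
  by (rule MB_ext[OF coef(1) Ea_hom]) (auto simp: coef Ea_smult Ea_Ei aug_def)

text \<open>On pure elements this is the product formula for index 1, in which the second summand
  carries the constant coefficient of \<sigma>(b). Both sides are additive in \<open>w\<close>, so
  pure elements suffice.\<close>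

lemma coef_1_smult:
  assumes b [simp]: "b \<in> carrier B" and w: "w \<in> carrier MB"
  shows "coef 1 (b \<odot>\<^bsub>MB\<^esub> w) = seq_of b 1 \<odot>\<^bsub>M\<^esub> Ea w \<oplus>\<^bsub>M\<^esub> S (seq_of b) 0 \<odot>\<^bsub>M\<^esub> coef 1 w"
  using _ _ _ w
proof (rule MB_ext)
  have S [simp]: "S (seq_of b) 0 \<in> carrier A" by (rule in_H) simp
  have Ea_add: "Ea (w \<oplus>\<^bsub>MB\<^esub> w') = Ea w \<oplus>\<^bsub>M\<^esub> Ea w'" if "w \<in> carrier MB" "w' \<in> carrier MB" for w w'
    using Ea_hom that unfolding ahom_iff by blast
  show "(\<lambda>w. coef 1 (b \<odot>\<^bsub>MB\<^esub> w)) \<in> ahom MB M" unfolding ahom_iff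
    by (simp add: MB.smult_r_distr coef_add)
  show "(\<lambda>w. seq_of b 1 \<odot>\<^bsub>M\<^esub> Ea w \<oplus>\<^bsub>M\<^esub> S (seq_of b) 0 \<odot>\<^bsub>M\<^esub> coef 1 w) \<in> ahom MB M" unfolding ahom_iff
    by (simp add: coef_add Ea_add M.smult_r_distr M.M.a_ac del: One_nat_def)
  fix b' s assume [simp]: "b' \<in> carrier B" "s \<in> carrier M"
  have "coef 1 (b \<odot>\<^bsub>MB\<^esub> (b' \<odot>\<^bsub>MB\<^esub> Ei s)) = seq_of (b \<otimes>\<^bsub>B\<^esub> b') 1 \<odot>\<^bsub>M\<^esub> s"
    using coef(2)[of "b \<otimes>\<^bsub>B\<^esub> b'" s 1] by (simp add: MB.smult_assoc1)
  also have "seq_of (b \<otimes>\<^bsub>B\<^esub> b') 1 = seq_of b 1 \<otimes>\<^bsub>A\<^esub> seq_of b' 0 \<oplus>\<^bsub>A\<^esub> S (seq_of b) 0 \<otimes>\<^bsub>A\<^esub> seq_of b' 1"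
    by (simp add: seq_mult ts_shift_def)
  also have "\<dots> \<odot>\<^bsub>M\<^esub> s = seq_of b 1 \<odot>\<^bsub>M\<^esub> Ea (b' \<odot>\<^bsub>MB\<^esub> Ei s) \<oplus>\<^bsub>M\<^esub> S (seq_of b) 0 \<odot>\<^bsub>M\<^esub> coef 1 (b' \<odot>\<^bsub>MB\<^esub> Ei s)"
    by (simp add: coef Ea_smult Ea_Ei aug_def M.smult_l_distr M.smult_assoc1)
  finally show "coef 1 (b \<odot>\<^bsub>MB\<^esub> (b' \<odot>\<^bsub>MB\<^esub> Ei s)) =
    seq_of b 1 \<odot>\<^bsub>M\<^esub> Ea (b' \<odot>\<^bsub>MB\<^esub> Ei s) \<oplus>\<^bsub>M\<^esub> S (seq_of b) 0 \<odot>\<^bsub>M\<^esub> coef 1 (b' \<odot>\<^bsub>MB\<^esub> Ei s)" .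
qed

definition nabla where "nabla s = coef 1 (Ef s)"

lemma nabla_closed [simp]: "s \<in> carrier M \<Longrightarrow> nabla s \<in> carrier M"
  and nabla_add: "s \<in> carrier M \<Longrightarrow> s' \<in> carrier M \<Longrightarrow> nabla (s \<oplus>\<^bsub>M\<^esub> s') = nabla s \<oplus>\<^bsub>M\<^esub> nabla s'"
  by (simp_all add: nabla_def Ef_add coef_add)

lemma nabla_smult: "a \<in> carrier A \<Longrightarrow> s \<in> carrier M \<Longrightarrow>
    nabla (a \<odot>\<^bsub>M\<^esub> s) = d a \<odot>\<^bsub>M\<^esub> s \<oplus>\<^bsub>M\<^esub> sig a \<odot>\<^bsub>M\<^esub> nabla s"
proof -
  interpret f1: ring_hom_cring A B f1 by (rule f1_hom)
  assume [simp]: "a \<in> carrier A" "s \<in> carrier M"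
  have "S (tay a) 0 = sig a" by (simp add: ts_sigma_def tay_def sig_def)
  then show ?thesis
    unfolding nabla_def using coef_1_smult[of "f1 a" "Ef s"] by (simp add: Ef_smult Ea_Ef tay_def)
qed

lemma nabla_pow_closed [simp]: "s \<in> carrier M \<Longrightarrow> (nabla ^^ k) s \<in> carrier M"
  by (induction k) auto

lemma crystal_site_HU: "crystal_site p HU yB R A0 h dB E"
  using site_qderiv_HU E.crystal_axioms by (simp add: crystal_site_def)

text \<open>An element of \<open>MB\<close> is a finite sum of terms \<open>b \<odot> Ei s\<close>,
  and the coefficients of each \<open>b\<close> form a null sequence.\<close>

lemma coef_null: "w \<in> carrier MB \<Longrightarrow> adic_null_seq A I M (\<lambda>k. coef k w)"
proof (induction w rule: MB_induct)
  case (add x y)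
  show ?case unfolding adic_null_seq_def
  proof
    fix n
    obtain K K' where "\<forall>k\<ge>K. coef k x \<in> adic_submodule A I M n" "\<forall>k\<ge>K'. coef k y \<in> adic_submodule A I M n"
      using add(3,4) unfolding adic_null_seq_def by blast
    then show "\<exists>K. \<forall>k\<ge>K. coef k (x \<oplus>\<^bsub>MB\<^esub> y) \<in> adic_submodule A I M n"
      using add(1,2) unfolding adic_submodule_def
      by (intro exI[of _ "max K K'"]) (auto simp: coef_add intro: span_add)
  qed
next
  case (pure b s)
  show ?case unfolding adic_null_seq_def
  proof
    fix n
    obtain K where "\<forall>k\<ge>K. seq_of b k \<in> Ip n" using seq_of_nulls[OF pure(1)] unfolding ts_nulls_def by blast
    then show "\<exists>K. \<forall>k\<ge>K. coef k (b \<odot>\<^bsub>MB\<^esub> Ei s) \<in> adic_submodule A I M n"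
      using pure unfolding adic_submodule_def by (intro exI[of _ K]) (auto simp: coef intro!: span_superset)
  qed
qed

text \<open>The Taylor map \<open>E(A) \<rightarrow> E(B)\<close> is horizontal: this is the cocycle condition, seen in the ring
  of null sequences over \<open>B\<close>.\<close>

lemma coef_Ef_nabla: "s \<in> carrier M \<Longrightarrow> coef k (Ef (nabla s)) = coef (Suc k) (Ef s)"
proof -
  assume s: "s \<in> carrier M"
  interpret V: crystal_site p HU yB R A0 h dB E by (rule crystal_site_HU)
  interpret c: coord_hom p A x B yB f1 by (rule coord_hom_f1)
  note [simp] = V.nabla_closed V.Ei_closed V.Ef_closed c.f.hom_closed
  define EH where "EH = trans E HU (ts_obj p HU yB) ar_Hf1"
  have HHU: "ts_obj p HU yB \<in> ob C" by (rule V.HU_ob)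
  have Hc: "c.Hf b \<in> carrier V.B" if "b \<in> carrier B" for b
    using ring_hom_closed[of c.Hf B V.B b] c.dpair_hom_Hf that by (simp add: dpair_hom_def)
  have EH_hom: "EH \<in> ahom MB V.MB" unfolding EH_def by (rule E.trans_hom[OF HU_ob HHU ar_Hf1])
  have EH_smult: "EH (b \<odot>\<^bsub>MB\<^esub> w) = c.Hf b \<odot>\<^bsub>V.MB\<^esub> EH w" if "b \<in> carrier B" "w \<in> carrier MB" for b w
    using E.trans_facts(3)[OF HU_ob HHU ar_Hf1] that by (simp add: EH_def ar_Hf1_def)
  \<comment> \<open>The shift kills constant series, so the constant and the Taylor arrow of
    \<open>HU\<close> agree after \<open>ar_iota\<close>.\<close>
  have Ei_Ei: "V.Ef (Ei u) = V.Ei (Ei u)" if u: "u \<in> carrier M" for u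
  proof -
    have "restrict (\<lambda>a. V.ar_f1 (ar_iota a)) (carrier A) = restrict (\<lambda>a. V.ar_iota (ar_iota a)) (carrier A)"
      unfolding V.ar_f1_def V.ar_iota_def ar_iota_def using V.f1_const dB_iota by (auto simp: restrict_def fun_eq_iff)
    then show ?thesis unfolding V.Ef_def V.Ei_def Ei_def
      using E.trans_comp[OF U HU_ob HHU ar_iota V.ar_f1 u] E.trans_comp[OF U HU_ob HHU ar_iota V.ar_iota u] by simp
  qed
  have EH_Ei: "EH (Ei u) = V.Ei (Ef u)" if u: "u \<in> carrier M" for u
  proof -
    have "restrict (\<lambda>a. ar_Hf1 (ar_iota a)) (carrier A) = restrict (\<lambda>a. V.ar_iota (ar_f1 a)) (carrier A)"
      unfolding ar_Hf1_def ar_f1_def V.ar_iota_def ar_iota_def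
      by (auto simp: restrict_def fun_eq_iff c.Hf_def c.fs_const c.V.iota_def V.iota_def)
    then show ?thesis unfolding EH_def V.Ei_def Ei_def Ef_def
      using E.trans_comp[OF U HU_ob HHU ar_iota ar_Hf1 u] E.trans_comp[OF U HU_ob HHU ar_f1 V.ar_iota u] by simp
  qed
  \<comment> \<open>On rings, the Taylor series of a Taylor series is obtained by applying the
    Taylor map to each coefficient, because the shift of the series of \<open>a\<close> is the
    series of \<open>d a\<close>.\<close>
  have EH_Ef: "V.Ef (Ef u) = EH (Ef u)" if u: "u \<in> carrier M" for u
  proof -
    have "V.f1 (f1 a) = c.Hf (f1 a)" if a: "a \<in> carrier A" for a
    proof -
      have "(dB ^^ k) (f1 a) = f1 ((d ^^ k) a)" for k
      proof (rule B_eqI)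
        show "(dB ^^ k) (f1 a) \<in> carrier B" by (induction k) (use a dB_closed in auto)
        show "f1 ((d ^^ k) a) \<in> carrier B" using a by simp
        show "seq_of ((dB ^^ k) (f1 a)) j = seq_of (f1 ((d ^^ k) a)) j" for j
          unfolding seq_dB_pow by (simp add: tay_def add.commute[of k j] funpow_add)
      qed
      then show ?thesis unfolding V.f1_def c.Hf_def V.tay_def c.fs_def by (simp add: tay_def)
    qed
    then have "restrict (\<lambda>a. V.ar_f1 (ar_f1 a)) (carrier A) = restrict (\<lambda>a. ar_Hf1 (ar_f1 a)) (carrier A)"
      unfolding ar_Hf1_def ar_f1_def V.ar_f1_def by (auto simp: restrict_def fun_eq_iff)
    then show ?thesis unfolding EH_def V.Ef_def Ef_def
      using E.trans_comp[OF U HU_ob HHU ar_f1 ar_Hf1 u] E.trans_comp[OF U HU_ob HHU ar_f1 V.ar_f1 u] by simp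
  qed
  have EH_coef: "V.coef 1 (EH w) = Ef (coef 1 w)" if "w \<in> carrier MB" for w
    using _ _ _ that
  proof (rule MB_ext)
    show "(\<lambda>w. V.coef 1 (EH w)) \<in> ahom MB MB"
      using EH_hom V.coef_closed V.coef_add unfolding ahom_iff by simp
    show "(\<lambda>w. Ef (coef 1 w)) \<in> ahom MB MB" unfolding ahom_iff by (simp add: coef_add Ef_add)
    fix b u assume bu: "b \<in> carrier B" "u \<in> carrier M"
    have "V.coef 1 (EH (b \<odot>\<^bsub>MB\<^esub> Ei u)) = V.coef 1 (c.Hf b \<odot>\<^bsub>V.MB\<^esub> V.Ei (Ef u))"
      using bu by (simp add: EH_smult EH_Ei)
    also have "\<dots> = f1 (seq_of b 1) \<odot>\<^bsub>MB\<^esub> Ef u"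
      using V.coef(2)[of "c.Hf b" "Ef u" 1] bu Hc by simp
    also have "\<dots> = Ef (coef 1 (b \<odot>\<^bsub>MB\<^esub> Ei u))" using bu by (simp add: coef Ef_smult)
    finally show "V.coef 1 (EH (b \<odot>\<^bsub>MB\<^esub> Ei u)) = Ef (coef 1 (b \<odot>\<^bsub>MB\<^esub> Ei u))" .
  qed
  \<comment> \<open>The derivation of the crystal over \<open>B\<close>, applied to the Taylor
    series of \<open>s\<close>, is computed in two ways: here by taking the coefficient before the
    Taylor map, in \<open>2\<close> as a shift of coefficients.\<close>
  have 1: "V.nabla (Ef s) = Ef (nabla s)"
    unfolding V.nabla_def nabla_def using EH_Ef[OF s] EH_coef s by simp
  \<comment> \<open>On a pure element the constant section \<open>Ei u\<close> is horizontal, so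
    only \<open>b\<close> is differentiated, and its derivative is its shift.\<close>
  have 2: "coef k (V.nabla w) = coef (Suc k) w" if "w \<in> carrier MB" for w
    using _ _ _ that
  proof (rule MB_ext)
    show "(\<lambda>w. coef k (V.nabla w)) \<in> ahom MB M"
      using V.nabla_closed V.nabla_add unfolding ahom_iff by (simp add: coef_add)
    show "coef (Suc k) \<in> ahom MB M" by (rule coef)
    fix b u assume bu: "b \<in> carrier B" "u \<in> carrier M"
    have "V.nabla (Ei u) = V.coef 1 (\<one>\<^bsub>V.B\<^esub> \<odot>\<^bsub>V.MB\<^esub> V.Ei (Ei u))"
      unfolding V.nabla_def using bu V.MB.smult_one[of "V.Ei (Ei u)"] by (simp add: Ei_Ei)
    also have "\<dots> = \<zero>\<^bsub>MB\<^esub>"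
    proof -
      have "seq_of \<one>\<^bsub>V.B\<^esub> 1 = \<zero>\<^bsub>B\<^esub>" by (simp add: c.V.B_simps(3) ts_const_def)
      then show ?thesis using V.coef(2)[of "\<one>\<^bsub>V.B\<^esub>" "Ei u" 1] bu by simp
    qed
    finally have "V.nabla (b \<odot>\<^bsub>MB\<^esub> Ei u) = dB b \<odot>\<^bsub>MB\<^esub> Ei u"
      using V.nabla_smult[of b "Ei u"] V.sig_closed[of b] bu dB_closed by simp
    then show "coef k (V.nabla (b \<odot>\<^bsub>MB\<^esub> Ei u)) = coef (Suc k) (b \<odot>\<^bsub>MB\<^esub> Ei u)"
      using bu dB_closed by (simp add: coef ts_shift_def)
  qed
  show ?thesis using 1 2[of "Ef s"] s by simp
qed

lemma nabla_pow: "s \<in> carrier M \<Longrightarrow> (nabla ^^ k) s = coef k (Ef s)"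
proof -
  have "coef j (Ef ((nabla ^^ k) s)) = coef (j + k) (Ef s)" if "s \<in> carrier M" for j s
    by (induction k arbitrary: j) (use that in \<open>auto simp: coef_Ef_nabla\<close>)
  from this[of s 0] show "s \<in> carrier M \<Longrightarrow> (nabla ^^ k) s = coef k (Ef s)"
    by (simp add: coef_0 Ea_Ef)
qed

lemma nabla_null: "s \<in> carrier M \<Longrightarrow> adic_null_seq A I M (\<lambda>k. (nabla ^^ k) s)"
  using coef_null[of "Ef s"] by (simp add: nabla_pow)

text \<open>A morphism commutes with the Taylor map by naturality, and with the coefficient because
  the latter is determined by its values on pure elements.\<close>

lemma nabla_natural:
  assumes E': "is_crystal C E'" and \<alpha>: "\<alpha> \<in> omod_hom C E E'" and s: "s \<in> carrier M"
  shows "\<alpha> U (nabla s) = crystal_site.nabla p U x d E' (\<alpha> U s)"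
proof -
  interpret E': crystal_site p U x R A0 h d E'
    using site_qderiv_axioms E' by (simp add: crystal_site_def crystal_def)
  have aU: "\<alpha> U \<in> mod_hom A M E'.M" and aH: "\<alpha> HU \<in> mod_hom B MB E'.MB"
    using \<alpha> U HU_ob unfolding omod_hom_def by force+
  have nat: "\<alpha> V (trans E U V f u) = trans E' U V f (\<alpha> U u)" if "V \<in> ob C" "f \<in> arr C U V" "u \<in> carrier M" for V f u
    using \<alpha> U that unfolding omod_hom_def by blast
  have a1: "\<alpha> U \<in> ahom M E'.M" "\<alpha> HU \<in> ahom MB E'.MB"
    using aU aH unfolding mod_hom_def ahom_iff by blast+
  have a2: "\<alpha> U u \<in> carrier E'.M" "\<alpha> U (a \<odot>\<^bsub>M\<^esub> u) = a \<odot>\<^bsub>E'.M\<^esub> \<alpha> U u" if "a \<in> carrier A" "u \<in> carrier M" for a u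
    using aU that unfolding mod_hom_def by blast+
  have a3: "\<alpha> HU (b \<odot>\<^bsub>MB\<^esub> u) = b \<odot>\<^bsub>E'.MB\<^esub> \<alpha> HU u" if "b \<in> carrier B" "u \<in> carrier MB" for b u
    using aH that unfolding mod_hom_def by blast
  have "\<alpha> U (coef 1 w) = E'.coef 1 (\<alpha> HU w)" if "w \<in> carrier MB" for w
    using _ _ _ that
  proof (rule MB_ext)
    show "(\<lambda>w. \<alpha> U (coef 1 w)) \<in> ahom MB E'.M" using a1 unfolding ahom_iff by (simp add: coef_add)
    show "(\<lambda>w. E'.coef 1 (\<alpha> HU w)) \<in> ahom MB E'.M"
      using a1 E'.coef_closed E'.coef_add unfolding ahom_iff by simp
    fix b u assume bu: "b \<in> carrier B" "u \<in> carrier M"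
    have "\<alpha> HU (Ei u) = E'.Ei (\<alpha> U u)" unfolding Ei_def E'.Ei_def by (rule nat[OF HU_ob ar_iota bu(2)])
    then show "\<alpha> U (coef 1 (b \<odot>\<^bsub>MB\<^esub> Ei u)) = E'.coef 1 (\<alpha> HU (b \<odot>\<^bsub>MB\<^esub> Ei u))"
      using bu a2[OF one_closed] by (simp add: coef a2 a3 E'.coef)
  qed
  then show ?thesis unfolding nabla_def E'.nabla_def Ef_def E'.Ef_def
    using nat[OF HU_ob ar_f1 s] Ef_closed[OF s] unfolding Ef_def by simp
qed

end

section \<open>Modules over twisted differential operators\<close>

lemma abelian_group_cong:
  assumes "abelian_group G" "carrier H = carrier G" "\<zero>\<^bsub>H\<^esub> = \<zero>\<^bsub>G\<^esub>"
    and "\<And>x y. x \<in> carrier G \<Longrightarrow> y \<in> carrier G \<Longrightarrow> x \<oplus>\<^bsub>H\<^esub> y = x \<oplus>\<^bsub>G\<^esub> y"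
  shows "abelian_group H"
proof -
  interpret G: abelian_group G by fact
  show ?thesis
  proof (rule abelian_groupI)
    show "\<exists>y\<in>carrier H. y \<oplus>\<^bsub>H\<^esub> x = \<zero>\<^bsub>H\<^esub>" if "x \<in> carrier H" for x
      using that assms(2-4) by (intro bexI[of _ "\<ominus>\<^bsub>G\<^esub> x"]) (auto simp: G.l_neg)
  qed (auto simp: assms(2-4) G.a_ac)
qed

lemma coef_UP: "P \<in> carrier (UP R) \<Longrightarrow> UnivPoly.coeff (UP R) P k = P k" by (simp add: UP_def)

lemma UP_simps:
  "P \<in> carrier (UP R) \<Longrightarrow> Q \<in> carrier (UP R) \<Longrightarrow> (P \<oplus>\<^bsub>UP R\<^esub> Q) k = P k \<oplus>\<^bsub>R\<^esub> Q k"
  "a \<in> carrier R \<Longrightarrow> P \<in> carrier (UP R) \<Longrightarrow> (a \<odot>\<^bsub>UP R\<^esub> P) k = a \<otimes>\<^bsub>R\<^esub> P k"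
  "a \<in> carrier R \<Longrightarrow> UnivPoly.monom (UP R) a n k = (if n = k then a else \<zero>\<^bsub>R\<^esub>)"
  "\<one>\<^bsub>UP R\<^esub> k = (if k = 0 then \<one>\<^bsub>R\<^esub> else \<zero>\<^bsub>R\<^esub>)" "\<zero>\<^bsub>UP R\<^esub> k = \<zero>\<^bsub>R\<^esub>"
  by (simp_all add: UP_def)

lemma UP_memI: "(\<And>k. P k \<in> carrier R) \<Longrightarrow> (\<And>k. n < k \<Longrightarrow> P k = \<zero>\<^bsub>R\<^esub>) \<Longrightarrow> P \<in> carrier (UP R)"
  by (auto simp: UP_def intro!: mem_upI exI[of _ n] bound.intro)

locale skew_data = cring R for R (structure) +
  fixes \<sigma> d
  assumes \<sigma>: "\<sigma> \<in> ring_hom R R" and d_closed [simp]: "a \<in> carrier R \<Longrightarrow> d a \<in> carrier R"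
    and d_add: "a \<in> carrier R \<Longrightarrow> b \<in> carrier R \<Longrightarrow> d (a \<oplus> b) = d a \<oplus> d b"
    and d_mult: "a \<in> carrier R \<Longrightarrow> b \<in> carrier R \<Longrightarrow> d (a \<otimes> b) = d a \<otimes> b \<oplus> \<sigma> a \<otimes> d b"
begin

sublocale UP: UP_cring R "UP R" by (simp add: UP_cring_def is_cring)

lemma \<sigma>_hom: "ring_hom_cring R R \<sigma>" by (rule ring_hom_cringI[OF is_cring is_cring \<sigma>])

sublocale \<sigma>: ring_hom_cring R R \<sigma> by (rule \<sigma>_hom)

abbreviation "\<Theta> \<equiv> skew_shift R \<sigma> d"
abbreviation "D \<equiv> D_ring R \<sigma> d"

lemma d_zero: "d \<zero> = \<zero>" using d_add[of \<zero> \<zero>] by (simp add: add.l_cancel_one)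

lemma d_one: "d \<one> = \<zero>" using d_mult[of \<one> \<one>] by (simp add: add.l_cancel_one)

lemma coef_closed [simp]: "P \<in> carrier (UP R) \<Longrightarrow> P k \<in> carrier R"
  using UP.coeff_closed[of P k] by (simp add: coef_UP)

lemma coef_deg: "P \<in> carrier (UP R) \<Longrightarrow> deg R P < k \<Longrightarrow> P k = \<zero>"
  using UP.deg_aboveD[of P k] by (simp add: coef_UP)

lemma UP_I: "(\<And>k. P k \<in> carrier R) \<Longrightarrow> (\<And>k. n < k \<Longrightarrow> P k = \<zero>) \<Longrightarrow> P \<in> carrier (UP R) \<and> deg R P \<le> n"
proof -
  assume P: "\<And>k. P k \<in> carrier R" "\<And>k. n < k \<Longrightarrow> P k = \<zero>"
  have c: "P \<in> carrier (UP R)" by (rule UP_memI[of P R n]) (use P in auto)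
  then show ?thesis using UP.deg_aboveI[of n P] P by (simp add: coef_UP)
qed

lemma theta_nth: "\<Theta> P k = d (P k) \<oplus> (if k = 0 then \<zero> else \<sigma> (P (k - 1)))"
  by (simp add: skew_shift_def)

lemma UP_repr: "P \<in> carrier (UP R) \<Longrightarrow> (\<Oplus>\<^bsub>UP R\<^esub>i\<in>{..deg R P}. UnivPoly.monom (UP R) (P i) i) = P"
  using UP.up_repr[of P] by (simp add: coef_UP)

lemma theta_closed: "P \<in> carrier (UP R) \<Longrightarrow> \<Theta> P \<in> carrier (UP R) \<and> deg R (\<Theta> P) \<le> Suc (deg R P)"
  by (rule UP_I) (auto simp: skew_shift_def coef_deg d_zero)

lemma theta_carrier [simp]: "P \<in> carrier (UP R) \<Longrightarrow> \<Theta> P \<in> carrier (UP R)"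
  using theta_closed by blast

lemma theta_pow_carrier [simp]: "P \<in> carrier (UP R) \<Longrightarrow> (\<Theta> ^^ k) P \<in> carrier (UP R)"
  by (induction k) auto

lemma theta_pow_one: "(\<Theta> ^^ k) \<one>\<^bsub>UP R\<^esub> = UnivPoly.monom (UP R) \<one> k"
proof (induction k)
  case (Suc k)
  have "\<Theta> (UnivPoly.monom (UP R) \<one> k) j = UnivPoly.monom (UP R) \<one> (Suc k) j" for j
    by (cases j) (auto simp: skew_shift_def UP_simps d_zero d_one)
  then show ?case using Suc by auto
qed (simp add: UP.monom_one)

lemma carrier_D [simp]: "carrier D = carrier (UP R)" and one_D: "\<one>\<^bsub>D\<^esub> = \<one>\<^bsub>UP R\<^esub>"
  and zero_D: "\<zero>\<^bsub>D\<^esub> = \<zero>\<^bsub>UP R\<^esub>" and add_D: "P \<oplus>\<^bsub>D\<^esub> Q = P \<oplus>\<^bsub>UP R\<^esub> Q"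
  by (simp_all add: D_ring_def)

end

text \<open>The ring of twisted differential operators acts on itself as a skew module, so associativity of
  its product is a special case of the compatibility of the action with products.\<close>

locale skew_module = skew_data R \<sigma> d + module R M for R :: "('r, 'x) ring_scheme" (structure) and \<sigma> d
    and M :: "('r, 'm, 'y) module_scheme" +
  fixes nab
  assumes nab_closed [simp]: "s \<in> carrier M \<Longrightarrow> nab s \<in> carrier M"
    and nab_add: "s \<in> carrier M \<Longrightarrow> s' \<in> carrier M \<Longrightarrow> nab (s \<oplus>\<^bsub>M\<^esub> s') = nab s \<oplus>\<^bsub>M\<^esub> nab s'"
    and nab_smult: "a \<in> carrier R \<Longrightarrow> s \<in> carrier M \<Longrightarrow> nab (a \<odot>\<^bsub>M\<^esub> s) = d a \<odot>\<^bsub>M\<^esub> s \<oplus>\<^bsub>M\<^esub> \<sigma> a \<odot>\<^bsub>M\<^esub> nab s"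
begin

definition act where "act P s = (\<Oplus>\<^bsub>M\<^esub>i\<in>{..deg R P}. P i \<odot>\<^bsub>M\<^esub> (nab ^^ i) s)"

lemma nab_pow_closed [simp]: "s \<in> carrier M \<Longrightarrow> (nab ^^ k) s \<in> carrier M"
  by (induction k) auto

lemma nab_pow_add: "s \<in> carrier M \<Longrightarrow> s' \<in> carrier M \<Longrightarrow> (nab ^^ k) (s \<oplus>\<^bsub>M\<^esub> s') = (nab ^^ k) s \<oplus>\<^bsub>M\<^esub> (nab ^^ k) s'"
  by (induction k) (auto simp: nab_add)

lemma act_closed [simp]: "P \<in> carrier (UP R) \<Longrightarrow> s \<in> carrier M \<Longrightarrow> act P s \<in> carrier M"
  unfolding act_def by (rule M.finsum_closed) auto

lemma act_bound:
  assumes "P \<in> carrier (UP R)" "s \<in> carrier M" "deg R P \<le> n"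
  shows "act P s = (\<Oplus>\<^bsub>M\<^esub>i\<in>{..n}. P i \<odot>\<^bsub>M\<^esub> (nab ^^ i) s)"
  unfolding act_def by (rule M.add.finprod_mono_neutral_cong_left) (use assms in \<open>auto simp: coef_deg\<close>)

lemma act_r_add: "P \<in> carrier (UP R) \<Longrightarrow> s \<in> carrier M \<Longrightarrow> s' \<in> carrier M \<Longrightarrow>
    act P (s \<oplus>\<^bsub>M\<^esub> s') = act P s \<oplus>\<^bsub>M\<^esub> act P s'"
proof -
  assume [simp]: "P \<in> carrier (UP R)" "s \<in> carrier M" "s' \<in> carrier M"
  have "act P (s \<oplus>\<^bsub>M\<^esub> s') = (\<Oplus>\<^bsub>M\<^esub>i\<in>{..deg R P}. P i \<odot>\<^bsub>M\<^esub> (nab ^^ i) s \<oplus>\<^bsub>M\<^esub> P i \<odot>\<^bsub>M\<^esub> (nab ^^ i) s')"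
    unfolding act_def by (rule M.finsum_cong') (auto simp: nab_pow_add smult_r_distr)
  then show ?thesis unfolding act_def by (subst (asm) M.finsum_addf) auto
qed

lemma act_add: "P \<in> carrier (UP R) \<Longrightarrow> Q \<in> carrier (UP R) \<Longrightarrow> s \<in> carrier M \<Longrightarrow>
    act (P \<oplus>\<^bsub>UP R\<^esub> Q) s = act P s \<oplus>\<^bsub>M\<^esub> act Q s"
proof -
  assume [simp]: "P \<in> carrier (UP R)" "Q \<in> carrier (UP R)" "s \<in> carrier M"
  define n where "n = max (deg R P) (deg R Q)"
  have "act (P \<oplus>\<^bsub>UP R\<^esub> Q) s = (\<Oplus>\<^bsub>M\<^esub>i\<in>{..n}. (P \<oplus>\<^bsub>UP R\<^esub> Q) i \<odot>\<^bsub>M\<^esub> (nab ^^ i) s)"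
    by (rule act_bound) (use UP.deg_add[of P Q] in \<open>auto simp: n_def\<close>)
  also have "\<dots> = (\<Oplus>\<^bsub>M\<^esub>i\<in>{..n}. P i \<odot>\<^bsub>M\<^esub> (nab ^^ i) s \<oplus>\<^bsub>M\<^esub> Q i \<odot>\<^bsub>M\<^esub> (nab ^^ i) s)"
    by (rule M.finsum_cong') (auto simp: UP_simps smult_l_distr)
  also have "\<dots> = (\<Oplus>\<^bsub>M\<^esub>i\<in>{..n}. P i \<odot>\<^bsub>M\<^esub> (nab ^^ i) s) \<oplus>\<^bsub>M\<^esub> (\<Oplus>\<^bsub>M\<^esub>i\<in>{..n}. Q i \<odot>\<^bsub>M\<^esub> (nab ^^ i) s)"
    by (rule M.finsum_addf) auto
  finally show ?thesis using act_bound[of P s n] act_bound[of Q s n] by (simp add: n_def)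
qed

lemma act_smult: "a \<in> carrier R \<Longrightarrow> P \<in> carrier (UP R) \<Longrightarrow> s \<in> carrier M \<Longrightarrow>
    act (a \<odot>\<^bsub>UP R\<^esub> P) s = a \<odot>\<^bsub>M\<^esub> act P s"
proof -
  assume [simp]: "a \<in> carrier R" "P \<in> carrier (UP R)" "s \<in> carrier M"
  have "act (a \<odot>\<^bsub>UP R\<^esub> P) s = (\<Oplus>\<^bsub>M\<^esub>i\<in>{..deg R P}. (a \<odot>\<^bsub>UP R\<^esub> P) i \<odot>\<^bsub>M\<^esub> (nab ^^ i) s)"
    by (rule act_bound) (simp_all add: UP.deg_smult_decr)
  also have "\<dots> = (\<Oplus>\<^bsub>M\<^esub>i\<in>{..deg R P}. a \<odot>\<^bsub>M\<^esub> (P i \<odot>\<^bsub>M\<^esub> (nab ^^ i) s))"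
    by (rule M.finsum_cong') (auto simp: UP_simps smult_assoc1)
  also have "\<dots> = a \<odot>\<^bsub>M\<^esub> act P s"
    unfolding act_def by (rule finsum_smult_ldistr[symmetric]) auto
  finally show ?thesis .
qed

lemma act_one: "s \<in> carrier M \<Longrightarrow> act \<one>\<^bsub>UP R\<^esub> s = s"
  unfolding act_def by (simp add: UP_simps)

lemma act_const: "a \<in> carrier R \<Longrightarrow> s \<in> carrier M \<Longrightarrow> act (D_const R a) s = a \<odot>\<^bsub>M\<^esub> s"
  unfolding act_def D_const_def by (simp add: UP_simps)

lemma act_gen: "s \<in> carrier M \<Longrightarrow> act (D_gen R) s = nab s"
  unfolding D_gen_def
  by (subst act_bound[where n=1]) (auto simp: UP.deg_monom_le UP_simps)

text \<open>\<Theta> is left multiplication by \<partial>. The two terms in the Leibniz rule of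
  \<open>nab\<close> correspond to the two terms of \<open>skew_shift\<close>, the second after a
  shift of the index of summation.\<close>

lemma act_theta: "P \<in> carrier (UP R) \<Longrightarrow> s \<in> carrier M \<Longrightarrow> act (\<Theta> P) s = nab (act P s)"
proof -
  assume [simp]: "P \<in> carrier (UP R)" "s \<in> carrier M"
  define n where "n = deg R P"
  have nab0: "nab \<zero>\<^bsub>M\<^esub> = \<zero>\<^bsub>M\<^esub>"
    using nab_smult[of "\<zero>\<^bsub>R\<^esub>" "\<zero>\<^bsub>M\<^esub>"] by (simp add: d_zero)
  have nab_sum: "nab (\<Oplus>\<^bsub>M\<^esub>i\<in>{..m}. f i) = (\<Oplus>\<^bsub>M\<^esub>i\<in>{..m}. nab (f i))" if f: "\<And>i. f i \<in> carrier M" for f and m :: nat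
    by (induction m) (auto simp: f nab_add M.finsum_Suc M.finsum_0)
  let ?F = "\<lambda>i. d (P i) \<odot>\<^bsub>M\<^esub> (nab ^^ i) s" and ?G = "\<lambda>i. \<sigma> (P i) \<odot>\<^bsub>M\<^esub> (nab ^^ Suc i) s"
  have "nab (act P s) = (\<Oplus>\<^bsub>M\<^esub>i\<in>{..n}. nab (P i \<odot>\<^bsub>M\<^esub> (nab ^^ i) s))"
    unfolding act_def n_def by (rule nab_sum) simp
  also have "\<dots> = (\<Oplus>\<^bsub>M\<^esub>i\<in>{..n}. ?F i \<oplus>\<^bsub>M\<^esub> ?G i)"
    by (rule M.finsum_cong') (auto simp: nab_smult)
  also have "\<dots> = (\<Oplus>\<^bsub>M\<^esub>i\<in>{..n}. ?F i) \<oplus>\<^bsub>M\<^esub> (\<Oplus>\<^bsub>M\<^esub>i\<in>{..n}. ?G i)"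
    by (rule M.finsum_addf) auto
  also have "(\<Oplus>\<^bsub>M\<^esub>i\<in>{..n}. ?F i) = (\<Oplus>\<^bsub>M\<^esub>i\<in>{..Suc n}. ?F i)"
    using coef_deg[of P "Suc n"] by (subst M.finsum_Suc) (auto simp: n_def d_zero)
  also have "(\<Oplus>\<^bsub>M\<^esub>i\<in>{..n}. ?G i) =
      (\<Oplus>\<^bsub>M\<^esub>i\<in>{..Suc n}. (if i = 0 then \<zero>\<^bsub>R\<^esub> else \<sigma> (P (i - 1))) \<odot>\<^bsub>M\<^esub> (nab ^^ i) s)"
    by (subst M.finsum_Suc2) auto
  also have "(\<Oplus>\<^bsub>M\<^esub>i\<in>{..Suc n}. ?F i) \<oplus>\<^bsub>M\<^esub> \<dots> = (\<Oplus>\<^bsub>M\<^esub>i\<in>{..Suc n}. ?F i \<oplus>\<^bsub>M\<^esub>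
      (if i = 0 then \<zero>\<^bsub>R\<^esub> else \<sigma> (P (i - 1))) \<odot>\<^bsub>M\<^esub> (nab ^^ i) s)"
    by (rule M.finsum_addf[symmetric]) auto
  also have "\<dots> = (\<Oplus>\<^bsub>M\<^esub>i\<in>{..Suc n}. \<Theta> P i \<odot>\<^bsub>M\<^esub> (nab ^^ i) s)"
    by (rule M.finsum_cong') (auto simp: skew_shift_def smult_l_distr simp del: funpow.simps)
  also have "\<dots> = act (\<Theta> P) s"
    by (rule act_bound[symmetric]) (use theta_closed[of P] in \<open>auto simp: n_def\<close>)
  finally show ?thesis by simp
qed

lemma act_theta_pow: "P \<in> carrier (UP R) \<Longrightarrow> s \<in> carrier M \<Longrightarrow> act ((\<Theta> ^^ k) P) s = (nab ^^ k) (act P s)"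
  by (induction k) (auto simp: act_theta)

end

context skew_data
begin

lemma skew_module_D: "skew_module R \<sigma> d (UP R) \<Theta>"
proof -
  have "module R (UP R)" using UP.UP_algebra by (simp add: algebra_def)
  then have "skew_module_axioms R \<sigma> d (UP R) \<Theta>"
    unfolding skew_module_axioms_def
    by (auto simp: fun_eq_iff UP_simps theta_nth d_add d_mult r_distr a_ac)
  then show ?thesis using \<open>module R (UP R)\<close> skew_data_axioms by (simp add: skew_module_def)
qed

sublocale Dm: skew_module R \<sigma> d "UP R" \<Theta> by (rule skew_module_D)

lemma mult_D: "P \<in> carrier (UP R) \<Longrightarrow> Q \<in> carrier (UP R) \<Longrightarrow> P \<otimes>\<^bsub>D\<^esub> Q = Dm.act P Q"
proof
  fix k assume [simp]: "P \<in> carrier (UP R)" "Q \<in> carrier (UP R)"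
  have "Dm.act P Q k = UnivPoly.coeff (UP R) (Dm.act P Q) k" by (simp add: coef_UP)
  also have "\<dots> = (\<Oplus>i\<in>{..deg R P}. UnivPoly.coeff (UP R) (P i \<odot>\<^bsub>UP R\<^esub> (\<Theta> ^^ i) Q) k)"
    unfolding Dm.act_def by (rule UP.coeff_finsum) auto
  also have "\<dots> = (P \<otimes>\<^bsub>D\<^esub> Q) k" by (simp add: D_ring_def coef_UP del: UP.coeff_smult)
      (simp add: UP_simps)
  finally show "(P \<otimes>\<^bsub>D\<^esub> Q) k = Dm.act P Q k" ..
qed

end

context skew_module
begin

text \<open>The inner product is the sum of \<open>P i \<odot> (\<Theta> ^^ i) Q\<close>, and each
  power of \<Theta> acts as the same power of \<open>nab\<close>.\<close>

lemma act_act: "P \<in> carrier (UP R) \<Longrightarrow> Q \<in> carrier (UP R) \<Longrightarrow> s \<in> carrier M \<Longrightarrow>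
    act (Dm.act P Q) s = act P (act Q s)"
proof -
  assume [simp]: "P \<in> carrier (UP R)" "Q \<in> carrier (UP R)" "s \<in> carrier M"
  have sum: "act (\<Oplus>\<^bsub>UP R\<^esub>i\<in>{..m}. W i) s = (\<Oplus>\<^bsub>M\<^esub>i\<in>{..m}. act (W i) s)"
    if W: "\<And>i. W i \<in> carrier (UP R)" for W and m :: nat
    by (induction m) (auto simp: W act_add UP.P.finsum_Suc UP.P.finsum_0 M.finsum_Suc M.finsum_0)
  show ?thesis unfolding Dm.act_def
    by (subst sum, simp, unfold act_def[of P "act Q s"], rule M.finsum_cong')
      (auto simp: act_smult act_theta_pow)
qed

end

context skew_data
begin

lemma ring_D: "ring D"
proof (rule ringI)
  show "abelian_group D"
    by (rule abelian_group_cong[OF UP.P.abelian_group_axioms]) (auto simp: zero_D add_D)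
  \<comment> \<open>Associativity is \<open>act_act\<close> for the action of the ring on itself.
    The right unit law holds because the powers of \<Theta> carry \<open>1\<close> to the monomials
    in \<partial>.\<close>
  show "Group.monoid D"
    by (rule monoidI) (auto simp: mult_D one_D Dm.act_act Dm.act_one,
      auto simp: Dm.act_def theta_pow_one UP_repr UP.monom_mult_smult[symmetric])
qed (auto simp: mult_D add_D Dm.act_add Dm.act_r_add)

end

section \<open>Modules over twisted differential operators from skew modules, and comparison of
  underlying modules\<close>

context skew_module
begin

definition D_module where
  "D_module = \<lparr>carrier = carrier M, monoid.mult = monoid.mult M, monoid.one = \<one>\<^bsub>M\<^esub>, ring.zero = \<zero>\<^bsub>M\<^esub>,
     ring.add = ring.add M, smult = act\<rparr>"

lemma D_module_simps [simp]: "carrier D_module = carrier M"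
  "\<zero>\<^bsub>D_module\<^esub> = \<zero>\<^bsub>M\<^esub>" "s \<oplus>\<^bsub>D_module\<^esub> t = s \<oplus>\<^bsub>M\<^esub> t" "P \<odot>\<^bsub>D_module\<^esub> s = act P s"
  by (simp_all add: D_module_def)

lemma left_module_D: "left_module D D_module"
proof -
  have "abelian_group D_module"
    by (rule abelian_group_cong[OF M.abelian_group_axioms]) auto
  then show ?thesis unfolding left_module_def left_module_axioms_def
    using ring_D by (auto simp: add_D one_D mult_D act_add act_r_add act_act act_one)
qed

end

lemma same_module_fin_pres:
  assumes "same_module R M N"
  shows "fin_pres_module R M \<longleftrightarrow> fin_pres_module R N"
proof -
  have c: "carrier M = carrier N" "\<zero>\<^bsub>M\<^esub> = \<zero>\<^bsub>N\<^esub>"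
    "\<And>s t. s \<in> carrier N \<Longrightarrow> t \<in> carrier N \<Longrightarrow> s \<oplus>\<^bsub>M\<^esub> t = s \<oplus>\<^bsub>N\<^esub> t"
    "\<And>a s. a \<in> carrier R \<Longrightarrow> s \<in> carrier N \<Longrightarrow> a \<odot>\<^bsub>M\<^esub> s = a \<odot>\<^bsub>N\<^esub> s"
    using assms by (auto simp: same_module_def)
  have "mod_hom R L M = mod_hom R L N" for L :: "('a, nat \<Rightarrow> 'a) module"
    unfolding mod_hom_def by (rule Collect_cong) (auto simp: c PiE_iff)
  then show ?thesis unfolding fin_pres_module_def c(1,2) by simp
qed

lemma same_module_flat:
  assumes "same_module R M N"
  shows "flat_module R M \<longleftrightarrow> flat_module R N"
proof -
  have c: "carrier M = carrier N"
    "\<And>s t. s \<in> carrier N \<Longrightarrow> t \<in> carrier N \<Longrightarrow> s \<oplus>\<^bsub>M\<^esub> t = s \<oplus>\<^bsub>N\<^esub> t"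
    "\<And>a s. a \<in> carrier R \<Longrightarrow> s \<in> carrier N \<Longrightarrow> a \<odot>\<^bsub>M\<^esub> s = a \<odot>\<^bsub>N\<^esub> s"
    using assms by (auto simp: same_module_def)
  have "tensor_rels R M L = tensor_rels R N L" for L :: "('a, 'a) module"
    unfolding tensor_rels_def by (intro arg_cong2[where f="(\<union>)"] Collect_cong iff_exI) (auto simp: c)
  then show ?thesis unfolding flat_module_def tensor_def pure_tensor_def tensor_null_def c(1) by simp
qed

text \<open>Submodules are subgroups of the additive monoid, whose operations are also referred to
  outside the carrier; this accounts for the equality of the additive monoids among the
  hypotheses.\<close>

lemma same_module_span:
  assumes "same_module R M N" "add_monoid M = add_monoid N"
  shows "mod_span R M S = mod_span R N S"
proof -
  have "submodule H R M \<longleftrightarrow> submodule H R N" for H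
    using assms subgroup.subset[of H "add_monoid N"]
    by (auto simp: submodule_def submodule_axioms_def same_module_def subset_iff)
  then show ?thesis unfolding mod_span_def by simp
qed

lemma base_obj_ob:
  assumes "qPD_pair p A" "bounded_pair p A" "complete_pair p A" "h \<in> dpair_hom R A"
  shows "base_obj A h \<in> ob (qCRIS_op p R A h)"
  using assms by (simp add: qCRIS_op_def base_obj_def ring_hom_def)

theorem theorem7p5:
  fixes p :: nat and R A :: "'u dpair" and h :: "'u \<Rightarrow> 'u" and x :: 'u
    and \<sigma> d :: "'u \<Rightarrow> 'u"
  assumes universe: "\<exists>e :: (nat \<Rightarrow> 'u) \<Rightarrow> 'u. inj e"
    and "Factorial_Ring.prime p"
    and "qPD_pair p R" and "bounded_pair p R"
    and "qPD_pair p A" and "bounded_pair p A"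
    and "h \<in> dpair_hom R A"
    and "complete_pair p A"
    and "top_etale_coordinate p R A h x" and "delta A x = \<zero>\<^bsub>A\<^esub>"
    and "is_sigma R A h x \<sigma>" and "is_qderiv R A h x \<sigma> d"
  shows "\<exists>(Fo :: ('u, 'm) omod \<Rightarrow> (nat \<Rightarrow> 'u, 'm) module) Fm.
    is_functor (fp_flat_crystals (qCRIS_op p R A h)) (fp_flat_D_modules p A \<sigma> d) Fo Fm \<and>
    (\<forall>E \<in> ob (fp_flat_crystals (qCRIS_op p R A h)).
       same_module A (underlying_module A (Fo E)) (sect E (base_obj A h))) \<and>
    (\<forall>E \<in> ob (fp_flat_crystals (qCRIS_op p R A h)).
     \<forall>E' \<in> ob (fp_flat_crystals (qCRIS_op p R A h)).
     \<forall>\<alpha> \<in> arr (fp_flat_crystals (qCRIS_op p R A h)) E E'. Fm E E' \<alpha> = \<alpha> (base_obj A h))"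
proof -
  define U where "U = base_obj A h"
  have U [simp]: "opair U = A" "ostr U = h" by (simp_all add: U_def base_obj_def)
  let ?C = "qCRIS_op p R A h"
  have U_ob: "U \<in> ob ?C" unfolding U_def using assms by (intro base_obj_ob)
  have x: "x \<in> carrier A" using assms(9) by (simp add: top_etale_coordinate_def)
  interpret ep: etale_pair p A x R h \<sigma> d using assms x by unfold_locales
  have qd: "qderiv_pair p (opair U) x d" using ep.qderiv_pair by simp
  have site: "site_qderiv p U x R A h d"
    unfolding site_qderiv_def site_qderiv_axioms_def site_pt_def site_pt_axioms_def
    using qd U_ob ep.d_h by (simp add: qderiv_pair_def)
  define nab where "nab E = crystal_site.nabla p U x d E" for E :: "('u, 'm) omod"
  have cs: "crystal_site p U x R A h d E" if "is_crystal ?C E" for E :: "('u, 'm) omod"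
    using site that by (simp add: crystal_site_def crystal_def)
  have sk: "skew_module A \<sigma> d (sect E U) (nab E)" if "is_crystal ?C E" for E :: "('u, 'm) omod"
  proof -
    interpret c: crystal_site p U x R A h d E by (rule cs[OF that])
    have m: "module A (sect E U)" using c.M_module by simp
    \<comment> \<open>The endomorphism is determined by the derivation, so the Leibniz rule of
      \<open>nabla\<close>, expressed with \<open>sig\<close>, is the commutation rule of the
      twisted polynomial ring.\<close>
    have "c.sig a = \<sigma> a" if "a \<in> carrier A" for a
      using ep.sigma_eq[OF that] unfolding c.sig_def by simp
    then have "skew_module_axioms A \<sigma> d (sect E U) (nab E)"
      unfolding skew_module_axioms_def nab_def using c.nabla_closed c.nabla_add c.nabla_smult by simp
    moreover have "skew_data A \<sigma> d"
      unfolding skew_data_def skew_data_axioms_def using ep.is_cring ep.s_facts ep.d_facts by simp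
    ultimately show ?thesis using m by (simp add: skew_module_def)
  qed
  define Fo where "Fo E = skew_module.D_module A (sect E U) (nab E)" for E :: "('u, 'm) omod"
  define Fm where "Fm E E' \<alpha> = \<alpha> U" for E E' :: "('u, 'm) omod" and \<alpha> :: "'u qobj \<Rightarrow> 'm \<Rightarrow> 'm"
  have same: "same_module A (underlying_module A (Fo E)) (sect E U)"
    and same_add: "add_monoid (underlying_module A (Fo E)) = add_monoid (sect E U)"
    and carrier_Fo: "carrier (Fo E) = carrier (sect E U)"
    if E: "is_crystal ?C E" for E :: "('u, 'm) omod"
  proof -
    interpret sk: skew_module A \<sigma> d "sect E U" "nab E" by (rule sk[OF E])
    show "same_module A (underlying_module A (Fo E)) (sect E U)"
      "add_monoid (underlying_module A (Fo E)) = add_monoid (sect E U)" "carrier (Fo E) = carrier (sect E U)"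
      by (auto simp: same_module_def underlying_module_def restrict_scalars_def Fo_def sk.D_module_def sk.act_const)
  qed
  have Fo_ob: "Fo E \<in> ob (fp_flat_D_modules p A \<sigma> d)" if E: "E \<in> ob (fp_flat_crystals ?C)" for E
  proof -
    have E: "is_crystal ?C E" "fin_pres_module A (sect E U)" "flat_module A (sect E U)"
      using E U_ob by (auto simp: fp_flat_crystals_def)
    interpret sk: skew_module A \<sigma> d "sect E U" "nab E" by (rule sk[OF E(1)])
    interpret c: crystal_site p U x R A h d E by (rule cs[OF E(1)])
    have "((\<lambda>t. D_gen A \<odot>\<^bsub>Fo E\<^esub> t) ^^ k) s = (nab E ^^ k) s" if "s \<in> carrier (sect E U)" for k s
      by (induction k) (use that in \<open>auto simp: Fo_def sk.act_gen\<close>)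
    moreover have "adic_null_seq A (pq_ideal p A) (sect E U) (\<lambda>k. (nab E ^^ k) s)" if "s \<in> carrier (sect E U)" for s
      using c.nabla_null[of s] that by (simp add: nab_def)
    moreover have "adic_submodule A (pq_ideal p A) (underlying_module A (Fo E)) n =
        adic_submodule A (pq_ideal p A) (sect E U) n" for n
    proof -
      have "{a \<odot>\<^bsub>underlying_module A (Fo E)\<^esub> s | a s. a \<in> ideal_pow A (pq_ideal p A) n \<and> s \<in> carrier (underlying_module A (Fo E))} =
          {a \<odot>\<^bsub>sect E U\<^esub> s | a s. a \<in> ideal_pow A (pq_ideal p A) n \<and> s \<in> carrier (sect E U)}"
        using same[OF E(1)] ep.Ip_carrier unfolding same_module_def by (intro Collect_cong iff_exI) auto
      then show ?thesis unfolding adic_submodule_def same_module_span[OF same[OF E(1)] same_add[OF E(1)]] by simp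
    qed
    ultimately have "top_quasi_nilpotent p A (Fo E)"
      unfolding top_quasi_nilpotent_def adic_null_seq_def carrier_Fo[OF E(1)] by simp
    then show ?thesis
      using E sk.left_module_D same_module_fin_pres[OF same[OF E(1)]] same_module_flat[OF same[OF E(1)]]
      by (simp add: fp_flat_D_modules_def Fo_def)
  qed
  have Fm_arr: "\<alpha> U \<in> arr (fp_flat_D_modules p A \<sigma> d) (Fo E) (Fo E')"
    if E: "E \<in> ob (fp_flat_crystals ?C)" and E': "E' \<in> ob (fp_flat_crystals ?C)"
      and \<alpha>: "\<alpha> \<in> arr (fp_flat_crystals ?C) E E'" for E E' \<alpha>
  proof -
    have E: "is_crystal ?C E" and E': "is_crystal ?C E'" and \<alpha>: "\<alpha> \<in> omod_hom ?C E E'"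
      using E E' \<alpha> by (auto simp: fp_flat_crystals_def)
    interpret sk: skew_module A \<sigma> d "sect E U" "nab E" by (rule sk[OF E])
    interpret sk': skew_module A \<sigma> d "sect E' U" "nab E'" by (rule sk[OF E'])
    interpret c: crystal_site p U x R A h d E by (rule cs[OF E])
    have a: "\<alpha> U \<in> mod_hom A (sect E U) (sect E' U)" using \<alpha> U_ob by (auto simp: omod_hom_def)
    have nab: "\<alpha> U (nab E s) = nab E' (\<alpha> U s)" if "s \<in> carrier (sect E U)" for s
      unfolding nab_def by (rule c.nabla_natural[OF E' \<alpha>]) (use that in simp)
    have a_closed: "\<alpha> U s \<in> carrier (sect E' U)" if "s \<in> carrier (sect E U)" for s using a that by (auto simp: mod_hom_def)
    have a_add: "\<alpha> U (s \<oplus>\<^bsub>sect E U\<^esub> s') = \<alpha> U s \<oplus>\<^bsub>sect E' U\<^esub> \<alpha> U s'"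
      if "s \<in> carrier (sect E U)" "s' \<in> carrier (sect E U)" for s s' using a that by (auto simp: mod_hom_def)
    have a_smult: "\<alpha> U (b \<odot>\<^bsub>sect E U\<^esub> s) = b \<odot>\<^bsub>sect E' U\<^esub> \<alpha> U s"
      if "b \<in> carrier A" "s \<in> carrier (sect E U)" for b s using a that by (auto simp: mod_hom_def)
    \<comment> \<open>Compatibility with the single operator \<partial> is extended to all its
      powers, and below to sums with coefficients in \<open>A\<close>, which are all the
      operators.\<close>
    have pow: "\<alpha> U ((nab E ^^ k) s) = (nab E' ^^ k) (\<alpha> U s)" if "s \<in> carrier (sect E U)" for k s
      by (induction k) (use that in \<open>auto simp: nab\<close>)
    have fin: "\<alpha> U (\<Oplus>\<^bsub>sect E U\<^esub>i\<in>{..m}. f i) = (\<Oplus>\<^bsub>sect E' U\<^esub>i\<in>{..m}. \<alpha> U (f i))"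
      if f: "\<And>i. f i \<in> carrier (sect E U)" for f and m :: nat
      by (induction m) (auto simp: f a_add a_closed sk.M.finsum_Suc sk.M.finsum_0 sk'.M.finsum_Suc sk'.M.finsum_0)
    have act: "\<alpha> U (sk.act P s) = sk'.act P (\<alpha> U s)" if [simp]: "P \<in> carrier (UP A)" "s \<in> carrier (sect E U)" for P s
      unfolding sk.act_def sk'.act_def by (subst fin) (simp_all add: a_smult pow)
    show ?thesis
      using a a_closed a_add act by (simp add: fp_flat_D_modules_def Fo_def mod_hom_def)
  qed
  have "is_functor (fp_flat_crystals ?C) (fp_flat_D_modules p A \<sigma> d) Fo Fm"
    unfolding is_functor_def
  proof (intro conjI ballI)
    fix E :: "('u, 'm) omod" assume E: "E \<in> ob (fp_flat_crystals ?C)"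
    show "Fo E \<in> ob (fp_flat_D_modules p A \<sigma> d)" by (rule Fo_ob[OF E])
    show "Fm E E (idt (fp_flat_crystals ?C) E) = idt (fp_flat_D_modules p A \<sigma> d) (Fo E)"
      using E U_ob carrier_Fo by (simp add: Fm_def fp_flat_crystals_def fp_flat_D_modules_def restrict_def)
    fix E' :: "('u, 'm) omod" and \<alpha> assume E': "E' \<in> ob (fp_flat_crystals ?C)" and \<alpha>: "\<alpha> \<in> arr (fp_flat_crystals ?C) E E'"
    show "Fm E E' \<alpha> \<in> arr (fp_flat_D_modules p A \<sigma> d) (Fo E) (Fo E')"
      unfolding Fm_def by (rule Fm_arr[OF E E' \<alpha>])
    fix E'' :: "('u, 'm) omod" and \<beta>
    show "Fm E E'' (cmp (fp_flat_crystals ?C) E E' E'' \<beta> \<alpha>) =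
        cmp (fp_flat_D_modules p A \<sigma> d) (Fo E) (Fo E') (Fo E'') (Fm E' E'' \<beta>) (Fm E E' \<alpha>)"
      using E U_ob carrier_Fo by (simp add: Fm_def fp_flat_crystals_def fp_flat_D_modules_def)
  qed
  moreover have "\<forall>E \<in> ob (fp_flat_crystals ?C). same_module A (underlying_module A (Fo E)) (sect E (base_obj A h))"
    using same by (auto simp: fp_flat_crystals_def U_def)
  ultimately show ?thesis
    by (intro exI[of _ Fo] exI[of _ Fm]) (auto simp: Fm_def U_def)
qed

end
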